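(* Let $W:\mathbb{R}^{3\times3}\to[0,\infty)$ be continuous and satisfy: (i) $\{W=0\}=\{A,B\}$, where $A=(A',A_3)$ and $B=(B',B_3)$ in $\mathbb{R}^{3\times2}\times\mathbb{R}^3$ are distinct matrices with $A'-B'=2a\otimes\bar\nu$ for some $a\in\mathbb{R}^3$ and $\bar\nu\in\mathbb{S}^1$; (ii) $\frac{1}{C_1}|\xi|^p-C_1\le W(\xi)\le C_1|\xi|^p+C_1$ for all $\xi\in\mathbb{R}^{3\times 3}$, for some $p\ge2$ and some constant $C_1>0$. Let $h_n\to0^+$ and $\varepsilon_n\to0^+$ be arbitrary sequences, and let $\{u_n\}\subset H^2(\Omega;\mathbb{R}^3)$ be such that $\sup_n F_{\varepsilon_n}^{h_n}(u_n)<\infty$. Then there exist a subsequence (not relabeled) and $(u,b)\in\mathscr{C}$ such that $u_n-\frac{1}{|\Omega|}\int_\Omega u_n\,dx\to u$ in $W^{1,p}(\Omega;\mathbb{R}^3)$ and $\frac{1}{h_n}\partial_3u_n\to b$ in $L^p(\Omega;\mathbb{R}^3)$.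
   Context: $I:=(-\frac12,\frac12)$, $\omega\subset\mathbb{R}^2$ is a bounded convex open set, and $\Omega:=\omega\times I$. Write $x=(x',x_3)$ with $x'=(x_1,x_2)$, and $\nabla':=(\partial_1,\partial_2)$. For $\xi\in\mathbb{R}^{3\times3}$ write $\xi=(\xi_1,\xi_2,\xi_3)$ (columns) and $\xi'=(\xi_1,\xi_2)\in\mathbb{R}^{3\times2}$; $|\cdot|$ is the Euclidean norm. For $h,\varepsilon>0$ and $u\in H^2(\Omega;\mathbb{R}^3)$: $\nabla_hu:=(\partial_1u,\partial_2u,\frac1h\partial_3u)$; $\nabla_h^2u$ is the rescaled Hessian, with $|\nabla^2_hu|^2=\sum_{i,j\in\{1,2\}}|\partial^2_{ij}u|^2+\frac{2}{h^2}\sum_{i\in\{1,2\}}|\partial^2_{i3}u|^2+\frac1{h^4}|\partial^2_{33}u|^2$; and $$F_\varepsilon^h(u):=\int_\Omega\frac1\varepsilon W(\nabla_hu)+\varepsilon|\nabla_h^2u|^2\,dx.$$ The class of limiting configurations is $$\mathscr{C}:=\{(u,b)\in W^{1,\infty}(\Omega;\mathbb{R}^3)\times L^\infty(\Omega;\mathbb{R}^3):(\nabla'u,b)\in BV(\Omega;\{A,B\}),\ \partial_3u=\partial_3b=0\}.$$ *)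

theory Defs
  imports "HOL-Analysis.Analysis"
begin

text \<open>
  Functions on an open set \<open>U\<close> are represented by total functions on the ambient space; only
  their values on \<open>U\<close>, up to null sets, matter. The exponent \<open>p\<close> below is a finite real number
  \<open>\<ge> 1\<close>; the case \<open>p = \<infinity>\<close> is treated separately.
\<close>

section \<open>Lebesgue spaces\<close>

definition Lp_space :: "real \<Rightarrow> 'a::euclidean_space set \<Rightarrow> ('a \<Rightarrow> 'b::euclidean_space) set" where
  "Lp_space p U = {f. f \<in> borel_measurable (lebesgue_on U) \<and>
     integrable (lebesgue_on U) (\<lambda>x. norm (f x) powr p)}"

definition Linf_space :: "'a::euclidean_space set \<Rightarrow> ('a \<Rightarrow> 'b::euclidean_space) set" where
  "Linf_space U = {f. f \<in> borel_measurable (lebesgue_on U) \<and>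
     (\<exists>C. AE x in lebesgue_on U. norm (f x) \<le> C)}"

definition Lp_norm :: "real \<Rightarrow> 'a::euclidean_space set \<Rightarrow> ('a \<Rightarrow> 'b::euclidean_space) \<Rightarrow> real" where
  "Lp_norm p U f = (LINT x|lebesgue_on U. norm (f x) powr p) powr (1 / p)"

definition Lp_tendsto ::
  "real \<Rightarrow> 'a::euclidean_space set \<Rightarrow> (nat \<Rightarrow> 'a \<Rightarrow> 'b::euclidean_space) \<Rightarrow> ('a \<Rightarrow> 'b) \<Rightarrow> bool" where
  "Lp_tendsto p U f g \<longleftrightarrow> (\<forall>n. f n \<in> Lp_space p U) \<and> g \<in> Lp_space p U \<and>
     (\<lambda>n. Lp_norm p U (\<lambda>x. f n x - g x)) \<longlonglongrightarrow> 0"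

definition locally_integrable :: "'a::euclidean_space set \<Rightarrow> ('a \<Rightarrow> 'b::euclidean_space) \<Rightarrow> bool" where
  "locally_integrable U f \<longleftrightarrow> (\<forall>K. compact K \<and> K \<subseteq> U \<longrightarrow> integrable (lebesgue_on K) f)"

section \<open>Test functions and weak derivatives\<close>

primrec Ck :: "nat \<Rightarrow> ('a::euclidean_space \<Rightarrow> 'b::euclidean_space) \<Rightarrow> bool" where
  "Ck 0 f \<longleftrightarrow> continuous_on UNIV f"
| "Ck (Suc k) f \<longleftrightarrow> (\<forall>x. f differentiable (at x)) \<and>
     (\<forall>i\<in>Basis. Ck k (\<lambda>x. frechet_derivative f (at x) i))"

definition Ck_compact :: "nat \<Rightarrow> 'a::euclidean_space set \<Rightarrow> ('a \<Rightarrow> 'b::euclidean_space) set" where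
  "Ck_compact k U = {f. Ck k f \<and> compact (closure {x. f x \<noteq> 0}) \<and> closure {x. f x \<noteq> 0} \<subseteq> U}"

definition test_functions :: "'a::euclidean_space set \<Rightarrow> ('a \<Rightarrow> real) set" where
  "test_functions U = (\<Inter>k. Ck_compact k U)"

definition has_weak_partial ::
  "'a::euclidean_space set \<Rightarrow> 'a \<Rightarrow> ('a \<Rightarrow> 'b::euclidean_space) \<Rightarrow> ('a \<Rightarrow> 'b) \<Rightarrow> bool" where
  "has_weak_partial U i f g \<longleftrightarrow> locally_integrable U f \<and> locally_integrable U g \<and>
     (\<forall>\<phi>\<in>test_functions U.
        (LINT x|lebesgue_on U. frechet_derivative \<phi> (at x) i *\<^sub>R f x) =
        - (LINT x|lebesgue_on U. \<phi> x *\<^sub>R g x))"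

text \<open>A representative of the weak derivative in direction \<open>i\<close>, which is unique up to null sets
  when it exists; the value is meaningful only in that case.\<close>

definition weak_partial ::
  "'a::euclidean_space set \<Rightarrow> 'a \<Rightarrow> ('a \<Rightarrow> 'b::euclidean_space) \<Rightarrow> 'a \<Rightarrow> 'b" where
  "weak_partial U i f = (SOME g. has_weak_partial U i f g)"

section \<open>Sobolev spaces\<close>

definition W1p_space :: "real \<Rightarrow> 'a::euclidean_space set \<Rightarrow> ('a \<Rightarrow> 'b::euclidean_space) set" where
  "W1p_space p U =
     {f \<in> Lp_space p U. \<forall>i\<in>Basis. \<exists>g\<in>Lp_space p U. has_weak_partial U i f g}"

definition W1inf_space :: "'a::euclidean_space set \<Rightarrow> ('a \<Rightarrow> 'b::euclidean_space) set" where
  "W1inf_space U =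
     {f \<in> Linf_space U. \<forall>i\<in>Basis. \<exists>g\<in>Linf_space U. has_weak_partial U i f g}"

definition H2_space :: "'a::euclidean_space set \<Rightarrow> ('a \<Rightarrow> 'b::euclidean_space) set" where
  "H2_space U =
     {f \<in> Lp_space 2 U. \<forall>i\<in>Basis. \<exists>g\<in>W1p_space 2 U. has_weak_partial U i f g}"

definition W1p_norm :: "real \<Rightarrow> 'a::euclidean_space set \<Rightarrow> ('a \<Rightarrow> 'b::euclidean_space) \<Rightarrow> real" where
  "W1p_norm p U f = (Lp_norm p U f powr p +
     (\<Sum>i\<in>Basis. Lp_norm p U (weak_partial U i f) powr p)) powr (1 / p)"

definition W1p_tendsto ::
  "real \<Rightarrow> 'a::euclidean_space set \<Rightarrow> (nat \<Rightarrow> 'a \<Rightarrow> 'b::euclidean_space) \<Rightarrow> ('a \<Rightarrow> 'b) \<Rightarrow> bool" where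
  "W1p_tendsto p U f g \<longleftrightarrow> (\<forall>n. f n \<in> W1p_space p U) \<and> g \<in> W1p_space p U \<and>
     (\<lambda>n. W1p_norm p U (\<lambda>x. f n x - g x)) \<longlonglongrightarrow> 0"

section \<open>Functions of bounded variation\<close>

text \<open>A test field for a \<open>'b\<close>-valued function has one \<open>'b\<close>-valued component \<open>\<phi> i\<close> for each
  coordinate direction \<open>i\<close>, so \<open>\<Sum>i\<in>Basis. (norm (\<phi> i x))\<^sup>2\<close> is the square of its Euclidean
  norm at \<open>x\<close>.\<close>

definition BV_test_fields ::
  "'a::euclidean_space set \<Rightarrow> ('a \<Rightarrow> 'a \<Rightarrow> 'b::euclidean_space) set" where
  "BV_test_fields U = {\<phi>. (\<forall>i\<in>Basis. \<phi> i \<in> Ck_compact 1 U) \<and>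
     (\<forall>x. (\<Sum>i\<in>Basis. (norm (\<phi> i x))\<^sup>2) \<le> 1)}"

definition variation :: "'a::euclidean_space set \<Rightarrow> ('a \<Rightarrow> 'b::euclidean_space) \<Rightarrow> ereal" where
  "variation U f = (SUP \<phi>\<in>BV_test_fields U.
     ereal (LINT x|lebesgue_on U. (\<Sum>i\<in>Basis. f x \<bullet> frechet_derivative (\<phi> i) (at x) i)))"

definition BV_space :: "'a::euclidean_space set \<Rightarrow> ('a \<Rightarrow> 'b::euclidean_space) set" where
  "BV_space U = {f \<in> Lp_space 1 U. variation U f < \<infinity>}"

definition BV_valued :: "'a::euclidean_space set \<Rightarrow> 'b::euclidean_space set \<Rightarrow> ('a \<Rightarrow> 'b) set" where
  "BV_valued U S = {f \<in> BV_space U. AE x in lebesgue_on U. f x \<in> S}"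

section \<open>Thin films\<close>

definition cylinder :: "(real^2) set \<Rightarrow> (real^3) set" where
  "cylinder \<omega> = {x. vector [x$1, x$2] \<in> \<omega> \<and> x$3 \<in> {-1/2<..<1/2}}"

text \<open>A matrix is a vector of rows, so \<open>\<xi> $ i $ j\<close> is the entry in row \<open>i\<close> and column \<open>j\<close>, and
  \<open>norm\<close> is the Frobenius norm.\<close>

definition first_two_columns :: "real^3^3 \<Rightarrow> real^2^3" where
  "first_two_columns \<xi> = (\<chi> i. vector [\<xi>$i$1, \<xi>$i$2])"

definition tensor :: "real^'m \<Rightarrow> real^'n \<Rightarrow> real^'n^'m" where
  "tensor a b = (\<chi> i j. a$i * b$j)"

abbreviation D :: "(real^3) set \<Rightarrow> 3 \<Rightarrow> (real^3 \<Rightarrow> real^3) \<Rightarrow> real^3 \<Rightarrow> real^3" where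
  "D \<Omega> j \<equiv> weak_partial \<Omega> (axis j 1)"

text \<open>The matrix field \<open>(\<nabla>'u, b)\<close>.\<close>

definition planar_grad_with ::
  "(real^3) set \<Rightarrow> (real^3 \<Rightarrow> real^3) \<Rightarrow> (real^3 \<Rightarrow> real^3) \<Rightarrow> real^3 \<Rightarrow> real^3^3" where
  "planar_grad_with \<Omega> u b x = (\<chi> i j. if j = 3 then b x $ i else D \<Omega> j u x $ i)"

definition scaled_grad ::
  "real \<Rightarrow> (real^3) set \<Rightarrow> (real^3 \<Rightarrow> real^3) \<Rightarrow> real^3 \<Rightarrow> real^3^3" where
  "scaled_grad h \<Omega> u = planar_grad_with \<Omega> u (\<lambda>x. (1 / h) *\<^sub>R D \<Omega> 3 u x)"

definition scaled_hessian_norm_sq ::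
  "real \<Rightarrow> (real^3) set \<Rightarrow> (real^3 \<Rightarrow> real^3) \<Rightarrow> real^3 \<Rightarrow> real" where
  "scaled_hessian_norm_sq h \<Omega> u x =
     (\<Sum>i\<in>{1,2}. \<Sum>j\<in>{1,2}. (norm (D \<Omega> i (D \<Omega> j u) x))\<^sup>2) +
     2 / h^2 * (\<Sum>i\<in>{1,2}. (norm (D \<Omega> i (D \<Omega> 3 u) x))\<^sup>2) +
     1 / h^4 * (norm (D \<Omega> 3 (D \<Omega> 3 u) x))\<^sup>2"

text \<open>The energy is \<open>ennreal\<close>-valued: for large \<open>p\<close> it may be infinite on \<open>H\<^sup>2\<close>.\<close>

definition energy ::
  "(real^3^3 \<Rightarrow> real) \<Rightarrow> (real^3) set \<Rightarrow> real \<Rightarrow> real \<Rightarrow> (real^3 \<Rightarrow> real^3) \<Rightarrow> ennreal" where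
  "energy W \<Omega> h \<epsilon> u =
     (\<integral>\<^sup>+ x. ennreal (1 / \<epsilon> * W (scaled_grad h \<Omega> u x) + \<epsilon> * scaled_hessian_norm_sq h \<Omega> u x)
        \<partial>lebesgue_on \<Omega>)"

definition limit_class ::
  "(real^3) set \<Rightarrow> real^3^3 \<Rightarrow> real^3^3 \<Rightarrow> ((real^3 \<Rightarrow> real^3) \<times> (real^3 \<Rightarrow> real^3)) set" where
  "limit_class \<Omega> A B = {(u, b). u \<in> W1inf_space \<Omega> \<and> b \<in> Linf_space \<Omega> \<and>
     planar_grad_with \<Omega> u b \<in> BV_valued \<Omega> {A, B} \<and>
     has_weak_partial \<Omega> (axis 3 1) u (\<lambda>_. 0) \<and> has_weak_partial \<Omega> (axis 3 1) b (\<lambda>_. 0)}"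

definition mean_value :: "'a::euclidean_space set \<Rightarrow> ('a \<Rightarrow> 'b::euclidean_space) \<Rightarrow> 'b" where
  "mean_value U f = (1 / measure lebesgue U) *\<^sub>R (LINT x|lebesgue_on U. f x)"

end

theory Submission
  imports Defs "HOL-Complex_Analysis.Great_Picard"
begin

text \<open>
  Let \<open>\<Phi>\<close> be a smooth function of \<open>|\<xi> - A|\<close> that is \<open>0\<close> near \<open>A\<close> and \<open>1\<close> outside a ball around
  \<open>A\<close> not containing \<open>B\<close>. Its gradient lives on a compact annulus where \<open>W\<close> is bounded below, so
  \<open>|D\<Phi>| \<le> K sqrt W\<close>. By the Modica--Mortola trick, Young's inequality turns the energy bound into
  a uniform bound on the total variations of \<open>\<Phi>(\<nabla>\<^sub>h u\<^sub>n)\<close>, and the variation in the direction \<open>x\<^sub>3\<close> is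
  even \<open>O(h\<^sub>n)\<close>, since by symmetry of the Hessian \<open>\<partial>\<^sub>3 \<nabla>\<^sub>h u\<^sub>n\<close> is \<open>h\<^sub>n\<close> times entries of the rescaled
  Hessian. A subsequence of \<open>\<Phi>(\<nabla>\<^sub>h u\<^sub>n)\<close> therefore converges almost everywhere to the indicator
  function of a set of finite perimeter that does not depend on \<open>x\<^sub>3\<close>. As \<open>W(\<nabla>\<^sub>h u\<^sub>n) \<rightarrow> 0\<close>, the rescaled
  gradients themselves converge to \<open>A\<close> or \<open>B\<close>, and the coercivity of \<open>W\<close> improves this to convergence
  in \<open>L\<^sup>p\<close>. Poincare's inequality then gives the convergence of \<open>u\<^sub>n\<close> minus its mean.
\<close>

section \<open>Smooth bump functions\<close>

text \<open>The cut-off \<Phi> takes the place of a geodesic distance weighted by sqrt W: being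
  bounded and Lipschitz, it keeps the composition with a merely integrable gradient field in
  W^{1,1}, and the compactness argument only meets functions bounded by 1. Once \<open>W\<close>
  tends to 0, the limit value 0 or 1 still tells the wells apart. Convexity keeps the analysis
  elementary: segments between interior points stay inside together with small balls, so that
  Poincare inequalities and compactness follow by mollifying, integrating along segments and
  applying Fatou's lemma. Mollification sees the gradient only away from the boundary; the remaining
  strip is controlled by its small measure. The directions are kept apart by weights \<kappa>, which
  is how the factor h_n reaches the limit and makes \<open>b\<close> independent of x_3. For
  \<open>u\<close> the reason is different: its thin derivative is h_n times a column of a field
  bounded in L^p. Concentration of the p-th powers of the gradients is excluded by comparing them
  with \<open>W\<close>, whose integral tends to 0.\<close>

text \<open>Admitting powers of \<open>t\<close> in the denominator makes this family closed under differentiation.\<close>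

definition flat :: "nat \<Rightarrow> real \<Rightarrow> real" where
  "flat n t = (if t > 0 then exp (- 1 / t) / t ^ n else 0)"

lemma flat_nonneg: "flat n t \<ge> 0"
  by (simp add: flat_def)

lemma flat_pos_iff: "flat n t > 0 \<longleftrightarrow> t > 0"
  by (auto simp: flat_def)

lemma flat_eq_0: "t \<le> 0 \<Longrightarrow> flat n t = 0"
  by (simp add: flat_def)

text \<open>One term of the exponential series at 1/t, the one of index n + 2, bounds exp (1/t) from
  below. It exceeds the power in the denominator by two, so that even \<open>flat n t / t\<close>
  tends to 0 at 0.\<close>

lemma abs_flat_le: "\<bar>flat n t\<bar> \<le> fact (n + 2) * t\<^sup>2"
proof (cases "t > 0")
  case True
  have "(1 / t) ^ (n + 2) / fact (n + 2) \<le> exp (1 / t)"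
  proof -
    have "(\<Sum>k\<in>{n+2}. (1 / t) ^ k /\<^sub>R fact k) \<le> (\<Sum>k. (1 / t) ^ k /\<^sub>R fact k)"
      using True by (intro sum_le_suminf summable_exp_generic) auto
    then show ?thesis
      by (simp add: exp_def divide_inverse mult.commute)
  qed
  moreover define C :: real where "C = fact (n + 2)"
  moreover have "C > 0"
    by (simp add: C_def del: fact_Suc)
  ultimately have "(1 / t) ^ (n + 2) \<le> C * exp (1 / t)"
    unfolding C_def[symmetric] by (subst (asm) pos_divide_le_eq) (auto simp: mult.commute)
  then have "(1 / t) ^ (n + 2) * (t ^ (n + 2) * exp (- (1 / t))) \<le> C * exp (1 / t) * (t ^ (n + 2) * exp (- (1 / t)))"
    using True by (intro mult_right_mono) auto
  then have "exp (- (1 / t)) \<le> C * (t\<^sup>2 * t ^ n)"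
    using True by (simp add: power_one_over exp_minus field_simps power_add power2_eq_square)
  then have "exp (- (1 / t)) / t ^ n \<le> fact (n + 2) * t\<^sup>2"
    using True by (simp add: pos_divide_le_eq C_def mult.assoc del: fact_Suc)
  then show ?thesis
    using True by (simp add: flat_def)
qed (simp add: flat_def)

text \<open>For t > 0 the exponential contributes the factor 1/t^2, hence the index n + 2, and the
  power contributes the index n + 1. At 0 the quadratic bound of \<open>abs_flat_le\<close> makes
  the difference quotient tend to 0.\<close>

lemma has_real_derivative_flat:
  "(flat n has_real_derivative (flat (n + 2) t - n * flat (n + 1) t)) (at t)"
proof -
  consider "t > 0" | "t < 0" | "t = 0" by linarith
  then show ?thesis
  proof cases
    case 1
    have "((\<lambda>t. exp (- 1 / t) / t ^ n) has_real_derivative (flat (n + 2) t - n * flat (n + 1) t)) (at t)"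
    proof (cases n)
      case (Suc m)
      have "t ^ m = t * t ^ (m - 1)" if "m \<noteq> 0"
        using that by (metis power_eq_if)
      then show ?thesis
        using 1 Suc
        by (cases "m = 0") (auto intro!: derivative_eq_intros simp: flat_def field_simps power2_eq_square)
    qed (use 1 in \<open>auto intro!: derivative_eq_intros simp: flat_def field_simps power2_eq_square\<close>)
    then show ?thesis
      by (rule has_field_derivative_transform_within_open[of _ _ _ "{0<..}"])
        (use 1 in \<open>auto simp: flat_def\<close>)
  next
    case 2
    have "((\<lambda>t. 0) has_real_derivative (flat (n + 2) t - n * flat (n + 1) t)) (at t)"
      using 2 by (simp add: flat_def)
    then show ?thesis
      by (rule has_field_derivative_transform_within_open[of _ _ _ "{..<0}"])
        (use 2 in \<open>auto simp: flat_def\<close>)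
  next
    case 3
    have "((\<lambda>s. flat n s / s) \<longlongrightarrow> 0) (at 0)"
    proof (rule Lim_null_comparison)
      show "\<forall>\<^sub>F s in at 0. norm (flat n s / s) \<le> fact (n + 2) * \<bar>s\<bar>"
      proof (intro always_eventually allI)
        fix s :: real
        show "norm (flat n s / s) \<le> fact (n + 2) * \<bar>s\<bar>"
          using abs_flat_le[of n s]
          by (cases "s = 0") (auto simp: divide_le_eq power2_eq_square abs_mult mult.assoc)
      qed
      show "((\<lambda>s::real. fact (n + 2) * \<bar>s\<bar>) \<longlongrightarrow> 0) (at 0)"
        by (rule tendsto_eq_intros refl | simp)+
    qed
    then show ?thesis
      unfolding has_field_derivative_iff 3 by (simp add: flat_eq_0)
  qed
qed

section \<open>Calculus of functions of class C^k\<close>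

lemma Ck_SucD: "Ck (Suc k) f \<Longrightarrow> Ck k f"
proof (induction k arbitrary: f)
  case 0
  then show ?case
    by (auto intro!: continuous_at_imp_continuous_on differentiable_imp_continuous_within)
next
  case (Suc k)
  then show ?case by simp
qed

lemma Ck_mono: "Ck k f \<Longrightarrow> j \<le> k \<Longrightarrow> Ck j f"
  by (induction k) (auto simp: le_Suc_eq simp del: Ck.simps dest: Ck_SucD)

lemma Ck_const [simp]: "Ck k (\<lambda>x. c)"
  by (induction k arbitrary: c) auto

lemma Ck_add: "Ck k f \<Longrightarrow> Ck k g \<Longrightarrow> Ck k (\<lambda>x. f x + g x)"
proof (induction k arbitrary: f g)
  case (Suc k)
  have "frechet_derivative (\<lambda>x. f x + g x) (at x) =
      (\<lambda>i. frechet_derivative f (at x) i + frechet_derivative g (at x) i)" for x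
    by (rule frechet_derivative_at[symmetric], rule has_derivative_add)
      (use Suc.prems in \<open>auto simp: frechet_derivative_works[symmetric]\<close>)
  then show ?case
    using Suc by auto
qed (auto intro: continuous_intros)

lemma Ck_linear: "bounded_linear L \<Longrightarrow> Ck k f \<Longrightarrow> Ck k (\<lambda>x. L (f x))"
proof (induction k arbitrary: f)
  case (Suc k)
  have "((\<lambda>x. L (f x)) has_derivative (\<lambda>i. L (frechet_derivative f (at x) i))) (at x)" for x
    using Suc.prems
    by (intro bounded_linear.has_derivative[OF Suc.prems(1)])
      (auto simp: frechet_derivative_works[symmetric])
  then have "frechet_derivative (\<lambda>x. L (f x)) (at x) =
      (\<lambda>i. L (frechet_derivative f (at x) i))" "(\<lambda>x. L (f x)) differentiable (at x)" for x
    by (auto simp: frechet_derivative_at[symmetric] intro: differentiableI)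
  then show ?case
    using Suc by auto
qed (auto intro: bounded_linear.continuous_on)

lemma Ck_scaleR:
  fixes f :: "'a::euclidean_space \<Rightarrow> real"
  shows "Ck k f \<Longrightarrow> Ck k g \<Longrightarrow> Ck k (\<lambda>x. f x *\<^sub>R g x)"
proof (induction k arbitrary: f g)
  case (Suc k)
  have "((\<lambda>x. f x *\<^sub>R g x) has_derivative (\<lambda>i. f x *\<^sub>R frechet_derivative g (at x) i +
      frechet_derivative f (at x) i *\<^sub>R g x)) (at x)" for x
    using Suc.prems by (intro has_derivative_scaleR) (auto simp: frechet_derivative_works[symmetric])
  then have "frechet_derivative (\<lambda>x. f x *\<^sub>R g x) (at x) = (\<lambda>i. f x *\<^sub>R frechet_derivative g (at x) i +
      frechet_derivative f (at x) i *\<^sub>R g x)" "(\<lambda>x. f x *\<^sub>R g x) differentiable (at x)" for x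
    by (auto simp: frechet_derivative_at[symmetric] intro: differentiableI)
  moreover have "Ck k f" "Ck k g"
    using Suc.prems Ck_SucD by blast+
  ultimately show ?case
    using Suc by (auto intro!: Ck_add)
qed (auto intro: continuous_intros)

text \<open>The factors s = -1 and s = 1 are the ones of interest: reflections turn kernels into
  test functions, translations enter difference quotients.\<close>

lemma Ck_affine:
  assumes "Ck k f" shows "Ck k (\<lambda>y. f (c + s *\<^sub>R y))"
  using assms
proof (induction k arbitrary: f)
  case (Suc k)
  have "((\<lambda>y. f (c + s *\<^sub>R y)) has_derivative (\<lambda>i. s *\<^sub>R frechet_derivative f (at (c + s *\<^sub>R y)) i)) (at y)" for y
  proof -
    have D: "(f has_derivative frechet_derivative f (at (c + s *\<^sub>R y))) (at (c + s *\<^sub>R y))"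
      using Suc.prems by (auto simp: frechet_derivative_works[symmetric])
    have "((\<lambda>y. f (c + s *\<^sub>R y)) has_derivative (\<lambda>i. frechet_derivative f (at (c + s *\<^sub>R y)) (s *\<^sub>R i))) (at y)"
      by (rule has_derivative_compose[of "\<lambda>y. c + s *\<^sub>R y" _ _ _ f, OF _ D]) (auto intro!: derivative_eq_intros)
    then show ?thesis
      using linear_cmul[OF has_derivative_linear[OF D]] by simp
  qed
  then have "frechet_derivative (\<lambda>y. f (c + s *\<^sub>R y)) (at y) = (\<lambda>i. s *\<^sub>R frechet_derivative f (at (c + s *\<^sub>R y)) i)"
     "(\<lambda>y. f (c + s *\<^sub>R y)) differentiable (at y)" for y
    by (auto simp: frechet_derivative_at[symmetric] intro: differentiableI)
  then show ?case
    using Suc.IH[of "\<lambda>x. frechet_derivative f (at x) _"] Suc.prems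
    by (auto intro!: Ck_linear[OF bounded_linear_scaleR_right])
qed (auto intro!: continuous_intros elim!: continuous_on_compose2)

text \<open>The induction over k treats all n together, because the derivative of
  \<open>flat n\<close> involves the indices n + 2 and n + 1. The inner function is taken of every
  class so that its own derivative is available at each stage.\<close>

lemma Ck_flat:
  assumes "\<And>k. Ck k q" shows "Ck k (\<lambda>x. flat n (q x))"
proof (induction k arbitrary: n)
  case 0
  have "continuous_on UNIV (flat n)"
    by (intro continuous_at_imp_continuous_on ballI DERIV_isCont[OF has_real_derivative_flat])
  moreover have "continuous_on UNIV q"
    using assms[of 0] by simp
  ultimately show ?case
    by (auto intro: continuous_on_compose2)
next
  case (Suc k)
  have "((\<lambda>x. flat n (q x)) has_derivative (\<lambda>i. (flat (n + 2) (q x) + (- real n) *\<^sub>R flat (n + 1) (q x))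
       *\<^sub>R frechet_derivative q (at x) i)) (at x)" for x
  proof -
    have "(q has_derivative frechet_derivative q (at x)) (at x)"
      using assms[of 1] by (auto simp: frechet_derivative_works[symmetric])
    from has_derivative_compose[OF this has_real_derivative_flat[unfolded has_field_derivative_def]]
    show ?thesis by (simp add: mult.commute)
  qed
  then have "frechet_derivative (\<lambda>x. flat n (q x)) (at x) = (\<lambda>i. (flat (n + 2) (q x) + (- real n) *\<^sub>R flat (n + 1) (q x))
       *\<^sub>R frechet_derivative q (at x) i)" "(\<lambda>x. flat n (q x)) differentiable (at x)" for x
    by (auto simp: frechet_derivative_at[symmetric] intro: differentiableI)
  moreover have "Ck k (\<lambda>x. frechet_derivative q (at x) i)" if "i \<in> Basis" for i
    using assms[of "Suc k"] that by auto
  moreover have "Ck k (\<lambda>x. flat (n + 2) (q x) + (- real n) *\<^sub>R flat (n + 1) (q x))"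
    by (intro Ck_add Ck_linear[OF bounded_linear_scaleR_right] Suc.IH)
  ultimately show ?case
    by (simp add: Ck_scaleR del: scaleR_conv_of_real real_scaleR_def)
qed

lemma Ck_ident: "Ck k (\<lambda>x. x \<bullet> i)"
proof (cases k)
  case (Suc j)
  have "frechet_derivative (\<lambda>x. x \<bullet> i) (at x) = (\<lambda>x. x \<bullet> i)" for x
    by (rule frechet_derivative_at[symmetric]) (auto intro!: derivative_eq_intros)
  then show ?thesis
    using Suc by auto
qed (auto intro: continuous_intros)

lemma Ck_sum: "(\<And>i. i \<in> I \<Longrightarrow> Ck k (f i)) \<Longrightarrow> Ck k (\<lambda>x. \<Sum>i\<in>I. f i x)"
  by (induction I rule: infinite_finite_induct) (auto intro: Ck_add)

text \<open>The squared norm is a polynomial in the coordinates, hence smooth also at the origin,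
  where the norm is not.\<close>

definition bump :: "real \<Rightarrow> 'a::euclidean_space \<Rightarrow> real" where
  "bump \<delta> x = flat 0 (\<delta>\<^sup>2 - (norm x)\<^sup>2)"

lemma Ck_bump: "Ck k (bump \<delta>)"
proof -
  have "Ck k (\<lambda>x::'a. \<delta>\<^sup>2 + (-1) *\<^sub>R (\<Sum>i\<in>Basis. (x \<bullet> i) *\<^sub>R (x \<bullet> i)))" for k
    by (intro Ck_add Ck_linear[OF bounded_linear_scaleR_right] Ck_sum Ck_scaleR Ck_ident Ck_const)
  then have "Ck k (\<lambda>x::'a. \<delta>\<^sup>2 - (norm x)\<^sup>2)" for k
    by (simp add: norm_conv_dist[symmetric] power2_norm_eq_inner euclidean_inner[symmetric])
  from Ck_flat[OF this] show ?thesis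
    by (simp add: bump_def[abs_def])
qed

section \<open>Invariance of the Lebesgue measure under translations and reflections\<close>

lemma lborel_distr_translate: "distr lborel borel (\<lambda>x::'a::euclidean_space. x + z) = lborel"
  using lborel_distr_plus[of z] by (simp add: add.commute[of _ z])

lemma lborel_distr_reflect: "distr lborel borel (\<lambda>y::'a::euclidean_space. x - y) = lborel"
  using lborel_affine[of "-1" x] by (simp add: density_1)

lemma
  fixes f :: "'a::euclidean_space \<Rightarrow> 'b::{banach, second_countable_topology}"
  assumes "f \<in> borel_measurable borel"
  shows integral_lborel_translate: "(\<integral>x. f (x + z) \<partial>lborel) = (\<integral>x. f x \<partial>lborel)"
    and integral_lborel_reflect: "(\<integral>y. f (x - y) \<partial>lborel) = (\<integral>y. f y \<partial>lborel)"
  using integral_distr[of "\<lambda>x::'a. x + z" lborel borel f]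
    integral_distr[of "\<lambda>y. x - y" lborel borel f] assms
  by (simp_all add: lborel_distr_translate lborel_distr_reflect)

lemma
  fixes f :: "'a::euclidean_space \<Rightarrow> 'b::{banach, second_countable_topology}"
  assumes "f \<in> borel_measurable borel"
  shows integrable_lborel_translate: "integrable lborel (\<lambda>x. f (x + z)) \<longleftrightarrow> integrable lborel f"
    and integrable_lborel_reflect: "integrable lborel (\<lambda>y. f (x - y)) \<longleftrightarrow> integrable lborel f"
  using integrable_distr_eq[of "\<lambda>x::'a. x + z" lborel borel f]
    integrable_distr_eq[of "\<lambda>y. x - y" lborel borel f] assms
  by (simp_all add: lborel_distr_translate lborel_distr_reflect)

lemma nn_integral_lborel_translate:
  fixes f :: "'a::euclidean_space \<Rightarrow> ennreal"
  assumes "f \<in> borel_measurable borel"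
  shows "(\<integral>\<^sup>+x. f (x + z) \<partial>lborel) = (\<integral>\<^sup>+x. f x \<partial>lborel)"
  using nn_integral_distr[of "\<lambda>x::'a. x + z" lborel borel f] assms
  by (simp add: lborel_distr_translate)

lemma integrable_lborel_borel: "integrable lborel f \<Longrightarrow> f \<in> borel_measurable borel"
  using borel_measurable_integrable by fastforce

section \<open>Continuity of translations in the mean\<close>

text \<open>Inserting g splits the difference into three parts; the two outer ones have the same
  integral by translation invariance. This reduces the continuity of translations to a class of
  functions that is dense in L1.\<close>

lemma translation_tendsto_approx:
  fixes f :: "'a::euclidean_space \<Rightarrow> 'b::{banach, second_countable_topology}"
  assumes f: "integrable lborel f"
    and approx: "\<And>e. e > 0 \<Longrightarrow> \<exists>g. integrable lborel g \<and> (\<integral>x. norm (f x - g x) \<partial>lborel) < e \<and>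
      ((\<lambda>z. \<integral>x. norm (g (x + z) - g x) \<partial>lborel) \<longlongrightarrow> 0) (at 0)"
  shows "((\<lambda>z. \<integral>x. norm (f (x + z) - f x) \<partial>lborel) \<longlongrightarrow> 0) (at 0)"
proof (rule tendstoI)
  fix e :: real assume "e > 0"
  then obtain g where g: "integrable lborel g" "(\<integral>x. norm (f x - g x) \<partial>lborel) < e / 3"
    and lim: "((\<lambda>z. \<integral>x. norm (g (x + z) - g x) \<partial>lborel) \<longlongrightarrow> 0) (at 0)"
    using approx[of "e / 3"] by auto
  have [measurable]: "f \<in> borel_measurable borel" "g \<in> borel_measurable borel"
    using f g(1) by (auto intro: integrable_lborel_borel)
  have int: "integrable lborel (\<lambda>x. f (x + z))" "integrable lborel (\<lambda>x. g (x + z))" for z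
    using f g(1) by (simp_all add: integrable_lborel_translate)
  have "(\<integral>x. norm (f (x + z) - f x) \<partial>lborel) < e" if z: "(\<integral>x. norm (g (x + z) - g x) \<partial>lborel) < e / 3" for z
  proof -
    have "(\<integral>x. norm (f (x + z) - f x) \<partial>lborel) \<le>
        (\<integral>x. norm (f (x + z) - g (x + z)) + norm (g (x + z) - g x) + norm (f x - g x) \<partial>lborel)"
    proof (intro integral_mono Bochner_Integration.integrable_add integrable_norm Bochner_Integration.integrable_diff)
      fix x
      have "f (x + z) - f x = (f (x + z) - g (x + z)) + (g (x + z) - g x) - (f x - g x)"
        by simp
      then show "norm (f (x + z) - f x) \<le> norm (f (x + z) - g (x + z)) + norm (g (x + z) - g x) + norm (f x - g x)"
        by (metis (no_types) norm_triangle_ineq4 norm_triangle_ineq add_right_mono order_trans)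
    qed (use f g int in auto)
    also have "\<dots> = (\<integral>x. norm (f (x + z) - g (x + z)) \<partial>lborel) + (\<integral>x. norm (g (x + z) - g x) \<partial>lborel) +
        (\<integral>x. norm (f x - g x) \<partial>lborel)"
      using f g int by simp
    also have "(\<integral>x. norm (f (x + z) - g (x + z)) \<partial>lborel) = (\<integral>x. norm (f x - g x) \<partial>lborel)"
      by (rule integral_lborel_translate[of "\<lambda>x. norm (f x - g x)"]) simp
    finally show ?thesis
      using z g(2) by simp
  qed
  then have "eventually (\<lambda>z. (\<integral>x. norm (f (x + z) - f x) \<partial>lborel) < e) (at 0)"
    using order_tendstoD(2)[OF lim, of "e / 3"] \<open>e > 0\<close> by (auto elim: eventually_mono)
  then show "eventually (\<lambda>z. dist (\<integral>x. norm (f (x + z) - f x) \<partial>lborel) 0 < e) (at 0)"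
    by simp
qed

text \<open>A point of the open set T stays in T under small shifts, so the loss
  \<open>indicator T x - indicator T (x + z)\<close> tends to 0 pointwise and dominated convergence
  applies to its positive part. The gain is not controlled pointwise, but it has the same integral
  as the loss because translates of T have the same measure.\<close>

lemma translation_tendsto_open:
  fixes T :: "'a::euclidean_space set" and c :: "'b::{banach, second_countable_topology}"
  assumes "open T" "emeasure lborel T < \<infinity>"
  shows "((\<lambda>z. \<integral>x. norm (indicator T (x + z) *\<^sub>R c - indicator T x *\<^sub>R c) \<partial>lborel) \<longlongrightarrow> 0) (at 0)"
  unfolding tendsto_at_iff_sequentially
proof (intro allI impI)
  fix Z :: "nat \<Rightarrow> 'a" assume Z: "Z \<longlonglongrightarrow> 0"
  have [measurable]: "T \<in> sets borel"
    using assms by auto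
  let ?I = "indicator T :: 'a \<Rightarrow> real"
  have int: "integrable lborel ?I"
    using assms by auto
  then have int': "integrable lborel (\<lambda>x. ?I (x + z))" for z
    by (subst integrable_lborel_translate) auto
  have "(\<lambda>n. \<integral>x. max 0 (?I x - ?I (x + Z n)) \<partial>lborel) \<longlonglongrightarrow> integral\<^sup>L lborel (\<lambda>x::'a. 0)"
  proof (rule integral_dominated_convergence[where w = ?I])
    show "AE x in lborel. (\<lambda>n. max 0 (?I x - ?I (x + Z n))) \<longlonglongrightarrow> 0"
    proof (intro always_eventually allI)
      fix x
      show "(\<lambda>n. max 0 (?I x - ?I (x + Z n))) \<longlonglongrightarrow> 0"
      proof (cases "x \<in> T")
        case True
        have "(\<lambda>n. x + Z n) \<longlonglongrightarrow> x"
          using tendsto_add[OF tendsto_const[of x] Z] by simp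
        from topological_tendstoD[OF this \<open>open T\<close> True]
        have "eventually (\<lambda>n. max 0 (?I x - ?I (x + Z n)) = 0) sequentially"
          by (auto elim!: eventually_mono simp: True)
        then show ?thesis
          by (rule tendsto_eventually)
      qed auto
    qed
  qed (use int in \<open>auto simp: indicator_def\<close>)
  moreover have "(\<integral>x. norm (?I (x + z) *\<^sub>R c - ?I x *\<^sub>R c) \<partial>lborel) =
      2 * norm c * (\<integral>x. max 0 (?I x - ?I (x + z)) \<partial>lborel)" for z
  proof -
    \<comment> \<open>Pointwise this is the identity |s - t| = 2 max 0 (t - s) + s - t; the last two
      terms cancel after integration.\<close>
    have "(\<integral>x. norm (?I (x + z) *\<^sub>R c - ?I x *\<^sub>R c) \<partial>lborel) =
        (\<integral>x. norm c * (2 * max 0 (?I x - ?I (x + z)) + ?I (x + z) - ?I x) \<partial>lborel)"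
      by (intro Bochner_Integration.integral_cong) (auto simp: indicator_def)
    also have "\<dots> = norm c * (2 * (\<integral>x. max 0 (?I x - ?I (x + z)) \<partial>lborel) + (\<integral>x. ?I (x + z) \<partial>lborel) - (\<integral>x. ?I x \<partial>lborel))"
    proof -
      have "integrable lborel (\<lambda>x. max 0 (?I x - ?I (x + z)))"
        by (rule Bochner_Integration.integrable_bound[OF int]) (auto simp: indicator_def)
      then show ?thesis
        using int int' by simp
    qed
    also have "(\<integral>x. ?I (x + z) \<partial>lborel) = (\<integral>x. ?I x \<partial>lborel)"
      by (rule integral_lborel_translate) auto
    finally show ?thesis by simp
  qed
  ultimately show "((\<lambda>z. \<integral>x. norm (?I (x + z) *\<^sub>R c - ?I x *\<^sub>R c) \<partial>lborel) \<circ> Z) \<longlonglongrightarrow> 0"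
    by (auto simp: comp_def intro!: tendsto_mult_right_zero)
qed

text \<open>The induction principle for integrable functions leaves indicators, sums and dominated
  limits. For indicators, outer regularity replaces the set by an open one of finite measure, which
  \<open>translation_tendsto_open\<close> covers.\<close>

lemma translation_tendsto:
  fixes f :: "'a::euclidean_space \<Rightarrow> 'b::{banach, second_countable_topology}"
  assumes "integrable lborel f"
  shows "((\<lambda>z. \<integral>x. norm (f (x + z) - f x) \<partial>lborel) \<longlongrightarrow> 0) (at 0)"
  using assms
proof (induction rule: integrable_induct)
  case (base A c)
  then have [measurable]: "A \<in> sets borel" by simp
  show ?case
  proof (rule translation_tendsto_approx)
    fix e :: real assume "e > 0"
    \<comment> \<open>The summand 1 admits c = 0 and makes norm c * d strictly less than e.\<close>
    define d where "d = e / (norm c + 1)"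
    have "d > 0" 
      unfolding d_def using \<open>e > 0\<close> by (intro divide_pos_pos) (auto simp: add_nonneg_pos)
    obtain T where T: "open T" "A \<subseteq> T" "emeasure lborel (T - A) < d"
      using outer_regular_lborel[of A d] \<open>d > 0\<close> by auto
    have [measurable]: "T \<in> sets borel" using T by auto
    have eT: "emeasure lborel T < \<infinity>"
    proof -
      have "emeasure lborel T \<le> emeasure lborel A + emeasure lborel (T - A)"
        using emeasure_subadditive[of A lborel "T - A"] T(2) by (simp add: Un_absorb1)
      also have "\<dots> < \<infinity>"
        using base T(3) by (auto simp: less_top[symmetric] top_unique)
      finally show ?thesis .
    qed
    have "(\<integral>x. norm (indicator A x *\<^sub>R c - indicator T x *\<^sub>R c) \<partial>lborel) = (\<integral>x. norm c * indicator (T - A) x \<partial>lborel)"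
      using T(2) by (intro Bochner_Integration.integral_cong) (auto simp: indicator_def)
    also have "\<dots> = norm c * measure lborel (T - A)"
      by simp
    also have "\<dots> < e"
    proof -
      have "measure lborel (T - A) < d"
      proof -
        have "emeasure lborel (T - A) \<noteq> top"
          using T(3) by auto
        then show ?thesis
          using T(3) emeasure_eq_ennreal_measure[of lborel "T - A"] by (simp add: ennreal_less_iff)
      qed
      moreover have "norm c * d < e"
      proof -
        have "norm c * d = e * (norm c / (norm c + 1))"
          by (simp add: d_def)
        also have "\<dots> < e * 1"
          using \<open>e > 0\<close> by (intro mult_strict_left_mono) (auto simp: divide_less_eq add_nonneg_pos)
        finally show ?thesis by simp
      qed
      ultimately show ?thesis
        by (smt (verit, best) mult_left_mono norm_ge_zero)
    qed
    finally show "\<exists>g. integrable lborel g \<and> (\<integral>x. norm (indicator A x *\<^sub>R c - g x) \<partial>lborel) < e \<and>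
        ((\<lambda>z. \<integral>x. norm (g (x + z) - g x) \<partial>lborel) \<longlongrightarrow> 0) (at 0)"
      using translation_tendsto_open[OF T(1) eT, of c] eT
      by (intro exI[of _ "\<lambda>x. indicator T x *\<^sub>R c"]) auto
  qed (use base in auto)
next
  case (add f g)
  note [measurable] = add.hyps[THEN integrable_lborel_borel]
  have int: "integrable lborel (\<lambda>x. f (x + z))" "integrable lborel (\<lambda>x. g (x + z))" for z
    using add by (simp_all add: integrable_lborel_translate)
  show ?case
  proof (rule Lim_null_comparison)
    show "\<forall>\<^sub>F z in at 0. norm (\<integral>x. norm (f (x + z) + g (x + z) - (f x + g x)) \<partial>lborel) \<le>
       (\<integral>x. norm (f (x + z) - f x) \<partial>lborel) + (\<integral>x. norm (g (x + z) - g x) \<partial>lborel)"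
    proof (intro always_eventually allI)
      fix z
      have "(\<integral>x. norm (f (x + z) + g (x + z) - (f x + g x)) \<partial>lborel) \<le>
        (\<integral>x. norm (f (x + z) - f x) + norm (g (x + z) - g x) \<partial>lborel)"
        using add int by (intro integral_mono) (auto simp: add_diff_add norm_triangle_ineq)
      then show "norm (\<integral>x. norm (f (x + z) + g (x + z) - (f x + g x)) \<partial>lborel) \<le>
       (\<integral>x. norm (f (x + z) - f x) \<partial>lborel) + (\<integral>x. norm (g (x + z) - g x) \<partial>lborel)"
        using add int by simp
    qed
    show "((\<lambda>z. (\<integral>x. norm (f (x + z) - f x) \<partial>lborel) + (\<integral>x. norm (g (x + z) - g x) \<partial>lborel)) \<longlongrightarrow> 0) (at 0)"
      using tendsto_add[OF add.IH] by simp
  qed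
next
  case (lim f s)
  note lim = lim.hyps(1) lim.IH lim.hyps(2-)
  show ?case
  proof (rule translation_tendsto_approx[OF lim(5)])
    fix e :: real assume "e > 0"
    have "(\<lambda>i. \<integral>x. norm (f x - s i x) \<partial>lborel) \<longlonglongrightarrow> integral\<^sup>L lborel (\<lambda>x::'a. 0)"
    \<comment> \<open>The approximating simple functions are bounded by 2 * norm (f x), whence the
      factor 3.\<close>
    proof (rule integral_dominated_convergence[where w = "\<lambda>x. 3 * norm (f x)"])
      show "AE x in lborel. (\<lambda>i. norm (f x - s i x)) \<longlonglongrightarrow> 0"
      proof (intro always_eventually allI)
        fix x
        show "(\<lambda>i. norm (f x - s i x)) \<longlonglongrightarrow> 0"
          using tendsto_diff[OF tendsto_const[of "f x"] lim(3)[of x]] by (auto intro: tendsto_norm_zero)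
      qed
      show "AE x in lborel. norm (norm (f x - s i x)) \<le> 3 * norm (f x)" for i
      proof (intro always_eventually allI)
        fix x
        show "norm (norm (f x - s i x)) \<le> 3 * norm (f x)"
          using lim(4)[of x i] norm_triangle_ineq4[of "f x" "s i x"] by simp
      qed
    qed (use lim in auto)
    then have "eventually (\<lambda>i. (\<integral>x. norm (f x - s i x) \<partial>lborel) < e) sequentially"
      using \<open>e > 0\<close> by (intro order_tendstoD(2)) auto
    then obtain i where "(\<integral>x. norm (f x - s i x) \<partial>lborel) < e"
      by (auto simp: eventually_sequentially)
    then show "\<exists>g. integrable lborel g \<and> (\<integral>x. norm (f x - g x) \<partial>lborel) < e \<and>
        ((\<lambda>z. \<integral>x. norm (g (x + z) - g x) \<partial>lborel) \<longlongrightarrow> 0) (at 0)"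
      using lim by blast
  qed
qed

section \<open>Compactly supported functions of class C^k\<close>

lemma Ck_compactI:
  assumes "Ck k f" "compact K" "K \<subseteq> U" "\<And>x. x \<notin> K \<Longrightarrow> f x = 0"
  shows "f \<in> Ck_compact k U"
proof -
  have sub: "closure {x. f x \<noteq> 0} \<subseteq> K"
    using assms by (intro closure_minimal compact_imp_closed) auto
  then have "compact (closure {x. f x \<noteq> 0})"
    using compact_Int_closed[OF assms(2) closed_closure] by (metis inf.absorb2)
  then show ?thesis
    using assms sub unfolding Ck_compact_def by blast
qed

lemma Ck_compact_supportE:
  assumes "f \<in> Ck_compact k U"
  obtains K where "compact K" "K \<subseteq> U" "\<And>x. x \<notin> K \<Longrightarrow> f x = 0"
  using assms closure_subset[of "{x. f x \<noteq> 0}"] unfolding Ck_compact_def by blast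

lemma Ck_compact_differentiable: "f \<in> Ck_compact (Suc k) U \<Longrightarrow> f differentiable (at x)"
  by (auto simp: Ck_compact_def)

lemma frechet_derivative_Ck_compact:
  assumes "f \<in> Ck_compact (Suc k) U" "i \<in> Basis"
  shows "(\<lambda>x. frechet_derivative f (at x) i) \<in> Ck_compact k U"
proof -
  obtain K where K: "compact K" "K \<subseteq> U" "\<And>x. x \<notin> K \<Longrightarrow> f x = 0"
    using assms by (auto elim: Ck_compact_supportE)
  show ?thesis
  proof (rule Ck_compactI[OF _ K(1,2)])
    show "Ck k (\<lambda>x. frechet_derivative f (at x) i)"
      using assms by (auto simp: Ck_compact_def)
    fix x assume x: "x \<notin> K"
    have "frechet_derivative f (at x) = frechet_derivative (\<lambda>x. 0) (at x)"
      by (rule frechet_derivative_transform_within_open[of _ _ "- K"])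
        (use x K assms in \<open>auto intro: Ck_compact_differentiable compact_imp_closed\<close>)
    then show "frechet_derivative f (at x) i = 0"
      by simp
  qed
qed

lemma Ck_compact_0_bounded:
  assumes "f \<in> Ck_compact k U"
  obtains B where "B \<ge> 0" "\<And>x. norm (f x) \<le> B"
proof -
  obtain K where K: "compact K" "K \<subseteq> U" "\<And>x. x \<notin> K \<Longrightarrow> f x = 0"
    using assms by (auto elim: Ck_compact_supportE)
  have "Ck 0 f"
    using assms Ck_mono[of k f 0] by (auto simp: Ck_compact_def)
  then have "compact (f ` K)"
    using K by (auto intro!: compact_continuous_image elim: continuous_on_subset)
  then obtain B where "\<And>x. x \<in> K \<Longrightarrow> norm (f x) \<le> B"
    by (metis bounded_iff compact_imp_bounded imageI)
  then have "norm (f x) \<le> max B 0" for x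
    using K(3)[of x] by (cases "x \<in> K") (auto simp: le_max_iff_disj)
  then show ?thesis
    using that[of "max B 0"] by auto
qed

lemma Ck_compact_measurable: "f \<in> Ck_compact k U \<Longrightarrow> f \<in> borel_measurable borel"
  using Ck_mono[of k f 0] by (auto simp: Ck_compact_def intro: borel_measurable_continuous_onI)

lemma Ck_compact_integrable:
  assumes "f \<in> Ck_compact k U"
  shows "integrable lborel f"
proof -
  obtain K where K: "compact K" "K \<subseteq> U" "\<And>x. x \<notin> K \<Longrightarrow> f x = 0"
    using assms by (auto elim: Ck_compact_supportE)
  have "continuous_on K f"
    using assms Ck_mono[of k f 0] by (auto simp: Ck_compact_def intro: continuous_on_subset)
  from borel_integrable_compact[OF K(1) this] show ?thesis
    by (rule Bochner_Integration.integrable_cong[THEN iffD1, rotated 2])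
      (use K in \<open>auto simp: indicator_def\<close>)
qed

lemma frechet_derivative_basis_sum:
  assumes "f differentiable (at x)"
  shows "frechet_derivative f (at x) v = (\<Sum>i\<in>Basis. (v \<bullet> i) *\<^sub>R frechet_derivative f (at x) i)"
proof -
  have lin: "linear (frechet_derivative f (at x))"
    using assms by (simp add: linear_frechet_derivative)
  have "frechet_derivative f (at x) v = frechet_derivative f (at x) (\<Sum>i\<in>Basis. (v \<bullet> i) *\<^sub>R i)"
    by (simp add: euclidean_representation)
  also have "\<dots> = (\<Sum>i\<in>Basis. (v \<bullet> i) *\<^sub>R frechet_derivative f (at x) i)"
    using lin by (simp add: linear_sum linear_cmul)
  finally show ?thesis .
qed

lemma Ck_compact_derivative_measurable:
  assumes "f \<in> Ck_compact (Suc k) U"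
  shows "(\<lambda>x. frechet_derivative f (at x) v) \<in> borel_measurable borel"
  unfolding frechet_derivative_basis_sum[OF Ck_compact_differentiable[OF assms], of _ v]
  using assms by (auto intro!: borel_measurable_sum borel_measurable_scaleR
      Ck_compact_measurable[OF frechet_derivative_Ck_compact])

lemma Ck_compact_derivative_bounded:
  assumes "f \<in> Ck_compact (Suc k) U"
  obtains L where "L \<ge> 0" "\<And>x v. norm (frechet_derivative f (at x) v) \<le> L * norm v"
proof -
  have "\<exists>B\<ge>0. \<forall>x. norm (frechet_derivative f (at x) i) \<le> B" if "i \<in> Basis" for i
    using Ck_compact_0_bounded[OF frechet_derivative_Ck_compact[OF assms that]] by metis
  then obtain B where B: "\<And>i. i \<in> Basis \<Longrightarrow> B i \<ge> 0"
    "\<And>i x. i \<in> Basis \<Longrightarrow> norm (frechet_derivative f (at x) i) \<le> B i"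
    by metis
  show ?thesis
  proof
    show "(\<Sum>i\<in>Basis. B i) \<ge> 0"
      using B by (auto intro: sum_nonneg)
    fix x v
    have "norm (frechet_derivative f (at x) v) \<le> (\<Sum>i\<in>Basis. norm ((v \<bullet> i) *\<^sub>R frechet_derivative f (at x) i))"
      unfolding frechet_derivative_basis_sum[OF Ck_compact_differentiable[OF assms], of x v]
      by (rule norm_sum)
    also have "\<dots> \<le> (\<Sum>i\<in>Basis. norm v * B i)"
      using B by (intro sum_mono) (auto intro!: mult_mono Basis_le_norm)
    finally show "norm (frechet_derivative f (at x) v) \<le> (\<Sum>i\<in>Basis. B i) * norm v"
      by (simp add: sum_distrib_left mult.commute)
  qed
qed

lemma lipschitz_from_derivative:
  fixes f :: "'a::euclidean_space \<Rightarrow> 'b::real_normed_vector"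
  assumes "\<And>x. f differentiable (at x)" "\<And>x v. norm (frechet_derivative f (at x) v) \<le> L * norm v"
  shows "norm (f x - f y) \<le> L * norm (x - y)"
proof (rule differentiable_bound[of UNIV])
  show "(f has_derivative frechet_derivative f (at x)) (at x within UNIV)" for x
    using assms(1) by (simp add: frechet_derivative_works[symmetric])
  show "onorm (frechet_derivative f (at x)) \<le> L" for x
    by (rule onorm_le) (rule assms(2))
qed auto

lemma has_vector_derivative_along_line:
  assumes "f differentiable (at (x + s *\<^sub>R v))"
  shows "((\<lambda>t. f (x + t *\<^sub>R v)) has_vector_derivative frechet_derivative f (at (x + s *\<^sub>R v)) v) (at s)"
proof -
  have D: "(f has_derivative frechet_derivative f (at (x + s *\<^sub>R v))) (at (x + s *\<^sub>R v))"
    using assms by (simp add: frechet_derivative_works[symmetric])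
  have "((\<lambda>t. f (x + t *\<^sub>R v)) has_derivative (\<lambda>t. frechet_derivative f (at (x + s *\<^sub>R v)) (t *\<^sub>R v))) (at s)"
    by (rule has_derivative_compose[where g = f and f = "\<lambda>t. x + t *\<^sub>R v" and g' = "frechet_derivative f (at (x + s *\<^sub>R v))"])
      (use D in \<open>auto intro!: derivative_eq_intros\<close>)
  then show ?thesis
    unfolding has_vector_derivative_def using linear_cmul[OF has_derivative_linear[OF D]] by simp
qed

text \<open>Difference quotients along null sequences are the form in which dominated convergence, a
  statement about sequences, can be used to differentiate under the integral sign.\<close>

lemma has_vector_derivative_sequentially:
  fixes f :: "real \<Rightarrow> 'b::real_normed_vector"
  shows "(f has_vector_derivative f') (at s) \<longleftrightarrow>
    (\<forall>X::nat \<Rightarrow> real. (\<forall>n. X n \<noteq> 0) \<longrightarrow> X \<longlonglongrightarrow> 0 \<longrightarrow> (\<lambda>n. (1 / X n) *\<^sub>R (f (s + X n) - f s)) \<longlonglongrightarrow> f')"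
proof -
  have "(f has_vector_derivative f') (at s) \<longleftrightarrow> ((\<lambda>t. (1 / t) *\<^sub>R (f (s + t) - f s)) \<longlongrightarrow> f') (at 0)"
  proof -
    have "((\<lambda>t. (1 / t) *\<^sub>R (f (s + t) - f s)) \<longlongrightarrow> f') (at 0) \<longleftrightarrow>
      ((\<lambda>t. norm ((1 / t) *\<^sub>R (f (s + t) - f s) - f')) \<longlongrightarrow> 0) (at 0)"
      unfolding tendsto_norm_zero_iff by (simp add: Lim_null[of _ f'])
    also have "\<dots> \<longleftrightarrow> ((\<lambda>t. norm (f (s + t) - f s - t *\<^sub>R f') / norm t) \<longlongrightarrow> 0) (at 0)"
    proof (rule tendsto_cong, rule eventually_at_topological[THEN iffD2], intro exI[of _ UNIV] conjI ballI impI)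
      fix t :: real assume t: "t \<noteq> 0"
      have "(1 / t) *\<^sub>R (f (s + t) - f s) - f' = (1 / t) *\<^sub>R (f (s + t) - f s - t *\<^sub>R f')"
        using t by (simp add: scaleR_diff_right)
      then show "norm ((1 / t) *\<^sub>R (f (s + t) - f s) - f') = norm (f (s + t) - f s - t *\<^sub>R f') / norm t"
        by simp
    qed auto
    finally show ?thesis
      unfolding has_vector_derivative_def has_derivative_at
      by (simp add: bounded_linear_scaleR_left)
  qed
  then show ?thesis
    unfolding tendsto_at_iff_sequentially by (auto simp: comp_def)
qed

text \<open>Translation invariance makes the integral of every difference quotient vanish.\<close>

lemma integral_directional_derivative_0:
  fixes \<psi> :: "'a::euclidean_space \<Rightarrow> 'b::{banach, second_countable_topology}"
  assumes int: "integrable lborel \<psi>"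
    and D: "\<And>x. ((\<lambda>t. \<psi> (x + t *\<^sub>R v)) has_vector_derivative \<psi>' x) (at 0)"
    and supp: "\<And>x. R < norm x \<Longrightarrow> \<psi> x = 0"
    and bound: "\<And>x. norm (\<psi>' x) \<le> B"
  shows "integral\<^sup>L lborel \<psi>' = 0"
proof -
  define X where "X n = inverse (real (Suc n))" for n
  have X: "X \<longlonglongrightarrow> 0" "\<And>n. X n > 0" "\<And>n. X n \<le> 1"
    unfolding X_def by (rule LIMSEQ_inverse_real_of_nat) (auto simp: divide_simps)
  have [measurable]: "\<psi> \<in> borel_measurable borel"
    using int by (rule integrable_lborel_borel)
  \<comment> \<open>The derivative is assumed at parameter 0 only, but at every base point, which
    gives it at every parameter of each line. Its bound \<open>B\<close> then bounds all difference
    quotients.\<close>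
  have lip: "norm (\<psi> (x + t *\<^sub>R v) - \<psi> x) \<le> B * t" if "t \<ge> 0" for x t
  proof -
    have "((\<lambda>t. \<psi> (x + t *\<^sub>R v)) has_vector_derivative \<psi>' (x + s *\<^sub>R v)) (at s)" for s
    proof -
      have "((\<lambda>t. \<psi> ((x + s *\<^sub>R v) + t *\<^sub>R v)) has_vector_derivative \<psi>' (x + s *\<^sub>R v)) (at 0)"
        by (rule D)
      then show ?thesis
        unfolding has_vector_derivative_sequentially by (simp add: algebra_simps)
    qed
    moreover have "norm (h *\<^sub>R \<psi>' (x + s *\<^sub>R v)) \<le> B * norm h" for h s
      using mult_left_mono[OF bound[of "x + s *\<^sub>R v"], of "\<bar>h\<bar>"] by (simp add: mult.commute)
    ultimately have "norm (\<psi> (x + t *\<^sub>R v) - \<psi> (x + 0 *\<^sub>R v)) \<le> B * norm (t - 0)"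
      by (intro differentiable_bound[of UNIV, where f' = "\<lambda>s h. h *\<^sub>R \<psi>' (x + s *\<^sub>R v)"] onorm_le)
        (auto simp: has_vector_derivative_def)
    then show ?thesis using that by simp
  qed
  have "(\<lambda>n. \<integral>x. (1 / X n) *\<^sub>R (\<psi> (x + X n *\<^sub>R v) - \<psi> x) \<partial>lborel) \<longlonglongrightarrow> integral\<^sup>L lborel \<psi>'"
  proof (rule integral_dominated_convergence)
    have lim: "(\<lambda>n. (1 / X n) *\<^sub>R (\<psi> (x + X n *\<^sub>R v) - \<psi> x)) \<longlonglongrightarrow> \<psi>' x" for x
      using D[of x] X(1) X(2) unfolding has_vector_derivative_sequentially by (force simp: less_imp_neq[symmetric])
    then show "AE x in lborel. (\<lambda>n. (1 / X n) *\<^sub>R (\<psi> (x + X n *\<^sub>R v) - \<psi> x)) \<longlonglongrightarrow> \<psi>' x"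
      by simp
    show "\<psi>' \<in> borel_measurable lborel"
      by (rule borel_measurable_LIMSEQ_metric[OF _ lim]) measurable
    \<comment> \<open>Shifts have length at most norm v because X n \<le> 1, so both values of
      \<psi> vanish outside this enlarged ball.\<close>
    show "integrable lborel (\<lambda>x. B * indicator (cball 0 (R + norm v)) x :: real)"
      by (intro integrable_mult_right) (auto intro!: emeasure_compact_finite)
    show "AE x in lborel. norm ((1 / X n) *\<^sub>R (\<psi> (x + X n *\<^sub>R v) - \<psi> x)) \<le> B * indicator (cball 0 (R + norm v)) x" for n
    proof (intro always_eventually allI)
      fix x
      show "norm ((1 / X n) *\<^sub>R (\<psi> (x + X n *\<^sub>R v) - \<psi> x)) \<le> B * indicator (cball 0 (R + norm v)) x"
      proof (cases "x \<in> cball 0 (R + norm v)")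
        case True
        then show ?thesis
          using lip[of "X n" x] X(2)[of n] by (simp add: divide_le_eq)
      next
        case False
        have "norm x \<le> norm (x + X n *\<^sub>R v) + norm (X n *\<^sub>R v)"
          using norm_triangle_ineq4[of "x + X n *\<^sub>R v" "X n *\<^sub>R v"] by simp
        also have "norm (X n *\<^sub>R v) \<le> norm v"
          using X(2,3)[of n] by (simp add: mult_left_le_one_le)
        finally have "R < norm (x + X n *\<^sub>R v)" "R < norm x"
          using False norm_ge_zero[of v] by (auto simp del: norm_ge_zero)
        then show ?thesis
          using False by (simp add: supp)
      qed
    qed
  qed measurable
  moreover have "(\<integral>x. (1 / X n) *\<^sub>R (\<psi> (x + X n *\<^sub>R v) - \<psi> x) \<partial>lborel) = 0" for n
    using int integrable_lborel_translate[of \<psi> "X n *\<^sub>R v"] integral_lborel_translate[of \<psi> "X n *\<^sub>R v"]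
    by simp
  ultimately show ?thesis
    using X(2) by (simp add: LIMSEQ_const_iff less_imp_neq[symmetric])
qed

section \<open>Mollification\<close>

definition conv :: "('a::euclidean_space \<Rightarrow> real) \<Rightarrow> ('a \<Rightarrow> 'b::euclidean_space) \<Rightarrow> 'a \<Rightarrow> 'b" where
  "conv \<rho> f x = (\<integral>y. \<rho> (x - y) *\<^sub>R f y \<partial>lborel)"

definition mollifier :: "real \<Rightarrow> 'a::euclidean_space \<Rightarrow> real" where
  "mollifier \<delta> x = bump \<delta> x / (\<integral>x. bump \<delta> (x::'a) \<partial>lborel)"

lemma bump_eq_0: "0 < \<delta> \<Longrightarrow> \<delta> \<le> norm x \<Longrightarrow> bump \<delta> x = 0"
  unfolding bump_def by (intro flat_eq_0) (simp add: power_mono)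

lemma bump_Ck_compact: "0 < \<delta> \<Longrightarrow> bump \<delta> \<in> Ck_compact k UNIV"
  by (rule Ck_compactI[OF Ck_bump, of "cball 0 \<delta>"]) (auto intro: bump_eq_0)

text \<open>A vanishing integral would make the bump zero almost everywhere, although it is positive
  on an open ball, which is not negligible.\<close>

lemma integral_bump_pos:
  assumes "0 < \<delta>"
  shows "0 < (\<integral>x. bump \<delta> (x::'a::euclidean_space) \<partial>lborel)"
proof -
  have int: "integrable lborel (bump \<delta> :: 'a \<Rightarrow> real)"
    using bump_Ck_compact[OF assms, of 0] by (rule Ck_compact_integrable)
  have nn: "0 \<le> bump \<delta> x" for x :: 'a
    by (simp add: bump_def flat_nonneg)
  have "\<not> (AE x::'a in lborel. bump \<delta> x = 0)"
  proof
    assume "AE x::'a in lborel. bump \<delta> x = 0"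
    then have "AE x::'a in lborel. x \<notin> ball 0 \<delta>"
    proof (rule AE_mp, intro AE_I2 impI)
      fix x :: 'a assume "bump \<delta> x = 0"
      then have "\<not> \<delta>\<^sup>2 - (norm x)\<^sup>2 > 0"
        unfolding bump_def by (metis flat_pos_iff less_irrefl)
      then show "x \<notin> ball 0 \<delta>"
        using assms by (auto simp: power_strict_mono)
    qed
    then have "emeasure lborel (ball (0::'a) \<delta>) = 0"
      by (subst (asm) AE_iff_measurable[OF _ refl]) (auto simp: ball_def)
    moreover have "emeasure lborel (ball (0::'a) \<delta>) \<noteq> 0"
      using open_not_negligible[of "ball (0::'a) \<delta>"] assms
      by (auto simp: negligible_iff_emeasure0 dest!: )
    ultimately show False by simp
  qed
  then have "(\<integral>x. bump \<delta> (x::'a) \<partial>lborel) \<noteq> 0"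
    using integral_nonneg_eq_0_iff_AE[OF int] nn by auto
  moreover have "(\<integral>x. bump \<delta> (x::'a) \<partial>lborel) \<ge> 0"
    using nn by (intro integral_nonneg_AE) auto
  ultimately show ?thesis by simp
qed

lemma mollifier:
  fixes x :: "'a::euclidean_space"
  assumes "0 < \<delta>"
  shows mollifier_nonneg: "0 \<le> mollifier \<delta> x"
    and mollifier_eq_0: "\<delta> \<le> norm x \<Longrightarrow> mollifier \<delta> x = 0"
    and mollifier_Ck_compact: "mollifier \<delta> \<in> Ck_compact k (UNIV :: 'a set)"
    and integral_mollifier: "(\<integral>x. mollifier \<delta> (x::'a) \<partial>lborel) = 1"
proof -
  show "0 \<le> mollifier \<delta> x"
    unfolding mollifier_def using integral_bump_pos[OF assms, where 'a='a]
    by (auto simp: bump_def flat_nonneg)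
  show "\<delta> \<le> norm x \<Longrightarrow> mollifier \<delta> x = 0"
    unfolding mollifier_def using assms by (simp add: bump_eq_0)
  show "mollifier \<delta> \<in> Ck_compact k (UNIV :: 'a set)"
  proof (rule Ck_compactI[of _ _ "cball 0 \<delta>"])
    have "Ck k (\<lambda>x::'a. bump \<delta> x / (\<integral>x. bump \<delta> (x::'a) \<partial>lborel))"
      by (rule Ck_linear[OF bounded_linear_divide Ck_bump])
    then show "Ck k (mollifier \<delta> :: 'a \<Rightarrow> real)"
      by (simp add: mollifier_def[abs_def])
  qed (use assms in \<open>auto simp: mollifier_def bump_eq_0\<close>)
  show "(\<integral>x. mollifier \<delta> (x::'a) \<partial>lborel) = 1"
    unfolding mollifier_def using integral_bump_pos[OF assms, where 'a='a] by simp
qed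

lemma nn_integral_mollifier:
  assumes "0 < \<delta>"
  shows "(\<integral>\<^sup>+x. ennreal (mollifier \<delta> (x::'a::euclidean_space)) \<partial>lborel) = 1"
  by (subst nn_integral_eq_integral[OF Ck_compact_integrable[OF mollifier_Ck_compact[OF assms, where k = 0]]])
    (auto simp: integral_mollifier[OF assms] mollifier_nonneg[OF assms])

lemma conv_integrand_integrable:
  fixes f :: "'a::euclidean_space \<Rightarrow> 'b::euclidean_space"
  assumes "\<rho> \<in> borel_measurable borel" "\<And>x. \<bar>\<rho> x\<bar> \<le> B" "integrable lborel f"
  shows "integrable lborel (\<lambda>y. \<rho> (x - y) *\<^sub>R f y)"
proof (rule Bochner_Integration.integrable_bound)
  show "integrable lborel (\<lambda>y. B * norm (f y))"
    using assms by simp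
  show "(\<lambda>y. \<rho> (x - y) *\<^sub>R f y) \<in> borel_measurable lborel"
    using assms integrable_lborel_borel[OF assms(3)] by simp
  have "B \<ge> 0"
    using assms(2)[of undefined] by linarith
  then show "AE y in lborel. norm (\<rho> (x - y) *\<^sub>R f y) \<le> norm (B * norm (f y))"
    using assms(2) by (auto intro!: mult_right_mono)
qed

lemma norm_conv_le:
  assumes "\<rho> \<in> borel_measurable borel" "\<And>x. \<bar>\<rho> x\<bar> \<le> B" "integrable lborel f"
  shows "norm (conv \<rho> f x) \<le> B * (\<integral>y. norm (f y) \<partial>lborel)"
proof -
  have "norm (conv \<rho> f x) \<le> (\<integral>y. norm (\<rho> (x - y) *\<^sub>R f y) \<partial>lborel)"
    unfolding conv_def by (rule integral_norm_bound)
  also have "\<dots> \<le> (\<integral>y. B * norm (f y) \<partial>lborel)"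
  proof (rule integral_mono)
    show "integrable lborel (\<lambda>y. norm (\<rho> (x - y) *\<^sub>R f y))"
      using conv_integrand_integrable[OF assms] by (rule integrable_norm)
    show "norm (\<rho> (x - y) *\<^sub>R f y) \<le> B * norm (f y)" for y
      using assms(2) by (auto intro: mult_right_mono)
  qed (use assms(3) in simp)
  finally show ?thesis by simp
qed

lemma conv_commute:
  assumes [measurable]: "\<rho> \<in> borel_measurable borel" "f \<in> borel_measurable borel"
  shows "conv \<rho> f x = (\<integral>z. \<rho> z *\<^sub>R f (x - z) \<partial>lborel)"
  using integral_lborel_reflect[of "\<lambda>z. \<rho> z *\<^sub>R f (x - z)" x] by (simp add: conv_def)

lemma conv_measurable [measurable (raw)]:
  assumes [measurable]: "\<rho> \<in> borel_measurable borel" "f \<in> borel_measurable borel"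
  shows "conv \<rho> f \<in> borel_measurable borel"
  unfolding conv_def[abs_def] by measurable

lemma Ck_compact_lipschitz:
  fixes \<rho> :: "'a::euclidean_space \<Rightarrow> real"
  assumes "\<rho> \<in> Ck_compact (Suc k) U"
  obtains L where "L \<ge> 0" "\<And>x y. \<bar>\<rho> x - \<rho> y\<bar> \<le> L * norm (x - y)"
    "\<And>x v. \<bar>frechet_derivative \<rho> (at x) v\<bar> \<le> L * norm v"
proof -
  obtain L where L: "L \<ge> 0" "\<And>x v. norm (frechet_derivative \<rho> (at x) v) \<le> L * norm v"
    using Ck_compact_derivative_bounded[OF assms] by blast
  with lipschitz_from_derivative[of \<rho> L] Ck_compact_differentiable[OF assms] that
  show ?thesis by simp
qed

text \<open>The Lipschitz constant depends on f only through its L1 norm. This is the equicontinuity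
  behind the compactness in the mean.\<close>

lemma conv_lipschitz:
  fixes \<rho> :: "'a::euclidean_space \<Rightarrow> real"
  assumes \<rho>: "\<rho> \<in> Ck_compact (Suc k) UNIV" and L: "\<And>x y. \<bar>\<rho> x - \<rho> y\<bar> \<le> L * norm (x - y)"
    and f: "integrable lborel f"
  shows "norm (conv \<rho> f x - conv \<rho> f y) \<le> L * norm (x - y) * (\<integral>y. norm (f y) \<partial>lborel)"
proof -
  obtain B where B: "\<And>x. \<bar>\<rho> x\<bar> \<le> B"
    using Ck_compact_0_bounded[OF \<rho>] by auto
  note int = conv_integrand_integrable[OF Ck_compact_measurable[OF \<rho>] B f]
  have "conv \<rho> f x - conv \<rho> f y = (\<integral>z. (\<rho> (x - z) - \<rho> (y - z)) *\<^sub>R f z \<partial>lborel)"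
    unfolding conv_def scaleR_diff_left using int by simp
  also have "norm \<dots> \<le> (\<integral>z. norm ((\<rho> (x - z) - \<rho> (y - z)) *\<^sub>R f z) \<partial>lborel)"
    by (rule integral_norm_bound)
  also have "\<dots> \<le> (\<integral>z. L * norm (x - y) * norm (f z) \<partial>lborel)"
  proof (rule integral_mono)
    show "integrable lborel (\<lambda>z. norm ((\<rho> (x - z) - \<rho> (y - z)) *\<^sub>R f z))"
      unfolding scaleR_diff_left using int by simp
    show "norm ((\<rho> (x - z) - \<rho> (y - z)) *\<^sub>R f z) \<le> L * norm (x - y) * norm (f z)" for z
      using L[of "x - z" "y - z"] by (auto intro!: mult_right_mono)
  qed (use f in simp)
  finally show ?thesis by simp
qed

text \<open>The derivative falls on the kernel, so f need only be integrable: the difference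
  quotients of \<rho> are bounded by its Lipschitz constant times norm v, and a multiple of norm f
  dominates.\<close>

lemma conv_has_vector_derivative:
  fixes \<rho> :: "'a::euclidean_space \<Rightarrow> real"
  assumes \<rho>: "\<rho> \<in> Ck_compact (Suc k) UNIV" and f: "integrable lborel f"
  shows "((\<lambda>t. conv \<rho> f (x + t *\<^sub>R v)) has_vector_derivative
    conv (\<lambda>z. frechet_derivative \<rho> (at z) v) f (x + s *\<^sub>R v)) (at s)"
proof -
  define d where "d z = frechet_derivative \<rho> (at z) v" for z
  have d_eq: "(\<lambda>z. frechet_derivative \<rho> (at z) v) = d"
    by (rule ext) (simp add: d_def)
  show ?thesis
    unfolding d_eq has_vector_derivative_sequentially
  proof (intro allI impI)
    fix X :: "nat \<Rightarrow> real" assume X: "\<forall>n. X n \<noteq> 0" "X \<longlonglongrightarrow> 0"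
    obtain L where L: "L \<ge> 0" "\<And>x y. \<bar>\<rho> x - \<rho> y\<bar> \<le> L * norm (x - y)"
      "\<And>x v. \<bar>frechet_derivative \<rho> (at x) v\<bar> \<le> L * norm v"
      by (rule Ck_compact_lipschitz[OF \<rho>]) (rule that; assumption)
    obtain B where B: "\<And>x. \<bar>\<rho> x\<bar> \<le> B"
      using Ck_compact_0_bounded[OF \<rho>] by auto
    have [measurable]: "\<rho> \<in> borel_measurable borel"
      using \<rho> by (rule Ck_compact_measurable)
    have f_m [measurable]: "f \<in> borel_measurable borel"
      using f by (rule integrable_lborel_borel)
    have [measurable]: "d \<in> borel_measurable borel"
      using Ck_compact_derivative_measurable[OF \<rho>, of v] unfolding d_eq .
    note int = conv_integrand_integrable[OF Ck_compact_measurable[OF \<rho>] B f]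
    have "(1 / X n) *\<^sub>R (conv \<rho> f (x + (s + X n) *\<^sub>R v) - conv \<rho> f (x + s *\<^sub>R v)) =
        (\<integral>y. ((\<rho> (x + (s + X n) *\<^sub>R v - y) - \<rho> (x + s *\<^sub>R v - y)) / X n) *\<^sub>R f y \<partial>lborel)" for n
    proof -
      have "(\<integral>y. ((\<rho> (x + (s + X n) *\<^sub>R v - y) - \<rho> (x + s *\<^sub>R v - y)) / X n) *\<^sub>R f y \<partial>lborel) =
        (\<integral>y. (1 / X n) *\<^sub>R (\<rho> (x + (s + X n) *\<^sub>R v - y) *\<^sub>R f y - \<rho> (x + s *\<^sub>R v - y) *\<^sub>R f y) \<partial>lborel)"
        by (rule Bochner_Integration.integral_cong) (simp_all flip: scaleR_diff_left)
      also have "\<dots> = (1 / X n) *\<^sub>R (conv \<rho> f (x + (s + X n) *\<^sub>R v) - conv \<rho> f (x + s *\<^sub>R v))"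
        unfolding conv_def using int
        by (simp only: integral_scaleR_right Bochner_Integration.integral_diff)
      finally show ?thesis ..
    qed
    moreover have "(\<lambda>n. \<integral>y. ((\<rho> (x + (s + X n) *\<^sub>R v - y) - \<rho> (x + s *\<^sub>R v - y)) / X n) *\<^sub>R f y \<partial>lborel)
        \<longlonglongrightarrow> (\<integral>y. d (x + s *\<^sub>R v - y) *\<^sub>R f y \<partial>lborel)"
    proof (rule integral_dominated_convergence[where w = "\<lambda>y. L * norm v * norm (f y)"])
      show "AE y in lborel. (\<lambda>n. ((\<rho> (x + (s + X n) *\<^sub>R v - y) - \<rho> (x + s *\<^sub>R v - y)) / X n) *\<^sub>R f y)
         \<longlonglongrightarrow> d (x + s *\<^sub>R v - y) *\<^sub>R f y"
      proof (intro always_eventually allI tendsto_scaleR tendsto_const)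
        fix y
        have "((\<lambda>t. \<rho> ((x - y) + t *\<^sub>R v)) has_vector_derivative d ((x - y) + s *\<^sub>R v)) (at s)"
          unfolding d_def using \<rho> by (intro has_vector_derivative_along_line Ck_compact_differentiable)
        then have "(\<lambda>n. (1 / X n) *\<^sub>R (\<rho> ((x - y) + (s + X n) *\<^sub>R v) - \<rho> ((x - y) + s *\<^sub>R v))) \<longlonglongrightarrow>
            d ((x - y) + s *\<^sub>R v)"
          unfolding has_vector_derivative_sequentially using X by (elim allE[of _ X]) simp
        then show "(\<lambda>n. (\<rho> (x + (s + X n) *\<^sub>R v - y) - \<rho> (x + s *\<^sub>R v - y)) / X n) \<longlonglongrightarrow>
            d (x + s *\<^sub>R v - y)"
          by (simp add: add_diff_eq add.commute add.assoc diff_add_eq)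
      qed
      show "AE y in lborel. norm (((\<rho> (x + (s + X n) *\<^sub>R v - y) - \<rho> (x + s *\<^sub>R v - y)) / X n) *\<^sub>R f y)
        \<le> L * norm v * norm (f y)" for n
      proof (intro always_eventually allI)
        fix y
        have "\<bar>\<rho> (x + (s + X n) *\<^sub>R v - y) - \<rho> (x + s *\<^sub>R v - y)\<bar> \<le> L * norm (X n *\<^sub>R v)"
          using L(2)[of "x + (s + X n) *\<^sub>R v - y" "x + s *\<^sub>R v - y"] by (simp add: scaleR_add_left)
        then have "\<bar>(\<rho> (x + (s + X n) *\<^sub>R v - y) - \<rho> (x + s *\<^sub>R v - y)) / X n\<bar> \<le> L * norm v"
          using X(1) by (simp add: divide_le_eq mult.assoc mult.commute[of "norm v"])
        then show "norm (((\<rho> (x + (s + X n) *\<^sub>R v - y) - \<rho> (x + s *\<^sub>R v - y)) / X n) *\<^sub>R f y) \<le> L * norm v * norm (f y)"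
          unfolding norm_scaleR real_norm_def by (rule mult_right_mono) simp
      qed
      show "integrable lborel (\<lambda>y. L * norm v * norm (f y))"
        using f by simp
    qed measurable
    ultimately show "(\<lambda>n. (1 / X n) *\<^sub>R (conv \<rho> f (x + (s + X n) *\<^sub>R v) - conv \<rho> f (x + s *\<^sub>R v))) \<longlonglongrightarrow>
        conv d f (x + s *\<^sub>R v)"
      by (simp add: conv_def)
  qed
qed

text \<open>As the kernel has integral 1, f x itself is an average over z and can be moved under the
  integral. The right-hand side is a nonnegative integral, ready for Tonelli's theorem.\<close>

lemma norm_conv_mollifier_diff_le:
  fixes f :: "'a::euclidean_space \<Rightarrow> 'b::euclidean_space"
  assumes \<delta>: "0 < \<delta>" and f: "integrable lborel f"
  shows "ennreal (norm (conv (mollifier \<delta>) f x - f x)) \<le>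
    (\<integral>\<^sup>+z. ennreal (mollifier \<delta> z) * ennreal (norm (f (x - z) - f x)) \<partial>lborel)"
proof -
  have \<rho>: "mollifier \<delta> \<in> Ck_compact 0 (UNIV :: 'a set)"
    using \<delta> by (rule mollifier_Ck_compact)
  obtain B where B: "\<And>x::'a. \<bar>mollifier \<delta> x\<bar> \<le> B"
    using Ck_compact_0_bounded[OF \<rho>] by auto
  have \<rho>_m [measurable]: "mollifier \<delta> \<in> borel_measurable (borel :: 'a measure)"
    using \<rho> by (rule Ck_compact_measurable)
  have f_m [measurable]: "f \<in> borel_measurable borel"
    using f by (rule integrable_lborel_borel)
  have int: "integrable lborel (\<lambda>z. mollifier \<delta> z *\<^sub>R f (x - z))"
    using conv_integrand_integrable[of "mollifier \<delta>" B f x] B f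
      integrable_lborel_reflect[of "\<lambda>z. mollifier \<delta> z *\<^sub>R f (x - z)" x] by simp
  have "conv (mollifier \<delta>) f x - f x = (\<integral>z. mollifier \<delta> z *\<^sub>R (f (x - z) - f x) \<partial>lborel)"
    using int Ck_compact_integrable[OF \<rho>] integral_mollifier[OF \<delta>, where 'a='a]
    by (simp add: conv_commute scaleR_diff_right)
  also have "ennreal (norm \<dots>) \<le> (\<integral>\<^sup>+z. norm (mollifier \<delta> z *\<^sub>R (f (x - z) - f x)) \<partial>lborel)"
    using int Ck_compact_integrable[OF \<rho>]
    by (intro integral_norm_bound_ennreal) (auto simp: scaleR_diff_right)
  also have "\<dots> = (\<integral>\<^sup>+z. ennreal (mollifier \<delta> z) * ennreal (norm (f (x - z) - f x)) \<partial>lborel)"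
    using mollifier_nonneg[OF \<delta>, where 'a='a] by (intro nn_integral_cong) (simp add: ennreal_mult)
  finally show ?thesis .
qed

text \<open>Averaging translates cannot increase the L1 norm: after exchanging the integrals, each
  translate contributes the norm of f, weighted by a density of total mass 1.\<close>

lemma nn_integral_conv_le:
  fixes f :: "'a::euclidean_space \<Rightarrow> 'b::euclidean_space"
  assumes \<delta>: "0 < \<delta>" and f: "integrable lborel f"
  shows "(\<integral>\<^sup>+x. ennreal (norm (conv (mollifier \<delta>) f x)) \<partial>lborel) \<le> (\<integral>\<^sup>+x. ennreal (norm (f x)) \<partial>lborel)"
proof -
  have \<rho>: "mollifier \<delta> \<in> Ck_compact 0 (UNIV :: 'a set)"
    using \<delta> by (rule mollifier_Ck_compact)
  obtain B where B: "\<And>x::'a. \<bar>mollifier \<delta> x\<bar> \<le> B"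
    using Ck_compact_0_bounded[OF \<rho>] by auto
  have \<rho>_m [measurable]: "mollifier \<delta> \<in> borel_measurable (borel :: 'a measure)"
    using \<rho> by (rule Ck_compact_measurable)
  have f_m [measurable]: "f \<in> borel_measurable borel"
    using f by (rule integrable_lborel_borel)
  have int: "integrable lborel (\<lambda>z. mollifier \<delta> z *\<^sub>R f (x - z))" for x
    using conv_integrand_integrable[of "mollifier \<delta>" B f x] B f
      integrable_lborel_reflect[of "\<lambda>z. mollifier \<delta> z *\<^sub>R f (x - z)" x] by simp
  have "(\<integral>\<^sup>+x. ennreal (norm (conv (mollifier \<delta>) f x)) \<partial>lborel) \<le>
      (\<integral>\<^sup>+x. (\<integral>\<^sup>+z. ennreal (mollifier \<delta> z) * ennreal (norm (f (x - z))) \<partial>lborel) \<partial>lborel)"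
  proof (rule nn_integral_mono)
    fix x
    have "ennreal (norm (conv (mollifier \<delta>) f x)) \<le> (\<integral>\<^sup>+z. norm (mollifier \<delta> z *\<^sub>R f (x - z)) \<partial>lborel)"
      unfolding conv_commute[OF \<rho>_m f_m] using int[of x]
      by (intro integral_norm_bound_ennreal) auto
    also have "\<dots> = (\<integral>\<^sup>+z. ennreal (mollifier \<delta> z) * ennreal (norm (f (x - z))) \<partial>lborel)"
      using mollifier_nonneg[OF \<delta>, where 'a='a] by (intro nn_integral_cong) (simp add: ennreal_mult)
    finally show "ennreal (norm (conv (mollifier \<delta>) f x)) \<le> \<dots>" .
  qed
  also have "\<dots> = (\<integral>\<^sup>+z. (\<integral>\<^sup>+x. ennreal (mollifier \<delta> z) * ennreal (norm (f (x - z))) \<partial>lborel) \<partial>lborel)"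
    by (rule lborel_pair.Fubini') measurable
  also have "\<dots> = (\<integral>\<^sup>+z. ennreal (mollifier \<delta> (z::'a)) * (\<integral>\<^sup>+x. ennreal (norm (f x)) \<partial>lborel) \<partial>lborel)"
  proof (rule nn_integral_cong)
    fix z :: 'a
    show "(\<integral>\<^sup>+x. ennreal (mollifier \<delta> z) * ennreal (norm (f (x - z))) \<partial>lborel) =
        ennreal (mollifier \<delta> z) * (\<integral>\<^sup>+x. ennreal (norm (f x)) \<partial>lborel)"
      using nn_integral_lborel_translate[of "\<lambda>x. ennreal (norm (f x))" "- z"]
      by (simp add: nn_integral_cmult)
  qed
  also have "\<dots> = (\<integral>\<^sup>+x. ennreal (norm (f x)) \<partial>lborel)"
    by (simp add: nn_integral_multc nn_integral_mollifier[OF \<delta>])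
  finally show ?thesis .
qed

lemma integrable_conv:
  fixes f :: "'a::euclidean_space \<Rightarrow> 'b::euclidean_space"
  assumes \<delta>: "0 < \<delta>" and f: "integrable lborel f"
  shows "integrable lborel (conv (mollifier \<delta>) f)"
proof (rule integrableI_bounded)
  show "conv (mollifier \<delta>) f \<in> borel_measurable lborel"
    using conv_measurable[OF Ck_compact_measurable[OF mollifier_Ck_compact[OF \<delta>]] integrable_lborel_borel[OF f]]
    by simp
  have "(\<integral>\<^sup>+x. ennreal (norm (f x)) \<partial>lborel) < \<infinity>"
    using f by (simp add: integrable_iff_bounded)
  with nn_integral_conv_le[OF assms] show "(\<integral>\<^sup>+x. ennreal (norm (conv (mollifier \<delta>) f x)) \<partial>lborel) < \<infinity>"
    by (rule le_less_trans)
qed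

text \<open>After Tonelli the error is at most the average, with respect to the kernel, of the L1
  distances between f and its translates by z. Only z with norm z < \<delta> n count, and there
  \<open>translation_tendsto\<close> makes the distance small.\<close>

lemma conv_mollifier_tendsto_L1:
  fixes f :: "'a::euclidean_space \<Rightarrow> 'b::euclidean_space"
  assumes f: "integrable lborel f" and \<delta>: "\<And>n. 0 < \<delta> n" "\<delta> \<longlonglongrightarrow> 0"
  shows "(\<lambda>n. \<integral>x. norm (conv (mollifier (\<delta> n)) f x - f x) \<partial>lborel) \<longlonglongrightarrow> 0"
proof (rule LIMSEQ_I)
  fix e :: real assume "e > 0"
  have f_m [measurable]: "f \<in> borel_measurable borel"
    using f by (rule integrable_lborel_borel)
  have "eventually (\<lambda>z. (\<integral>x. norm (f (x + z) - f x) \<partial>lborel) < e / 2) (at 0)"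
    using \<open>e > 0\<close> by (intro order_tendstoD(2)[OF translation_tendsto[OF f]]) simp
  then obtain d where d: "d > 0" "\<And>z. z \<noteq> 0 \<Longrightarrow> norm z < d \<Longrightarrow> (\<integral>x. norm (f (x + z) - f x) \<partial>lborel) < e / 2"
    unfolding eventually_at by auto
  have T: "(\<integral>\<^sup>+x. ennreal (norm (f (x - z) - f x)) \<partial>lborel) \<le> ennreal (e / 2)" if "norm z < d" for z
  proof -
    have "(\<integral>x. norm (f (x + - z) - f x) \<partial>lborel) \<le> e / 2"
      using d(2)[of "- z"] that \<open>e > 0\<close> by (cases "z = 0") auto
    moreover have "integrable lborel (\<lambda>x. norm (f (x + - z) - f x))"
      using f integrable_lborel_translate[of f "- z"] by auto
    ultimately show ?thesis
      by (subst nn_integral_eq_integral) (auto intro: ennreal_leI)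
  qed
  from order_tendstoD(2)[OF \<delta>(2) d(1)] obtain N where N: "\<And>n. n \<ge> N \<Longrightarrow> \<delta> n < d"
    by (auto simp: eventually_sequentially)
  show "\<exists>N. \<forall>n\<ge>N. norm ((\<integral>x. norm (conv (mollifier (\<delta> n)) f x - f x) \<partial>lborel) - 0) < e"
  proof (intro exI[of _ N] allI impI)
    fix n assume n: "n \<ge> N"
    let ?\<rho> = "mollifier (\<delta> n) :: 'a \<Rightarrow> real"
    have [measurable]: "?\<rho> \<in> borel_measurable borel"
      using mollifier_Ck_compact[OF \<delta>(1)] by (rule Ck_compact_measurable)
    have "(\<integral>\<^sup>+x. ennreal (norm (conv ?\<rho> f x - f x)) \<partial>lborel) \<le>
        (\<integral>\<^sup>+x. (\<integral>\<^sup>+z. ennreal (?\<rho> z) * ennreal (norm (f (x - z) - f x)) \<partial>lborel) \<partial>lborel)"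
      by (intro nn_integral_mono norm_conv_mollifier_diff_le \<delta> f)
    also have "\<dots> = (\<integral>\<^sup>+z. (\<integral>\<^sup>+x. ennreal (?\<rho> z) * ennreal (norm (f (x - z) - f x)) \<partial>lborel) \<partial>lborel)"
      by (rule lborel_pair.Fubini') measurable
    also have "\<dots> = (\<integral>\<^sup>+z. ennreal (?\<rho> z) * (\<integral>\<^sup>+x. ennreal (norm (f (x - z) - f x)) \<partial>lborel) \<partial>lborel)"
      by (intro nn_integral_cong nn_integral_cmult) measurable
    also have "\<dots> \<le> (\<integral>\<^sup>+z. ennreal (?\<rho> z) * ennreal (e / 2) \<partial>lborel)"
    proof (rule nn_integral_mono)
      fix z
      show "ennreal (?\<rho> z) * (\<integral>\<^sup>+x. ennreal (norm (f (x - z) - f x)) \<partial>lborel) \<le> ennreal (?\<rho> z) * ennreal (e / 2)"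
        using T[of z] N[OF n] mollifier_eq_0[OF \<delta>(1), of n z]
        by (cases "\<delta> n \<le> norm z") (auto intro!: mult_left_mono)
    qed
    also have "\<dots> = ennreal (e / 2)"
      by (simp add: nn_integral_multc nn_integral_mollifier[OF \<delta>(1)])
    also have "(\<integral>\<^sup>+x. ennreal (norm (conv ?\<rho> f x - f x)) \<partial>lborel) =
        ennreal (\<integral>x. norm (conv ?\<rho> f x - f x) \<partial>lborel)"
      using f integrable_conv[OF \<delta>(1) f] by (intro nn_integral_eq_integral) auto
    finally show "norm ((\<integral>x. norm (conv ?\<rho> f x - f x) \<partial>lborel) - 0) < e"
      using \<open>e > 0\<close> by (simp add: ennreal_le_iff2)
  qed
qed

section \<open>Weak derivatives of Borel functions on the whole space\<close>

text \<open>Extension by zero lets translations and convolutions act on the whole space.\<close>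

definition weak_pd :: "'a::euclidean_space set \<Rightarrow> 'a \<Rightarrow> ('a \<Rightarrow> 'b::euclidean_space) \<Rightarrow> ('a \<Rightarrow> 'b) \<Rightarrow> bool" where
  "weak_pd U i f g \<longleftrightarrow> integrable lborel f \<and> integrable lborel g \<and> (\<forall>x. x \<notin> U \<longrightarrow> f x = 0 \<and> g x = 0) \<and>
    (\<forall>\<phi>\<in>test_functions U. (\<integral>x. frechet_derivative \<phi> (at x) i *\<^sub>R f x \<partial>lborel) = - (\<integral>x. \<phi> x *\<^sub>R g x \<partial>lborel))"

lemma weak_pdD:
  assumes "weak_pd U i f g"
  shows "integrable lborel f" "integrable lborel g" "x \<notin> U \<Longrightarrow> f x = 0" "x \<notin> U \<Longrightarrow> g x = 0"
    "\<phi> \<in> test_functions U \<Longrightarrow> (\<integral>x. frechet_derivative \<phi> (at x) i *\<^sub>R f x \<partial>lborel) = - (\<integral>x. \<phi> x *\<^sub>R g x \<partial>lborel)"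
  using assms by (auto simp: weak_pd_def)

lemma test_functions_Ck_compact: "\<phi> \<in> test_functions U \<Longrightarrow> \<phi> \<in> Ck_compact k U"
  by (auto simp: test_functions_def)

lemma
  fixes x :: "'a::euclidean_space"
  assumes "0 < \<delta>"
  shows mollifier_reflect_test_function: "cball x \<delta> \<subseteq> U \<Longrightarrow> (\<lambda>y. mollifier \<delta> (x - y)) \<in> test_functions U"
    and frechet_derivative_mollifier_reflect:
      "frechet_derivative (\<lambda>y. mollifier \<delta> (x - y)) (at y) v = - frechet_derivative (mollifier \<delta>) (at (x - y)) v"
proof -
  assume sub: "cball x \<delta> \<subseteq> U"
  have "Ck k (\<lambda>y. mollifier \<delta> (x + (-1) *\<^sub>R y))" for k
    using mollifier_Ck_compact[OF assms, of k, where 'a='a] by (intro Ck_affine) (simp add: Ck_compact_def)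
  then show "(\<lambda>y. mollifier \<delta> (x - y)) \<in> test_functions U"
    unfolding test_functions_def
    by (auto intro!: Ck_compactI[OF _ compact_cball sub] mollifier_eq_0[OF assms] simp: dist_norm)
next
  have "mollifier \<delta> differentiable (at (x - y))"
    using mollifier_Ck_compact[OF assms, of "Suc 0"] by (rule Ck_compact_differentiable)
  then have D: "(mollifier \<delta> has_derivative frechet_derivative (mollifier \<delta>) (at (x - y))) (at (x - y))"
    by (simp add: frechet_derivative_works[symmetric])
  have "((\<lambda>y. mollifier \<delta> (x - y)) has_derivative (\<lambda>v. frechet_derivative (mollifier \<delta>) (at (x - y)) (- v))) (at y)"
    by (rule has_derivative_compose[where g = "mollifier \<delta>" and f = "\<lambda>y. x - y"
          and g' = "frechet_derivative (mollifier \<delta>) (at (x - y))"])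
      (use D in \<open>auto intro!: derivative_eq_intros\<close>)
  from frechet_derivative_at[OF this]
  show "frechet_derivative (\<lambda>y. mollifier \<delta> (x - y)) (at y) v = - frechet_derivative (mollifier \<delta>) (at (x - y)) v"
    using linear_neg[OF has_derivative_linear[OF D], of v] by metis
qed

text \<open>The reflected kernel is a test function as soon as the ball of radius \<delta> around x
  lies in U. The sign produced by the reflection cancels the one in the definition of the weak
  derivative.\<close>

lemma conv_weak_pd:
  assumes "weak_pd U i f g" "0 < \<delta>" "cball x \<delta> \<subseteq> U"
  shows "conv (\<lambda>z. frechet_derivative (mollifier \<delta>) (at z) i) f x = conv (mollifier \<delta>) g x"
  using weak_pdD(5)[OF assms(1) mollifier_reflect_test_function[OF assms(2,3)]]
  by (simp add: conv_def frechet_derivative_mollifier_reflect[OF assms(2)])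

text \<open>L1 convergence yields almost everywhere convergence along a subsequence of radii; the
  extraction for g is made within the one for f, so that both share their radii.\<close>

lemma conv_mollifier_AE:
  fixes f :: "'a::euclidean_space \<Rightarrow> 'b::euclidean_space" and g :: "'a \<Rightarrow> 'c::euclidean_space"
  assumes f: "integrable lborel f" and g: "integrable lborel g"
  obtains \<delta> :: "nat \<Rightarrow> real" where "\<And>n. 0 < \<delta> n" "\<delta> \<longlonglongrightarrow> 0"
    "AE x in lborel. (\<lambda>n. conv (mollifier (\<delta> n)) f x) \<longlonglongrightarrow> f x"
    "AE x in lborel. (\<lambda>n. conv (mollifier (\<delta> n)) g x) \<longlonglongrightarrow> g x"
proof -
  define X where "X n = inverse (real (Suc n))" for n
  have X: "X \<longlonglongrightarrow> 0" "\<And>n. X n > 0"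
    unfolding X_def by (rule LIMSEQ_inverse_real_of_nat) auto
  obtain r where r: "strict_mono r" "AE x in lborel. (\<lambda>n. conv (mollifier (X (r n))) f x - f x) \<longlonglongrightarrow> 0"
    using tendsto_L1_AE_subseq[OF _ conv_mollifier_tendsto_L1[OF f X(2,1)]]
      integrable_conv[OF X(2) f] f by auto
  have Xr: "(\<lambda>n. X (r n)) \<longlonglongrightarrow> 0"
    using LIMSEQ_subseq_LIMSEQ[OF X(1) r(1)] by (simp add: comp_def)
  obtain q where q: "strict_mono q" "AE x in lborel. (\<lambda>n. conv (mollifier (X (r (q n)))) g x - g x) \<longlonglongrightarrow> 0"
    using tendsto_L1_AE_subseq[OF _ conv_mollifier_tendsto_L1[OF g X(2) Xr]]
      integrable_conv[OF X(2) g] g by auto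
  show ?thesis
  proof (rule that[of "\<lambda>n. X (r (q n))"])
    show "(\<lambda>n. X (r (q n))) \<longlonglongrightarrow> 0"
      using LIMSEQ_subseq_LIMSEQ[OF Xr q(1)] by (simp add: comp_def)
    show "AE x in lborel. (\<lambda>n. conv (mollifier (X (r (q n)))) f x) \<longlonglongrightarrow> f x"
      using r(2)
    proof eventually_elim
      case (elim x)
      from LIMSEQ_subseq_LIMSEQ[OF this q(1)] show ?case
        by (simp add: comp_def LIM_zero_iff)
    qed
    show "AE x in lborel. (\<lambda>n. conv (mollifier (X (r (q n)))) g x) \<longlonglongrightarrow> g x"
      using q(2) by (simp add: LIM_zero_iff)
  qed (rule X)
qed

lemma eventually_cball_subset:
  fixes x :: "'a::euclidean_space"
  assumes "open U" "x \<in> U" "\<delta> \<longlonglongrightarrow> 0"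
  shows "eventually (\<lambda>n. cball x (\<delta> n) \<subseteq> U) sequentially"
proof -
  obtain d where d: "d > 0" "cball x d \<subseteq> U"
    using assms open_contains_cball by blast
  from order_tendstoD(2)[OF assms(3) d(1)] show ?thesis
    by eventually_elim (use d in auto)
qed

text \<open>This is the fundamental lemma of the calculus of variations. A mollification of h at a
  point of U is, for small radii, an integral against a test function and hence 0, and the
  mollifications converge to h almost everywhere.\<close>

lemma AE_eq_0_if_orthogonal_test_functions:
  fixes h :: "'a::euclidean_space \<Rightarrow> 'b::euclidean_space"
  assumes h: "integrable lborel h" and U: "open U" and 0: "\<And>x. x \<notin> U \<Longrightarrow> h x = 0"
    and orth: "\<And>\<phi>. \<phi> \<in> test_functions U \<Longrightarrow> (\<integral>x. \<phi> x *\<^sub>R h x \<partial>lborel) = 0"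
  shows "AE x in lborel. h x = 0"
proof -
  obtain \<delta> where \<delta>: "\<And>n. 0 < \<delta> n" "\<delta> \<longlonglongrightarrow> 0"
    and lim: "AE x in lborel. (\<lambda>n. conv (mollifier (\<delta> n)) h x) \<longlonglongrightarrow> h x"
    by (rule conv_mollifier_AE[OF h h]) (rule that; assumption)
  show ?thesis
    using lim
  proof eventually_elim
    case (elim x)
    show ?case
    proof (cases "x \<in> U")
      case True
      have "eventually (\<lambda>n. conv (mollifier (\<delta> n)) h x = 0) sequentially"
        using eventually_cball_subset[OF U True \<delta>(2)]
        by eventually_elim (simp add: conv_def orth mollifier_reflect_test_function \<delta>(1))
      then have "(\<lambda>n. conv (mollifier (\<delta> n)) h x) \<longlonglongrightarrow> 0"
        by (rule tendsto_eventually)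
      with elim show ?thesis
        by (rule LIMSEQ_unique)
    qed (rule 0)
  qed
qed

lemma integrable_test_function_scaleR:
  assumes "\<phi> \<in> Ck_compact k U" "integrable lborel g"
  shows "integrable lborel (\<lambda>x. \<phi> x *\<^sub>R (g x :: 'b::euclidean_space))"
proof -
  obtain B where B: "\<And>x. norm (\<phi> x) \<le> B"
    using Ck_compact_0_bounded[OF assms(1)] by metis
  show ?thesis
  proof (rule Bochner_Integration.integrable_bound)
    show "integrable lborel (\<lambda>x. B * norm (g x))"
      using assms(2) by simp
    show "(\<lambda>x. \<phi> x *\<^sub>R g x) \<in> borel_measurable lborel"
      using Ck_compact_measurable[OF assms(1)] integrable_lborel_borel[OF assms(2)] by simp
    have "B \<ge> 0"
      using B[of undefined] norm_ge_zero order_trans by blast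
    then show "AE x in lborel. norm (\<phi> x *\<^sub>R g x) \<le> norm (B * norm (g x))"
      using B by (auto intro!: mult_right_mono)
  qed
qed

lemma weak_pd_unique:
  assumes "open U" "weak_pd U i f g" "weak_pd U i f g'"
  shows "AE x in lborel. g x = g' x"
proof -
  have "AE x in lborel. g x - g' x = 0"
  proof (rule AE_eq_0_if_orthogonal_test_functions[OF _ assms(1)])
    fix \<phi> assume \<phi>: "\<phi> \<in> test_functions U"
    show "(\<integral>x. \<phi> x *\<^sub>R (g x - g' x) \<partial>lborel) = 0"
      using weak_pdD(5)[OF assms(2) \<phi>] weak_pdD(5)[OF assms(3) \<phi>]
        integrable_test_function_scaleR[OF test_functions_Ck_compact[OF \<phi>, of 0] weak_pdD(2)[OF assms(2)]]
        integrable_test_function_scaleR[OF test_functions_Ck_compact[OF \<phi>, of 0] weak_pdD(2)[OF assms(3)]]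
      by (simp add: scaleR_diff_right)
  qed (use assms in \<open>auto simp: weak_pd_def\<close>)
  then show ?thesis by simp
qed

lemma integrable_test_function_derivative_scaleR:
  assumes "\<phi> \<in> Ck_compact (Suc k) U" "i \<in> Basis" "integrable lborel g"
  shows "integrable lborel (\<lambda>x. frechet_derivative \<phi> (at x) i *\<^sub>R (g x :: 'b::euclidean_space))"
  using integrable_test_function_scaleR[OF frechet_derivative_Ck_compact[OF assms(1,2)] assms(3)] .

lemma weak_pd_linear:
  assumes "bounded_linear T" "i \<in> Basis" "weak_pd U i f g"
  shows "weak_pd U i (\<lambda>x. T (f x)) (\<lambda>x. T (g x))"
proof -
  interpret T: bounded_linear T by fact
  have "(\<integral>x. frechet_derivative \<phi> (at x) i *\<^sub>R T (f x) \<partial>lborel) = - (\<integral>x. \<phi> x *\<^sub>R T (g x) \<partial>lborel)"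
    if \<phi>: "\<phi> \<in> test_functions U" for \<phi>
  proof -
    have "(\<integral>x. T (frechet_derivative \<phi> (at x) i *\<^sub>R f x) \<partial>lborel) = T (\<integral>x. frechet_derivative \<phi> (at x) i *\<^sub>R f x \<partial>lborel)"
      by (rule integral_bounded_linear[OF assms(1) integrable_test_function_derivative_scaleR[OF
            test_functions_Ck_compact[OF \<phi>, of "Suc 0"] assms(2) weak_pdD(1)[OF assms(3)]]])
    also have "\<dots> = - T (\<integral>x. \<phi> x *\<^sub>R g x \<partial>lborel)"
      by (simp add: weak_pdD(5)[OF assms(3) \<phi>] T.neg)
    also have "T (\<integral>x. \<phi> x *\<^sub>R g x \<partial>lborel) = (\<integral>x. T (\<phi> x *\<^sub>R g x) \<partial>lborel)"
      by (rule integral_bounded_linear[OF assms(1) integrable_test_function_scaleR[OF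
            test_functions_Ck_compact[OF \<phi>, of 0] weak_pdD(2)[OF assms(3)]], symmetric])
    finally show ?thesis
      by (simp add: T.scaleR)
  qed
  then show ?thesis
    unfolding weak_pd_def using weak_pdD(1-4)[OF assms(3)]
    by (auto intro: integrable_bounded_linear[OF assms(1)] simp: T.zero)
qed

lemma weak_pd_add:
  assumes i: "i \<in> Basis" and 1: "weak_pd U i f g" and 2: "weak_pd U i f' g'"
  shows "weak_pd U i (\<lambda>x. f x + f' x) (\<lambda>x. g x + g' x)"
proof -
  have "(\<integral>x. frechet_derivative \<phi> (at x) i *\<^sub>R (f x + f' x) \<partial>lborel) = - (\<integral>x. \<phi> x *\<^sub>R (g x + g' x) \<partial>lborel)"
    if \<phi>: "\<phi> \<in> test_functions U" for \<phi>
    unfolding scaleR_add_right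
    using weak_pdD(5)[OF 1 \<phi>] weak_pdD(5)[OF 2 \<phi>]
      integrable_test_function_derivative_scaleR[OF test_functions_Ck_compact[OF \<phi>, of "Suc 0"] i weak_pdD(1)[OF 1]]
      integrable_test_function_derivative_scaleR[OF test_functions_Ck_compact[OF \<phi>, of "Suc 0"] i weak_pdD(1)[OF 2]]
      integrable_test_function_scaleR[OF test_functions_Ck_compact[OF \<phi>, of 0] weak_pdD(2)[OF 1]]
      integrable_test_function_scaleR[OF test_functions_Ck_compact[OF \<phi>, of 0] weak_pdD(2)[OF 2]]
    by simp
  then show ?thesis
    using 1 2 unfolding weak_pd_def by auto
qed

lemma weak_pd_diff:
  assumes "i \<in> Basis" "weak_pd U i f g" "weak_pd U i f' g'"
  shows "weak_pd U i (\<lambda>x. f x - f' x) (\<lambda>x. g x - g' x)"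
  using weak_pd_add[OF assms(1,2) weak_pd_linear[OF bounded_linear_minus[OF bounded_linear_ident] assms(1,3)]]
  by simp

lemma weak_pd_0: "weak_pd U i (\<lambda>x. 0) (\<lambda>x. 0)"
  by (simp add: weak_pd_def)

lemma weak_pd_sum:
  assumes "i \<in> Basis" "\<And>j. j \<in> J \<Longrightarrow> weak_pd U i (f j) (g j)"
  shows "weak_pd U i (\<lambda>x. \<Sum>j\<in>J. f j x) (\<lambda>x. \<Sum>j\<in>J. g j x)"
  using assms(2)
  by (induction J rule: infinite_finite_induct) (auto intro: weak_pd_0 weak_pd_add[OF assms(1)])

lemma integral_partial_Ck_compact:
  assumes "\<phi> \<in> Ck_compact (Suc k) U"
  shows "(\<integral>x. frechet_derivative \<phi> (at x) i \<partial>lborel) = 0"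
proof -
  obtain K where K: "compact K" "K \<subseteq> U" "\<And>x. x \<notin> K \<Longrightarrow> \<phi> x = 0"
    using assms by (auto elim: Ck_compact_supportE)
  obtain R where R: "\<And>x. x \<in> K \<Longrightarrow> norm x \<le> R"
    using K(1) by (metis bounded_iff compact_imp_bounded)
  obtain L where L: "\<And>x v. norm (frechet_derivative \<phi> (at x) v) \<le> L * norm v"
    using Ck_compact_derivative_bounded[OF assms] by metis
  show ?thesis
  proof (rule integral_directional_derivative_0[where \<psi> = \<phi> and v = i and R = R])
    fix x
    show "((\<lambda>t. \<phi> (x + t *\<^sub>R i)) has_vector_derivative frechet_derivative \<phi> (at x) i) (at 0)"
      using has_vector_derivative_along_line[of \<phi> x 0 i] Ck_compact_differentiable[OF assms] by simp
    show "R < norm x \<Longrightarrow> \<phi> x = 0"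
      using K(3) R by fastforce
  qed (use L in \<open>auto intro: Ck_compact_integrable[OF assms]\<close>)
qed

text \<open>Cutting the constant off at the boundary of U creates no derivative, since test
  functions are supported inside U; there the integral of a partial derivative is 0. The lemma
  allows mean values to be subtracted.\<close>

lemma weak_pd_const:
  assumes "open U" "emeasure lborel U < \<infinity>" "i \<in> Basis"
  shows "weak_pd U i (\<lambda>x. indicator U x *\<^sub>R c) (\<lambda>x. 0)"
proof -
  have "(\<integral>x. frechet_derivative \<phi> (at x) i *\<^sub>R indicator U x *\<^sub>R c \<partial>lborel) = 0"
    if \<phi>: "\<phi> \<in> test_functions U" for \<phi>
  proof -
    have 1: "\<phi> \<in> Ck_compact (Suc 0) U"
      using \<phi> by (rule test_functions_Ck_compact)
    have "frechet_derivative \<phi> (at x) i *\<^sub>R indicator U x *\<^sub>R c = frechet_derivative \<phi> (at x) i *\<^sub>R c" for x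
    proof -
      obtain K where "K \<subseteq> U" "\<And>x. x \<notin> K \<Longrightarrow> frechet_derivative \<phi> (at x) i = 0"
        by (rule Ck_compact_supportE[OF frechet_derivative_Ck_compact[OF 1 assms(3)]]) (rule that; assumption)
      then have "frechet_derivative \<phi> (at x) i = 0" if "x \<notin> U"
        using that by (metis subsetD)
      then show ?thesis by (auto simp: indicator_def)
    qed
    then have "(\<integral>x. frechet_derivative \<phi> (at x) i *\<^sub>R indicator U x *\<^sub>R c \<partial>lborel) =
        (\<integral>x. frechet_derivative \<phi> (at x) i *\<^sub>R c \<partial>lborel)"
      by presburger
    also have "\<dots> = 0"
      using integral_partial_Ck_compact[OF 1] Ck_compact_integrable[OF frechet_derivative_Ck_compact[OF 1 assms(3)]]
      by simp
    finally show ?thesis .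
  qed
  then show ?thesis
    unfolding weak_pd_def using assms by auto
qed

lemma tendsto_integral_L1:
  fixes a :: "'a \<Rightarrow> 'b::{banach, second_countable_topology}"
  assumes "\<And>n. integrable M (a' n)" "integrable M a" "\<And>n. integrable M (w n)"
    and "\<And>n x. norm (a' n x - a x) \<le> w n x" and "(\<lambda>n. integral\<^sup>L M (w n)) \<longlonglongrightarrow> 0"
  shows "(\<lambda>n. integral\<^sup>L M (a' n)) \<longlonglongrightarrow> integral\<^sup>L M a"
proof -
  have "(\<lambda>n. integral\<^sup>L M (a' n) - integral\<^sup>L M a) \<longlonglongrightarrow> 0"
  proof (rule Lim_null_comparison[OF _ assms(5)], intro always_eventually allI)
    fix n
    have "norm (\<integral>x. a' n x - a x \<partial>M) \<le> integral\<^sup>L M (w n)"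
    proof -
      have "norm (\<integral>x. a' n x - a x \<partial>M) \<le> (\<integral>x. norm (a' n x - a x) \<partial>M)"
        by (rule integral_norm_bound)
      also have "\<dots> \<le> integral\<^sup>L M (w n)"
        using assms by (intro integral_mono) auto
      finally show ?thesis .
    qed
    then show "norm (integral\<^sup>L M (a' n) - integral\<^sup>L M a) \<le> integral\<^sup>L M (w n)"
      using assms by simp
  qed
  then show ?thesis
    by (simp add: LIM_zero_iff)
qed

lemma tendsto_integral_bounded_scaleR:
  fixes \<phi> :: "'a::euclidean_space \<Rightarrow> real" and f :: "'a \<Rightarrow> 'b::euclidean_space"
  assumes \<phi>: "\<phi> \<in> Ck_compact k U" and f: "\<And>n. integrable lborel (f' n)" "integrable lborel f"
    and lim: "(\<lambda>n. \<integral>x. norm (f' n x - f x) \<partial>lborel) \<longlonglongrightarrow> 0"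
  shows "(\<lambda>n. \<integral>x. \<phi> x *\<^sub>R f' n x \<partial>lborel) \<longlonglongrightarrow> (\<integral>x. \<phi> x *\<^sub>R f x \<partial>lborel)"
proof -
  obtain B where B: "\<And>x. norm (\<phi> x) \<le> B"
    using Ck_compact_0_bounded[OF \<phi>] by metis
  show ?thesis
  proof (rule tendsto_integral_L1[where w = "\<lambda>n x. B * norm (f' n x - f x)"])
    show "norm (\<phi> x *\<^sub>R f' n x - \<phi> x *\<^sub>R f x) \<le> B * norm (f' n x - f x)" for n x
      using B[of x] by (simp add: scaleR_diff_right[symmetric] mult_right_mono)
    show "(\<lambda>n. \<integral>x. B * norm (f' n x - f x) \<partial>lborel) \<longlonglongrightarrow> 0"
      using tendsto_mult_right_zero[OF lim, of B] by simp
  qed (use f integrable_test_function_scaleR[OF \<phi>] in auto)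
qed

text \<open>Test functions and their partial derivatives are bounded, so both sides of the defining
  identity are continuous under convergence in L1: weak differentiation is a closed
  operator.\<close>

lemma weak_pd_limit:
  assumes i: "i \<in> Basis" and wp: "\<And>n. weak_pd U i (f' n) (g' n)"
    and f: "integrable lborel f" "\<And>x. x \<notin> U \<Longrightarrow> f x = 0" "(\<lambda>n. \<integral>x. norm (f' n x - f x) \<partial>lborel) \<longlonglongrightarrow> 0"
    and g: "integrable lborel g" "\<And>x. x \<notin> U \<Longrightarrow> g x = 0" "(\<lambda>n. \<integral>x. norm (g' n x - g x) \<partial>lborel) \<longlonglongrightarrow> 0"
  shows "weak_pd U i f g"
proof -
  have "(\<integral>x. frechet_derivative \<phi> (at x) i *\<^sub>R f x \<partial>lborel) = - (\<integral>x. \<phi> x *\<^sub>R g x \<partial>lborel)"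
    if \<phi>: "\<phi> \<in> test_functions U" for \<phi>
  proof -
    have "(\<lambda>n. \<integral>x. frechet_derivative \<phi> (at x) i *\<^sub>R f' n x \<partial>lborel) \<longlonglongrightarrow> (\<integral>x. frechet_derivative \<phi> (at x) i *\<^sub>R f x \<partial>lborel)"
      by (rule tendsto_integral_bounded_scaleR[OF frechet_derivative_Ck_compact[OF test_functions_Ck_compact[OF \<phi>, of "Suc 0"] i]
            weak_pdD(1)[OF wp] f(1,3)])
    moreover have "(\<lambda>n. - (\<integral>x. \<phi> x *\<^sub>R g' n x \<partial>lborel)) \<longlonglongrightarrow> - (\<integral>x. \<phi> x *\<^sub>R g x \<partial>lborel)"
      by (intro tendsto_minus tendsto_integral_bounded_scaleR[OF test_functions_Ck_compact[OF \<phi>, of 0] weak_pdD(2)[OF wp] g(1,3)])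
    ultimately show ?thesis
      by (simp only: weak_pdD(5)[OF wp \<phi>]) (rule LIMSEQ_unique)
  qed
  then show ?thesis
    using f g unfolding weak_pd_def by simp
qed

section \<open>Chain rule\<close>

lemma Ck_compact_near_support:
  fixes U :: "'a::euclidean_space set"
  assumes "\<phi> \<in> Ck_compact k U" "open U"
  obtains K d where "compact K" "K \<subseteq> U" "\<And>x. x \<notin> K \<Longrightarrow> \<phi> x = 0" "d > 0" "\<And>x. x \<in> K \<Longrightarrow> cball x d \<subseteq> U"
proof -
  obtain K where K: "compact K" "K \<subseteq> U" "\<And>x. x \<notin> K \<Longrightarrow> \<phi> x = 0"
    using assms(1) by (rule Ck_compact_supportE) (rule that; assumption)
  obtain d where d: "d > 0" "(\<Union>x\<in>K. cball x d) \<subseteq> U"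
    using compact_subset_open_imp_cball_epsilon_subset[OF K(1) assms(2) K(2)] by blast
  show ?thesis
    using that[OF K d(1)] d(2) by (simp add: UN_subset_iff)
qed

text \<open>The bound L is uniform, so \<Phi> is Lipschitz and grows at most linearly; compositions
  with integrable functions are then locally integrable. Continuity of the derivative is required
  direction by direction, which is how it is used.\<close>

locale C1_function =
  fixes \<Phi> :: "'b::euclidean_space \<Rightarrow> 'c::euclidean_space" and \<Phi>' :: "'b \<Rightarrow> 'b \<Rightarrow> 'c" and L :: real
  assumes deriv: "\<And>y. (\<Phi> has_derivative \<Phi>' y) (at y)"
    and cont: "\<And>z. continuous_on UNIV (\<lambda>y. \<Phi>' y z)"
    and bound: "\<And>y z. norm (\<Phi>' y z) \<le> L * norm z"
begin

lemma L_nonneg: "L \<ge> 0"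
proof -
  obtain i :: 'b where "i \<in> Basis" using nonempty_Basis by blast
  then show ?thesis
    using bound[of 0 i] norm_ge_zero[of "\<Phi>' 0 i"] by (simp del: norm_ge_zero)
qed

lemma lipschitz: "norm (\<Phi> y - \<Phi> z) \<le> L * norm (y - z)"
proof (rule differentiable_bound[of UNIV])
  show "onorm (\<Phi>' x) \<le> L" for x
    by (rule onorm_le) (rule bound)
qed (use deriv in auto)

lemma growth: "norm (\<Phi> y) \<le> norm (\<Phi> 0) + L * norm y"
proof -
  have "norm (\<Phi> y) \<le> norm (\<Phi> 0) + norm (\<Phi> y - \<Phi> 0)"
    using norm_triangle_ineq[of "\<Phi> 0" "\<Phi> y - \<Phi> 0"] by simp
  with lipschitz[of y 0] show ?thesis by simp
qed

lemma linear_deriv: "linear (\<Phi>' y)"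
  by (rule has_derivative_linear[OF deriv])

lemma measurable_\<Phi> [measurable]: "\<Phi> \<in> borel_measurable borel"
  by (intro borel_measurable_continuous_onI continuous_at_imp_continuous_on ballI has_derivative_continuous[OF deriv])

text \<open>Expanding the second argument in the basis reduces joint measurability to continuity in
  the base point for finitely many fixed directions.\<close>

lemma measurable_\<Phi>':
  assumes [measurable]: "f \<in> borel_measurable M" "g \<in> borel_measurable M"
  shows "(\<lambda>x. \<Phi>' (f x) (g x)) \<in> borel_measurable M"
proof -
  have [measurable]: "(\<lambda>y. \<Phi>' y j) \<in> borel_measurable borel" for j
    by (rule borel_measurable_continuous_onI[OF cont])
  have "\<Phi>' (f x) (g x) = (\<Sum>j\<in>Basis. (g x \<bullet> j) *\<^sub>R \<Phi>' (f x) j)" for x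
  proof -
    have "\<Phi>' (f x) (g x) = \<Phi>' (f x) (\<Sum>j\<in>Basis. (g x \<bullet> j) *\<^sub>R j)"
      by (simp add: euclidean_representation)
    also have "\<dots> = (\<Sum>j\<in>Basis. (g x \<bullet> j) *\<^sub>R \<Phi>' (f x) j)"
      by (simp add: linear_sum[OF linear_deriv] linear_cmul[OF linear_deriv])
    finally show ?thesis .
  qed
  moreover have "(\<lambda>x. \<Sum>j\<in>Basis. (g x \<bullet> j) *\<^sub>R \<Phi>' (f x) j) \<in> borel_measurable M"
    by measurable
  ultimately show ?thesis by presburger
qed

lemma integrable_\<Phi>':
  assumes "integrable lborel g" "f \<in> borel_measurable borel"
  shows "integrable lborel (\<lambda>x. \<Phi>' (f x) (g x))"
proof (rule Bochner_Integration.integrable_bound)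
  show "integrable lborel (\<lambda>x. L * norm (g x))"
    using assms(1) by simp
  show "(\<lambda>x. \<Phi>' (f x) (g x)) \<in> borel_measurable lborel"
    using assms integrable_lborel_borel[OF assms(1)] by (intro measurable_\<Phi>') simp_all
  show "AE x in lborel. norm (\<Phi>' (f x) (g x)) \<le> norm (L * norm (g x))"
    using bound L_nonneg by (auto simp: abs_mult)
qed

lemma integrable_Ck_compact_\<Phi>:
  assumes \<phi>: "\<phi> \<in> Ck_compact k U" and f: "integrable lborel f"
  shows "integrable lborel (\<lambda>x. \<phi> x *\<^sub>R \<Phi> (f x))"
proof (rule Bochner_Integration.integrable_bound)
  show "integrable lborel (\<lambda>x. norm (\<phi> x) * norm (\<Phi> 0) + L * norm (\<phi> x *\<^sub>R f x))"
    using Ck_compact_integrable[OF \<phi>] integrable_test_function_scaleR[OF \<phi> f]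
    by (intro Bochner_Integration.integrable_add integrable_mult_right integrable_mult_left integrable_norm)
  have [measurable]: "\<phi> \<in> borel_measurable borel" "f \<in> borel_measurable borel"
    using Ck_compact_measurable[OF \<phi>] integrable_lborel_borel[OF f] by simp_all
  show "(\<lambda>x. \<phi> x *\<^sub>R \<Phi> (f x)) \<in> borel_measurable lborel"
    by measurable
  show "AE x in lborel. norm (\<phi> x *\<^sub>R \<Phi> (f x)) \<le> norm (norm (\<phi> x) * norm (\<Phi> 0) + L * norm (\<phi> x *\<^sub>R f x))"
  proof (intro always_eventually allI)
    fix x
    have "norm (\<phi> x *\<^sub>R \<Phi> (f x)) \<le> \<bar>\<phi> x\<bar> * (norm (\<Phi> 0) + L * norm (f x))"
      using growth[of "f x"] by (simp add: mult_left_mono)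
    also have "\<dots> = norm (\<phi> x) * norm (\<Phi> 0) + L * norm (\<phi> x *\<^sub>R f x)"
      by (simp add: algebra_simps)
    finally show "norm (\<phi> x *\<^sub>R \<Phi> (f x)) \<le> norm (norm (\<phi> x) * norm (\<Phi> 0) + L * norm (\<phi> x *\<^sub>R f x))"
      by simp
  qed
qed

text \<open>After mollification the product of \<phi> and \<Phi>(F) has a classical directional
  derivative, bounded and supported in K, so the integral of that derivative vanishes. The product
  rule and the chain rule split it into the two sides of the claim.\<close>

lemma chain_rule_mollified:
  fixes \<phi> :: "'a::euclidean_space \<Rightarrow> real" and f g :: "'a \<Rightarrow> 'b"
  assumes wp: "weak_pd U i f g" and i: "i \<in> Basis" and \<phi>: "\<phi> \<in> Ck_compact (Suc 0) U" and \<delta>: "0 < \<delta>"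
    and K: "compact K" "\<And>x. x \<notin> K \<Longrightarrow> \<phi> x = 0" "\<And>x. x \<in> K \<Longrightarrow> cball x \<delta> \<subseteq> U"
  shows "(\<integral>x. frechet_derivative \<phi> (at x) i *\<^sub>R \<Phi> (conv (mollifier \<delta>) f x) \<partial>lborel) =
    - (\<integral>x. \<phi> x *\<^sub>R \<Phi>' (conv (mollifier \<delta>) f x) (conv (mollifier \<delta>) g x) \<partial>lborel)"
proof -
  define d where "d x = frechet_derivative \<phi> (at x) i" for x
  define F where "F = conv (mollifier \<delta>) f"
  define H where "H = conv (\<lambda>z. frechet_derivative (mollifier \<delta>) (at z) i) f"
  define G where "G = conv (mollifier \<delta>) g"
  note int_f = weak_pdD(1)[OF wp] and int_g = weak_pdD(2)[OF wp]
  \<comment> \<open>On the support of \<phi> the derivative of the mollified f is the mollified g;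
    elsewhere the factor \<phi> removes the difference between them.\<close>
  have HG: "\<phi> x *\<^sub>R \<Phi>' (F x) (H x) = \<phi> x *\<^sub>R \<Phi>' (F x) (G x)" for x
    using K(2,3)[of x] conv_weak_pd[OF wp \<delta>, of x] by (cases "x \<in> K") (auto simp: H_def G_def)
  have \<rho>: "mollifier \<delta> \<in> Ck_compact (Suc 0) (UNIV :: 'a set)"
    by (rule mollifier_Ck_compact[OF \<delta>])
  obtain B where B: "\<And>x::'a. norm (mollifier \<delta> x) \<le> B"
    using Ck_compact_0_bounded[OF \<rho>] by metis
  obtain M where M: "\<And>(x::'a) v. norm (frechet_derivative (mollifier \<delta>) (at x) v) \<le> M * norm v"
    using Ck_compact_derivative_bounded[OF \<rho>] by metis
  obtain N where N: "\<And>x v. norm (frechet_derivative \<phi> (at x) v) \<le> N * norm v"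
    using Ck_compact_derivative_bounded[OF \<phi>] by metis
  obtain B' where B': "B' \<ge> 0" "\<And>x. norm (\<phi> x) \<le> B'"
    using Ck_compact_0_bounded[OF \<phi>] by metis
  define I where "I = (\<integral>x. norm (f x) \<partial>lborel)"
  have F_le: "norm (F x) \<le> B * I" for x
    unfolding F_def I_def using B by (intro norm_conv_le Ck_compact_measurable[OF \<rho>] int_f) simp
  have H_le: "norm (H x) \<le> M * I" for x
    unfolding H_def I_def using M[of _ i] i
    by (intro norm_conv_le Ck_compact_derivative_measurable[OF \<rho>] int_f) simp
  have int_F: "integrable lborel F" and int_G: "integrable lborel G"
    unfolding F_def G_def by (intro integrable_conv \<delta> int_f int_g)+
  have d_Ck: "d \<in> Ck_compact 0 U"
    unfolding d_def by (rule frechet_derivative_Ck_compact[OF \<phi> i])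
  have int1: "integrable lborel (\<lambda>x. d x *\<^sub>R \<Phi> (F x))"
    by (rule integrable_Ck_compact_\<Phi>[OF d_Ck int_F])
  have int2: "integrable lborel (\<lambda>x. \<phi> x *\<^sub>R \<Phi>' (F x) (G x))"
    by (rule integrable_test_function_scaleR[OF \<phi> integrable_\<Phi>'[OF int_G integrable_lborel_borel[OF int_F]]])
  have "(\<integral>x. d x *\<^sub>R \<Phi> (F x) + \<phi> x *\<^sub>R \<Phi>' (F x) (H x) \<partial>lborel) = 0"
  proof -
    obtain R where R: "\<And>x. x \<in> K \<Longrightarrow> norm x \<le> R"
      using K(1) by (metis bounded_iff compact_imp_bounded)
    show ?thesis
    proof (rule integral_directional_derivative_0[where \<psi> = "\<lambda>x. \<phi> x *\<^sub>R \<Phi> (F x)" and v = i and R = R])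
      show "integrable lborel (\<lambda>x. \<phi> x *\<^sub>R \<Phi> (F x))"
        by (rule integrable_Ck_compact_\<Phi>[OF \<phi> int_F])
      show "R < norm x \<Longrightarrow> \<phi> x *\<^sub>R \<Phi> (F x) = 0" for x
        using R[of x] K(2)[of x] by (cases "x \<in> K") auto
      fix x
      have "((\<lambda>t. \<phi> (x + t *\<^sub>R i)) has_vector_derivative d x) (at 0)"
        unfolding d_def using has_vector_derivative_along_line[of \<phi> x 0 i] Ck_compact_differentiable[OF \<phi>] by simp
      then have 1: "((\<lambda>t. \<phi> (x + t *\<^sub>R i)) has_derivative (\<lambda>h. h *\<^sub>R d x)) (at 0)"
        by (simp add: has_vector_derivative_def)
      have "((\<lambda>t. F (x + t *\<^sub>R i)) has_vector_derivative H x) (at 0)"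
        unfolding F_def H_def using conv_has_vector_derivative[OF \<rho> int_f, of x i 0] by simp
      then have "((\<lambda>t. F (x + t *\<^sub>R i)) has_derivative (\<lambda>h. h *\<^sub>R H x)) (at 0)"
        by (simp add: has_vector_derivative_def)
      then have "((\<lambda>t. \<Phi> (F (x + t *\<^sub>R i))) has_derivative (\<lambda>h. \<Phi>' (F x) (h *\<^sub>R H x))) (at 0)"
        by (rule has_derivative_compose) (use deriv in simp)
      from has_derivative_scaleR[OF 1 this]
      show "((\<lambda>t. \<phi> (x + t *\<^sub>R i) *\<^sub>R \<Phi> (F (x + t *\<^sub>R i))) has_vector_derivative
          d x *\<^sub>R \<Phi> (F x) + \<phi> x *\<^sub>R \<Phi>' (F x) (H x)) (at 0)"
        unfolding has_vector_derivative_def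
        by (simp add: linear_cmul[OF linear_deriv] scaleR_add_right add.commute mult.commute)
      have "norm (d x *\<^sub>R \<Phi> (F x)) \<le> N * (norm (\<Phi> 0) + L * (B * I))"
        unfolding norm_scaleR
      proof (rule mult_mono)
        show "\<bar>d x\<bar> \<le> N"
          using N[of x i] i by (simp add: d_def)
        then show "0 \<le> N" by linarith
        show "norm (\<Phi> (F x)) \<le> norm (\<Phi> 0) + L * (B * I)"
          using growth[of "F x"] mult_left_mono[OF F_le[of x] L_nonneg] by linarith
      qed simp
      moreover have "norm (\<phi> x *\<^sub>R \<Phi>' (F x) (H x)) \<le> B' * (L * (M * I))"
        unfolding norm_scaleR
        using B'(2)[of x] bound[of "F x" "H x"] mult_left_mono[OF H_le[of x] L_nonneg] B'(1)
        by (intro mult_mono) auto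
      ultimately show "norm (d x *\<^sub>R \<Phi> (F x) + \<phi> x *\<^sub>R \<Phi>' (F x) (H x)) \<le> N * (norm (\<Phi> 0) + L * (B * I)) + B' * (L * (M * I))"
        by (rule norm_triangle_mono)
    qed
  qed
  then have "(\<integral>x. d x *\<^sub>R \<Phi> (F x) \<partial>lborel) + (\<integral>x. \<phi> x *\<^sub>R \<Phi>' (F x) (G x) \<partial>lborel) = 0"
    using int1 int2 by (simp add: HG)
  then show ?thesis
    unfolding d_def F_def G_def by (simp add: eq_neg_iff_add_eq_0)
qed

text \<open>The radii in \<open>chain_rule_mollified\<close> tend to 0. The function \<phi> is only
  of class C^1: smoothness is demanded of the kernel alone, because the weak derivative is tested
  with reflected kernels.\<close>

lemma integration_by_parts:
  fixes \<phi> :: "'a::euclidean_space \<Rightarrow> real" and f g :: "'a \<Rightarrow> 'b"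
  assumes U: "open U" and wp: "weak_pd U i f g" and i: "i \<in> Basis" and \<phi>: "\<phi> \<in> Ck_compact (Suc 0) U"
  shows "(\<integral>x. frechet_derivative \<phi> (at x) i *\<^sub>R \<Phi> (f x) \<partial>lborel) = - (\<integral>x. \<phi> x *\<^sub>R \<Phi>' (f x) (g x) \<partial>lborel)"
proof -
  note int_f = weak_pdD(1)[OF wp] and int_g = weak_pdD(2)[OF wp]
  have f_m [measurable]: "f \<in> borel_measurable borel" and g_m [measurable]: "g \<in> borel_measurable borel"
    using int_f int_g by (simp_all add: integrable_lborel_borel)
  define d where "d x = frechet_derivative \<phi> (at x) i" for x
  have d_Ck: "d \<in> Ck_compact 0 U"
    unfolding d_def by (rule frechet_derivative_Ck_compact[OF \<phi> i])
  obtain K e where K: "compact K" "K \<subseteq> U" "\<And>x. x \<notin> K \<Longrightarrow> \<phi> x = 0" and e: "e > 0" "\<And>x. x \<in> K \<Longrightarrow> cball x e \<subseteq> U"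
    by (rule Ck_compact_near_support[OF \<phi> U]) (rule that; assumption)
  obtain \<delta> where \<delta>: "\<And>n. 0 < \<delta> n" "\<delta> \<longlonglongrightarrow> 0"
    and lim: "AE x in lborel. (\<lambda>n. conv (mollifier (\<delta> n)) f x) \<longlonglongrightarrow> f x"
    by (rule conv_mollifier_AE[OF int_f int_f]) (rule that; assumption)
  define F where "F n = conv (mollifier (\<delta> n)) f" for n
  define G where "G n = conv (mollifier (\<delta> n)) g" for n
  have int_F: "integrable lborel (F n)" and int_G: "integrable lborel (G n)" for n
    unfolding F_def G_def by (intro integrable_conv \<delta> int_f int_g)+
  have F_m [measurable]: "F n \<in> borel_measurable borel" and G_m [measurable]: "G n \<in> borel_measurable borel" for n
    using int_F int_G by (simp_all add: integrable_lborel_borel)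
  have LF: "(\<lambda>n. \<integral>x. norm (F n x - f x) \<partial>lborel) \<longlonglongrightarrow> 0" and LG: "(\<lambda>n. \<integral>x. norm (G n x - g x) \<partial>lborel) \<longlonglongrightarrow> 0"
    unfolding F_def G_def by (intro conv_mollifier_tendsto_L1 int_f int_g \<delta>)+
  obtain N where N: "\<And>x. norm (d x) \<le> N"
    using Ck_compact_0_bounded[OF d_Ck] by metis
  obtain B where B: "B \<ge> 0" "\<And>x. norm (\<phi> x) \<le> B"
    using Ck_compact_0_bounded[OF \<phi>] by metis
  have ev: "eventually (\<lambda>n. (\<integral>x. d x *\<^sub>R \<Phi> (F n x) \<partial>lborel) = - (\<integral>x. \<phi> x *\<^sub>R \<Phi>' (F n x) (G n x) \<partial>lborel)) sequentially"
    using order_tendstoD(2)[OF \<delta>(2) e(1)]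
  proof eventually_elim
    case (elim n)
    have sub: "cball x (\<delta> n) \<subseteq> U" if "x \<in> K" for x
      using e(2)[OF that] elim by auto
    show ?case
      unfolding d_def F_def G_def by (rule chain_rule_mollified[OF wp i \<phi> \<delta>(1) K(1,3) sub])
  qed
  have "(\<lambda>n. \<integral>x. d x *\<^sub>R \<Phi> (F n x) \<partial>lborel) \<longlonglongrightarrow> (\<integral>x. d x *\<^sub>R \<Phi> (f x) \<partial>lborel)"
  proof (rule tendsto_integral_L1[where w = "\<lambda>n x. N * (L * norm (F n x - f x))"])
    show "norm (d x *\<^sub>R \<Phi> (F n x) - d x *\<^sub>R \<Phi> (f x)) \<le> N * (L * norm (F n x - f x))" for n x
      unfolding scaleR_diff_right[symmetric] norm_scaleR real_norm_def[symmetric]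
      using N[of x] lipschitz[of "F n x" "f x"] order_trans[OF norm_ge_zero N[of x]]
      by (intro mult_mono) auto
    show "(\<lambda>n. \<integral>x. N * (L * norm (F n x - f x)) \<partial>lborel) \<longlonglongrightarrow> 0"
      using tendsto_mult_right_zero[OF tendsto_mult_right_zero[OF LF]] by simp
  qed (use int_F int_f integrable_Ck_compact_\<Phi>[OF d_Ck] in simp_all)
  moreover have "(\<lambda>n. \<integral>x. \<phi> x *\<^sub>R \<Phi>' (F n x) (G n x) \<partial>lborel) \<longlonglongrightarrow> (\<integral>x. \<phi> x *\<^sub>R \<Phi>' (f x) (g x) \<partial>lborel)"
  proof -
    have int_a: "integrable lborel (\<lambda>x. \<phi> x *\<^sub>R \<Phi>' (F n x) (h x))" if "integrable lborel h" for n h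
      by (rule integrable_test_function_scaleR[OF \<phi> integrable_\<Phi>'[OF that F_m]])
    have int_b: "integrable lborel (\<lambda>x. \<phi> x *\<^sub>R \<Phi>' (f x) (g x))"
      by (rule integrable_test_function_scaleR[OF \<phi> integrable_\<Phi>'[OF int_g f_m]])
    \<comment> \<open>The limit is taken in two stages: G n is first replaced by g, at a cost
      controlled by L and the L1 distance; then F n converges almost everywhere inside \<Phi>', with
      norm g as dominating function.\<close>
    have "(\<lambda>n. \<integral>x. \<phi> x *\<^sub>R \<Phi>' (F n x) (G n x) - \<phi> x *\<^sub>R \<Phi>' (F n x) (g x) \<partial>lborel) \<longlonglongrightarrow> integral\<^sup>L lborel (\<lambda>x::'a. 0)"
    proof (rule tendsto_integral_L1[where w = "\<lambda>n x. B * (L * norm (G n x - g x))"])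
      show "norm (\<phi> x *\<^sub>R \<Phi>' (F n x) (G n x) - \<phi> x *\<^sub>R \<Phi>' (F n x) (g x) - 0) \<le> B * (L * norm (G n x - g x))" for n x
        unfolding scaleR_diff_right[symmetric] linear_diff[OF linear_deriv, symmetric] diff_zero norm_scaleR real_norm_def[symmetric]
        using B bound[of "F n x" "G n x - g x"] by (intro mult_mono) auto
      show "(\<lambda>n. \<integral>x. B * (L * norm (G n x - g x)) \<partial>lborel) \<longlonglongrightarrow> 0"
        using tendsto_mult_right_zero[OF tendsto_mult_right_zero[OF LG]] by simp
    qed (use int_G int_g int_a in simp_all)
    moreover have "(\<lambda>n. \<integral>x. \<phi> x *\<^sub>R \<Phi>' (F n x) (g x) \<partial>lborel) \<longlonglongrightarrow> (\<integral>x. \<phi> x *\<^sub>R \<Phi>' (f x) (g x) \<partial>lborel)"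
    proof (rule integral_dominated_convergence[where w = "\<lambda>x. B * (L * norm (g x))"])
      show "AE x in lborel. (\<lambda>n. \<phi> x *\<^sub>R \<Phi>' (F n x) (g x)) \<longlonglongrightarrow> \<phi> x *\<^sub>R \<Phi>' (f x) (g x)"
        using lim
      proof eventually_elim
        case (elim x)
        have "isCont (\<lambda>y. \<Phi>' y (g x)) (f x)"
          using cont[of "g x"] by (simp add: continuous_on_eq_continuous_at)
        from isCont_tendsto_compose[OF this elim] show ?case
          unfolding F_def by (intro tendsto_scaleR tendsto_const)
      qed
      show "AE x in lborel. norm (\<phi> x *\<^sub>R \<Phi>' (F n x) (g x)) \<le> B * (L * norm (g x))" for n
        unfolding norm_scaleR real_norm_def[symmetric]
        using B bound by (intro always_eventually allI mult_mono) auto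
    qed (use int_g borel_measurable_integrable[OF int_a[OF int_g]] borel_measurable_integrable[OF int_b] in simp_all)
    ultimately have "(\<lambda>n. (\<integral>x. \<phi> x *\<^sub>R \<Phi>' (F n x) (G n x) - \<phi> x *\<^sub>R \<Phi>' (F n x) (g x) \<partial>lborel) + (\<integral>x. \<phi> x *\<^sub>R \<Phi>' (F n x) (g x) \<partial>lborel))
        \<longlonglongrightarrow> integral\<^sup>L lborel (\<lambda>x::'a. 0) + (\<integral>x. \<phi> x *\<^sub>R \<Phi>' (f x) (g x) \<partial>lborel)"
      by (rule tendsto_add)
    then show ?thesis
      using int_a[OF int_G] int_a[OF int_g] by simp
  qed
  then have "(\<lambda>n. - (\<integral>x. \<phi> x *\<^sub>R \<Phi>' (F n x) (G n x) \<partial>lborel)) \<longlonglongrightarrow> - (\<integral>x. \<phi> x *\<^sub>R \<Phi>' (f x) (g x) \<partial>lborel)"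
    by (rule tendsto_minus)
  then have "(\<lambda>n. \<integral>x. d x *\<^sub>R \<Phi> (F n x) \<partial>lborel) \<longlonglongrightarrow> - (\<integral>x. \<phi> x *\<^sub>R \<Phi>' (f x) (g x) \<partial>lborel)"
    by (rule Lim_transform_eventually) (use ev in eventually_elim, simp)
  ultimately show ?thesis
    unfolding d_def by (rule LIMSEQ_unique)
qed

text \<open>Outside U the function f is 0 but \<Phi> 0 may differ from 0, hence the indicator. The
  derivative vanishes there by itself, as \<Phi>' is linear in g x = 0.\<close>

lemma weak_pd_chain:
  fixes f g :: "'a::euclidean_space \<Rightarrow> 'b"
  assumes U: "open U" "emeasure lborel U < \<infinity>" and wp: "weak_pd U i f g" and i: "i \<in> Basis"
  shows "weak_pd U i (\<lambda>x. indicator U x *\<^sub>R \<Phi> (f x)) (\<lambda>x. \<Phi>' (f x) (g x))"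
proof -
  note int_f = weak_pdD(1)[OF wp] and int_g = weak_pdD(2)[OF wp]
  have f_m [measurable]: "f \<in> borel_measurable borel"
    using int_f by (rule integrable_lborel_borel)
  have [measurable]: "U \<in> sets borel" using U by simp
  have "integrable lborel (\<lambda>x. indicator U x *\<^sub>R \<Phi> (f x))"
  proof (rule Bochner_Integration.integrable_bound)
    show "integrable lborel (\<lambda>x. norm (\<Phi> 0) * indicator U x + L * norm (f x))"
      using int_f U by (intro Bochner_Integration.integrable_add integrable_mult_right integrable_norm) auto
    show "AE x in lborel. norm (indicator U x *\<^sub>R \<Phi> (f x)) \<le> norm (norm (\<Phi> 0) * indicator U x + L * norm (f x))"
      using growth L_nonneg by (auto simp: indicator_def)
  qed measurable
  moreover have "(\<integral>x. frechet_derivative \<phi> (at x) i *\<^sub>R (indicator U x *\<^sub>R \<Phi> (f x)) \<partial>lborel) =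
     - (\<integral>x. \<phi> x *\<^sub>R \<Phi>' (f x) (g x) \<partial>lborel)" if \<phi>: "\<phi> \<in> test_functions U" for \<phi>
  proof -
    have 1: "\<phi> \<in> Ck_compact (Suc 0) U"
      using \<phi> by (rule test_functions_Ck_compact)
    obtain K where K: "K \<subseteq> U" "\<And>x. x \<notin> K \<Longrightarrow> frechet_derivative \<phi> (at x) i = 0"
      by (rule Ck_compact_supportE[OF frechet_derivative_Ck_compact[OF 1 i]]) (rule that; assumption)
    have "frechet_derivative \<phi> (at x) i *\<^sub>R (indicator U x *\<^sub>R \<Phi> (f x)) = frechet_derivative \<phi> (at x) i *\<^sub>R \<Phi> (f x)" for x
      using K(1) K(2)[of x] by (cases "x \<in> K") auto
    then show ?thesis
      using integration_by_parts[OF U(1) wp i 1] by presburger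
  qed
  ultimately show ?thesis
    unfolding weak_pd_def using integrable_\<Phi>'[OF int_g f_m] weak_pdD(3,4)[OF wp] linear_0[OF linear_deriv]
    by simp
qed

end

text \<open>The case of the identity function enlarges the admissible test functions from smooth to
  C^1, the regularity of the fields that define the variation.\<close>

lemma integration_by_parts_C1:
  fixes \<phi> :: "'a::euclidean_space \<Rightarrow> real" and f g :: "'a \<Rightarrow> 'b::euclidean_space"
  assumes "open U" "weak_pd U i f g" "i \<in> Basis" "\<phi> \<in> Ck_compact (Suc 0) U"
  shows "(\<integral>x. frechet_derivative \<phi> (at x) i *\<^sub>R f x \<partial>lborel) = - (\<integral>x. \<phi> x *\<^sub>R g x \<partial>lborel)"
proof -
  interpret C1_function "\<lambda>y::'b. y" "\<lambda>y z. z" 1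
    by unfold_locales auto
  show ?thesis
    by (rule integration_by_parts[OF assms])
qed

section \<open>Poincare inequalities on convex sets\<close>

text \<open>Convexity of the power lets it lie above its tangent at m. The tangent argument runs on
  the open half-line, so zero values are separate; for m = 0 the left-hand side is 0 because
  \<open>0 powr y\<close> is \<open>0\<close> for every y.\<close>

lemma powr_ge_tangent:
  fixes s m q :: real
  assumes "q \<ge> 1" "s \<ge> 0" "m \<ge> 0"
  shows "m powr q + q * m powr (q - 1) * (s - m) \<le> s powr q"
proof -
  consider "m = 0" | "m > 0" "s = 0" | "m > 0" "s > 0"
    using assms by linarith
  then show ?thesis
  proof cases
    case 2
    have "m powr (q - 1) * m = m powr q"
      using 2 by (simp add: powr_mult_base[symmetric] powr_diff)
    then have "m powr q + q * m powr (q - 1) * (s - m) = (1 - q) * m powr q"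
      using 2 by (simp add: algebra_simps)
    also have "\<dots> \<le> 0"
      using assms by (intro mult_nonpos_nonneg) auto
    finally show ?thesis by (rule order_trans) simp
  next
    case 3
    have "((\<lambda>x. x powr q) has_real_derivative q * m powr (q - 1)) (at m within {0<..})"
      using 3 by (intro has_real_derivative_powr[THEN DERIV_subset]) auto
    from convex_on_imp_above_tangent[OF powr_convex[OF assms(1)] _ _ _ this, of s] 3
    show ?thesis by (simp add: interior_open)
  qed simp
qed

text \<open>On sets of finite measure this crude bound turns integrability of a power into
  integrability, in place of Hoelder's inequality.\<close>

lemma le_one_plus_powr:
  fixes s q :: real
  assumes "q \<ge> 1" "s \<ge> 0"
  shows "s \<le> 1 + s powr q"
proof (cases "s \<le> 1")
  case False
  then have "s powr 1 \<le> s powr q"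
    using assms by (intro powr_mono) auto
  with False show ?thesis by simp
qed (simp add: add_increasing2)

text \<open>Integrate the tangent inequality at the mean m of norm f: since w is a probability
  density, the linear term integrates to 0 and m powr q remains.\<close>

lemma jensen_powr:
  fixes f :: "'a \<Rightarrow> 'b::{banach, second_countable_topology}" and w :: "'a \<Rightarrow> real"
  assumes q: "q \<ge> 1" and w: "integrable M w" "\<And>x. 0 \<le> w x" "integral\<^sup>L M w = 1"
    and f: "f \<in> borel_measurable M" and fq: "integrable M (\<lambda>x. w x * norm (f x) powr q)"
  shows "norm (\<integral>x. w x *\<^sub>R f x \<partial>M) powr q \<le> (\<integral>x. w x * norm (f x) powr q \<partial>M)"
proof -
  have w_m: "w \<in> borel_measurable M"
    using w(1) by (rule borel_measurable_integrable)
  have int: "integrable M (\<lambda>x. w x *\<^sub>R f x)"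
  proof (rule Bochner_Integration.integrable_bound)
    show "integrable M (\<lambda>x. w x + w x * norm (f x) powr q)"
      using w fq by simp
    show "(\<lambda>x. w x *\<^sub>R f x) \<in> borel_measurable M"
      using f w_m by simp
    show "AE x in M. norm (w x *\<^sub>R f x) \<le> norm (w x + w x * norm (f x) powr q)"
    proof (intro always_eventually allI)
      fix x
      have "w x * norm (f x) \<le> w x * (1 + norm (f x) powr q)"
        using w(2) le_one_plus_powr[OF q] by (intro mult_left_mono) auto
      then show "norm (w x *\<^sub>R f x) \<le> norm (w x + w x * norm (f x) powr q)"
        using w(2)[of x] by (simp add: distrib_left)
    qed
  qed
  then have int': "integrable M (\<lambda>x. w x * norm (f x))"
    using integrable_norm[OF int] w(2) by simp
  define m where "m = (\<integral>x. w x * norm (f x) \<partial>M)"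
  have "m \<ge> 0"
    unfolding m_def using w(2) by (intro integral_nonneg_AE) auto
  have "norm (\<integral>x. w x *\<^sub>R f x \<partial>M) \<le> m"
    unfolding m_def using integral_norm_bound[of M "\<lambda>x. w x *\<^sub>R f x"] w(2) by simp
  then have "norm (\<integral>x. w x *\<^sub>R f x \<partial>M) powr q \<le> m powr q"
    using q by (intro powr_mono2) auto
  also have "m powr q = (\<integral>x. (m powr q - q * m powr (q - 1) * m) * w x + (q * m powr (q - 1)) * (w x * norm (f x)) \<partial>M)"
    using w int' by (simp add: m_def[symmetric])
  also have "\<dots> \<le> (\<integral>x. w x * norm (f x) powr q \<partial>M)"
  proof (rule integral_mono)
    fix x
    have "w x * (m powr q + q * m powr (q - 1) * (norm (f x) - m)) \<le> w x * norm (f x) powr q"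
      using powr_ge_tangent[OF q norm_ge_zero \<open>m \<ge> 0\<close>] w(2) by (intro mult_left_mono) auto
    then show "(m powr q - q * m powr (q - 1) * m) * w x + (q * m powr (q - 1)) * (w x * norm (f x)) \<le> w x * norm (f x) powr q"
      by (simp add: algebra_simps)
  qed (use w int' fq in simp_all)
  finally show ?thesis .
qed

lemma mollifier_kernel:
  fixes x :: "'a::euclidean_space"
  assumes "0 < \<delta>"
  shows "integrable lborel (\<lambda>y. mollifier \<delta> (x - y))" "(\<integral>y. mollifier \<delta> (x - y) \<partial>lborel) = 1"
proof -
  have \<rho>: "mollifier \<delta> \<in> Ck_compact 0 (UNIV :: 'a set)"
    by (rule mollifier_Ck_compact[OF assms])
  show "integrable lborel (\<lambda>y. mollifier \<delta> (x - y))"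
    using Ck_compact_integrable[OF \<rho>] integrable_lborel_reflect[OF Ck_compact_measurable[OF \<rho>]] by simp
  show "(\<integral>y. mollifier \<delta> (x - y) \<partial>lborel) = 1"
    using integral_lborel_reflect[OF Ck_compact_measurable[OF \<rho>]] integral_mollifier[OF assms, where 'a='a] by simp
qed

lemma mollifier_integrand_integrable:
  fixes f :: "'a::euclidean_space \<Rightarrow> 'b::euclidean_space"
  assumes "0 < \<delta>" "integrable lborel f"
  shows "integrable lborel (\<lambda>y. mollifier \<delta> (x - y) *\<^sub>R f y)"
proof -
  have \<rho>: "mollifier \<delta> \<in> Ck_compact 0 (UNIV :: 'a set)"
    by (rule mollifier_Ck_compact[OF assms(1)])
  obtain B where B: "\<And>x::'a. \<bar>mollifier \<delta> x\<bar> \<le> B"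
    using Ck_compact_0_bounded[OF \<rho>] real_norm_def by metis
  show ?thesis
    by (rule conv_integrand_integrable[OF Ck_compact_measurable[OF \<rho>] B assms(2)])
qed

lemma continuous_conv_mollifier:
  fixes f :: "'a::euclidean_space \<Rightarrow> 'b::euclidean_space"
  assumes \<delta>: "0 < \<delta>" and f: "integrable lborel f"
  shows "continuous_on UNIV (conv (mollifier \<delta>) f)"
proof -
  have \<rho>: "mollifier \<delta> \<in> Ck_compact (Suc 0) (UNIV :: 'a set)"
    by (rule mollifier_Ck_compact[OF \<delta>])
  obtain L where L: "L \<ge> 0" "\<And>x y::'a. \<bar>mollifier \<delta> x - mollifier \<delta> y\<bar> \<le> L * norm (x - y)"
    "\<And>(x::'a) v. \<bar>frechet_derivative (mollifier \<delta>) (at x) v\<bar> \<le> L * norm v"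
    by (rule Ck_compact_lipschitz[OF \<rho>]) (rule that; assumption)
  define C where "C = L * (\<integral>y. norm (f y) \<partial>lborel)"
  have "C \<ge> 0"
    unfolding C_def using L(1) by simp
  have "norm (conv (mollifier \<delta>) f x - conv (mollifier \<delta>) f y) \<le> C * norm (x - y)" for x y
    using conv_lipschitz[OF \<rho> L(2) f, of x y] by (simp add: C_def algebra_simps)
  then have "C-lipschitz_on UNIV (conv (mollifier \<delta>) f)"
    using \<open>C \<ge> 0\<close> by (auto simp: lipschitz_on_def dist_norm)
  then show ?thesis
    by (rule lipschitz_on_continuous_on)
qed

lemma conv_mollifier_nonneg:
  fixes s :: "'a::euclidean_space \<Rightarrow> real"
  assumes "0 < \<delta>" "\<And>x. 0 \<le> s x"
  shows "0 \<le> conv (mollifier \<delta>) s x"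
  unfolding conv_def using assms mollifier_nonneg by (intro integral_nonneg_AE) (auto intro!: mult_nonneg_nonneg)

lemma conv_mollifier_powr:
  fixes s :: "'a::euclidean_space \<Rightarrow> real"
  assumes \<delta>: "0 < \<delta>" and q: "q \<ge> 1" and s: "integrable lborel s" "\<And>x. 0 \<le> s x" "integrable lborel (\<lambda>x. s x powr q)"
  shows "conv (mollifier \<delta>) s x powr q \<le> conv (mollifier \<delta>) (\<lambda>x. s x powr q) x"
proof -
  have "norm (\<integral>y. mollifier \<delta> (x - y) *\<^sub>R s y \<partial>lborel) powr q \<le> (\<integral>y. mollifier \<delta> (x - y) * norm (s y) powr q \<partial>lborel)"
  proof (rule jensen_powr[OF q mollifier_kernel(1)[OF \<delta>] mollifier_nonneg[OF \<delta>] mollifier_kernel(2)[OF \<delta>] borel_measurable_integrable[OF s(1)]])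
    show "integrable lborel (\<lambda>y. mollifier \<delta> (x - y) * norm (s y) powr q)"
      using mollifier_integrand_integrable[OF \<delta> s(3), of x] s(2) by simp
  qed
  then show ?thesis
    using conv_mollifier_nonneg[OF \<delta>, of s x] s(2) by (simp add: conv_def)
qed

text \<open>A point of the ball around an intermediate point is the same convex combination of x + e
  and y + e, with one common offset e. This is where convexity of U enters the segment
  estimates.\<close>

lemma cball_segment_subset:
  fixes x y :: "'a::euclidean_space"
  assumes "convex U" "cball x \<delta> \<subseteq> U" "cball y \<delta> \<subseteq> U" "t \<in> {0..1}"
  shows "cball (x + t *\<^sub>R (y - x)) \<delta> \<subseteq> U"
proof
  fix z assume z: "z \<in> cball (x + t *\<^sub>R (y - x)) \<delta>"
  define e where "e = z - (x + t *\<^sub>R (y - x))"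
  have "norm e \<le> \<delta>"
    using z by (simp add: e_def dist_norm norm_minus_commute)
  then have "x + e \<in> U" "y + e \<in> U"
    using assms(2,3) by (auto simp: subset_iff dist_norm)
  then have "(1 - t) *\<^sub>R (x + e) + t *\<^sub>R (y + e) \<in> U"
    using assms(1,4) by (intro convexD) auto
  also have "(1 - t) *\<^sub>R (x + e) + t *\<^sub>R (y + e) = z"
    by (simp add: e_def algebra_simps)
  finally show "z \<in> U" .
qed

lemma integrable_indicator_segment:
  fixes h :: "'a::euclidean_space \<Rightarrow> real"
  assumes "continuous_on UNIV h"
  shows "integrable lborel (\<lambda>t::real. indicator {0..1} t * h (x + t *\<^sub>R v))"
proof -
  have "continuous_on {0..1::real} (\<lambda>t. h (x + t *\<^sub>R v))"
    by (intro continuous_on_compose2[OF assms] continuous_intros) auto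
  from borel_integrable_compact[OF compact_Icc this] show ?thesis
    by simp
qed

text \<open>The fundamental theorem of calculus is applied to the mollified f along the segment. The
  balls around all its points stay in U, so the partial derivatives there are the mollified weak
  ones, and each component of the direction is at most norm (y - x).\<close>

lemma conv_diff_le_segment:
  fixes f :: "'a::euclidean_space \<Rightarrow> 'b::euclidean_space"
  assumes wp: "\<And>i. i \<in> Basis \<Longrightarrow> weak_pd U i f (g i)" and \<delta>: "0 < \<delta>" and U: "convex U"
    and x: "cball x \<delta> \<subseteq> U" and y: "cball y \<delta> \<subseteq> U"
  shows "norm (conv (mollifier \<delta>) f y - conv (mollifier \<delta>) f x) \<le>
    norm (y - x) * (\<integral>t. indicator {0..1} t * conv (mollifier \<delta>) (\<lambda>x. \<Sum>i\<in>Basis. norm (g i x)) (x + t *\<^sub>R (y - x)) \<partial>lborel)"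
proof -
  let ?\<rho> = "mollifier \<delta> :: 'a \<Rightarrow> real"
  define v where "v = y - x"
  obtain b :: 'a where "b \<in> Basis" using nonempty_Basis by blast
  then have int_f: "integrable lborel f"
    using weak_pdD(1)[OF wp] by blast
  have int_g: "integrable lborel (g i)" if "i \<in> Basis" for i
    using weak_pdD(2)[OF wp[OF that]] .
  have \<rho>: "?\<rho> \<in> Ck_compact (Suc 0) UNIV"
    by (rule mollifier_Ck_compact[OF \<delta>])
  define F where "F t = conv ?\<rho> f (x + t *\<^sub>R v)" for t
  define F' where "F' t = (\<Sum>i\<in>Basis. (v \<bullet> i) *\<^sub>R conv ?\<rho> (g i) (x + t *\<^sub>R v))" for t
  define c where "c = conv ?\<rho> (\<lambda>x. \<Sum>i\<in>Basis. norm (g i x))"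
  have c_eq: "c z = (\<Sum>i\<in>Basis. conv ?\<rho> (\<lambda>x. norm (g i x)) z)" for z
    unfolding c_def conv_def scaleR_sum_right
    by (rule Bochner_Integration.integral_sum) (intro mollifier_integrand_integrable[OF \<delta>] integrable_norm int_g)
  have cont_c: "continuous_on UNIV c"
    unfolding c_def by (intro continuous_conv_mollifier \<delta> Bochner_Integration.integrable_sum integrable_norm int_g)
  have F': "(F has_vector_derivative F' t) (at t within {0..1})" if t: "t \<in> {0..1}" for t
  proof -
    have sub: "cball (x + t *\<^sub>R v) \<delta> \<subseteq> U"
      unfolding v_def by (rule cball_segment_subset[OF U x y t])
    have "(F has_vector_derivative conv (\<lambda>z. frechet_derivative ?\<rho> (at z) v) f (x + t *\<^sub>R v)) (at t within {0..1})"
      unfolding F_def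
      by (rule has_vector_derivative_at_within[OF conv_has_vector_derivative[OF \<rho> int_f]])
    also have "conv (\<lambda>z. frechet_derivative ?\<rho> (at z) v) f (x + t *\<^sub>R v) = F' t"
    proof -
      have "conv (\<lambda>z. frechet_derivative ?\<rho> (at z) v) f (x + t *\<^sub>R v) =
        (\<integral>z. (\<Sum>i\<in>Basis. (v \<bullet> i) *\<^sub>R (frechet_derivative ?\<rho> (at (x + t *\<^sub>R v - z)) i *\<^sub>R f z)) \<partial>lborel)"
        unfolding conv_def frechet_derivative_basis_sum[OF Ck_compact_differentiable[OF \<rho>], of _ v]
        by (simp add: scaleR_sum_left)
      also have "\<dots> = (\<Sum>i\<in>Basis. (\<integral>z. (v \<bullet> i) *\<^sub>R (frechet_derivative ?\<rho> (at (x + t *\<^sub>R v - z)) i *\<^sub>R f z) \<partial>lborel))"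
      proof (rule Bochner_Integration.integral_sum)
        fix i :: 'a assume i: "i \<in> Basis"
        note d = frechet_derivative_Ck_compact[OF \<rho> i]
        obtain B where "\<And>z. \<bar>frechet_derivative ?\<rho> (at z) i\<bar> \<le> B"
          using Ck_compact_0_bounded[OF d] real_norm_def by metis
        from conv_integrand_integrable[OF Ck_compact_measurable[OF d] this int_f]
        show "integrable lborel (\<lambda>z. (v \<bullet> i) *\<^sub>R (frechet_derivative ?\<rho> (at (x + t *\<^sub>R v - z)) i *\<^sub>R f z))"
          by (rule integrable_scaleR_right)
      qed
      also have "\<dots> = F' t"
        unfolding F'_def integral_scaleR_right
        using conv_weak_pd[OF wp \<delta> sub] by (intro sum.cong) (simp_all add: conv_def)
      finally show ?thesis .
    qed
    finally show ?thesis .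
  qed
  have cont_F': "continuous_on {0..1} F'"
    unfolding F'_def
    by (intro continuous_intros continuous_on_compose2[OF continuous_conv_mollifier[OF \<delta> int_g]]) auto
  have F'_le: "norm (F' t) \<le> norm v * c (x + t *\<^sub>R v)" for t
  proof -
    have "norm (F' t) \<le> (\<Sum>i\<in>Basis. norm ((v \<bullet> i) *\<^sub>R conv ?\<rho> (g i) (x + t *\<^sub>R v)))"
      unfolding F'_def by (rule norm_sum)
    also have "\<dots> \<le> (\<Sum>i\<in>Basis. norm v * conv ?\<rho> (\<lambda>x. norm (g i x)) (x + t *\<^sub>R v))"
    proof (rule sum_mono)
      fix i :: 'a assume i: "i \<in> Basis"
      have "norm (conv ?\<rho> (g i) (x + t *\<^sub>R v)) \<le> (\<integral>z. norm (?\<rho> (x + t *\<^sub>R v - z) *\<^sub>R g i z) \<partial>lborel)"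
        unfolding conv_def by (rule integral_norm_bound)
      also have "\<dots> = conv ?\<rho> (\<lambda>x. norm (g i x)) (x + t *\<^sub>R v)"
        unfolding conv_def using mollifier_nonneg[OF \<delta>, where 'a='a] by simp
      finally show "norm ((v \<bullet> i) *\<^sub>R conv ?\<rho> (g i) (x + t *\<^sub>R v)) \<le> norm v * conv ?\<rho> (\<lambda>x. norm (g i x)) (x + t *\<^sub>R v)"
        unfolding norm_scaleR using Basis_le_norm[OF i, of v] by (intro mult_mono) auto
    qed
    also have "\<dots> = norm v * c (x + t *\<^sub>R v)"
      unfolding c_eq by (simp add: sum_distrib_left)
    finally show ?thesis .
  qed
  have "F 1 - F 0 = (\<integral>t. indicator {0..1} t *\<^sub>R F' t \<partial>lborel)"
    by (rule integral_FTC_Icc[symmetric]) (use F' cont_F' in auto)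
  then have "norm (F 1 - F 0) \<le> (\<integral>t. norm (indicator {0..1} t *\<^sub>R F' t) \<partial>lborel)"
    by (metis integral_norm_bound)
  also have "\<dots> \<le> (\<integral>t. norm v * (indicator {0..1} t * c (x + t *\<^sub>R v)) \<partial>lborel)"
  proof (rule integral_mono)
    show "integrable lborel (\<lambda>t. norm (indicator {0..1} t *\<^sub>R F' t))"
      using borel_integrable_compact[OF compact_Icc cont_F'] by (rule integrable_norm)
    show "integrable lborel (\<lambda>t. norm v * (indicator {0..1} t * c (x + t *\<^sub>R v)))"
      by (intro integrable_mult_right integrable_indicator_segment cont_c)
    show "norm (indicator {0..1} t *\<^sub>R F' t) \<le> norm v * (indicator {0..1} t * c (x + t *\<^sub>R v))" for t
      using F'_le[of t] by (simp add: indicator_def)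
  qed
  finally show ?thesis
    by (simp add: F_def v_def c_def)
qed

text \<open>Jensen's inequality is used twice, once for the uniform density on the unit interval and
  once for the mollifying kernel, to bring the power onto the gradient.\<close>

lemma conv_diff_powr_le_segment:
  fixes f :: "'a::euclidean_space \<Rightarrow> 'b::euclidean_space"
  assumes wp: "\<And>i. i \<in> Basis \<Longrightarrow> weak_pd U i f (g i)" and \<delta>: "0 < \<delta>" and U: "convex U"
    and x: "cball x \<delta> \<subseteq> U" and y: "cball y \<delta> \<subseteq> U" and q: "q \<ge> 1"
  defines "S \<equiv> \<lambda>x. (\<Sum>i\<in>Basis. norm (g i x)) powr q"
  assumes int_S: "integrable lborel S"
  shows "ennreal (norm (conv (mollifier \<delta>) f y - conv (mollifier \<delta>) f x) powr q) \<le>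
    ennreal (norm (y - x) powr q) * (\<integral>\<^sup>+t. indicator {0..1} t * ennreal (conv (mollifier \<delta>) S (x + t *\<^sub>R (y - x))) \<partial>lborel)"
proof -
  let ?\<rho> = "mollifier \<delta> :: 'a \<Rightarrow> real"
  define s where "s x = (\<Sum>i\<in>Basis. norm (g i x))" for x
  have s_nn: "0 \<le> s x" for x
    unfolding s_def by (intro sum_nonneg) simp
  have int_s: "integrable lborel s"
    unfolding s_def using weak_pdD(2)[OF wp] by (intro Bochner_Integration.integrable_sum integrable_norm)
  have S_eq: "S = (\<lambda>x. s x powr q)"
    by (simp add: S_def s_def)
  note int_sq = int_S[unfolded S_eq]
  define c where "c t = conv ?\<rho> s (x + t *\<^sub>R (y - x))" for t
  have c_nn: "0 \<le> c t" for t
    unfolding c_def by (rule conv_mollifier_nonneg[OF \<delta> s_nn])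
  define J where "J = (\<integral>t. indicator {0..1} t * c t \<partial>lborel)"
  have "J \<ge> 0"
    unfolding J_def using c_nn by (intro integral_nonneg_AE) auto
  have cq: "c t powr q \<le> conv ?\<rho> S (x + t *\<^sub>R (y - x))" for t
    unfolding c_def S_eq by (rule conv_mollifier_powr[OF \<delta> q int_s s_nn int_sq])
  have int_cS: "integrable lborel (\<lambda>t. indicator {0..1} t * conv ?\<rho> S (x + t *\<^sub>R (y - x)))"
    by (intro integrable_indicator_segment continuous_conv_mollifier \<delta> int_S)
  have c_m: "c \<in> borel_measurable borel"
  proof -
    have "continuous_on UNIV c"
      unfolding c_def
      by (intro continuous_on_compose2[OF continuous_conv_mollifier[OF \<delta> int_s]] continuous_intros) auto
    then show ?thesis by (rule borel_measurable_continuous_onI)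
  qed
  have int_cq: "integrable lborel (\<lambda>t. indicator {0..1} t * norm (c t) powr q)"
    by (rule Bochner_Integration.integrable_bound[OF int_cS])
      (use c_m c_nn order_trans[OF cq abs_ge_self] in \<open>auto simp: indicator_def\<close>)
  have "norm (conv ?\<rho> f y - conv ?\<rho> f x) \<le> norm (y - x) * J"
    using conv_diff_le_segment[OF wp \<delta> U x y] unfolding J_def c_def s_def by simp
  then have "norm (conv ?\<rho> f y - conv ?\<rho> f x) powr q \<le> (norm (y - x) * J) powr q"
    using q by (intro powr_mono2) auto
  also have "\<dots> = norm (y - x) powr q * J powr q"
    using \<open>J \<ge> 0\<close> by (simp add: powr_mult)
  also have "J powr q \<le> (\<integral>t. indicator {0..1} t * norm (c t) powr q \<partial>lborel)"
  proof -
    have "norm (\<integral>t. indicator {0..1::real} t *\<^sub>R c t \<partial>lborel) powr q \<le> (\<integral>t. indicator {0..1} t * norm (c t) powr q \<partial>lborel)"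
      by (rule jensen_powr[OF q _ _ _ _ int_cq]) (use c_m in auto)
    then show ?thesis
      using \<open>J \<ge> 0\<close> by (simp add: J_def)
  qed
  also have "\<dots> \<le> (\<integral>t. indicator {0..1} t * conv ?\<rho> S (x + t *\<^sub>R (y - x)) \<partial>lborel)"
    using cq c_nn by (intro integral_mono int_cq int_cS) (auto simp: indicator_def)
  finally have "ennreal (norm (conv ?\<rho> f y - conv ?\<rho> f x) powr q) \<le>
      ennreal (norm (y - x) powr q) * ennreal (\<integral>t. indicator {0..1} t * conv ?\<rho> S (x + t *\<^sub>R (y - x)) \<partial>lborel)"
    by (simp add: ennreal_mult[symmetric] ennreal_leI mult_left_mono integral_nonneg_AE conv_mollifier_nonneg[OF \<delta>] S_def)
  also have "ennreal (\<integral>t. indicator {0..1} t * conv ?\<rho> S (x + t *\<^sub>R (y - x)) \<partial>lborel) =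
      (\<integral>\<^sup>+t. ennreal (indicator {0..1} t * conv ?\<rho> S (x + t *\<^sub>R (y - x))) \<partial>lborel)"
    by (rule nn_integral_eq_integral[symmetric, OF int_cS])
      (simp add: conv_mollifier_nonneg[OF \<delta>] S_def)
  also have "\<dots> = (\<integral>\<^sup>+t. indicator {0..1} t * ennreal (conv ?\<rho> S (x + t *\<^sub>R (y - x))) \<partial>lborel)"
    by (intro nn_integral_cong) (simp add: indicator_def)
  finally show ?thesis .
qed

text \<open>The change of variables costs the factor 1 / t^DIM, which is at most 2^DIM for t \<ge>
  1/2.\<close>

lemma nn_integral_affine_le:
  fixes h :: "'a::euclidean_space \<Rightarrow> ennreal"
  assumes [measurable]: "h \<in> borel_measurable borel" and t: "1 / 2 \<le> t"
  shows "(\<integral>\<^sup>+y. h (a + t *\<^sub>R y) \<partial>lborel) \<le> 2 ^ DIM('a) * (\<integral>\<^sup>+y. h y \<partial>lborel)"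
proof -
  let ?X = "\<integral>\<^sup>+y. h (a + t *\<^sub>R y) \<partial>lborel"
  have "(\<integral>\<^sup>+y. h y \<partial>lborel) = (\<integral>\<^sup>+y. h y \<partial>density (distr lborel borel (\<lambda>x. a + t *\<^sub>R x)) (\<lambda>_. ennreal (\<bar>t\<bar> ^ DIM('a))))"
    using lborel_affine[of t a] t by simp
  also have "\<dots> = ennreal (\<bar>t\<bar> ^ DIM('a)) * ?X"
    by (simp add: nn_integral_density nn_integral_distr nn_integral_cmult)
  finally have eq: "(\<integral>\<^sup>+y. h y \<partial>lborel) = ennreal (\<bar>t\<bar> ^ DIM('a)) * ?X" .
  have "1 \<le> (2 * t) ^ DIM('a)"
    using t by (intro one_le_power) simp
  then have "1 \<le> ennreal (2 ^ DIM('a) * \<bar>t\<bar> ^ DIM('a))"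
    using t by (simp add: power_mult_distrib ennreal_ge_1)
  also have "\<dots> = 2 ^ DIM('a) * ennreal (\<bar>t\<bar> ^ DIM('a))"
    by (simp add: ennreal_mult ennreal_power[symmetric])
  finally have "1 * ?X \<le> 2 ^ DIM('a) * ennreal (\<bar>t\<bar> ^ DIM('a)) * ?X"
    by (rule mult_right_mono) simp
  then show ?thesis
    by (simp add: eq mult.assoc)
qed

text \<open>The point x + t (y - x) moves with speed t in y and 1 - t in x. One of the two is at
  least 1/2; integrating over that variable first keeps the Jacobian factor below 2^DIM uniformly in
  t, and the other variable then contributes the measure of U.\<close>

lemma nn_integral_segments_le:
  fixes h :: "'a::euclidean_space \<Rightarrow> ennreal"
  assumes [measurable]: "h \<in> borel_measurable borel" "U \<in> sets borel"
  shows "(\<integral>\<^sup>+x. \<integral>\<^sup>+y. indicator U x * indicator U y * (\<integral>\<^sup>+t. indicator {0..1::real} t * h (x + t *\<^sub>R (y - x)) \<partial>lborel) \<partial>lborel \<partial>lborel)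
    \<le> 2 ^ DIM('a) * emeasure lborel U * (\<integral>\<^sup>+y. h y \<partial>lborel)"
proof -
  define I where "I = 2 ^ DIM('a) * (\<integral>\<^sup>+y. h y \<partial>lborel)"
  define K where "K t = (\<integral>\<^sup>+x. \<integral>\<^sup>+y. indicator U x * indicator U y * h (x + t *\<^sub>R (y - x)) \<partial>lborel \<partial>lborel)" for t
  have K: "K t \<le> emeasure lborel U * I" if t: "t \<in> {0..1}" for t
  proof (cases "1 / 2 \<le> t")
    case True
    have "K t \<le> (\<integral>\<^sup>+x. indicator U x * I \<partial>lborel)"
      unfolding K_def
    proof (rule nn_integral_mono)
      fix x
      have "(\<integral>\<^sup>+y. indicator U x * indicator U y * h (x + t *\<^sub>R (y - x)) \<partial>lborel) \<le>
          (\<integral>\<^sup>+y. indicator U x * h ((x - t *\<^sub>R x) + t *\<^sub>R y) \<partial>lborel)"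
        by (intro nn_integral_mono) (auto simp: indicator_def algebra_simps)
      also have "\<dots> \<le> indicator U x * I"
        using nn_integral_affine_le[of h t "x - t *\<^sub>R x"] True
        by (simp add: nn_integral_cmult I_def mult_left_mono)
      finally show "(\<integral>\<^sup>+y. indicator U x * indicator U y * h (x + t *\<^sub>R (y - x)) \<partial>lborel) \<le> indicator U x * I" .
    qed
    then show ?thesis
      by (simp add: nn_integral_multc)
  next
    case False
    have "K t = (\<integral>\<^sup>+y. \<integral>\<^sup>+x. indicator U x * indicator U y * h (x + t *\<^sub>R (y - x)) \<partial>lborel \<partial>lborel)"
      unfolding K_def by (rule lborel_pair.Fubini') measurable
    also have "\<dots> \<le> (\<integral>\<^sup>+y. indicator U y * I \<partial>lborel)"
    proof (rule nn_integral_mono)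
      fix y
      have "(\<integral>\<^sup>+x. indicator U x * indicator U y * h (x + t *\<^sub>R (y - x)) \<partial>lborel) \<le>
          (\<integral>\<^sup>+x. indicator U y * h (t *\<^sub>R y + (1 - t) *\<^sub>R x) \<partial>lborel)"
        by (intro nn_integral_mono) (auto simp: indicator_def algebra_simps)
      also have "\<dots> \<le> indicator U y * I"
        using nn_integral_affine_le[of h "1 - t" "t *\<^sub>R y"] False
        by (simp add: nn_integral_cmult I_def mult_left_mono)
      finally show "(\<integral>\<^sup>+x. indicator U x * indicator U y * h (x + t *\<^sub>R (y - x)) \<partial>lborel) \<le> indicator U y * I" .
    qed
    finally show ?thesis
      by (simp add: nn_integral_multc)
  qed
  have "(\<integral>\<^sup>+x. \<integral>\<^sup>+y. indicator U x * indicator U y * (\<integral>\<^sup>+t. indicator {0..1::real} t * h (x + t *\<^sub>R (y - x)) \<partial>lborel) \<partial>lborel \<partial>lborel) =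
      (\<integral>\<^sup>+x. \<integral>\<^sup>+y. \<integral>\<^sup>+t. indicator {0..1::real} t * (indicator U x * indicator U y * h (x + t *\<^sub>R (y - x))) \<partial>lborel \<partial>lborel \<partial>lborel)"
    by (intro nn_integral_cong) (simp add: nn_integral_cmult[symmetric] mult.left_commute)
  also have "\<dots> = (\<integral>\<^sup>+x. \<integral>\<^sup>+t. \<integral>\<^sup>+y. indicator {0..1::real} t * (indicator U x * indicator U y * h (x + t *\<^sub>R (y - x))) \<partial>lborel \<partial>lborel \<partial>lborel)"
    by (intro nn_integral_cong lborel_pair.Fubini') measurable
  also have "\<dots> = (\<integral>\<^sup>+t. \<integral>\<^sup>+x. \<integral>\<^sup>+y. indicator {0..1::real} t * (indicator U x * indicator U y * h (x + t *\<^sub>R (y - x))) \<partial>lborel \<partial>lborel \<partial>lborel)"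
    by (rule lborel_pair.Fubini') measurable
  also have "\<dots> = (\<integral>\<^sup>+t. indicator {0..1::real} t * K t \<partial>lborel)"
    unfolding K_def by (intro nn_integral_cong) (simp add: nn_integral_cmult)
  also have "\<dots> \<le> (\<integral>\<^sup>+t. indicator {0..1::real} t * (emeasure lborel U * I) \<partial>lborel)"
    using K by (intro nn_integral_mono) (auto simp: indicator_def)
  also have "\<dots> = emeasure lborel U * I"
    by (simp add: nn_integral_multc)
  finally show ?thesis
    by (simp add: I_def mult_ac)
qed

text \<open>Fatou's lemma in the form that carries estimates for approximations over to their
  limits.\<close>

lemma nn_integral_le_if_liminf:
  fixes F :: "'a \<Rightarrow> ennreal"
  assumes A: "\<And>k::nat. A k \<in> borel_measurable M"
    and le: "AE x in M. F x \<le> liminf (\<lambda>k. A k x)" and C: "\<And>k. (\<integral>\<^sup>+x. A k x \<partial>M) \<le> C"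
  shows "(\<integral>\<^sup>+x. F x \<partial>M) \<le> C"
proof -
  have "(\<integral>\<^sup>+x. F x \<partial>M) \<le> (\<integral>\<^sup>+x. liminf (\<lambda>k. A k x) \<partial>M)"
    using le by (rule nn_integral_mono_AE)
  also have "\<dots> \<le> liminf (\<lambda>k. \<integral>\<^sup>+x. A k x \<partial>M)"
    using A by (rule nn_integral_liminf)
  also have "\<dots> \<le> liminf (\<lambda>k. C)"
    using C by (intro Liminf_mono) simp
  also have "\<dots> = C"
    by (simp add: Liminf_const)
  finally show ?thesis .
qed

lemma le_liminf_if_tendsto:
  fixes X :: "nat \<Rightarrow> ennreal"
  assumes "X \<longlonglongrightarrow> l" "eventually (\<lambda>k. X k \<le> A k) sequentially"
  shows "l \<le> liminf A"
  using lim_imp_Liminf[OF _ assms(1)] Liminf_mono[OF assms(2)] by simp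

lemma nn_integral_conv_nonneg_le:
  fixes S :: "'a::euclidean_space \<Rightarrow> real"
  assumes "0 < \<delta>" "integrable lborel S" "\<And>x. 0 \<le> S x"
  shows "(\<integral>\<^sup>+x. ennreal (conv (mollifier \<delta>) S x) \<partial>lborel) \<le> (\<integral>\<^sup>+x. ennreal (S x) \<partial>lborel)"
  using nn_integral_conv_le[OF assms(1,2)] conv_mollifier_nonneg[OF assms(1), of S, OF assms(3)] assms(3) by simp

lemma conv_mollifier_measurable:
  fixes f :: "'a::euclidean_space \<Rightarrow> 'b::euclidean_space"
  assumes "0 < \<delta>" "integrable lborel f"
  shows "conv (mollifier \<delta>) f \<in> borel_measurable borel"
  by (rule borel_measurable_continuous_onI[OF continuous_conv_mollifier[OF assms]])

text \<open>The double integral involves no mean value and so follows directly from the segment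
  estimate for mollifications. Fatou's lemma is applied twice, first in y for almost every fixed x
  and then in x, since the mollifications converge only almost everywhere in each variable.\<close>

lemma poincare_double:
  fixes f :: "'a::euclidean_space \<Rightarrow> 'b::euclidean_space"
  assumes U: "open U" "convex U" and d: "\<And>x y. x \<in> U \<Longrightarrow> y \<in> U \<Longrightarrow> norm (x - y) \<le> d"
    and wp: "\<And>i. i \<in> Basis \<Longrightarrow> weak_pd U i f (g i)" and q: "q \<ge> 1"
  defines "S \<equiv> \<lambda>x. (\<Sum>i\<in>Basis. norm (g i x)) powr q"
  assumes int_S: "integrable lborel S"
  shows "(\<integral>\<^sup>+x. \<integral>\<^sup>+y. indicator U x * indicator U y * ennreal (norm (f x - f y) powr q) \<partial>lborel \<partial>lborel) \<le>
    ennreal (d powr q) * (2 ^ DIM('a) * emeasure lborel U * (\<integral>\<^sup>+x. ennreal (S x) \<partial>lborel))"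
proof -
  obtain b :: 'a where "b \<in> Basis" using nonempty_Basis by blast
  then have int_f: "integrable lborel f"
    using weak_pdD(1)[OF wp] by blast
  obtain \<delta> where \<delta>: "\<And>n. 0 < \<delta> n" "\<delta> \<longlonglongrightarrow> 0"
    and lim: "AE x in lborel. (\<lambda>n. conv (mollifier (\<delta> n)) f x) \<longlonglongrightarrow> f x"
    by (rule conv_mollifier_AE[OF int_f int_f]) (rule that; assumption)
  have [measurable]: "U \<in> sets borel" using U by simp
  have S_nn: "0 \<le> S x" for x by (simp add: S_def)
  define s where "s n x = ennreal (conv (mollifier (\<delta> n)) S x)" for n x
  have [measurable]: "s n \<in> borel_measurable borel" for n
    unfolding s_def using conv_mollifier_measurable[OF \<delta>(1) int_S] by measurable
  \<comment> \<open>The segment runs from y to x; after exchanging the integrals,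
    \<open>nn_integral_segments_le\<close> applies with the roles of x and y interchanged.\<close>
  define A where "A n x y = indicator U x * indicator U y * (ennreal (d powr q) *
    (\<integral>\<^sup>+t. indicator {0..1::real} t * s n (y + t *\<^sub>R (x - y)) \<partial>lborel))" for n x y
  have [measurable]: "(\<lambda>(x, y). A n x y) \<in> borel_measurable (borel \<Otimes>\<^sub>M borel)" for n
    unfolding A_def by measurable
  have AA: "(\<integral>\<^sup>+x. \<integral>\<^sup>+y. A n x y \<partial>lborel \<partial>lborel) \<le> ennreal (d powr q) * (2 ^ DIM('a) * emeasure lborel U * (\<integral>\<^sup>+x. ennreal (S x) \<partial>lborel))" for n
  proof -
    have "(\<integral>\<^sup>+x. \<integral>\<^sup>+y. A n x y \<partial>lborel \<partial>lborel) = (\<integral>\<^sup>+y. \<integral>\<^sup>+x. A n x y \<partial>lborel \<partial>lborel)"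
      by (rule lborel_pair.Fubini') measurable
    also have "\<dots> = ennreal (d powr q) * (\<integral>\<^sup>+y. \<integral>\<^sup>+x. indicator U y * indicator U x *
        (\<integral>\<^sup>+t. indicator {0..1::real} t * s n (y + t *\<^sub>R (x - y)) \<partial>lborel) \<partial>lborel \<partial>lborel)"
      unfolding A_def by (simp add: nn_integral_cmult[symmetric] mult_ac)
    also have "\<dots> \<le> ennreal (d powr q) * (2 ^ DIM('a) * emeasure lborel U * (\<integral>\<^sup>+x. s n x \<partial>lborel))"
      by (intro mult_left_mono nn_integral_segments_le) measurable
    also have "\<dots> \<le> ennreal (d powr q) * (2 ^ DIM('a) * emeasure lborel U * (\<integral>\<^sup>+x. ennreal (S x) \<partial>lborel))"
      unfolding s_def by (intro mult_left_mono nn_integral_conv_nonneg_le \<delta> int_S S_nn) simp_all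
    finally show ?thesis .
  qed
  have pw: "indicator U x * indicator U y * ennreal (norm (f x - f y) powr q) \<le> liminf (\<lambda>n. A n x y)"
    if x: "(\<lambda>n. conv (mollifier (\<delta> n)) f x) \<longlonglongrightarrow> f x" and y: "(\<lambda>n. conv (mollifier (\<delta> n)) f y) \<longlonglongrightarrow> f y" for x y
  proof (cases "x \<in> U \<and> y \<in> U")
    case True
    have "(\<lambda>n. ennreal (norm (conv (mollifier (\<delta> n)) f x - conv (mollifier (\<delta> n)) f y) powr q)) \<longlonglongrightarrow> ennreal (norm (f x - f y) powr q)"
      using q by (intro tendsto_ennrealI tendsto_powr2 tendsto_norm tendsto_diff x y tendsto_const) auto
    moreover have "eventually (\<lambda>n. ennreal (norm (conv (mollifier (\<delta> n)) f x - conv (mollifier (\<delta> n)) f y) powr q) \<le> A n x y) sequentially"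
      using eventually_cball_subset[OF U(1) conjunct1[OF True] \<delta>(2)] eventually_cball_subset[OF U(1) conjunct2[OF True] \<delta>(2)]
    proof eventually_elim
      case (elim n)
      have "ennreal (norm (conv (mollifier (\<delta> n)) f x - conv (mollifier (\<delta> n)) f y) powr q) \<le>
          ennreal (norm (x - y) powr q) * (\<integral>\<^sup>+t. indicator {0..1} t * s n (y + t *\<^sub>R (x - y)) \<partial>lborel)"
        unfolding s_def S_def
        by (rule conv_diff_powr_le_segment[OF wp \<delta>(1) U(2) elim(2,1) q int_S[unfolded S_def]])
      also have "\<dots> \<le> ennreal (d powr q) * (\<integral>\<^sup>+t. indicator {0..1} t * s n (y + t *\<^sub>R (x - y)) \<partial>lborel)"
        using d[of x y] True q by (intro mult_right_mono ennreal_leI powr_mono2) auto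
      finally show ?case
        using True by (simp add: A_def)
    qed
    ultimately have "ennreal (norm (f x - f y) powr q) \<le> liminf (\<lambda>n. A n x y)"
      by (rule le_liminf_if_tendsto)
    then show ?thesis
      using True by simp
  qed (auto simp: indicator_def)
  show ?thesis
  proof (rule nn_integral_le_if_liminf[where A = "\<lambda>n x. \<integral>\<^sup>+y. A n x y \<partial>lborel"])
    show "AE x in lborel. (\<integral>\<^sup>+y. indicator U x * indicator U y * ennreal (norm (f x - f y) powr q) \<partial>lborel)
        \<le> liminf (\<lambda>n. \<integral>\<^sup>+y. A n x y \<partial>lborel)"
      using lim
    proof eventually_elim
      case x: (elim x)
      have "(\<integral>\<^sup>+y. indicator U x * indicator U y * ennreal (norm (f x - f y) powr q) \<partial>lborel) \<le>
          (\<integral>\<^sup>+y. liminf (\<lambda>n. A n x y) \<partial>lborel)"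
      proof (rule nn_integral_mono_AE)
        show "AE y in lborel. indicator U x * indicator U y * ennreal (norm (f x - f y) powr q) \<le> liminf (\<lambda>n. A n x y)"
          using lim by eventually_elim (rule pw[OF x])
      qed
      also have "\<dots> \<le> liminf (\<lambda>n. \<integral>\<^sup>+y. A n x y \<partial>lborel)"
        by (rule nn_integral_liminf) measurable
      finally show ?case .
    qed
  qed (use AA in measurable)
qed

text \<open>The counterpart for bounded gradients: the bound M survives averaging by the kernel and
  along segments. It will show that the limit deformation is bounded.\<close>

lemma poincare_sup:
  fixes f :: "'a::euclidean_space \<Rightarrow> 'b::euclidean_space"
  assumes U: "open U" "convex U" and d: "\<And>x y. x \<in> U \<Longrightarrow> y \<in> U \<Longrightarrow> norm (x - y) \<le> d"
    and wp: "\<And>i. i \<in> Basis \<Longrightarrow> weak_pd U i f (g i)"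
    and M: "AE x in lborel. (\<Sum>i\<in>Basis. norm (g i x)) \<le> M" "0 \<le> M"
  shows "AE x in lborel. AE y in lborel. x \<in> U \<longrightarrow> y \<in> U \<longrightarrow> norm (f x - f y) \<le> d * M"
proof -
  obtain b :: 'a where "b \<in> Basis" using nonempty_Basis by blast
  then have int_f: "integrable lborel f"
    using weak_pdD(1)[OF wp] by blast
  obtain \<delta> where \<delta>: "\<And>n. 0 < \<delta> n" "\<delta> \<longlonglongrightarrow> 0"
    and lim: "AE x in lborel. (\<lambda>n. conv (mollifier (\<delta> n)) f x) \<longlonglongrightarrow> f x"
    by (rule conv_mollifier_AE[OF int_f int_f]) (rule that; assumption)
  define s where "s x = (\<Sum>i\<in>Basis. norm (g i x))" for x
  have int_s: "integrable lborel s"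
    unfolding s_def using weak_pdD(2)[OF wp] by (intro Bochner_Integration.integrable_sum integrable_norm)
  have s_nn: "0 \<le> s x" for x
    unfolding s_def by (intro sum_nonneg) simp
  have conv_le: "conv (mollifier (\<delta> n)) s z \<le> M" for n z
  proof -
    have "conv (mollifier (\<delta> n)) s z \<le> (\<integral>y. mollifier (\<delta> n) (z - y) * M \<partial>lborel)"
      unfolding conv_def
    proof (rule integral_mono_AE)
      show "AE y in lborel. mollifier (\<delta> n) (z - y) *\<^sub>R s y \<le> mollifier (\<delta> n) (z - y) * M"
        using M(1) unfolding s_def[symmetric]
        by eventually_elim (auto intro!: mult_left_mono mollifier_nonneg \<delta>)
    qed (use mollifier_integrand_integrable[OF \<delta>(1) int_s] mollifier_kernel(1)[OF \<delta>(1), where 'a='a] in simp_all)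
    also have "\<dots> = M"
      using mollifier_kernel[OF \<delta>(1), where 'a='a] by simp
    finally show ?thesis .
  qed
  have pw: "norm (f x - f y) \<le> d * M"
    if x: "(\<lambda>n. conv (mollifier (\<delta> n)) f x) \<longlonglongrightarrow> f x" and y: "(\<lambda>n. conv (mollifier (\<delta> n)) f y) \<longlonglongrightarrow> f y"
      and xU: "x \<in> U" and yU: "y \<in> U" for x y
  proof (rule tendsto_upperbound)
    show "(\<lambda>n. norm (conv (mollifier (\<delta> n)) f x - conv (mollifier (\<delta> n)) f y)) \<longlonglongrightarrow> norm (f x - f y)"
      by (intro tendsto_norm tendsto_diff x y)
    show "eventually (\<lambda>n. norm (conv (mollifier (\<delta> n)) f x - conv (mollifier (\<delta> n)) f y) \<le> d * M) sequentially"
      using eventually_cball_subset[OF U(1) xU \<delta>(2)] eventually_cball_subset[OF U(1) yU \<delta>(2)]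
    proof eventually_elim
      case (elim n)
      have "norm (conv (mollifier (\<delta> n)) f x - conv (mollifier (\<delta> n)) f y) \<le>
          norm (x - y) * (\<integral>t. indicator {0..1} t * conv (mollifier (\<delta> n)) s (y + t *\<^sub>R (x - y)) \<partial>lborel)"
        unfolding s_def by (rule conv_diff_le_segment[OF wp \<delta>(1) U(2) elim(2,1)])
      also have "\<dots> \<le> d * M"
      proof (rule mult_mono)
        have "(\<integral>t. indicator {0..1} t * conv (mollifier (\<delta> n)) s (y + t *\<^sub>R (x - y)) \<partial>lborel) \<le> (\<integral>t. indicator {0..1::real} t * M \<partial>lborel)"
        proof (rule integral_mono)
          show "integrable lborel (\<lambda>t. indicator {0..1} t * conv (mollifier (\<delta> n)) s (y + t *\<^sub>R (x - y)))"
            by (rule integrable_indicator_segment[OF continuous_conv_mollifier[OF \<delta>(1) int_s]])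
          show "indicator {0..1} t * conv (mollifier (\<delta> n)) s (y + t *\<^sub>R (x - y)) \<le> indicator {0..1::real} t * M" for t
            using conv_le by (auto simp: indicator_def)
        qed simp
        then show "(\<integral>t. indicator {0..1} t * conv (mollifier (\<delta> n)) s (y + t *\<^sub>R (x - y)) \<partial>lborel) \<le> M"
          by simp
        show "0 \<le> (\<integral>t. indicator {0..1} t * conv (mollifier (\<delta> n)) s (y + t *\<^sub>R (x - y)) \<partial>lborel)"
          using conv_mollifier_nonneg[OF \<delta>(1), of s, OF s_nn] by (intro integral_nonneg_AE) auto
        show "0 \<le> d"
          using d[OF xU xU] by simp
      qed (use d[OF xU yU] in simp)
      finally show ?case .
    qed
  qed simp
  show ?thesis
    using lim
  proof eventually_elim
    case x: (elim x)
    show ?case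
      using lim by eventually_elim (use pw[OF x] in blast)
  qed
qed

lemma AE_lborel_translate:
  assumes "AE x in lborel. P (x::'a::euclidean_space)"
  shows "AE x in lborel. P (x + z)"
proof (rule AE_distrD[of "\<lambda>x. x + z" lborel borel])
  show "AE x in distr lborel borel (\<lambda>x. x + z). P x"
    unfolding lborel_distr_translate by (rule assms)
qed simp

text \<open>All segments from x to x + z are translates of one another, so integrating over x first
  gives the full gradient norm for every t, without the loss of a Jacobian. The two indicators keep
  both end points, and hence by convexity the segment, in U.\<close>

lemma translation_estimate:
  fixes f :: "'a::euclidean_space \<Rightarrow> 'b::euclidean_space"
  assumes U: "open U" "convex U" and wp: "\<And>i. i \<in> Basis \<Longrightarrow> weak_pd U i f (g i)"
  shows "(\<integral>\<^sup>+x. indicator U x * indicator U (x + z) * ennreal (norm (f (x + z) - f x)) \<partial>lborel) \<le>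
    ennreal (norm z) * (\<integral>\<^sup>+x. ennreal (\<Sum>i\<in>Basis. norm (g i x)) \<partial>lborel)"
proof -
  obtain b :: 'a where "b \<in> Basis" using nonempty_Basis by blast
  then have int_f: "integrable lborel f"
    using weak_pdD(1)[OF wp] by blast
  obtain \<delta> where \<delta>: "\<And>n. 0 < \<delta> n" "\<delta> \<longlonglongrightarrow> 0"
    and lim: "AE x in lborel. (\<lambda>n. conv (mollifier (\<delta> n)) f x) \<longlonglongrightarrow> f x"
    by (rule conv_mollifier_AE[OF int_f int_f]) (rule that; assumption)
  define S where "S x = (\<Sum>i\<in>Basis. norm (g i x))" for x
  have S_nn: "0 \<le> S x" for x
    unfolding S_def by (intro sum_nonneg) simp
  have S_eq: "(\<lambda>x. (\<Sum>i\<in>Basis. norm (g i x)) powr 1) = S"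
    by (simp add: S_def sum_nonneg fun_eq_iff)
  have int_S: "integrable lborel S"
    unfolding S_def using weak_pdD(2)[OF wp] by (intro Bochner_Integration.integrable_sum integrable_norm)
  have [measurable]: "U \<in> sets borel" using U by simp
  define s where "s n x = ennreal (conv (mollifier (\<delta> n)) S x)" for n x
  have [measurable]: "s n \<in> borel_measurable borel" for n
    unfolding s_def using conv_mollifier_measurable[OF \<delta>(1) int_S] by measurable
  define A where "A n x = ennreal (norm z) * (\<integral>\<^sup>+t. indicator {0..1::real} t * s n (x + t *\<^sub>R z) \<partial>lborel)" for n x
  have AA: "(\<integral>\<^sup>+x. A n x \<partial>lborel) \<le> ennreal (norm z) * (\<integral>\<^sup>+x. ennreal (S x) \<partial>lborel)" for n
  proof -
    have "(\<integral>\<^sup>+x. A n x \<partial>lborel) = ennreal (norm z) * (\<integral>\<^sup>+x. \<integral>\<^sup>+t. indicator {0..1::real} t * s n (x + t *\<^sub>R z) \<partial>lborel \<partial>lborel)"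
      unfolding A_def by (rule nn_integral_cmult) measurable
    also have "(\<integral>\<^sup>+x. \<integral>\<^sup>+t. indicator {0..1::real} t * s n (x + t *\<^sub>R z) \<partial>lborel \<partial>lborel) =
        (\<integral>\<^sup>+t. \<integral>\<^sup>+x. indicator {0..1::real} t * s n (x + t *\<^sub>R z) \<partial>lborel \<partial>lborel)"
      by (rule lborel_pair.Fubini') measurable
    also have "\<dots> = (\<integral>\<^sup>+t. indicator {0..1::real} t * (\<integral>\<^sup>+x. s n x \<partial>lborel) \<partial>lborel)"
    proof (rule nn_integral_cong)
      fix t :: real
      show "(\<integral>\<^sup>+x. indicator {0..1} t * s n (x + t *\<^sub>R z) \<partial>lborel) = indicator {0..1} t * (\<integral>\<^sup>+x. s n x \<partial>lborel)"
        using nn_integral_lborel_translate[of "s n" "t *\<^sub>R z"] by (simp add: nn_integral_cmult)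
    qed
    also have "\<dots> = (\<integral>\<^sup>+x. s n x \<partial>lborel)"
      by (simp add: nn_integral_multc)
    also have "\<dots> \<le> (\<integral>\<^sup>+x. ennreal (S x) \<partial>lborel)"
      unfolding s_def by (intro nn_integral_conv_nonneg_le \<delta> int_S S_nn)
    finally show ?thesis
      by (simp add: mult_left_mono)
  qed
  show ?thesis
    unfolding S_def[symmetric]
  proof (rule nn_integral_le_if_liminf[where A = A])
    show "AE x in lborel. indicator U x * indicator U (x + z) * ennreal (norm (f (x + z) - f x)) \<le> liminf (\<lambda>k. A k x)"
      using lim AE_lborel_translate[OF lim, of z]
    proof eventually_elim
      case x: (elim x)
      show ?case
      proof (cases "x \<in> U \<and> x + z \<in> U")
        case True
        have "(\<lambda>n. ennreal (norm (conv (mollifier (\<delta> n)) f (x + z) - conv (mollifier (\<delta> n)) f x))) \<longlonglongrightarrow> ennreal (norm (f (x + z) - f x))"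
          by (intro tendsto_ennrealI tendsto_norm tendsto_diff x)
        moreover have "eventually (\<lambda>n. ennreal (norm (conv (mollifier (\<delta> n)) f (x + z) - conv (mollifier (\<delta> n)) f x)) \<le> A n x) sequentially"
          using eventually_cball_subset[OF U(1) conjunct1[OF True] \<delta>(2)] eventually_cball_subset[OF U(1) conjunct2[OF True] \<delta>(2)]
        proof eventually_elim
          case (elim n)
          have "ennreal (norm (conv (mollifier (\<delta> n)) f (x + z) - conv (mollifier (\<delta> n)) f x) powr 1) \<le>
            ennreal (norm (x + z - x) powr 1) * (\<integral>\<^sup>+t. indicator {0..1} t * ennreal (conv (mollifier (\<delta> n)) S (x + t *\<^sub>R (x + z - x))) \<partial>lborel)"
            using conv_diff_powr_le_segment[where q = 1 and g = g, OF wp \<delta>(1) U(2) elim, unfolded S_eq] int_S by simp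
          then show ?case
            by (simp add: A_def s_def)
        qed
        ultimately have "ennreal (norm (f (x + z) - f x)) \<le> liminf (\<lambda>n. A n x)"
          by (rule le_liminf_if_tendsto)
        then show ?thesis
          using True by simp
      qed (auto simp: indicator_def)
    qed
    show "A n \<in> borel_measurable lborel" for n
      unfolding A_def by measurable
  qed (rule AA)
qed

section \<open>Compactness in the mean\<close>

text \<open>The compact ball around x has a neighbourhood of some width e in U, and moving the
  centre by less than e stays inside it. Openness makes this eroded set measurable.\<close>

lemma open_cball_subset:
  fixes U :: "'a::euclidean_space set"
  assumes "open U"
  shows "open {x. cball x \<delta> \<subseteq> U}"
  unfolding open_contains_ball
proof (intro ballI)
  fix x assume "x \<in> {x. cball x \<delta> \<subseteq> U}"
  then obtain e where e: "e > 0" "(\<Union>y\<in>cball x \<delta>. cball y e) \<subseteq> U"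
    using compact_subset_open_imp_cball_epsilon_subset[OF compact_cball assms, of x \<delta>] by auto
  have "cball x' \<delta> \<subseteq> U" if "x' \<in> ball x e" for x'
  proof
    fix y assume "y \<in> cball x' \<delta>"
    then have "y - x' + x \<in> cball x \<delta>" "y \<in> cball (y - x' + x) e"
      using that by (auto simp: dist_norm norm_minus_commute)
    with e(2) show "y \<in> U" by blast
  qed
  then have "ball x e \<subseteq> {x. cball x \<delta> \<subseteq> U}"
    by blast
  with e(1) show "\<exists>e>0. ball x e \<subseteq> {x. cball x \<delta> \<subseteq> U}"
    by blast
qed

text \<open>The translation estimate is averaged over shifts shorter than \<delta>; for x in the
  eroded set both x and x - z lie in U. The rate \<delta> depends on f only through the L1 norm of
  its gradient, hence is uniform along bounded sequences.\<close>

lemma mollification_error: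
  fixes f :: "'a::euclidean_space \<Rightarrow> 'b::euclidean_space"
  assumes U: "open U" "convex U" and wp: "\<And>i. i \<in> Basis \<Longrightarrow> weak_pd U i f (g i)" and \<delta>: "0 < \<delta>"
  shows "(\<integral>\<^sup>+x. indicator {x. cball x \<delta> \<subseteq> U} x * ennreal (norm (conv (mollifier \<delta>) f x - f x)) \<partial>lborel) \<le>
    ennreal \<delta> * (\<integral>\<^sup>+x. ennreal (\<Sum>i\<in>Basis. norm (g i x)) \<partial>lborel)"
proof -
  obtain b :: 'a where "b \<in> Basis" using nonempty_Basis by blast
  then have int_f: "integrable lborel f"
    using weak_pdD(1)[OF wp] by blast
  let ?V = "{x. cball x \<delta> \<subseteq> U}" and ?I = "\<integral>\<^sup>+x. ennreal (\<Sum>i\<in>Basis. norm (g i x)) \<partial>lborel"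
  define \<rho> where "\<rho> = (mollifier \<delta> :: 'a \<Rightarrow> real)"
  have \<rho>_m [measurable]: "\<rho> \<in> borel_measurable borel"
    unfolding \<rho>_def by (rule Ck_compact_measurable[OF mollifier_Ck_compact[OF \<delta>]])
  have f_m [measurable]: "f \<in> borel_measurable borel"
    by (rule integrable_lborel_borel[OF int_f])
  have [measurable]: "?V \<in> sets borel" "U \<in> sets borel"
    using open_cball_subset[OF U(1)] U(1) by (simp_all add: borel_open)
  have "(\<integral>\<^sup>+x. indicator ?V x * ennreal (norm (conv (mollifier \<delta>) f x - f x)) \<partial>lborel) \<le>
      (\<integral>\<^sup>+x. \<integral>\<^sup>+z. indicator ?V x * (ennreal (\<rho> z) * ennreal (norm (f (x - z) - f x))) \<partial>lborel \<partial>lborel)"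
  proof (rule nn_integral_mono)
    fix x
    have "indicator ?V x * ennreal (norm (conv (mollifier \<delta>) f x - f x)) \<le>
      indicator ?V x * (\<integral>\<^sup>+z. ennreal (\<rho> z) * ennreal (norm (f (x - z) - f x)) \<partial>lborel)"
      unfolding \<rho>_def by (intro mult_left_mono norm_conv_mollifier_diff_le \<delta> int_f) simp
    also have "\<dots> = (\<integral>\<^sup>+z. indicator ?V x * (ennreal (\<rho> z) * ennreal (norm (f (x - z) - f x))) \<partial>lborel)"
      by (rule nn_integral_cmult[symmetric]) measurable
    finally show "indicator ?V x * ennreal (norm (conv (mollifier \<delta>) f x - f x)) \<le> \<dots>" .
  qed
  also have "\<dots> = (\<integral>\<^sup>+z. \<integral>\<^sup>+x. indicator ?V x * (ennreal (\<rho> z) * ennreal (norm (f (x - z) - f x))) \<partial>lborel \<partial>lborel)"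
    by (rule lborel_pair.Fubini') measurable
  also have "\<dots> \<le> (\<integral>\<^sup>+z. ennreal (\<rho> z) * (ennreal \<delta> * ?I) \<partial>lborel)"
  proof (rule nn_integral_mono)
    fix z
    show "(\<integral>\<^sup>+x. indicator ?V x * (ennreal (\<rho> z) * ennreal (norm (f (x - z) - f x))) \<partial>lborel) \<le> ennreal (\<rho> z) * (ennreal \<delta> * ?I)"
    proof (cases "norm z < \<delta>")
      case True
      have "(\<integral>\<^sup>+x. indicator ?V x * (ennreal (\<rho> z) * ennreal (norm (f (x - z) - f x))) \<partial>lborel) \<le>
        (\<integral>\<^sup>+x. ennreal (\<rho> z) * (indicator U x * indicator U (x + - z) * ennreal (norm (f (x + - z) - f x))) \<partial>lborel)"
      proof (rule nn_integral_mono)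
        fix x
        have "x \<in> U \<and> x - z \<in> U" if "x \<in> ?V"
          using that True \<delta> by (auto simp: subset_iff dist_norm)
        then show "indicator ?V x * (ennreal (\<rho> z) * ennreal (norm (f (x - z) - f x))) \<le>
            ennreal (\<rho> z) * (indicator U x * indicator U (x + - z) * ennreal (norm (f (x + - z) - f x)))"
          by (simp add: indicator_def)
      qed
      also have "\<dots> = ennreal (\<rho> z) * (\<integral>\<^sup>+x. indicator U x * indicator U (x + - z) * ennreal (norm (f (x + - z) - f x)) \<partial>lborel)"
        by (rule nn_integral_cmult) measurable
      also have "\<dots> \<le> ennreal (\<rho> z) * (ennreal (norm (- z)) * ?I)"
        by (intro mult_left_mono translation_estimate[OF U wp]) simp_all
      also have "\<dots> \<le> ennreal (\<rho> z) * (ennreal \<delta> * ?I)"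
        using True by (intro mult_left_mono mult_right_mono ennreal_leI) simp_all
      finally show ?thesis .
    next
      case False
      then have "\<rho> z = 0"
        unfolding \<rho>_def by (intro mollifier_eq_0[OF \<delta>]) simp
      then show ?thesis by simp
    qed
  qed
  also have "\<dots> = ennreal \<delta> * ?I"
    using nn_integral_mollifier[OF \<delta>, where 'a='a] by (simp add: nn_integral_multc \<rho>_def[symmetric])
  finally show ?thesis .
qed

text \<open>Along a fast subsequence, consecutive differences have integrals below 2^(-k). Their sum
  is then finite almost everywhere, and a telescoping series converges absolutely.\<close>

lemma L1_Cauchy_AE_subseq:
  fixes f :: "nat \<Rightarrow> 'a \<Rightarrow> 'b::{banach, second_countable_topology}"
  assumes f: "\<And>n. integrable M (f n)"
    and Cauchy: "\<And>e. e > 0 \<Longrightarrow> \<exists>N. \<forall>m\<ge>N. \<forall>n\<ge>N. (\<integral>x. norm (f m x - f n x) \<partial>M) < e"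
  obtains r :: "nat \<Rightarrow> nat" where "strict_mono r" "AE x in M. convergent (\<lambda>n. f (r n) x)"
proof -
  have "\<forall>k. \<exists>N. \<forall>m\<ge>N. \<forall>n\<ge>N. (\<integral>x. norm (f m x - f n x) \<partial>M) < (1/2)^k"
    using Cauchy by simp
  then obtain N where N: "\<And>k m n. m \<ge> N k \<Longrightarrow> n \<ge> N k \<Longrightarrow> (\<integral>x. norm (f m x - f n x) \<partial>M) < (1/2)^k"
    by metis
  \<comment> \<open>Summing all thresholds up to k keeps r k above N k; the summand k makes the
    sequence strictly increasing.\<close>
  define r where "r k = (\<Sum>j\<le>k. N j) + k" for k
  have r: "strict_mono r"
    unfolding strict_mono_Suc_iff r_def by simp
  have rN: "N k \<le> r k" for k
    unfolding r_def using member_le_sum[of k "{..k}" N] by simp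
  define g where "g k x = norm (f (r (Suc k)) x - f (r k) x)" for k x
  have int_g: "integrable M (g k)" for k
    unfolding g_def using f by simp
  have "(\<integral>\<^sup>+x. (\<Sum>k. ennreal (g k x)) \<partial>M) = (\<Sum>k. \<integral>\<^sup>+x. ennreal (g k x) \<partial>M)"
    using borel_measurable_integrable[OF int_g] by (intro nn_integral_suminf) simp
  also have "\<dots> \<le> (\<Sum>k. ennreal ((1/2)^k))"
  proof (intro suminf_le summableI)
    fix k
    have "(\<integral>x. g k x \<partial>M) \<le> (1/2)^k"
      unfolding g_def using N[OF order_trans[OF rN strict_mono_leD[OF r le_SucI[OF order_refl]]] rN] by (rule less_imp_le)
    then show "(\<integral>\<^sup>+x. ennreal (g k x) \<partial>M) \<le> ennreal ((1/2)^k)"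
      by (subst nn_integral_eq_integral[OF int_g]) (auto simp: g_def[abs_def] intro: ennreal_leI)
  qed
  also have "\<dots> = ennreal (\<Sum>k. (1/2)^k)"
    by (intro suminf_ennreal2) auto
  also have "\<dots> < \<infinity>" by simp
  finally have fin: "(\<integral>\<^sup>+x. (\<Sum>k. ennreal (g k x)) \<partial>M) \<noteq> \<infinity>"
    by simp
  have "AE x in M. (\<Sum>k. ennreal (g k x)) \<noteq> \<infinity>"
    using borel_measurable_integrable[OF int_g] by (intro nn_integral_noteq_infinite fin) measurable
  then have "AE x in M. convergent (\<lambda>n. f (r n) x)"
  proof eventually_elim
    case (elim x)
    have "summable (\<lambda>k. g k x)"
      using elim by (intro summable_suminf_not_top) (auto simp: g_def)
    then have "summable (\<lambda>k. f (r (Suc k)) x - f (r k) x)"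
      unfolding g_def by (rule summable_norm_cancel)
    then have "convergent (\<lambda>n. \<Sum>k<n. f (r (Suc k)) x - f (r k) x)"
      by (simp add: summable_iff_convergent)
    then have "convergent (\<lambda>n. f (r n) x - f (r 0) x)"
      by (simp add: sum_lessThan_telescope[of "\<lambda>n. f (r n) x"])
    from convergent_add[OF this convergent_const[of "f (r 0) x"]] show ?case by simp
  qed
  with r show ?thesis by (rule that)
qed

text \<open>The common Lipschitz constant transports the Cauchy property from a nearby point of the
  dense set, in the manner of the Arzela--Ascoli theorem.\<close>

lemma convergent_if_dense_lipschitz:
  fixes a :: "nat \<Rightarrow> 'a::metric_space \<Rightarrow> 'b::banach"
  assumes lip: "\<And>n x y. norm (a n x - a n y) \<le> C * dist x y"
    and dense: "\<And>X. open X \<Longrightarrow> X \<noteq> {} \<Longrightarrow> \<exists>d\<in>D'. d \<in> X"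
    and conv: "\<And>d. d \<in> D' \<Longrightarrow> convergent (\<lambda>n. a n d)"
  shows "convergent (\<lambda>n. a n x)"
proof -
  have "Cauchy (\<lambda>n. a n x)"
    unfolding Cauchy_iff
  proof (intro allI impI)
    fix e :: real assume "e > 0"
    \<comment> \<open>A strictly positive Lipschitz constant, so that a radius can be divided by
      it.\<close>
    define C' where "C' = \<bar>C\<bar> + 1"
    have C': "C' > 0" "C \<le> C'" by (auto simp: C'_def)
    have "ball x (e / (3 * C')) \<noteq> {}"
      using \<open>e > 0\<close> C' by (simp add: not_le)
    then obtain d where d: "d \<in> D'" "d \<in> ball x (e / (3 * C'))"
      using dense[OF open_ball] by blast
    have close: "norm (a n x - a n d) < e / 3" for n
    proof -
      have "norm (a n x - a n d) \<le> C' * dist x d"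
        using lip[of n x d] C' mult_right_mono[of C C' "dist x d"] by simp
      also have "\<dots> < C' * (e / (3 * C'))"
        using d(2) C' by (intro mult_strict_left_mono) auto
      finally show ?thesis using C' by simp
    qed
    from conv[OF d(1)] have "Cauchy (\<lambda>n. a n d)"
      by (rule convergent_Cauchy)
    then obtain N where N: "\<And>m n. m \<ge> N \<Longrightarrow> n \<ge> N \<Longrightarrow> norm (a m d - a n d) < e / 3"
      unfolding Cauchy_iff using \<open>e > 0\<close> by (metis divide_pos_pos zero_less_numeral)
    show "\<exists>N. \<forall>m\<ge>N. \<forall>n\<ge>N. norm (a m x - a n x) < e"
    proof (intro exI[of _ N] allI impI)
      fix m n assume "m \<ge> N" "n \<ge> N"
      have "a m x - a n x = (a m x - a m d) + (a m d - a n d) + - (a n x - a n d)"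
        by simp
      also have "norm \<dots> \<le> norm (a m x - a m d) + norm (a m d - a n d) + norm (- (a n x - a n d))"
        by (intro norm_triangle_le add_right_mono norm_triangle_ineq)
      also have "\<dots> < e / 3 + e / 3 + e / 3"
        unfolding norm_minus_cancel using close N[OF \<open>m \<ge> N\<close> \<open>n \<ge> N\<close>] by (intro add_strict_mono)
      finally show "norm (a m x - a n x) < e" by simp
    qed
  qed
  then show ?thesis
    by (rule Cauchy_convergent)
qed

lemma norm_conv_mollifier_le:
  fixes f :: "'a::euclidean_space \<Rightarrow> 'b::euclidean_space"
  assumes "0 < \<delta>" "integrable lborel f" "\<And>x. norm (f x) \<le> B"
  shows "norm (conv (mollifier \<delta>) f x) \<le> B"
proof -
  have "norm (conv (mollifier \<delta>) f x) \<le> (\<integral>y. norm (mollifier \<delta> (x - y) *\<^sub>R f y) \<partial>lborel)"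
    unfolding conv_def by (rule integral_norm_bound)
  also have "\<dots> \<le> (\<integral>y. mollifier \<delta> (x - y) * B \<partial>lborel)"
  proof (rule integral_mono)
    show "integrable lborel (\<lambda>y. norm (mollifier \<delta> (x - y) *\<^sub>R f y))"
      by (intro integrable_norm mollifier_integrand_integrable assms)
    show "integrable lborel (\<lambda>y. mollifier \<delta> (x - y) * B)"
      by (intro integrable_mult_left mollifier_kernel(1)[OF assms(1)])
    show "norm (mollifier \<delta> (x - y) *\<^sub>R f y) \<le> mollifier \<delta> (x - y) * B" for y
      using mollifier_nonneg[OF assms(1), of "x - y"] assms(3)[of y] by (simp add: mult_left_mono)
  qed
  also have "\<dots> = B"
    using mollifier_kernel[OF assms(1), where 'a='a] by simp
  finally show ?thesis .
qed

text \<open>For a fixed radius the mollifications are equi-Lipschitz, hence converge along a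
  subsequence. The mollification error is uniform in n away from the boundary, and the functions
  differ by at most 2 on the boundary strip, whose measure tends to 0. Together this makes the
  subsequence Cauchy in L1.\<close>

lemma bounded_W11_compact:
  fixes v :: "nat \<Rightarrow> 'a::euclidean_space \<Rightarrow> 'b::euclidean_space"
  assumes U: "open U" "convex U" "emeasure lborel U < \<infinity>"
    and wp: "\<And>n i. i \<in> Basis \<Longrightarrow> weak_pd U i (v n) (g n i)" and v: "\<And>n x. norm (v n x) \<le> 1"
    and M: "\<And>n. (\<integral>\<^sup>+x. ennreal (\<Sum>i\<in>Basis. norm (g n i x)) \<partial>lborel) \<le> ennreal M" "0 \<le> M"
  obtains r :: "nat \<Rightarrow> nat" where "strict_mono r" "AE x in lborel. convergent (\<lambda>n. v (r n) x)"
proof -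
  obtain b :: 'a where "b \<in> Basis" using nonempty_Basis by blast
  then have int_v: "integrable lborel (v n)" for n
    using weak_pdD(1)[OF wp] by blast
  have v_off: "v n x = 0" if "x \<notin> U" for n x
    using weak_pdD(3)[OF wp[OF \<open>b \<in> Basis\<close>] that] .
  have v_m [measurable]: "v n \<in> borel_measurable borel" for n
    by (rule integrable_lborel_borel[OF int_v])
  have U_m [measurable]: "U \<in> sets borel" using U(1) by simp
  have int_U: "integrable lborel (indicator U :: 'a \<Rightarrow> real)"
    using U by auto
  define \<delta> where "\<delta> k = inverse (real (Suc k))" for k
  have \<delta>: "\<delta> \<longlonglongrightarrow> 0" "\<And>k. 0 < \<delta> k"
    unfolding \<delta>_def by (rule LIMSEQ_inverse_real_of_nat) auto
  define a where "a n k x = conv (mollifier (\<delta> k)) (v n) x" for n k x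
  have a_m [measurable]: "a n k \<in> borel_measurable borel" for n k
    unfolding a_def using conv_mollifier_measurable[OF \<delta>(2) int_v] by simp
  have a_le: "norm (a n k x) \<le> 1" for n k x
    unfolding a_def by (rule norm_conv_mollifier_le[OF \<delta>(2) int_v v])
  obtain D' :: "'a set" where D': "countable D'" "\<And>X. open X \<Longrightarrow> X \<noteq> {} \<Longrightarrow> \<exists>d\<in>D'. d \<in> X"
    using countable_dense_exists[where 'a='a] by blast
  \<comment> \<open>One extraction serves all radii and all points of the countable dense set at
    once, so r does not depend on k.\<close>
  obtain r :: "nat \<Rightarrow> nat" where r: "strict_mono r"
    and lim: "\<And>z. z \<in> UNIV \<times> D' \<Longrightarrow> \<exists>l. (\<lambda>n. a (r n) (fst z) (snd z)) \<longlonglongrightarrow> l"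
    using function_convergent_subsequence[of "UNIV \<times> D'" "\<lambda>n z. a n (fst z) (snd z)" 1] D'(1) a_le by auto
  have norm_v: "(\<integral>x. norm (v n x) \<partial>lborel) \<le> measure lborel U" for n
  proof -
    have "(\<integral>x. norm (v n x) \<partial>lborel) \<le> (\<integral>x. indicator U x \<partial>lborel)"
      using v v_off by (intro integral_mono integrable_norm int_v int_U) (auto simp: indicator_def)
    then show ?thesis by simp
  qed
  have conv_a: "convergent (\<lambda>n. a (r n) k x)" for k x
  proof -
    have \<rho>: "mollifier (\<delta> k) \<in> Ck_compact (Suc 0) (UNIV :: 'a set)"
      by (rule mollifier_Ck_compact[OF \<delta>(2)])
    obtain L where L: "L \<ge> 0" "\<And>x y::'a. \<bar>mollifier (\<delta> k) x - mollifier (\<delta> k) y\<bar> \<le> L * norm (x - y)"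
      "\<And>(x::'a) v. \<bar>frechet_derivative (mollifier (\<delta> k)) (at x) v\<bar> \<le> L * norm v"
      by (rule Ck_compact_lipschitz[OF \<rho>]) (rule that; assumption)
    show ?thesis
    proof (rule convergent_if_dense_lipschitz[where D' = D' and C = "L * measure lborel U"])
      fix n and x y :: 'a
      have "norm (a (r n) k x - a (r n) k y) \<le> L * norm (x - y) * (\<integral>y. norm (v (r n) y) \<partial>lborel)"
        unfolding a_def by (rule conv_lipschitz[OF \<rho> L(2) int_v])
      also have "\<dots> \<le> L * norm (x - y) * measure lborel U"
        using L(1) by (intro mult_left_mono norm_v) simp
      finally show "norm (a (r n) k x - a (r n) k y) \<le> L * measure lborel U * dist x y"
        by (simp add: dist_norm mult_ac)
    next
      show "convergent (\<lambda>n. a (r n) k d)" if "d \<in> D'" for d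
        using lim[of "(k, d)"] that by (auto simp: convergent_def)
    qed (rule D'(2))
  qed
  define V where "V k = {x. cball x (\<delta> k) \<subseteq> U}" for k
  have V_m [measurable]: "V k \<in> sets borel" for k
    unfolding V_def using open_cball_subset[OF U(1)] by (simp add: borel_open)
  have V_sub: "V k \<subseteq> U" for k
    unfolding V_def using \<delta>(2)[of k] by (auto simp: subset_iff dist_norm)
  have int_diff: "integrable lborel (\<lambda>x. norm (v m x - v n x))" for m n
    using int_v by simp
  have err: "(\<integral>x. indicator (V k) x * norm (a n k x - v n x) \<partial>lborel) \<le> \<delta> k * M" for n k
  proof -
    have "(\<integral>\<^sup>+x. indicator (V k) x * ennreal (norm (a n k x - v n x)) \<partial>lborel) \<le>
        ennreal (\<delta> k) * (\<integral>\<^sup>+x. ennreal (\<Sum>i\<in>Basis. norm (g n i x)) \<partial>lborel)"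
      unfolding V_def a_def by (rule mollification_error[OF U(1,2) wp \<delta>(2)])
    also have "\<dots> \<le> ennreal (\<delta> k) * ennreal M"
      by (intro mult_left_mono M) simp
    also have "\<dots> = ennreal (\<delta> k * M)"
      using \<delta>(2)[of k] M(2) by (simp add: ennreal_mult)
    finally have "(\<integral>\<^sup>+x. ennreal (indicator (V k) x * norm (a n k x - v n x)) \<partial>lborel) \<le> ennreal (\<delta> k * M)"
      by (simp add: ennreal_mult ennreal_indicator[symmetric] mult.commute)
    then show ?thesis
      using \<delta>(2)[of k] M(2) by (subst integral_eq_nn_integral) (auto intro!: enn2real_leI)
  qed
  have int_aV: "integrable lborel (\<lambda>x. indicator (V k) x * norm (a n k x - v n x))" for n k
  proof (rule Bochner_Integration.integrable_bound)
    show "integrable lborel (\<lambda>x. 2 * indicator U x :: real)"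
      using int_U by simp
    show "AE x in lborel. norm (indicator (V k) x * norm (a n k x - v n x)) \<le> norm (2 * indicator U x :: real)"
    proof (intro always_eventually allI)
      fix x
      have "norm (a n k x - v n x) \<le> 2"
        using a_le[of n k x] v[of n x] norm_triangle_ineq4[of "a n k x" "v n x"] by linarith
      then show "norm (indicator (V k) x * norm (a n k x - v n x)) \<le> norm (2 * indicator U x :: real)"
        using V_sub[of k] by (auto simp: indicator_def)
    qed
  qed measurable
  define c where "c k x = lim (\<lambda>n. a (r n) k x)" for k x
  have c_m [measurable]: "c k \<in> borel_measurable borel" for k
    unfolding c_def by (rule borel_measurable_lim_metric) measurable
  have c_lim: "(\<lambda>n. a (r n) k x) \<longlonglongrightarrow> c k x" for k x
    unfolding c_def using conv_a by (simp add: convergent_LIMSEQ_iff)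
  have c_le: "norm (c k x) \<le> 1" for k x
    by (rule tendsto_upperbound[OF tendsto_norm[OF c_lim]]) (use a_le in auto)
  have int_ac: "integrable lborel (\<lambda>x. indicator U x * norm (a n k x - c k x))" for n k
  proof (rule Bochner_Integration.integrable_bound)
    show "integrable lborel (\<lambda>x. 2 * indicator U x :: real)"
      using int_U by simp
    show "AE x in lborel. norm (indicator U x * norm (a n k x - c k x)) \<le> norm (2 * indicator U x :: real)"
    proof (intro always_eventually allI)
      fix x
      have "norm (a n k x - c k x) \<le> 2"
        using a_le[of n k x] c_le[of k x] norm_triangle_ineq4[of "a n k x" "c k x"] by linarith
      then show "norm (indicator U x * norm (a n k x - c k x)) \<le> norm (2 * indicator U x :: real)"
        by (auto simp: indicator_def)
    qed
  qed measurable
  have lim_ac: "(\<lambda>n. \<integral>x. indicator U x * norm (a (r n) k x - c k x) \<partial>lborel) \<longlonglongrightarrow> integral\<^sup>L lborel (\<lambda>x::'a. 0)" for k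
  proof (rule integral_dominated_convergence[where w = "\<lambda>x. 2 * indicator U x"])
    show "AE x in lborel. (\<lambda>n. indicator U x * norm (a (r n) k x - c k x)) \<longlonglongrightarrow> 0"
      using c_lim by (intro always_eventually allI tendsto_mult_right_zero tendsto_norm_zero) (simp add: LIM_zero)
    show "AE x in lborel. norm (indicator U x * norm (a (r n) k x - c k x)) \<le> 2 * indicator U x" for n
    proof (intro always_eventually allI)
      fix x
      have "norm (a (r n) k x - c k x) \<le> 2"
        using a_le[of "r n" k x] c_le[of k x] norm_triangle_ineq4[of "a (r n) k x" "c k x"] by linarith
      then show "norm (indicator U x * norm (a (r n) k x - c k x)) \<le> 2 * indicator U x"
        by (auto simp: indicator_def)
    qed
    show "integrable lborel (\<lambda>x. 2 * indicator U x :: real)"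
      using int_U by simp
  qed measurable
  have int_UV: "integrable lborel (indicator (U - V k) :: 'a \<Rightarrow> real)" for k
    by (rule Bochner_Integration.integrable_bound[OF int_U]) (auto simp: indicator_def)
  have lim_UV: "(\<lambda>k. \<integral>x. indicator (U - V k) x \<partial>lborel) \<longlonglongrightarrow> integral\<^sup>L lborel (\<lambda>x::'a. 0::real)"
  proof (rule integral_dominated_convergence[where w = "indicator U"])
    show "AE x in lborel. (\<lambda>k. indicator (U - V k) x :: real) \<longlonglongrightarrow> 0"
    proof (intro always_eventually allI)
      fix x
      show "(\<lambda>k. indicator (U - V k) x :: real) \<longlonglongrightarrow> 0"
      proof (cases "x \<in> U")
        case True
        have "eventually (\<lambda>k. indicator (U - V k) x = (0::real)) sequentially"
          using eventually_cball_subset[OF U(1) True \<delta>(1)] by eventually_elim (simp add: V_def)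
        then show ?thesis by (rule tendsto_eventually)
      qed simp
    qed
  qed (use int_U in \<open>auto simp: indicator_def\<close>)
  \<comment> \<open>The radius k is fixed before N. The strip counts twice, and two mollification
    errors and two distances to the limit c k follow: six contributions below e / 8.\<close>
  have "\<exists>N. \<forall>m\<ge>N. \<forall>n\<ge>N. (\<integral>x. norm (v (r m) x - v (r n) x) \<partial>lborel) < e" if "e > 0" for e
  proof -
    have "eventually (\<lambda>k. (\<integral>x. indicator (U - V k) x \<partial>lborel) < e / 8) sequentially"
      using \<open>e > 0\<close> by (intro order_tendstoD(2)[OF lim_UV]) simp
    moreover have "(\<lambda>k. \<delta> k * M) \<longlonglongrightarrow> 0"
      using tendsto_mult_left_zero[OF \<delta>(1)] .
    then have "eventually (\<lambda>k. \<delta> k * M < e / 8) sequentially"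
      by (rule order_tendstoD(2)) (use \<open>e > 0\<close> in simp)
    ultimately have "eventually (\<lambda>k. (\<integral>x. indicator (U - V k) x \<partial>lborel) < e / 8 \<and> \<delta> k * M < e / 8) sequentially"
      by eventually_elim simp
    then obtain k where k: "(\<integral>x. indicator (U - V k) x \<partial>lborel) < e / 8" "\<delta> k * M < e / 8"
      by (auto simp: eventually_sequentially)
    have "eventually (\<lambda>n. (\<integral>x. indicator U x * norm (a (r n) k x - c k x) \<partial>lborel) < e / 8) sequentially"
      using \<open>e > 0\<close> by (intro order_tendstoD(2)[OF lim_ac]) simp
    then obtain N where N: "\<And>n. n \<ge> N \<Longrightarrow> (\<integral>x. indicator U x * norm (a (r n) k x - c k x) \<partial>lborel) < e / 8"
      by (auto simp: eventually_sequentially)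
    show ?thesis
    proof (intro exI[of _ N] allI impI)
      fix m n assume mn: "m \<ge> N" "n \<ge> N"
      have "(\<integral>x. norm (v (r m) x - v (r n) x) \<partial>lborel) \<le>
        (\<integral>x. 2 * indicator (U - V k) x +
          ((indicator (V k) x * norm (a (r m) k x - v (r m) x) + indicator (V k) x * norm (a (r n) k x - v (r n) x)) +
          (indicator U x * norm (a (r m) k x - c k x) + indicator U x * norm (a (r n) k x - c k x))) \<partial>lborel)"
      proof (rule integral_mono)
        fix x
        consider "x \<notin> U" | "x \<in> U - V k" | "x \<in> V k" "x \<in> U"
          using V_sub by blast
        then show "norm (v (r m) x - v (r n) x) \<le> 2 * indicator (U - V k) x +
          ((indicator (V k) x * norm (a (r m) k x - v (r m) x) + indicator (V k) x * norm (a (r n) k x - v (r n) x)) +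
          (indicator U x * norm (a (r m) k x - c k x) + indicator U x * norm (a (r n) k x - c k x)))"
        proof cases
          case 1
          then show ?thesis using v_off V_sub by (auto simp: indicator_def)
        next
          case 2
          have "norm (v (r m) x - v (r n) x) \<le> 2"
            using v[of "r m" x] v[of "r n" x] norm_triangle_ineq4[of "v (r m) x" "v (r n) x"] by linarith
          with 2 show ?thesis by (simp add: add_nonneg_nonneg add_increasing2)
        next
          case 3
          have "v (r m) x - v (r n) x = - (a (r m) k x - v (r m) x) + (a (r n) k x - v (r n) x) +
            (a (r m) k x - c k x) + - (a (r n) k x - c k x)"
            by simp
          also have "norm \<dots> \<le> norm (- (a (r m) k x - v (r m) x)) + norm (a (r n) k x - v (r n) x) +
              norm (a (r m) k x - c k x) + norm (- (a (r n) k x - c k x))"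
            by (intro norm_triangle_le add_right_mono order_refl)
          finally show ?thesis using 3 by (simp add: norm_minus_commute)
        qed
      qed (intro Bochner_Integration.integrable_add integrable_mult_right int_diff int_UV int_aV int_ac)+
      also have "\<dots> = 2 * (\<integral>x. indicator (U - V k) x \<partial>lborel) +
          (((\<integral>x. indicator (V k) x * norm (a (r m) k x - v (r m) x) \<partial>lborel) + (\<integral>x. indicator (V k) x * norm (a (r n) k x - v (r n) x) \<partial>lborel)) +
          ((\<integral>x. indicator U x * norm (a (r m) k x - c k x) \<partial>lborel) + (\<integral>x. indicator U x * norm (a (r n) k x - c k x) \<partial>lborel)))"
        by (simp only: Bochner_Integration.integral_add integral_mult_right_zero
            Bochner_Integration.integrable_add integrable_mult_right int_UV int_aV int_ac)
      also have "\<dots> < e"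
        using k err[of k "r m"] err[of k "r n"] N[OF mn(1)] N[OF mn(2)] \<open>e > 0\<close> by linarith
      finally show "(\<integral>x. norm (v (r m) x - v (r n) x) \<partial>lborel) < e" .
    qed
  qed
  from L1_Cauchy_AE_subseq[OF int_v this]
  obtain q :: "nat \<Rightarrow> nat" where q: "strict_mono q" "AE x in lborel. convergent (\<lambda>n. v (r (q n)) x)"
    by blast
  show ?thesis
  proof (rule that[of "r \<circ> q"])
    show "strict_mono (r \<circ> q)"
      using r q(1) by (rule strict_mono_o)
    show "AE x in lborel. convergent (\<lambda>n. v ((r \<circ> q) n) x)"
      using q(2) by simp
  qed
qed

section \<open>Weak derivatives of Lebesgue measurable functions\<close>

lemma AE_lebesgue_on_iff:
  assumes "U \<in> sets borel"
  shows "(AE x in lebesgue_on U. P x) \<longleftrightarrow> (AE x in lborel. x \<in> U \<longrightarrow> P x)"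
  using assms by (subst AE_restrict_space_iff) (auto simp: AE_completion_iff)

lemma nn_integral_lebesgue_on:
  assumes "U \<in> sets borel"
  shows "(\<integral>\<^sup>+x. F x \<partial>lebesgue_on U) = (\<integral>\<^sup>+x. F x * indicator U x \<partial>lborel)"
  using assms by (subst nn_integral_restrict_space) (auto simp: nn_integral_completion)

text \<open>Translations and Tonelli's theorem are used for Borel functions on the whole space,
  whereas Sobolev functions are only Lebesgue measurable on U. The representative is built from
  Borel versions of the coordinates and cut off outside U.\<close>

lemma borel_representative:
  fixes f :: "'a::euclidean_space \<Rightarrow> 'b::euclidean_space"
  assumes f: "f \<in> borel_measurable (lebesgue_on U)" and U: "U \<in> sets borel"
  obtains f' where "f' \<in> borel_measurable borel" "\<And>x. x \<notin> U \<Longrightarrow> f' x = 0" "AE x in lebesgue_on U. f x = f' x"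
proof -
  define P where "P b g \<longleftrightarrow> g \<in> borel_measurable lborel \<and> (AE x in lborel. (if x \<in> U then f x \<bullet> b else 0) = g x)" for b g
  define g where "g b = (SOME g. P b g)" for b
  have "\<exists>g. P b g" for b
    unfolding P_def Bex_def[symmetric]
  proof (rule completion_ex_borel_measurable_real)
    have "(\<lambda>x. f x \<bullet> b) \<in> borel_measurable (lebesgue_on U)"
      using f by (rule borel_measurable_inner) simp
    then show "(\<lambda>x. if x \<in> U then f x \<bullet> b else 0) \<in> borel_measurable lebesgue"
      using U by (subst borel_measurable_if) (auto)
  qed
  then have "P b (g b)" for b
    unfolding g_def by (rule someI_ex)
  then have g: "g b \<in> borel_measurable lborel" "AE x in lborel. (if x \<in> U then f x \<bullet> b else 0) = g b x" for b
    unfolding P_def by blast+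
  have [measurable]: "g b \<in> borel_measurable borel" for b
    using g(1)[of b] by simp
  note [measurable] = U
  show ?thesis
  proof (rule that[of "\<lambda>x. indicator U x *\<^sub>R (\<Sum>b\<in>Basis. g b x *\<^sub>R b)"])
    have "AE x in lborel. \<forall>b\<in>Basis. (if x \<in> U then f x \<bullet> b else 0) = g b x"
      by (rule AE_finite_allI) (use g(2) in auto)
    then have "AE x in lborel. x \<in> U \<longrightarrow> f x = indicator U x *\<^sub>R (\<Sum>b\<in>Basis. g b x *\<^sub>R b)"
    proof eventually_elim
      case (elim x)
      show ?case
      proof
        assume "x \<in> U"
        then have "(\<Sum>b\<in>Basis. g b x *\<^sub>R b) = (\<Sum>b\<in>Basis. (f x \<bullet> b) *\<^sub>R b)"
          using elim by (intro sum.cong) auto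
        with \<open>x \<in> U\<close> show "f x = indicator U x *\<^sub>R (\<Sum>b\<in>Basis. g b x *\<^sub>R b)"
          by (simp add: euclidean_representation)
      qed
    qed
    then show "AE x in lebesgue_on U. f x = indicator U x *\<^sub>R (\<Sum>b\<in>Basis. g b x *\<^sub>R b)"
      using U by (simp add: AE_lebesgue_on_iff)
    show "(\<lambda>x. indicator U x *\<^sub>R (\<Sum>b\<in>Basis. g b x *\<^sub>R b)) \<in> borel_measurable borel"
      by measurable
  qed simp
qed

lemma measurable_lebesgue_on_borel: "f \<in> borel_measurable borel \<Longrightarrow> f \<in> borel_measurable (lebesgue_on U)"
  by (intro measurable_restrict_space1 measurable_completion) simp

lemma
  fixes f :: "'a::euclidean_space \<Rightarrow> 'b::euclidean_space"
  assumes f: "f \<in> borel_measurable (lebesgue_on U)" and U: "U \<in> sets borel"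
    and f': "f' \<in> borel_measurable borel" "\<And>x. x \<notin> U \<Longrightarrow> f' x = 0" "AE x in lebesgue_on U. f x = f' x"
  shows integrable_lebesgue_on_representative: "integrable (lebesgue_on U) f \<longleftrightarrow> integrable lborel f'"
    and integral_lebesgue_on_representative: "(\<integral>x. f x \<partial>lebesgue_on U) = (\<integral>x. f' x \<partial>lborel)"
proof -
  have eq: "(\<lambda>x. indicator U x *\<^sub>R f' x) = f'"
    using f'(2) by (auto simp: indicator_def)
  have U': "U \<inter> space lebesgue \<in> sets lebesgue"
    using U by simp
  have "integrable (lebesgue_on U) f \<longleftrightarrow> integrable (lebesgue_on U) f'"
    using f f'(3) measurable_lebesgue_on_borel[OF f'(1)] by (intro integrable_cong_AE)
  also have "\<dots> \<longleftrightarrow> integrable lborel f'"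
    unfolding integrable_restrict_space[OF U'] eq using f'(1) by (intro integrable_completion) simp
  finally show "integrable (lebesgue_on U) f \<longleftrightarrow> integrable lborel f'" .
  have "(\<integral>x. f x \<partial>lebesgue_on U) = (\<integral>x. f' x \<partial>lebesgue_on U)"
    using f f'(3) measurable_lebesgue_on_borel[OF f'(1)] by (intro integral_cong_AE)
  also have "\<dots> = (\<integral>x. f' x \<partial>lborel)"
    unfolding integral_restrict_space[OF U'] eq using f'(1) by (intro integral_completion) simp
  finally show "(\<integral>x. f x \<partial>lebesgue_on U) = (\<integral>x. f' x \<partial>lborel)" .
qed

lemma integral_scaleR_representative:
  fixes f :: "'a::euclidean_space \<Rightarrow> 'b::euclidean_space"
  assumes \<phi>: "\<phi> \<in> borel_measurable borel"
    and f: "f \<in> borel_measurable (lebesgue_on U)" and U: "U \<in> sets borel"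
    and f': "f' \<in> borel_measurable borel" "\<And>x. x \<notin> U \<Longrightarrow> f' x = 0" "AE x in lebesgue_on U. f x = f' x"
  shows "(\<integral>x. \<phi> x *\<^sub>R f x \<partial>lebesgue_on U) = (\<integral>x. \<phi> x *\<^sub>R f' x \<partial>lborel)"
proof (rule integral_lebesgue_on_representative[OF _ U])
  show "(\<lambda>x. \<phi> x *\<^sub>R f x) \<in> borel_measurable (lebesgue_on U)"
    using measurable_lebesgue_on_borel[OF \<phi>] f by (rule borel_measurable_scaleR)
  show "(\<lambda>x. \<phi> x *\<^sub>R f' x) \<in> borel_measurable borel"
    using \<phi> f'(1) by (rule borel_measurable_scaleR)
  show "AE x in lebesgue_on U. \<phi> x *\<^sub>R f x = \<phi> x *\<^sub>R f' x"
    using f'(3) by eventually_elim simp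
qed (simp add: f'(2))

lemma integrable_lebesgue_on_subset:
  fixes f :: "'a::euclidean_space \<Rightarrow> 'b::euclidean_space"
  assumes f: "integrable (lebesgue_on U) f" and "K \<subseteq> U" "K \<in> sets borel" "U \<in> sets borel"
  shows "integrable (lebesgue_on K) f"
proof -
  have "integrable lebesgue (\<lambda>x. indicator K x *\<^sub>R (indicator U x *\<^sub>R f x))"
  proof (rule integrable_mult_indicator)
    show "integrable lebesgue (\<lambda>x. indicator U x *\<^sub>R f x)"
      using f assms(4) by (simp add: integrable_restrict_space)
  qed (use assms(3) in simp)
  also have "(\<lambda>x. indicator K x *\<^sub>R (indicator U x *\<^sub>R f x)) = (\<lambda>x. indicator K x *\<^sub>R f x)"
    using assms(2) by (auto simp: indicator_def fun_eq_iff)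
  finally show ?thesis
    using assms(3) by (simp add: integrable_restrict_space)
qed

lemma weak_pd_imp_has_weak_partial:
  fixes f g :: "'a::euclidean_space \<Rightarrow> 'b::euclidean_space"
  assumes U: "open U" and i: "i \<in> Basis" and wp: "weak_pd U i f' g'"
    and f: "f \<in> borel_measurable (lebesgue_on U)" "AE x in lebesgue_on U. f x = f' x"
    and g: "g \<in> borel_measurable (lebesgue_on U)" "AE x in lebesgue_on U. g x = g' x"
  shows "has_weak_partial U i f g"
proof -
  have Um: "U \<in> sets borel" using U by simp
  note f' = integrable_lborel_borel[OF weak_pdD(1)[OF wp]] and g' = integrable_lborel_borel[OF weak_pdD(2)[OF wp]]
  have int: "integrable (lebesgue_on U) f" "integrable (lebesgue_on U) g"
    using integrable_lebesgue_on_representative[OF f(1) Um f' weak_pdD(3)[OF wp] f(2)]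
      integrable_lebesgue_on_representative[OF g(1) Um g' weak_pdD(4)[OF wp] g(2)] weak_pdD(1,2)[OF wp] by auto
  have "locally_integrable U f" "locally_integrable U g"
    unfolding locally_integrable_def
    using integrable_lebesgue_on_subset[OF int(1) _ _ Um] integrable_lebesgue_on_subset[OF int(2) _ _ Um]
    by (metis borel_compact)+
  moreover have "(\<integral>x. frechet_derivative \<phi> (at x) i *\<^sub>R f x \<partial>lebesgue_on U) = - (\<integral>x. \<phi> x *\<^sub>R g x \<partial>lebesgue_on U)"
    if \<phi>: "\<phi> \<in> test_functions U" for \<phi>
    using weak_pdD(5)[OF wp \<phi>]
      integral_scaleR_representative[OF Ck_compact_measurable[OF frechet_derivative_Ck_compact[OF
        test_functions_Ck_compact[OF \<phi>, of "Suc 0"] i]] f(1) Um f' weak_pdD(3)[OF wp] f(2)]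
      integral_scaleR_representative[OF Ck_compact_measurable[OF test_functions_Ck_compact[OF \<phi>, of 0]]
        g(1) Um g' weak_pdD(4)[OF wp] g(2)]
    by simp
  ultimately show ?thesis
    unfolding has_weak_partial_def by blast
qed

text \<open>Integrability on all of U is a separate premise because a weak partial derivative
  provides local integrability only.\<close>

lemma has_weak_partial_imp_weak_pd:
  fixes f g :: "'a::euclidean_space \<Rightarrow> 'b::euclidean_space"
  assumes U: "open U" and i: "i \<in> Basis" and hw: "has_weak_partial U i f g"
    and int: "integrable (lebesgue_on U) f" "integrable (lebesgue_on U) g"
    and f': "f' \<in> borel_measurable borel" "\<And>x. x \<notin> U \<Longrightarrow> f' x = 0" "AE x in lebesgue_on U. f x = f' x"
    and g': "g' \<in> borel_measurable borel" "\<And>x. x \<notin> U \<Longrightarrow> g' x = 0" "AE x in lebesgue_on U. g x = g' x"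
  shows "weak_pd U i f' g'"
proof -
  have Um: "U \<in> sets borel" using U by simp
  note f = borel_measurable_integrable[OF int(1)] and g = borel_measurable_integrable[OF int(2)]
  have "integrable lborel f'" "integrable lborel g'"
    using integrable_lebesgue_on_representative[OF f Um f'] integrable_lebesgue_on_representative[OF g Um g'] int by auto
  moreover have "(\<integral>x. frechet_derivative \<phi> (at x) i *\<^sub>R f' x \<partial>lborel) = - (\<integral>x. \<phi> x *\<^sub>R g' x \<partial>lborel)"
    if \<phi>: "\<phi> \<in> test_functions U" for \<phi>
  proof -
    have "(\<integral>x. frechet_derivative \<phi> (at x) i *\<^sub>R f x \<partial>lebesgue_on U) = - (\<integral>x. \<phi> x *\<^sub>R g x \<partial>lebesgue_on U)"
      using hw \<phi> by (simp add: has_weak_partial_def)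
    then show ?thesis
      using integral_scaleR_representative[OF Ck_compact_measurable[OF frechet_derivative_Ck_compact[OF
          test_functions_Ck_compact[OF \<phi>, of "Suc 0"] i]] f Um f']
        integral_scaleR_representative[OF Ck_compact_measurable[OF test_functions_Ck_compact[OF \<phi>, of 0]] g Um g']
      by simp
  qed
  ultimately show ?thesis
    unfolding weak_pd_def using f'(2) g'(2) by blast
qed

lemma integral_lebesgue_on_support:
  fixes F :: "'a::euclidean_space \<Rightarrow> 'b::euclidean_space"
  assumes "K \<subseteq> U" "K \<in> sets borel" "U \<in> sets borel" "\<And>x. x \<in> U - K \<Longrightarrow> F x = 0"
  shows "(\<integral>x. F x \<partial>lebesgue_on U) = (\<integral>x. F x \<partial>lebesgue_on K)"
proof -
  have "(\<integral>x. F x \<partial>lebesgue_on U) = (\<integral>x. (if x \<in> K then F x else 0) \<partial>lebesgue_on U)"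
    using assms by (intro Bochner_Integration.integral_cong) auto
  also have "\<dots> = (\<integral>x. F x \<partial>lebesgue_on K)"
    using assms by (intro integral_restrict) auto
  finally show ?thesis .
qed

lemma test_functions_mono: "\<phi> \<in> test_functions V \<Longrightarrow> V \<subseteq> U \<Longrightarrow> \<phi> \<in> test_functions U"
  by (auto simp: test_functions_def Ck_compact_def)

lemma test_function_derivative_off_support:
  assumes "\<phi> \<in> test_functions V" "i \<in> Basis"
  obtains K where "compact K" "K \<subseteq> V" "\<And>x. x \<notin> K \<Longrightarrow> \<phi> x = 0" "\<And>x. x \<notin> K \<Longrightarrow> frechet_derivative \<phi> (at x) i = 0"
proof -
  note \<phi> = test_functions_Ck_compact[OF assms(1), of "Suc 0"]
  obtain K1 where K1: "compact K1" "K1 \<subseteq> V" "\<And>x. x \<notin> K1 \<Longrightarrow> \<phi> x = 0"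
    by (rule Ck_compact_supportE[OF \<phi>]) (rule that; assumption)
  obtain K2 where K2: "compact K2" "K2 \<subseteq> V" "\<And>x. x \<notin> K2 \<Longrightarrow> frechet_derivative \<phi> (at x) i = 0"
    by (rule Ck_compact_supportE[OF frechet_derivative_Ck_compact[OF \<phi> assms(2)]]) (rule that; assumption)
  show ?thesis
    by (rule that[of "K1 \<union> K2"]) (use K1 K2 in \<open>auto intro: compact_Un\<close>)
qed

lemma has_weak_partial_subset:
  fixes f g :: "'a::euclidean_space \<Rightarrow> 'b::euclidean_space"
  assumes hw: "has_weak_partial U i f g" and i: "i \<in> Basis" and VU: "V \<subseteq> U" "open V" "open U"
  shows "has_weak_partial V i f g"
proof -
  have "locally_integrable V f" "locally_integrable V g"
    using hw VU(1) unfolding has_weak_partial_def locally_integrable_def by (meson order_trans)+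
  moreover have "(\<integral>x. frechet_derivative \<phi> (at x) i *\<^sub>R f x \<partial>lebesgue_on V) = - (\<integral>x. \<phi> x *\<^sub>R g x \<partial>lebesgue_on V)"
    if \<phi>: "\<phi> \<in> test_functions V" for \<phi>
  proof -
    obtain K where K: "compact K" "K \<subseteq> V" "\<And>x. x \<notin> K \<Longrightarrow> \<phi> x = 0" "\<And>x. x \<notin> K \<Longrightarrow> frechet_derivative \<phi> (at x) i = 0"
      by (rule test_function_derivative_off_support[OF \<phi> i]) (rule that; assumption)
    have "(\<integral>x. frechet_derivative \<phi> (at x) i *\<^sub>R f x \<partial>lebesgue_on U) = (\<integral>x. frechet_derivative \<phi> (at x) i *\<^sub>R f x \<partial>lebesgue_on V)"
    proof (rule integral_lebesgue_on_support)
      fix x assume "x \<in> U - V"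
      with K(2) have "x \<notin> K" by blast
      then show "frechet_derivative \<phi> (at x) i *\<^sub>R f x = 0" by (simp add: K(4))
    qed (use VU in simp_all)
    moreover have "(\<integral>x. \<phi> x *\<^sub>R g x \<partial>lebesgue_on U) = (\<integral>x. \<phi> x *\<^sub>R g x \<partial>lebesgue_on V)"
    proof (rule integral_lebesgue_on_support)
      fix x assume "x \<in> U - V"
      with K(2) have "x \<notin> K" by blast
      then show "\<phi> x *\<^sub>R g x = 0" by (simp add: K(3))
    qed (use VU in simp_all)
    ultimately show ?thesis
      using hw test_functions_mono[OF \<phi> VU(1)] by (simp add: has_weak_partial_def)
  qed
  ultimately show ?thesis
    unfolding has_weak_partial_def by blast
qed

text \<open>The functions are only locally integrable, so uniqueness is first proved on balls with
  closure in U, where they have integrable representatives. By Lindelof's theorem countably many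
  such balls cover U, and the exceptional null sets unite to a null set.\<close>

lemma has_weak_partial_unique:
  fixes f g :: "'a::euclidean_space \<Rightarrow> 'b::euclidean_space"
  assumes U: "open U" and i: "i \<in> Basis" and hw: "has_weak_partial U i f g" "has_weak_partial U i f g'"
  shows "AE x in lebesgue_on U. g x = g' x"
proof -
  define B where "B = {ball x e | x e. cball x e \<subseteq> U}"
  have "\<Union>B = U"
  proof
    show "U \<subseteq> \<Union>B"
    proof
      fix x assume "x \<in> U"
      then obtain e where "e > 0" "cball x e \<subseteq> U"
        using U open_contains_cball by blast
      then show "x \<in> \<Union>B"
        unfolding B_def by (auto intro!: exI[of _ "ball x e"])
    qed
    show "\<Union>B \<subseteq> U"
      unfolding B_def by (auto simp: subset_iff less_imp_le)
  qed
  have B_open: "open V" if "V \<in> B" for V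
    using that unfolding B_def by auto
  obtain C where C: "C \<subseteq> B" "countable C" "\<Union>C = \<Union>B"
    using Lindelof[of B] B_open by blast
  have "AE x in lborel. x \<in> V \<longrightarrow> g x = g' x" if VC: "V \<in> C" for V
  proof -
    have "V \<in> B"
      using VC C(1) by (rule subsetD[rotated])
    then obtain z e where V: "V = ball z e" and sub: "cball z e \<subseteq> U"
      unfolding B_def by blast
    have VU: "V \<subseteq> U" "open V"
      using sub ball_subset_cball[of z e] by (auto simp: V)
    have Vm: "V \<in> sets borel" using VU by simp
    have int: "integrable (lebesgue_on V) k" if "locally_integrable U k" for k :: "'a \<Rightarrow> 'b"
    proof -
      have "integrable (lebesgue_on (cball z e)) k"
        using that sub unfolding locally_integrable_def by simp
      then show ?thesis
        unfolding V by (rule integrable_lebesgue_on_subset) auto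
    qed
    have int3: "integrable (lebesgue_on V) f" "integrable (lebesgue_on V) g" "integrable (lebesgue_on V) g'"
      using hw int unfolding has_weak_partial_def by blast+
    obtain f1 where f1: "f1 \<in> borel_measurable borel" "\<And>x. x \<notin> V \<Longrightarrow> f1 x = 0" "AE x in lebesgue_on V. f x = f1 x"
      by (rule borel_representative[OF borel_measurable_integrable[OF int3(1)] Vm]) (rule that; assumption)
    obtain g1 where g1: "g1 \<in> borel_measurable borel" "\<And>x. x \<notin> V \<Longrightarrow> g1 x = 0" "AE x in lebesgue_on V. g x = g1 x"
      by (rule borel_representative[OF borel_measurable_integrable[OF int3(2)] Vm]) (rule that; assumption)
    obtain g2 where g2: "g2 \<in> borel_measurable borel" "\<And>x. x \<notin> V \<Longrightarrow> g2 x = 0" "AE x in lebesgue_on V. g' x = g2 x"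
      by (rule borel_representative[OF borel_measurable_integrable[OF int3(3)] Vm]) (rule that; assumption)
    note hwV = has_weak_partial_subset[OF hw(1) i VU(1,2) U] has_weak_partial_subset[OF hw(2) i VU(1,2) U]
    have "AE x in lborel. g1 x = g2 x"
      by (rule weak_pd_unique[OF VU(2) has_weak_partial_imp_weak_pd[OF VU(2) i hwV(1) int3(1,2) f1 g1]
            has_weak_partial_imp_weak_pd[OF VU(2) i hwV(2) int3(1,3) f1 g2]])
    moreover have "AE x in lborel. x \<in> V \<longrightarrow> g x = g1 x" "AE x in lborel. x \<in> V \<longrightarrow> g' x = g2 x"
      using g1(3) g2(3) Vm by (simp_all add: AE_lebesgue_on_iff)
    ultimately show ?thesis
      by eventually_elim simp
  qed
  then have "AE x in lborel. \<forall>V\<in>C. x \<in> V \<longrightarrow> g x = g' x"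
    unfolding AE_ball_countable[OF C(2)] by blast
  then have "AE x in lborel. x \<in> U \<longrightarrow> g x = g' x"
    by eventually_elim (use C(3) \<open>\<Union>B = U\<close> in blast)
  then show ?thesis
    using U by (simp add: AE_lebesgue_on_iff)
qed

lemma AE_lebesgue_on_subset:
  assumes "AE x in lebesgue_on U. P x" "K \<subseteq> U" "K \<in> sets borel" "U \<in> sets borel"
  shows "AE x in lebesgue_on K. P x"
proof -
  have "AE x in lborel. x \<in> U \<longrightarrow> P x"
    using assms by (simp add: AE_lebesgue_on_iff)
  then have "AE x in lborel. x \<in> K \<longrightarrow> P x"
    by eventually_elim (use assms(2) in blast)
  then show ?thesis
    using assms by (simp add: AE_lebesgue_on_iff)
qed

text \<open>In an iterated \<open>weak_partial\<close> the inner derivative is an arbitrary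
  representative, equal to the Sobolev witness only almost everywhere; its outer derivative is
  obtained through this lemma.\<close>

lemma has_weak_partial_cong_AE:
  fixes f f' g :: "'a::euclidean_space \<Rightarrow> 'b::euclidean_space"
  assumes U: "open U" and i: "i \<in> Basis" and hw: "has_weak_partial U i f g"
    and f': "locally_integrable U f'" "AE x in lebesgue_on U. f x = f' x"
  shows "has_weak_partial U i f' g"
proof -
  have "(\<integral>x. frechet_derivative \<phi> (at x) i *\<^sub>R f x \<partial>lebesgue_on U) = (\<integral>x. frechet_derivative \<phi> (at x) i *\<^sub>R f' x \<partial>lebesgue_on U)"
    if \<phi>: "\<phi> \<in> test_functions U" for \<phi>
  proof -
    obtain K where K: "compact K" "K \<subseteq> U" "\<And>x. x \<notin> K \<Longrightarrow> \<phi> x = 0" "\<And>x. x \<notin> K \<Longrightarrow> frechet_derivative \<phi> (at x) i = 0"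
      by (rule test_function_derivative_off_support[OF \<phi> i]) (rule that; assumption)
    have Km: "K \<in> sets borel" and Um: "U \<in> sets borel"
      using K(1) U by (auto intro: borel_closed compact_imp_closed)
    have d: "(\<lambda>x. frechet_derivative \<phi> (at x) i) \<in> borel_measurable (lebesgue_on K)"
      by (rule measurable_lebesgue_on_borel[OF Ck_compact_measurable[OF frechet_derivative_Ck_compact[OF
              test_functions_Ck_compact[OF \<phi>, of "Suc 0"] i]]])
    have "integrable (lebesgue_on K) f" "integrable (lebesgue_on K) f'"
      using hw f'(1) K(1,2) unfolding has_weak_partial_def locally_integrable_def by blast+
    note fm = this[THEN borel_measurable_integrable]
    have "(\<integral>x. frechet_derivative \<phi> (at x) i *\<^sub>R f x \<partial>lebesgue_on U) = (\<integral>x. frechet_derivative \<phi> (at x) i *\<^sub>R f x \<partial>lebesgue_on K)"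
      using K(2) Km Um by (rule integral_lebesgue_on_support) (simp add: K(4))
    also have "\<dots> = (\<integral>x. frechet_derivative \<phi> (at x) i *\<^sub>R f' x \<partial>lebesgue_on K)"
    proof (rule integral_cong_AE)
      show "AE x in lebesgue_on K. frechet_derivative \<phi> (at x) i *\<^sub>R f x = frechet_derivative \<phi> (at x) i *\<^sub>R f' x"
        using AE_lebesgue_on_subset[OF f'(2) K(2) Km Um] by eventually_elim simp
    qed (intro borel_measurable_scaleR d fm)+
    also have "\<dots> = (\<integral>x. frechet_derivative \<phi> (at x) i *\<^sub>R f' x \<partial>lebesgue_on U)"
      using K(2) Km Um by (rule integral_lebesgue_on_support[symmetric]) (simp add: K(4))
    finally show ?thesis .
  qed
  then show ?thesis
    using hw f'(1) unfolding has_weak_partial_def by simp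
qed

lemma weak_partial_works: "has_weak_partial U i f g \<Longrightarrow> has_weak_partial U i f (weak_partial U i f)"
  unfolding weak_partial_def by (rule someI[of "has_weak_partial U i f"])

lemma weak_partial_AE:
  fixes f g :: "'a::euclidean_space \<Rightarrow> 'b::euclidean_space"
  assumes "open U" "i \<in> Basis" "has_weak_partial U i f g"
  shows "AE x in lebesgue_on U. weak_partial U i f x = g x"
  using has_weak_partial_unique[OF assms(1,2) weak_partial_works[OF assms(3)] assms(3)] .

section \<open>Mixed second derivatives\<close>

text \<open>A test function is differentiated in the second direction by difference quotients, which are
  again test functions; this avoids the symmetry of its second derivatives.\<close>

lemma integral_second_derivative_swap:
  fixes f g :: "'a::euclidean_space \<Rightarrow> 'b::euclidean_space"
  assumes U: "open U" and i: "i \<in> Basis" and j: "j \<in> Basis" and wp: "weak_pd U i f g" and \<phi>: "\<phi> \<in> test_functions U"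
  shows "(\<integral>x. frechet_derivative (\<lambda>x. frechet_derivative \<phi> (at x) i) (at x) j *\<^sub>R f x \<partial>lborel) =
    - (\<integral>x. frechet_derivative \<phi> (at x) j *\<^sub>R g x \<partial>lborel)"
proof -
  note \<phi>k = test_functions_Ck_compact[OF \<phi>]
  define \<psi> where "\<psi> x = frechet_derivative \<phi> (at x) i" for x
  have \<psi>k: "\<psi> \<in> Ck_compact k U" for k
    unfolding \<psi>_def by (rule frechet_derivative_Ck_compact[OF \<phi>k[of "Suc k"] i])
  obtain K d where K: "compact K" "K \<subseteq> U" "\<And>x. x \<notin> K \<Longrightarrow> \<phi> x = 0" and d: "d > 0" "\<And>x. x \<in> K \<Longrightarrow> cball x d \<subseteq> U"
    by (rule Ck_compact_near_support[OF \<phi>k[of 0] U]) (rule that; assumption)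
  \<comment> \<open>Steps of length at most d keep the shifted support of \<phi> inside U, so the
    difference quotients are again test functions on U.\<close>
  define X where "X n = d / real (Suc n)" for n
  have X_pos: "X n > 0" and X_le: "X n \<le> d" for n
    using d(1) by (auto simp: X_def divide_le_eq)
  have X0: "X \<longlonglongrightarrow> 0"
    unfolding X_def using LIMSEQ_inverse_real_of_nat by (auto simp: divide_inverse intro: tendsto_mult_right_zero)
  define q where "q F n x = (1 / X n) *\<^sub>R (F (x + X n *\<^sub>R j) - F x)" for F :: "'a \<Rightarrow> real" and n x
  have q_Ck: "Ck k (q F n)" if "Ck k F" for k F n
  proof -
    have "Ck k (\<lambda>x. (1 / X n) *\<^sub>R (F (X n *\<^sub>R j + 1 *\<^sub>R x) + (-1) *\<^sub>R F x))"
      by (intro Ck_linear[OF bounded_linear_scaleR_right] Ck_add Ck_affine that)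
    then show ?thesis by (simp add: q_def[abs_def] add.commute)
  qed
  have q_test: "q \<phi> n \<in> test_functions U" for n
    unfolding test_functions_def
  proof (rule INT_I)
    fix k
    show "q \<phi> n \<in> Ck_compact k U"
    proof (rule Ck_compactI[of _ _ "K \<union> (\<lambda>x. - (X n *\<^sub>R j) + x) ` K"])
      show "Ck k (q \<phi> n)"
        using \<phi>k[of k] by (intro q_Ck) (simp add: Ck_compact_def)
      show "compact (K \<union> (\<lambda>x. - (X n *\<^sub>R j) + x) ` K)"
        using K(1) by (intro compact_Un compact_translation)
      have "- (X n *\<^sub>R j) + x \<in> U" if "x \<in> K" for x
      proof -
        have "- (X n *\<^sub>R j) + x \<in> cball x d"
          using j X_pos[of n] X_le[of n] by (simp add: dist_norm)
        then show ?thesis using d(2)[OF that] by blast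
      qed
      then show "K \<union> (\<lambda>x. - (X n *\<^sub>R j) + x) ` K \<subseteq> U"
        using K(2) by blast
      fix x assume x: "x \<notin> K \<union> (\<lambda>x. - (X n *\<^sub>R j) + x) ` K"
      then have "x + X n *\<^sub>R j \<notin> K"
        by (metis Un_iff add.commute add_diff_cancel_left' image_eqI uminus_add_conv_diff diff_add_cancel)
      with x show "q \<phi> n x = 0"
        by (simp add: q_def K(3))
    qed
  qed
  have dq: "frechet_derivative (q \<phi> n) (at x) i = q \<psi> n x" for n x
  proof -
    have d1: "(\<phi> has_derivative frechet_derivative \<phi> (at y)) (at y)" for y
      using Ck_compact_differentiable[OF \<phi>k[of "Suc 0"]] by (simp add: frechet_derivative_works[symmetric])
    have d2: "((\<lambda>x. \<phi> (x + X n *\<^sub>R j)) has_derivative frechet_derivative \<phi> (at (x + X n *\<^sub>R j))) (at x)"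
      by (rule has_derivative_compose[where f = "\<lambda>x. x + X n *\<^sub>R j" and g = \<phi>
            and g' = "frechet_derivative \<phi> (at (x + X n *\<^sub>R j))"])
        (use d1 in \<open>auto intro!: derivative_eq_intros\<close>)
    have "(q \<phi> n has_derivative (\<lambda>v. (1 / X n) *\<^sub>R (frechet_derivative \<phi> (at (x + X n *\<^sub>R j)) v - frechet_derivative \<phi> (at x) v))) (at x)"
      unfolding q_def[abs_def] by (intro has_derivative_scaleR_right has_derivative_diff d1 d2)
    from frechet_derivative_at[OF this] show ?thesis
      unfolding q_def \<psi>_def by metis
  qed
  have lim: "(\<lambda>n. \<integral>x. q F n x *\<^sub>R k x \<partial>lborel) \<longlonglongrightarrow> (\<integral>x. frechet_derivative F (at x) j *\<^sub>R k x \<partial>lborel)"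
    if F: "F \<in> Ck_compact (Suc 0) U" and k: "integrable lborel k" for F and k :: "'a \<Rightarrow> 'b"
  proof -
    obtain L where L: "L \<ge> 0" "\<And>x y. \<bar>F x - F y\<bar> \<le> L * norm (x - y)" "\<And>x v. \<bar>frechet_derivative F (at x) v\<bar> \<le> L * norm v"
      by (rule Ck_compact_lipschitz[OF F]) (rule that; assumption)
    show ?thesis
    proof (rule integral_dominated_convergence[where w = "\<lambda>x. L * norm (k x)"])
      show "integrable lborel (\<lambda>x. L * norm (k x))"
        using k by simp
      show "(\<lambda>x. frechet_derivative F (at x) j *\<^sub>R k x) \<in> borel_measurable lborel"
        by (rule borel_measurable_integrable[OF integrable_test_function_derivative_scaleR[OF F j k]])
      have [measurable]: "F \<in> borel_measurable borel" "k \<in> borel_measurable borel"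
        using Ck_compact_measurable[OF F] integrable_lborel_borel[OF k] by simp_all
      show "(\<lambda>x. q F n x *\<^sub>R k x) \<in> borel_measurable lborel" for n
        unfolding q_def by measurable
      show "AE x in lborel. (\<lambda>n. q F n x *\<^sub>R k x) \<longlonglongrightarrow> frechet_derivative F (at x) j *\<^sub>R k x"
      proof (intro always_eventually allI tendsto_scaleR tendsto_const)
        fix x
        have "((\<lambda>t. F (x + t *\<^sub>R j)) has_vector_derivative frechet_derivative F (at x) j) (at 0)"
          using has_vector_derivative_along_line[of F x 0 j] Ck_compact_differentiable[OF F] by simp
        then have "(\<lambda>n. (1 / X n) *\<^sub>R (F (x + (0 + X n) *\<^sub>R j) - F (x + 0 *\<^sub>R j))) \<longlonglongrightarrow> frechet_derivative F (at x) j"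
          unfolding has_vector_derivative_sequentially using X0 X_pos by (elim allE[of _ X]) (simp add: less_imp_neq[symmetric])
        then show "(\<lambda>n. q F n x) \<longlonglongrightarrow> frechet_derivative F (at x) j"
          by (simp add: q_def)
      qed
      show "AE x in lborel. norm (q F n x *\<^sub>R k x) \<le> L * norm (k x)" for n
      proof (intro always_eventually allI)
        fix x
        have "\<bar>F (x + X n *\<^sub>R j) - F x\<bar> \<le> L * X n"
          using L(2)[of "x + X n *\<^sub>R j" x] j X_pos[of n] by simp
        then have "\<bar>q F n x\<bar> \<le> L"
          using X_pos[of n] by (simp add: q_def abs_mult divide_le_eq)
        then show "norm (q F n x *\<^sub>R k x) \<le> L * norm (k x)"
          unfolding norm_scaleR by (rule mult_right_mono) simp
      qed
    qed
  qed
  have "(\<integral>x. q \<psi> n x *\<^sub>R f x \<partial>lborel) = - (\<integral>x. q \<phi> n x *\<^sub>R g x \<partial>lborel)" for n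
    using weak_pdD(5)[OF wp q_test[of n]] by (simp add: dq)
  then have "(\<lambda>n. - (\<integral>x. q \<phi> n x *\<^sub>R g x \<partial>lborel)) \<longlonglongrightarrow> (\<integral>x. frechet_derivative \<psi> (at x) j *\<^sub>R f x \<partial>lborel)"
    using lim[OF \<psi>k weak_pdD(1)[OF wp]] by presburger
  moreover have "(\<lambda>n. - (\<integral>x. q \<phi> n x *\<^sub>R g x \<partial>lborel)) \<longlonglongrightarrow> - (\<integral>x. frechet_derivative \<phi> (at x) j *\<^sub>R g x \<partial>lborel)"
    by (intro tendsto_minus lim[OF \<phi>k weak_pdD(2)[OF wp]])
  ultimately show ?thesis
    unfolding \<psi>_def by (rule LIMSEQ_unique)
qed

lemma frechet_derivative_test_function:
  assumes "\<phi> \<in> test_functions U" "i \<in> Basis"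
  shows "(\<lambda>x. frechet_derivative \<phi> (at x) i) \<in> test_functions U"
  unfolding test_functions_def
  using frechet_derivative_Ck_compact[OF test_functions_Ck_compact[OF assms(1)] assms(2)] by blast

text \<open>Both mixed derivatives, tested with \<phi>, reduce to integrals against first
  derivatives of f; \<open>integral_second_derivative_swap\<close> identifies these, and the
  difference is orthogonal to all test functions.\<close>

lemma weak_pd_mixed:
  fixes f :: "'a::euclidean_space \<Rightarrow> 'b::euclidean_space"
  assumes U: "open U" and i: "i \<in> Basis" and j: "j \<in> Basis"
    and fi: "weak_pd U i f fi" and fj: "weak_pd U j f fj" and fij: "weak_pd U i fj fij" and fji: "weak_pd U j fi fji"
  shows "AE x in lborel. fij x = fji x"
proof -
  have "AE x in lborel. fij x - fji x = 0"
  proof (rule AE_eq_0_if_orthogonal_test_functions[OF _ U])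
    show "integrable lborel (\<lambda>x. fij x - fji x)"
      using weak_pdD(2)[OF fij] weak_pdD(2)[OF fji] by simp
    show "fij x - fji x = 0" if "x \<notin> U" for x
      using weak_pdD(4)[OF fij that] weak_pdD(4)[OF fji that] by simp
    fix \<phi> assume \<phi>: "\<phi> \<in> test_functions U"
    have "(\<integral>x. \<phi> x *\<^sub>R fij x \<partial>lborel) = - (\<integral>x. frechet_derivative \<phi> (at x) i *\<^sub>R fj x \<partial>lborel)"
      using weak_pdD(5)[OF fij \<phi>] by simp
    also have "\<dots> = (\<integral>x. frechet_derivative (\<lambda>x. frechet_derivative \<phi> (at x) i) (at x) j *\<^sub>R f x \<partial>lborel)"
      using weak_pdD(5)[OF fj frechet_derivative_test_function[OF \<phi> i]] by simp
    also have "\<dots> = - (\<integral>x. frechet_derivative \<phi> (at x) j *\<^sub>R fi x \<partial>lborel)"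
      by (rule integral_second_derivative_swap[OF U i j fi \<phi>])
    also have "\<dots> = (\<integral>x. \<phi> x *\<^sub>R fji x \<partial>lborel)"
      using weak_pdD(5)[OF fji \<phi>] by simp
    finally show "(\<integral>x. \<phi> x *\<^sub>R (fij x - fji x) \<partial>lborel) = 0"
      using integrable_test_function_scaleR[OF test_functions_Ck_compact[OF \<phi>, of 0] weak_pdD(2)[OF fij]]
        integrable_test_function_scaleR[OF test_functions_Ck_compact[OF \<phi>, of 0] weak_pdD(2)[OF fji]]
      by (simp add: scaleR_diff_right)
  qed
  then show ?thesis by simp
qed

section \<open>Deviation from the mean\<close>

lemma nn_integral_jensen_powr:
  fixes f :: "'a \<Rightarrow> 'b::{banach, second_countable_topology}" and w :: "'a \<Rightarrow> real"
  assumes q: "q \<ge> 1" and w: "integrable M w" "\<And>x. 0 \<le> w x" "integral\<^sup>L M w = 1" and f: "f \<in> borel_measurable M"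
  shows "ennreal (norm (\<integral>x. w x *\<^sub>R f x \<partial>M) powr q) \<le> (\<integral>\<^sup>+x. ennreal (w x * norm (f x) powr q) \<partial>M)"
proof (cases "(\<integral>\<^sup>+x. ennreal (w x * norm (f x) powr q) \<partial>M) < \<infinity>")
  case True
  have int: "integrable M (\<lambda>x. w x * norm (f x) powr q)"
  proof (rule integrableI_bounded)
    show "(\<lambda>x. w x * norm (f x) powr q) \<in> borel_measurable M"
      using borel_measurable_integrable[OF w(1)] f by measurable
    show "(\<integral>\<^sup>+x. ennreal (norm (w x * norm (f x) powr q)) \<partial>M) < \<infinity>"
      using True w(2) by simp
  qed
  have "ennreal (norm (\<integral>x. w x *\<^sub>R f x \<partial>M) powr q) \<le> ennreal (\<integral>x. w x * norm (f x) powr q \<partial>M)"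
    by (rule ennreal_leI[OF jensen_powr[OF q w f int]])
  also have "\<dots> = (\<integral>\<^sup>+x. ennreal (w x * norm (f x) powr q) \<partial>M)"
    using w(2) by (intro nn_integral_eq_integral[symmetric] int) auto
  finally show ?thesis .
qed (simp add: not_less top_unique)

text \<open>The deviation of f x from the mean is the average of f x - f y over y in U. Jensen's
  inequality leads to \<open>poincare_double\<close>, whose factor measure U cancels the 1 / m of
  the average.\<close>

lemma poincare_mean:
  fixes f :: "'a::euclidean_space \<Rightarrow> 'b::euclidean_space"
  assumes U: "open U" "convex U" "emeasure lborel U < \<infinity>" and d: "\<And>x y. x \<in> U \<Longrightarrow> y \<in> U \<Longrightarrow> norm (x - y) \<le> d"
    and wp: "\<And>i. i \<in> Basis \<Longrightarrow> weak_pd U i f (g i)" and q: "q \<ge> 1"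
  defines "S \<equiv> \<lambda>x. (\<Sum>i\<in>Basis. norm (g i x)) powr q"
  assumes int_S: "integrable lborel S"
  shows "(\<integral>\<^sup>+x. indicator U x * ennreal (norm (f x - (1 / measure lborel U) *\<^sub>R integral\<^sup>L lborel f) powr q) \<partial>lborel) \<le>
    ennreal (d powr q * 2 ^ DIM('a)) * (\<integral>\<^sup>+x. ennreal (S x) \<partial>lborel)"
proof (cases "U = {}")
  case False
  obtain b :: 'a where "b \<in> Basis" using nonempty_Basis by blast
  then have int_f: "integrable lborel f" and f_off: "\<And>x. x \<notin> U \<Longrightarrow> f x = 0"
    using weak_pdD(1,3)[OF wp] by blast+
  have [measurable]: "U \<in> sets borel" "f \<in> borel_measurable borel"
    using U(1) integrable_lborel_borel[OF int_f] by simp_all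
  define m where "m = measure lborel U"
  have "emeasure lborel U \<noteq> 0"
    using open_not_negligible[OF U(1) False] U(1) by (simp add: negligible_iff_emeasure0)
  then have m: "m > 0" "emeasure lborel U = ennreal m"
    using U(3) by (simp_all add: m_def measure_def enn2real_positive_iff zero_less_iff_neq_zero)
  define w where "w y = (1 / m) * indicator U y" for y :: 'a
  have w: "integrable lborel w" "\<And>y. 0 \<le> w y" "integral\<^sup>L lborel w = 1"
    unfolding w_def using U m(1) by (auto simp: m_def)
  have pw: "ennreal (norm (f x - (1 / m) *\<^sub>R integral\<^sup>L lborel f) powr q) \<le>
      ennreal (1 / m) * (\<integral>\<^sup>+y. indicator U y * ennreal (norm (f x - f y) powr q) \<partial>lborel)" for x
  proof -
    \<comment> \<open>As f vanishes outside U, the cut-off weight may be replaced by the constant 1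
      / m in front of f y.\<close>
    have "(\<integral>y. w y *\<^sub>R (f x - f y) \<partial>lborel) = (\<integral>y. w y *\<^sub>R f x - (1 / m) *\<^sub>R f y \<partial>lborel)"
    proof (rule Bochner_Integration.integral_cong)
      fix y
      show "w y *\<^sub>R (f x - f y) = w y *\<^sub>R f x - (1 / m) *\<^sub>R f y"
        using f_off[of y] by (cases "y \<in> U") (simp_all add: w_def scaleR_diff_right)
    qed simp
    also have "\<dots> = f x - (1 / m) *\<^sub>R integral\<^sup>L lborel f"
      using w(1,3) int_f by simp
    finally have "ennreal (norm (f x - (1 / m) *\<^sub>R integral\<^sup>L lborel f) powr q) \<le> (\<integral>\<^sup>+y. ennreal (w y * norm (f x - f y) powr q) \<partial>lborel)"
      using nn_integral_jensen_powr[OF q w, of "\<lambda>y. f x - f y"] by simp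
    also have "\<dots> = (\<integral>\<^sup>+y. ennreal (1 / m) * (indicator U y * ennreal (norm (f x - f y) powr q)) \<partial>lborel)"
      using m(1) by (intro nn_integral_cong) (auto simp: w_def indicator_def ennreal_mult[symmetric])
    also have "\<dots> = ennreal (1 / m) * (\<integral>\<^sup>+y. indicator U y * ennreal (norm (f x - f y) powr q) \<partial>lborel)"
      by (rule nn_integral_cmult) measurable
    finally show ?thesis .
  qed
  have "(\<integral>\<^sup>+x. indicator U x * ennreal (norm (f x - (1 / m) *\<^sub>R integral\<^sup>L lborel f) powr q) \<partial>lborel) \<le>
      (\<integral>\<^sup>+x. ennreal (1 / m) * (\<integral>\<^sup>+y. indicator U x * indicator U y * ennreal (norm (f x - f y) powr q) \<partial>lborel) \<partial>lborel)"
  proof (rule nn_integral_mono)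
    fix x
    show "indicator U x * ennreal (norm (f x - (1 / m) *\<^sub>R integral\<^sup>L lborel f) powr q) \<le>
        ennreal (1 / m) * (\<integral>\<^sup>+y. indicator U x * indicator U y * ennreal (norm (f x - f y) powr q) \<partial>lborel)"
      using pw[of x] by (cases "x \<in> U") (simp_all add: mult.assoc)
  qed
  also have "\<dots> = ennreal (1 / m) * (\<integral>\<^sup>+x. \<integral>\<^sup>+y. indicator U x * indicator U y * ennreal (norm (f x - f y) powr q) \<partial>lborel \<partial>lborel)"
    by (rule nn_integral_cmult) measurable
  also have "\<dots> \<le> ennreal (1 / m) * (ennreal (d powr q) * (2 ^ DIM('a) * emeasure lborel U * (\<integral>\<^sup>+x. ennreal (S x) \<partial>lborel)))"
    unfolding S_def
    by (intro mult_left_mono poincare_double[OF U(1,2) d wp q int_S[unfolded S_def]]) simp_all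
  also have "\<dots> = (ennreal (1 / m) * ennreal m) * (ennreal (d powr q) * 2 ^ DIM('a)) * (\<integral>\<^sup>+x. ennreal (S x) \<partial>lborel)"
    by (simp add: m(2) mult_ac)
  also have "ennreal (1 / m) * ennreal m = 1"
    using m(1) by (simp add: ennreal_mult[symmetric])
  also have "ennreal (d powr q) * 2 ^ DIM('a) = ennreal (d powr q * 2 ^ DIM('a))"
    by (simp add: ennreal_mult ennreal_power[symmetric])
  finally show ?thesis
    by (simp add: m_def)
qed simp

section \<open>Sobolev functions and their representatives\<close>

lemma Lp_space_integrable:
  fixes f :: "'a::euclidean_space \<Rightarrow> 'b::euclidean_space"
  assumes f: "f \<in> Lp_space q U" and q: "q \<ge> 1" and U: "U \<in> sets borel" "emeasure lborel U < \<infinity>"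
  shows "integrable (lebesgue_on U) f"
proof (rule Bochner_Integration.integrable_bound)
  have "emeasure lebesgue U < \<infinity>"
    using U by (simp add: emeasure_completion)
  then have "integrable (lebesgue_on U) (\<lambda>x. 1 :: real)"
    using U(1) by (intro finite_measure.integrable_const finite_measureI)
      (simp add: emeasure_restrict_space space_restrict_space)
  then show "integrable (lebesgue_on U) (\<lambda>x. 1 + norm (f x) powr q)"
    using f by (auto simp: Lp_space_def)
  show "f \<in> borel_measurable (lebesgue_on U)"
    using f by (simp add: Lp_space_def)
  show "AE x in lebesgue_on U. norm (f x) \<le> norm (1 + norm (f x) powr q)"
    using le_one_plus_powr[OF q] by auto
qed

text \<open>By completeness of the Lebesgue measure, preimages under f and g differ by measurable
  sets. This settles measurability of \<open>weak_partial\<close>, whose values are known only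
  almost everywhere.\<close>

lemma measurable_lebesgue_on_AE_cong:
  fixes f g :: "'a::euclidean_space \<Rightarrow> 'b::euclidean_space"
  assumes g: "g \<in> borel_measurable (lebesgue_on U)" and U: "U \<in> sets borel" and eq: "AE x in lebesgue_on U. f x = g x"
  shows "f \<in> borel_measurable (lebesgue_on U)"
proof (rule borel_measurableI)
  fix S :: "'b set" assume S: "open S"
  have "AE x in lebesgue. x \<in> U \<longrightarrow> f x = g x"
    using eq U by (simp add: AE_restrict_space_iff)
  then obtain N where N: "{x. \<not> (x \<in> U \<longrightarrow> f x = g x)} \<subseteq> N" "N \<in> null_sets lebesgue"
    by (auto simp: eventually_ae_filter)
  have US: "U \<inter> space lebesgue \<in> sets lebesgue"
    using U by simp
  have gS: "g -` S \<inter> U \<in> sets lebesgue"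
    using measurable_sets[OF g, of S] S U by (simp add: sets_restrict_space_iff[OF US] space_restrict_space)
  have "f -` S \<inter> U \<inter> N \<in> null_sets lebesgue"
    by (rule null_sets_completion_subset[OF _ N(2)]) blast
  then have "f -` S \<inter> U \<inter> N \<in> sets lebesgue"
    by (rule null_setsD2)
  moreover have "f -` S \<inter> U = (g -` S \<inter> U - N) \<union> (f -` S \<inter> U \<inter> N)"
    using N(1) by auto
  ultimately have "f -` S \<inter> U \<in> sets lebesgue"
    using gS null_setsD2[OF N(2)] by (metis sets.Diff sets.Un)
  then show "f -` S \<inter> space (lebesgue_on U) \<in> sets (lebesgue_on U)"
    using U by (simp add: sets_restrict_space_iff[OF US] space_restrict_space)
qed

text \<open>Fixes one family of Borel representatives for the function, its gradient and its second
  derivatives, so that all later analysis takes place in terms of \<open>weak_pd\<close>. In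
  \<open>dd i j\<close> the derivative in direction j is taken before that in direction i.\<close>

lemma H2_space_representatives:
  fixes u :: "'a::euclidean_space \<Rightarrow> 'b::euclidean_space"
  assumes u: "u \<in> H2_space U" and U: "open U" "emeasure lborel U < \<infinity>"
  obtains f d dd where "AE x in lebesgue_on U. u x = f x"
    "\<And>i. i \<in> Basis \<Longrightarrow> weak_pd U i f (d i)" "\<And>i. i \<in> Basis \<Longrightarrow> AE x in lebesgue_on U. weak_partial U i u x = d i x"
    "\<And>i j. i \<in> Basis \<Longrightarrow> j \<in> Basis \<Longrightarrow> weak_pd U i (d j) (dd i j)"
    "\<And>i j. i \<in> Basis \<Longrightarrow> j \<in> Basis \<Longrightarrow> AE x in lebesgue_on U. weak_partial U i (weak_partial U j u) x = dd i j x"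
    "\<And>i. i \<in> Basis \<Longrightarrow> weak_partial U i u \<in> borel_measurable (lebesgue_on U)"
proof -
  have Um: "U \<in> sets borel" using U(1) by simp
  note int2 = Lp_space_integrable[of _ 2, OF _ _ Um U(2), simplified]
  have rep: "\<exists>k'. k' \<in> borel_measurable borel \<and> (\<forall>x. x \<notin> U \<longrightarrow> k' x = 0) \<and> (AE x in lebesgue_on U. k x = k' x)"
    if "k \<in> Lp_space 2 U" for k :: "'a \<Rightarrow> 'b"
    by (rule borel_representative[OF borel_measurable_integrable[OF int2[OF that]] Um]) blast
  have uL: "u \<in> Lp_space 2 U"
    using u by (simp add: H2_space_def)
  have "\<forall>i\<in>Basis. \<exists>g. g \<in> W1p_space 2 U \<and> has_weak_partial U i u g"
    using u by (auto simp: H2_space_def)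
  then obtain g where g: "\<And>i. i \<in> Basis \<Longrightarrow> g i \<in> W1p_space 2 U" "\<And>i. i \<in> Basis \<Longrightarrow> has_weak_partial U i u (g i)"
    by metis
  then have gL: "g i \<in> Lp_space 2 U" if "i \<in> Basis" for i
    using that by (auto simp: W1p_space_def)
  have "\<forall>i\<in>Basis. \<forall>j\<in>Basis. \<exists>k. k \<in> Lp_space 2 U \<and> has_weak_partial U i (g j) k"
    using g(1) by (auto simp: W1p_space_def)
  then obtain k where k: "\<And>i j. i \<in> Basis \<Longrightarrow> j \<in> Basis \<Longrightarrow> k i j \<in> Lp_space 2 U"
    "\<And>i j. i \<in> Basis \<Longrightarrow> j \<in> Basis \<Longrightarrow> has_weak_partial U i (g j) (k i j)"
    by metis
  obtain f where f: "f \<in> borel_measurable borel" "\<And>x. x \<notin> U \<Longrightarrow> f x = 0" "AE x in lebesgue_on U. u x = f x"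
    using rep[OF uL] by blast
  have "\<forall>i\<in>Basis. \<exists>k'. k' \<in> borel_measurable borel \<and> (\<forall>x. x \<notin> U \<longrightarrow> k' x = 0) \<and> (AE x in lebesgue_on U. g i x = k' x)"
    using rep gL by blast
  then obtain d where d: "\<And>i. i \<in> Basis \<Longrightarrow> d i \<in> borel_measurable borel" "\<And>i x. i \<in> Basis \<Longrightarrow> x \<notin> U \<Longrightarrow> d i x = 0"
    "\<And>i. i \<in> Basis \<Longrightarrow> AE x in lebesgue_on U. g i x = d i x"
    by metis
  have "\<forall>i\<in>Basis. \<forall>j\<in>Basis. \<exists>k'. k' \<in> borel_measurable borel \<and> (\<forall>x. x \<notin> U \<longrightarrow> k' x = 0) \<and> (AE x in lebesgue_on U. k i j x = k' x)"
    using rep k(1) by blast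
  then obtain dd where dd: "\<And>i j. i \<in> Basis \<Longrightarrow> j \<in> Basis \<Longrightarrow> dd i j \<in> borel_measurable borel"
    "\<And>i j x. i \<in> Basis \<Longrightarrow> j \<in> Basis \<Longrightarrow> x \<notin> U \<Longrightarrow> dd i j x = 0"
    "\<And>i j. i \<in> Basis \<Longrightarrow> j \<in> Basis \<Longrightarrow> AE x in lebesgue_on U. k i j x = dd i j x"
    by metis
  have wu: "has_weak_partial U i u (weak_partial U i u)" if "i \<in> Basis" for i
    by (rule weak_partial_works[OF g(2)[OF that]])
  have wug: "AE x in lebesgue_on U. weak_partial U i u x = g i x" if "i \<in> Basis" for i
    by (rule weak_partial_AE[OF U(1) that g(2)[OF that]])
  have wug': "AE x in lebesgue_on U. g i x = weak_partial U i u x" if "i \<in> Basis" for i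
    using wug[OF that] by eventually_elim simp
  show ?thesis
  proof (rule that[of f d dd])
    show "AE x in lebesgue_on U. u x = f x" by (rule f(3))
    fix i :: 'a assume i: "i \<in> Basis"
    show "weak_pd U i f (d i)"
      by (rule has_weak_partial_imp_weak_pd[OF U(1) i g(2)[OF i] int2[OF uL] int2[OF gL[OF i]] f d(1,2,3)[OF i]])
    show "AE x in lebesgue_on U. weak_partial U i u x = d i x"
      using wug[OF i] d(3)[OF i] by eventually_elim simp
    have gm: "g i \<in> borel_measurable (lebesgue_on U)"
      by (rule borel_measurable_integrable[OF int2[OF gL[OF i]]])
    show "weak_partial U i u \<in> borel_measurable (lebesgue_on U)"
      by (rule measurable_lebesgue_on_AE_cong[OF gm Um wug[OF i]])
    fix j :: 'a assume j: "j \<in> Basis"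
    show "weak_pd U i (d j) (dd i j)"
      by (rule has_weak_partial_imp_weak_pd[OF U(1) i k(2)[OF i j] int2[OF gL[OF j]] int2[OF k(1)[OF i j]] d(1,2,3)[OF j] dd(1,2,3)[OF i j]])
    have "has_weak_partial U i (weak_partial U j u) (k i j)"
      by (rule has_weak_partial_cong_AE[OF U(1) i k(2)[OF i j] _ wug'[OF j]]) (use wu[OF j] in \<open>simp add: has_weak_partial_def\<close>)
    from weak_partial_AE[OF U(1) i this] dd(3)[OF i j]
    show "AE x in lebesgue_on U. weak_partial U i (weak_partial U j u) x = dd i j x"
      by eventually_elim simp
  qed
qed

section \<open>Phase separation\<close>

lemma flat_sum_pos: "a < b \<Longrightarrow> flat 0 (t - a) + flat 0 (b - t) > 0"
  using flat_nonneg[of 0 "t - a"] flat_nonneg[of 0 "b - t"] flat_pos_iff[of 0 "t - a"] flat_pos_iff[of 0 "b - t"]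
  by (cases "a < t") (auto intro: add_pos_nonneg add_nonneg_pos)

lemma continuous_on_flat: "continuous_on S f \<Longrightarrow> continuous_on S (\<lambda>x. flat n (f x))"
proof -
  have "continuous_on UNIV (flat n)"
    by (intro continuous_at_imp_continuous_on ballI DERIV_isCont[OF has_real_derivative_flat])
  then show "continuous_on S f \<Longrightarrow> continuous_on S (\<lambda>x. flat n (f x))"
    by (rule continuous_on_compose2) auto
qed

text \<open>The quotient of two flat functions with positive denominator: its numerator vanishes up
  to a, and from b on the numerator equals the denominator.\<close>

lemma smooth_step:
  fixes a b :: real
  assumes "0 < a" "a < b"
  obtains \<theta> \<theta>' :: "real \<Rightarrow> real" where "\<And>t. (\<theta> has_real_derivative \<theta>' t) (at t)" "continuous_on UNIV \<theta>'"
    "\<And>t. t \<le> a \<Longrightarrow> \<theta> t = 0" "\<And>t. b \<le> t \<Longrightarrow> \<theta> t = 1" "\<And>t. 0 \<le> \<theta> t" "\<And>t. \<theta> t \<le> 1"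
    "\<And>t. t \<le> a \<or> b \<le> t \<Longrightarrow> \<theta>' t = 0"
proof -
  define \<theta> where "\<theta> t = flat 0 (t - a) / (flat 0 (t - a) + flat 0 (b - t))" for t
  define \<theta>' where "\<theta>' t = (flat 2 (t - a) * (flat 0 (t - a) + flat 0 (b - t)) - flat 0 (t - a) * (flat 2 (t - a) - flat 2 (b - t)))
    / ((flat 0 (t - a) + flat 0 (b - t)) * (flat 0 (t - a) + flat 0 (b - t)))" for t
  have pos: "flat 0 (t - a) + flat 0 (b - t) > 0" for t
    using assms(2) by (rule flat_sum_pos)
  have d: "(flat 0 has_real_derivative flat 2 t) (at t)" for t
    using has_real_derivative_flat[of 0 t] by (simp add: numeral_2_eq_2)
  have d1: "((\<lambda>t. flat 0 (t - a)) has_real_derivative flat 2 (t - a)) (at t)" for t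
  proof -
    have "((\<lambda>t. flat 0 (t - a)) has_real_derivative flat 2 (t - a) * 1) (at t)"
      by (rule DERIV_chain2[OF d]) (auto intro!: derivative_eq_intros)
    then show ?thesis by simp
  qed
  have d2: "((\<lambda>t. flat 0 (b - t)) has_real_derivative - flat 2 (b - t)) (at t)" for t
  proof -
    have "((\<lambda>t. flat 0 (b - t)) has_real_derivative flat 2 (b - t) * (-1)) (at t)"
      by (rule DERIV_chain2[OF d]) (auto intro!: derivative_eq_intros)
    then show ?thesis by simp
  qed
  have D1: "(\<theta> has_real_derivative \<theta>' t) (at t)" for t
    unfolding \<theta>_def[abs_def] \<theta>'_def
    using DERIV_divide[OF d1[of t] DERIV_add[OF d1[of t] d2[of t]]] pos[of t] by simp
  have nz: "flat 0 (t - a) + flat 0 (b - t) \<noteq> 0" for t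
    using pos[of t] by simp
  have "continuous_on UNIV \<theta>'"
    unfolding \<theta>'_def using nz by (intro continuous_intros continuous_on_flat) auto
  moreover have "\<theta> t = 0" if "t \<le> a" for t
    using that by (simp add: \<theta>_def flat_eq_0)
  moreover have "\<theta> t = 1" if "b \<le> t" for t
    using that nz[of t] by (simp add: \<theta>_def flat_eq_0)
  moreover have "0 \<le> \<theta> t" "\<theta> t \<le> 1" for t
    using pos[of t] flat_nonneg[of 0 "t - a"] flat_nonneg[of 0 "b - t"] by (auto simp: \<theta>_def divide_le_eq)
  moreover have "\<theta>' t = 0" if "t \<le> a \<or> b \<le> t" for t
    using that by (auto simp: \<theta>'_def flat_eq_0)
  ultimately show ?thesis
    using that[of \<theta> \<theta>'] D1 by blast
qed

text \<open>The gradient of \<open>\<Phi>\<close> is supported in a compact annulus around \<open>A\<close> that contains neither well, so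
  that a multiple of \<open>sqrt W\<close> bounds it.\<close>

lemma phase_function:
  fixes W :: "'m::euclidean_space \<Rightarrow> real"
  assumes W: "continuous_on UNIV W" "\<And>\<xi>. W \<xi> \<ge> 0" "\<And>\<xi>. W \<xi> = 0 \<longleftrightarrow> \<xi> = A \<or> \<xi> = B" and AB: "A \<noteq> B"
  obtains \<Phi> :: "'m \<Rightarrow> real" and \<Phi>' L K where "C1_function \<Phi> \<Phi>' L" "\<Phi> A = 0" "\<Phi> B = 1" "\<And>y. 0 \<le> \<Phi> y" "\<And>y. \<Phi> y \<le> 1"
    "0 \<le> K" "\<And>y z. norm (\<Phi>' y z) \<le> K * sqrt (W y) * norm z"
proof -
  define \<delta> where "\<delta> = (norm (B - A))\<^sup>2"
  have \<delta>: "\<delta> > 0" using AB by (simp add: \<delta>_def)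
  \<comment> \<open>The step acts on the squared distance from A. It rises between \<delta> / 4 and
    \<delta> / 2, while the squared distance of B is \<delta>, so B lies where \<Phi> is already
    1.\<close>
  then have \<delta>': "0 < \<delta> / 4" "\<delta> / 4 < \<delta> / 2" by simp_all
  obtain \<theta> \<theta>' :: "real \<Rightarrow> real" where \<theta>: "\<And>t. (\<theta> has_real_derivative \<theta>' t) (at t)" "continuous_on UNIV \<theta>'"
    "\<And>t. t \<le> \<delta> / 4 \<Longrightarrow> \<theta> t = 0" "\<And>t. \<delta> / 2 \<le> t \<Longrightarrow> \<theta> t = 1" "\<And>t. 0 \<le> \<theta> t" "\<And>t. \<theta> t \<le> 1"
    "\<And>t. t \<le> \<delta> / 4 \<or> \<delta> / 2 \<le> t \<Longrightarrow> \<theta>' t = 0"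
    by (rule smooth_step[OF \<delta>']) (rule that; assumption)
  define \<Phi> where "\<Phi> y = \<theta> ((y - A) \<bullet> (y - A))" for y
  define \<Phi>' where "\<Phi>' y z = \<theta>' ((y - A) \<bullet> (y - A)) * (2 * ((y - A) \<bullet> z))" for y z
  have deriv: "(\<Phi> has_derivative \<Phi>' y) (at y)" for y
  proof -
    have "((\<lambda>y. (y - A) \<bullet> (y - A)) has_derivative (\<lambda>z. 2 * ((y - A) \<bullet> z))) (at y)"
      by (auto intro!: derivative_eq_intros simp: inner_commute)
    from has_derivative_compose[OF this \<theta>(1)[unfolded has_field_derivative_def]]
    show ?thesis
      unfolding \<Phi>_def[abs_def] \<Phi>'_def[abs_def] .
  qed
  define k where "k y = \<bar>\<theta>' ((y - A) \<bullet> (y - A))\<bar> * (2 * norm (y - A))" for y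
  have \<theta>'_cont: "continuous_on UNIV (\<lambda>y::'m. \<theta>' ((y - A) \<bullet> (y - A)))"
    by (intro continuous_on_compose2[OF \<theta>(2)] continuous_intros) auto
  have k_cont: "continuous_on UNIV k"
    unfolding k_def by (intro continuous_intros \<theta>'_cont)
  have \<Phi>'_le: "norm (\<Phi>' y z) \<le> k y * norm z" for y z
  proof -
    have "\<bar>\<theta>' ((y - A) \<bullet> (y - A))\<bar> * (2 * \<bar>(y - A) \<bullet> z\<bar>) \<le> \<bar>\<theta>' ((y - A) \<bullet> (y - A))\<bar> * (2 * (norm (y - A) * norm z))"
      using Cauchy_Schwarz_ineq2[of "y - A" z] by (intro mult_left_mono) auto
    then show ?thesis
      by (simp add: \<Phi>'_def k_def abs_mult mult.assoc)
  qed
  define S where "S = {y. \<delta> / 4 \<le> (y - A) \<bullet> (y - A) \<and> (y - A) \<bullet> (y - A) \<le> \<delta> / 2}"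
  have k_off: "k y = 0" if "y \<notin> S" for y
    using that \<theta>(7)[of "(y - A) \<bullet> (y - A)"] by (auto simp: k_def S_def)
  have "closed S"
    unfolding S_def by (intro closed_Collect_conj closed_Collect_le continuous_intros)
  moreover have "S \<subseteq> cball A (sqrt (\<delta> / 2))"
  proof
    fix y assume "y \<in> S"
    then have "(norm (y - A))\<^sup>2 \<le> \<delta> / 2"
      by (simp add: S_def power2_norm_eq_inner)
    then have "norm (y - A) \<le> sqrt (\<delta> / 2)"
      by (rule real_le_rsqrt)
    then show "y \<in> cball A (sqrt (\<delta> / 2))"
      by (simp add: dist_norm norm_minus_commute)
  qed
  ultimately have S: "compact S"
    by (meson bounded_cball bounded_subset compact_eq_bounded_closed)
  have "A \<notin> S" "B \<notin> S"
  proof -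
    have "(B - A) \<bullet> (B - A) = \<delta>"
      by (simp add: \<delta>_def power2_norm_eq_inner)
    with \<delta> show "A \<notin> S" "B \<notin> S"
      by (auto simp: S_def)
  qed
  then have W_pos: "W y > 0" if "y \<in> S" for y
    using W(2)[of y] W(3)[of y] that by (auto simp: less_le)
  obtain L where L: "L \<ge> 0" "\<And>y. y \<in> S \<Longrightarrow> k y \<le> L"
  proof -
    have "compact (k ` S)"
      using S k_cont by (intro compact_continuous_image) (auto intro: continuous_on_subset)
    then have "bdd_above (k ` S)"
      by (intro bounded_imp_bdd_above compact_imp_bounded)
    then obtain L where "\<And>y. y \<in> S \<Longrightarrow> k y \<le> L"
      by (auto simp: bdd_above_def)
    then have "\<And>y. y \<in> S \<Longrightarrow> k y \<le> max L 0"
      by (simp add: le_max_iff_disj)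
    with that[of "max L 0"] show ?thesis by simp
  qed
  obtain m where m: "m > 0" "\<And>y. y \<in> S \<Longrightarrow> m \<le> W y"
  proof (cases "S = {}")
    case False
    obtain y where "y \<in> S" "\<And>z. z \<in> S \<Longrightarrow> W y \<le> W z"
      using continuous_attains_inf[OF S False, of W] W(1) by (meson continuous_on_subset subset_UNIV)
    with that[of "W y"] W_pos show ?thesis by blast
  qed (use that[of 1] in simp)
  have k_L: "k y \<le> L" for y
    using L k_off[of y] by (cases "y \<in> S") auto
  \<comment> \<open>On the annulus \<open>sqrt (W y) / sqrt m\<close> is at least 1 by the choice of
    m, which converts the constant bound L; off the annulus k vanishes.\<close>
  have k_W: "k y \<le> L / sqrt m * sqrt (W y)" for y
  proof (cases "y \<in> S")
    case True
    have "1 \<le> sqrt (W y) / sqrt m"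
      using m(1) m(2)[OF True] by simp
    then have "L * 1 \<le> L * (sqrt (W y) / sqrt m)"
      using L(1) by (rule mult_left_mono)
    then show ?thesis
      using L(2)[OF True] by simp
  qed (use k_off L m W in simp)
  show ?thesis
  proof (rule that[of \<Phi> \<Phi>' L "L / sqrt m"])
    show "C1_function \<Phi> \<Phi>' L"
    proof
      show "(\<Phi> has_derivative \<Phi>' y) (at y)" for y by (rule deriv)
      show "continuous_on UNIV (\<lambda>y. \<Phi>' y z)" for z
        unfolding \<Phi>'_def by (intro continuous_intros \<theta>'_cont)
      show "norm (\<Phi>' y z) \<le> L * norm z" for y z
        using \<Phi>'_le[of y z] mult_right_mono[OF k_L[of y], of "norm z"] by simp
    qed
    show "\<Phi> A = 0" "\<Phi> B = 1"
      using \<theta>(3)[of 0] \<theta>(4)[of \<delta>] \<delta> by (simp_all add: \<Phi>_def \<delta>_def power2_norm_eq_inner)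
    show "0 \<le> \<Phi> y" "\<Phi> y \<le> 1" for y
      using \<theta>(5,6) by (simp_all add: \<Phi>_def)
    show "0 \<le> L / sqrt m"
      using L(1) m(1) by simp
    show "norm (\<Phi>' y z) \<le> L / sqrt m * sqrt (W y) * norm z" for y z
      using \<Phi>'_le[of y z] mult_right_mono[OF k_W[of y], of "norm z"] by simp
  qed
qed

text \<open>Convergence of \<open>W\<close> to 0 alone leaves a choice between the wells, which the
  limit of \<Phi> decides: W + |\<Phi> - c| can vanish only at the selected well, so it has a
  positive minimum on the rest of a compact ball. Coercivity keeps the sequence in that
  ball.\<close>

lemma phase_convergence:
  fixes W \<Phi> :: "'m::euclidean_space \<Rightarrow> real" and \<xi> :: "nat \<Rightarrow> 'm"
  assumes W: "continuous_on UNIV W" "\<And>\<xi>. W \<xi> \<ge> 0" "\<And>\<xi>. W \<xi> = 0 \<longleftrightarrow> \<xi> = A \<or> \<xi> = B"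
    and coercive: "\<And>\<xi>. 1 / C1 * norm \<xi> powr p - C1 \<le> W \<xi>" "C1 > 0" "p \<ge> 1"
    and \<Phi>: "continuous_on UNIV \<Phi>" "\<Phi> A = 0" "\<Phi> B = 1"
    and lim: "(\<lambda>n. W (\<xi> n)) \<longlonglongrightarrow> 0" "(\<lambda>n. \<Phi> (\<xi> n)) \<longlonglongrightarrow> c"
  shows "\<xi> \<longlonglongrightarrow> (if c = 0 then A else B)"
proof (rule tendstoI)
  fix e :: real assume "e > 0"
  let ?l = "if c = 0 then A else B"
  \<comment> \<open>Eventually W < 1, so coercivity bounds norm \<xi> powr p by C1 * (1 + C1); one
    more unit bounds norm \<xi> itself.\<close>
  define R where "R = 1 + C1 * (1 + C1)"
  define S where "S = cball 0 R - ball ?l e"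
  define m where "m y = W y + \<bar>\<Phi> y - c\<bar>" for y
  have S: "compact S"
    unfolding S_def by (intro compact_diff compact_cball open_ball)
  have m_cont: "continuous_on S m"
    unfolding m_def using W(1) \<Phi>(1) by (intro continuous_intros) (auto elim: continuous_on_subset)
  have m_pos: "m y > 0" if "y \<in> S" for y
  proof (rule ccontr)
    assume "\<not> m y > 0"
    with W(2)[of y] have "W y = 0" "\<Phi> y = c"
      by (auto simp: m_def)
    with W(3)[of y] \<Phi>(2,3) have "y = ?l" by auto
    with that \<open>e > 0\<close> show False by (auto simp: S_def)
  qed
  obtain \<mu> where \<mu>: "\<mu> > 0" "\<And>y. y \<in> S \<Longrightarrow> \<mu> \<le> m y"
  proof (cases "S = {}")
    case False
    obtain y where "y \<in> S" "\<And>z. z \<in> S \<Longrightarrow> m y \<le> m z"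
      using continuous_attains_inf[OF S False m_cont] by blast
    with that[of "m y"] m_pos show ?thesis by blast
  qed (use that[of 1] in simp)
  have "(\<lambda>n. m (\<xi> n)) \<longlonglongrightarrow> 0 + \<bar>c - c\<bar>"
    unfolding m_def by (intro tendsto_intros lim)
  then have "(\<lambda>n. m (\<xi> n)) \<longlonglongrightarrow> 0" by simp
  from order_tendstoD(2)[OF this \<mu>(1)] order_tendstoD(2)[OF lim(1) zero_less_one]
  show "eventually (\<lambda>n. dist (\<xi> n) ?l < e) sequentially"
  proof eventually_elim
    case (elim n)
    have "norm (\<xi> n) powr p \<le> C1 * (1 + C1)"
    proof -
      have "norm (\<xi> n) powr p \<le> C1 * (W (\<xi> n) + C1)"
        using coercive(1)[of "\<xi> n"] coercive(2) by (simp add: field_simps)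
      also have "\<dots> \<le> C1 * (1 + C1)"
        using elim(2) coercive(2) by (intro mult_left_mono) auto
      finally show ?thesis .
    qed
    then have "norm (\<xi> n) \<le> R"
      using le_one_plus_powr[OF coercive(3), of "norm (\<xi> n)"] by (simp add: R_def)
    moreover have "\<xi> n \<notin> S"
      using \<mu>(2)[of "\<xi> n"] elim(1) by auto
    ultimately show ?case
      by (auto simp: S_def dist_commute)
  qed
qed

lemma powr_add_le:
  fixes x y p :: real
  assumes "x \<ge> 0" "y \<ge> 0" "p \<ge> 0"
  shows "(x + y) powr p \<le> 2 powr p * (x powr p + y powr p)"
proof -
  have "(x + y) powr p \<le> (2 * max x y) powr p"
    using assms by (intro powr_mono2) auto
  also have "\<dots> = 2 powr p * max x y powr p"
    using assms by (simp add: powr_mult)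
  also have "max x y powr p \<le> x powr p + y powr p"
    by (simp add: max_def)
  finally show ?thesis by simp
qed

text \<open>Coercivity bounds the p-th power of the distance by K1 * W + K2. Truncated at K2 it
  converges by dominated convergence; the excess over K2 is at most K1 * W, whose integral tends to
  0. This replaces an argument by equi-integrability.\<close>

lemma Lp_convergence_from_energy:
  fixes G :: "nat \<Rightarrow> 'a::euclidean_space \<Rightarrow> 'm::euclidean_space" and W :: "'m \<Rightarrow> real"
  assumes U: "U \<in> sets borel" "emeasure lborel U < \<infinity>"
    and W: "W \<in> borel_measurable borel" "\<And>\<xi>. W \<xi> \<ge> 0" and coercive: "\<And>\<xi>. 1 / C1 * norm \<xi> powr p - C1 \<le> W \<xi>" "C1 > 0" "p \<ge> 1"
    and G: "\<And>n. G n \<in> borel_measurable borel" "G\<^sub>0 \<in> borel_measurable borel" "\<And>x. norm (G\<^sub>0 x) \<le> R"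
    and lim: "AE x in lborel. x \<in> U \<longrightarrow> (\<lambda>n. G n x) \<longlonglongrightarrow> G\<^sub>0 x"
    and energy: "\<And>n. (\<integral>\<^sup>+x. indicator U x * ennreal (W (G n x)) \<partial>lborel) \<le> ennreal (a n)" "a \<longlonglongrightarrow> 0"
  shows "(\<lambda>n. \<integral>\<^sup>+x. indicator U x * ennreal (norm (G n x - G\<^sub>0 x) powr p) \<partial>lborel) \<longlonglongrightarrow> 0"
proof -
  note [measurable] = U(1) W(1) G(1,2)
  have "R \<ge> 0"
    using G(3)[of undefined] norm_ge_zero order_trans by blast
  \<comment> \<open>Both constants come from norm G powr p \<le> C1 * W + C1 * C1, the bound R for
    the limit, and the factor 2 powr p for the power of a sum.\<close>
  define K1 where "K1 = 2 powr p * C1"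
  define K2 where "K2 = 2 powr p * (C1 * C1 + R powr p)"
  have K: "K1 \<ge> 0" "K2 \<ge> 0"
    using coercive(2) by (simp_all add: K1_def K2_def)
  define T where "T n x = indicator U x * min (norm (G n x - G\<^sub>0 x) powr p) K2" for n x
  have bound: "norm (G n x - G\<^sub>0 x) powr p \<le> K1 * W (G n x) + K2" for n x
  proof -
    have "norm (G n x - G\<^sub>0 x) powr p \<le> (norm (G n x) + R) powr p"
      using coercive(3) norm_triangle_ineq4[of "G n x" "G\<^sub>0 x"] G(3)[of x] by (intro powr_mono2) auto
    also have "\<dots> \<le> 2 powr p * (norm (G n x) powr p + R powr p)"
      using coercive(3) \<open>R \<ge> 0\<close> by (intro powr_add_le) auto
    also have "norm (G n x) powr p \<le> C1 * W (G n x) + C1 * C1"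
      using coercive(1)[of "G n x"] coercive(2) by (simp add: field_simps)
    finally show ?thesis
      by (simp add: K1_def K2_def algebra_simps mult_left_mono)
  qed
  have int_T: "integrable lborel (T n)" and lim_T: "(\<lambda>n. integral\<^sup>L lborel (T n)) \<longlonglongrightarrow> integral\<^sup>L lborel (\<lambda>x::'a. 0::real)" for n
  proof -
    have 1: "integrable lborel (\<lambda>x. K2 * indicator U x :: real)"
      using U by (intro integrable_mult_right) auto
    have 2: "AE x in lborel. (\<lambda>n. T n x) \<longlonglongrightarrow> 0"
      using lim
    proof eventually_elim
      case (elim x)
      show ?case
      proof (cases "x \<in> U")
        case True
        then have "(\<lambda>n. G n x - G\<^sub>0 x) \<longlonglongrightarrow> 0"
          using elim by (simp add: LIM_zero)
        then have "(\<lambda>n. norm (G n x - G\<^sub>0 x) powr p) \<longlonglongrightarrow> 0 powr p"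
          using coercive(3) by (intro tendsto_powr2 tendsto_norm_zero tendsto_const) auto
        then have "(\<lambda>n. min (norm (G n x - G\<^sub>0 x) powr p) K2) \<longlonglongrightarrow> min (0 powr p) K2"
          by (intro tendsto_min tendsto_const)
        then show ?thesis
          using True K(2) by (simp add: T_def)
      qed (simp add: T_def)
    qed
    have 3: "AE x in lborel. norm (T n x) \<le> K2 * indicator U x" for n
      using K(2) by (auto simp: T_def indicator_def)
    have 4: "T n \<in> borel_measurable lborel" for n
      unfolding T_def by measurable
    show "integrable lborel (T n)"
      by (rule integrable_dominated_convergence2[OF _ 4 1 2 3]) simp
    show "(\<lambda>n. integral\<^sup>L lborel (T n)) \<longlonglongrightarrow> integral\<^sup>L lborel (\<lambda>x::'a. 0::real)"
      by (rule integral_dominated_convergence[OF _ 4 1 2 3]) simp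
  qed
  have le: "(\<integral>\<^sup>+x. indicator U x * ennreal (norm (G n x - G\<^sub>0 x) powr p) \<partial>lborel) \<le> ennreal (integral\<^sup>L lborel (T n)) + ennreal K1 * ennreal (a n)" for n
  proof -
    have "(\<integral>\<^sup>+x. indicator U x * ennreal (norm (G n x - G\<^sub>0 x) powr p) \<partial>lborel) \<le>
        (\<integral>\<^sup>+x. ennreal (T n x) + ennreal K1 * (indicator U x * ennreal (W (G n x))) \<partial>lborel)"
    proof (rule nn_integral_mono)
      fix x
      have "norm (G n x - G\<^sub>0 x) powr p \<le> min (norm (G n x - G\<^sub>0 x) powr p) K2 + K1 * W (G n x)"
        using bound[of n x] K W(2)[of "G n x"] by (auto simp: min_def)
      then show "indicator U x * ennreal (norm (G n x - G\<^sub>0 x) powr p) \<le> ennreal (T n x) + ennreal K1 * (indicator U x * ennreal (W (G n x)))"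
        using K W(2)[of "G n x"]
        by (cases "x \<in> U") (auto simp: T_def ennreal_mult[symmetric] ennreal_plus[symmetric] intro!: ennreal_leI simp del: ennreal_plus)
    qed
    also have "\<dots> = (\<integral>\<^sup>+x. ennreal (T n x) \<partial>lborel) + ennreal K1 * (\<integral>\<^sup>+x. indicator U x * ennreal (W (G n x)) \<partial>lborel)"
      using borel_measurable_integrable[OF int_T] by (subst nn_integral_add) (auto simp: nn_integral_cmult)
    also have "(\<integral>\<^sup>+x. ennreal (T n x) \<partial>lborel) = ennreal (integral\<^sup>L lborel (T n))"
      using K(2) by (intro nn_integral_eq_integral int_T) (auto simp: T_def)
    finally show ?thesis
      using energy(1)[of n] by (meson add_left_mono mult_left_mono order_trans zero_le)
  qed
  show ?thesis
  proof (rule tendsto_sandwich[OF always_eventually always_eventually tendsto_const])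
    show "\<forall>n. (\<integral>\<^sup>+x. indicator U x * ennreal (norm (G n x - G\<^sub>0 x) powr p) \<partial>lborel) \<le> ennreal (integral\<^sup>L lborel (T n)) + ennreal K1 * ennreal (a n)"
      using le by blast
    have "(\<lambda>n. ennreal (integral\<^sup>L lborel (T n)) + ennreal K1 * ennreal (a n)) \<longlonglongrightarrow> ennreal 0 + ennreal K1 * ennreal 0"
      using lim_T energy(2) by (intro tendsto_add tendsto_ennrealI ennreal_tendsto_cmult) auto
    then show "(\<lambda>n. ennreal (integral\<^sup>L lborel (T n)) + ennreal K1 * ennreal (a n)) \<longlonglongrightarrow> 0"
      by simp
  qed simp
qed

text \<open>The derivatives of G enter only through bounds by sqrt H, weighted by \<kappa> n i. The
  weights reappear in the bounds for the phase functions v, so a direction with \<kappa> n i tending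
  to 0 yields a limit without variation in that direction.\<close>

lemma phase_compactness:
  fixes G :: "nat \<Rightarrow> 'a::euclidean_space \<Rightarrow> 'm::euclidean_space" and W :: "'m \<Rightarrow> real"
  assumes U: "open U" "convex U" "emeasure lborel U < \<infinity>"
    and W: "continuous_on UNIV W" "\<And>\<xi>. W \<xi> \<ge> 0" "\<And>\<xi>. W \<xi> = 0 \<longleftrightarrow> \<xi> = A \<or> \<xi> = B" and AB: "A \<noteq> B"
    and coercive: "\<And>\<xi>. 1 / C1 * norm \<xi> powr p - C1 \<le> W \<xi>" "C1 > 0" "p \<ge> 1"
    and wp: "\<And>n i. i \<in> Basis \<Longrightarrow> weak_pd U i (G n) (GG n i)"
    and H: "\<And>n. H n \<in> borel_measurable borel" "\<And>n x. 0 \<le> H n x"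
    and GG: "\<And>n i. i \<in> Basis \<Longrightarrow> AE x in lborel. norm (GG n i x) \<le> \<kappa> n i * sqrt (H n x)"
    and lam: "\<And>n i. 0 \<le> \<kappa> n i" "\<And>n i. \<kappa> n i \<le> \<Lambda>"
    and \<epsilon>: "\<And>n. \<epsilon> n > 0" "\<epsilon> \<longlonglongrightarrow> 0"
    and E: "0 \<le> E" "\<And>n. (\<integral>\<^sup>+x. indicator U x * ennreal (1 / \<epsilon> n * W (G n x)) \<partial>lborel) \<le> ennreal E"
      "\<And>n. (\<integral>\<^sup>+x. indicator U x * ennreal (\<epsilon> n * H n x) \<partial>lborel) \<le> ennreal E"
  obtains r :: "nat \<Rightarrow> nat" and c :: "'a set" and v :: "nat \<Rightarrow> 'a \<Rightarrow> real" and w K where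
    "strict_mono r" "c \<in> sets borel" "c \<subseteq> U"
    "AE x in lborel. x \<in> U \<longrightarrow> (\<lambda>n. G (r n) x) \<longlonglongrightarrow> (if x \<in> c then B else A)"
    "\<And>n i. i \<in> Basis \<Longrightarrow> weak_pd U i (v n) (w n i)" "\<And>n x. \<bar>v n x\<bar> \<le> 1"
    "AE x in lborel. (\<lambda>n. v (r n) x) \<longlonglongrightarrow> indicator c x" "0 \<le> K"
    "\<And>n i. i \<in> Basis \<Longrightarrow> (\<integral>\<^sup>+x. ennreal \<bar>w n i x\<bar> \<partial>lborel) \<le> ennreal (K * \<kappa> n i)"
proof -
  obtain \<Phi> :: "'m \<Rightarrow> real" and \<Phi>' L K where \<Phi>C1: "C1_function \<Phi> \<Phi>' L" and \<Phi>: "\<Phi> A = 0" "\<Phi> B = 1" "\<And>y. 0 \<le> \<Phi> y" "\<And>y. \<Phi> y \<le> 1"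
    and K: "0 \<le> K" "\<And>y z. norm (\<Phi>' y z) \<le> K * sqrt (W y) * norm z"
    by (rule phase_function[OF W AB]) (rule that; assumption)
  interpret C1_function \<Phi> \<Phi>' L by (rule \<Phi>C1)
  have \<Phi>_cont: "continuous_on UNIV \<Phi>"
    by (intro continuous_at_imp_continuous_on ballI has_derivative_continuous[OF deriv])
  have [measurable]: "U \<in> sets borel" using U(1) by simp
  have W_m [measurable]: "W \<in> borel_measurable borel"
    using W(1) by (rule borel_measurable_continuous_onI)
  note [measurable] = H(1)
  obtain b :: 'a where b: "b \<in> Basis" using nonempty_Basis by blast
  have G_m [measurable]: "G n \<in> borel_measurable borel" for n
    using integrable_lborel_borel[OF weak_pdD(1)[OF wp[OF b]]] .
  define v where "v n x = indicator U x *\<^sub>R \<Phi> (G n x)" for n x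
  define w where "w n i x = \<Phi>' (G n x) (GG n i x)" for n i x
  have vw: "weak_pd U i (v n) (w n i)" if "i \<in> Basis" for n i
    unfolding v_def w_def by (rule weak_pd_chain[OF U(1,3) wp[OF that] that])
  have v_le: "\<bar>v n x\<bar> \<le> 1" for n x
    using \<Phi>(3,4)[of "G n x"] by (auto simp: v_def indicator_def)
  have w_le: "(\<integral>\<^sup>+x. ennreal \<bar>w n i x\<bar> \<partial>lborel) \<le> ennreal (K * E * \<kappa> n i)" if i: "i \<in> Basis" for n i
  proof -
    have "(\<integral>\<^sup>+x. ennreal \<bar>w n i x\<bar> \<partial>lborel) \<le>
      (\<integral>\<^sup>+x. ennreal (K * \<kappa> n i / 2) * (indicator U x * ennreal (1 / \<epsilon> n * W (G n x)) + indicator U x * ennreal (\<epsilon> n * H n x)) \<partial>lborel)"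
    proof (rule nn_integral_mono_AE, use GG[OF i, of n] in eventually_elim)
      fix x assume GG: "norm (GG n i x) \<le> \<kappa> n i * sqrt (H n x)"
      show "ennreal \<bar>w n i x\<bar> \<le> ennreal (K * \<kappa> n i / 2) * (indicator U x * ennreal (1 / \<epsilon> n * W (G n x)) + indicator U x * ennreal (\<epsilon> n * H n x))"
      proof (cases "x \<in> U")
        case True
        \<comment> \<open>Distributing 1 / \<epsilon> and \<epsilon> over the factors leaves the
          product unchanged; the inequality 2 s t \<le> s^2 + t^2 then produces exactly the two
          energy densities.\<close>
        define s where "s = sqrt (1 / \<epsilon> n * W (G n x))"
        define t where "t = sqrt (\<epsilon> n * H n x)"
        have nn: "0 \<le> 1 / \<epsilon> n * W (G n x)" "0 \<le> \<epsilon> n * H n x"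
          using \<epsilon>(1)[of n] W(2) H(2) by (auto intro: mult_nonneg_nonneg divide_nonneg_pos)
        have st: "sqrt (W (G n x)) * sqrt (H n x) = s * t"
          using \<epsilon>(1)[of n] by (simp add: s_def t_def real_sqrt_mult[symmetric])
        have "\<bar>w n i x\<bar> \<le> K * sqrt (W (G n x)) * (\<kappa> n i * sqrt (H n x))"
          using K(2)[of "G n x" "GG n i x"] mult_left_mono[OF GG, of "K * sqrt (W (G n x))"] K(1) W(2)
          by (simp add: w_def)
        also have "\<dots> = K * \<kappa> n i * (s * t)"
          unfolding st[symmetric] by simp
        also have "\<dots> \<le> K * \<kappa> n i * ((s\<^sup>2 + t\<^sup>2) / 2)"
          using K(1) lam(1) sum_squares_bound[of s t] by (intro mult_left_mono) auto
        also have "\<dots> = K * \<kappa> n i / 2 * (1 / \<epsilon> n * W (G n x) + \<epsilon> n * H n x)"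
          using nn by (simp add: s_def t_def)
        finally have "ennreal \<bar>w n i x\<bar> \<le> ennreal (K * \<kappa> n i / 2 * (1 / \<epsilon> n * W (G n x) + \<epsilon> n * H n x))"
          by (rule ennreal_leI)
        also have "\<dots> = ennreal (K * \<kappa> n i / 2) * (ennreal (1 / \<epsilon> n * W (G n x)) + ennreal (\<epsilon> n * H n x))"
        proof -
          have "0 \<le> K * \<kappa> n i / 2"
            using K(1) lam(1) by simp
          from ennreal_mult[OF this add_nonneg_nonneg[OF nn]] ennreal_plus[OF nn] show ?thesis
            by presburger
        qed
        finally show ?thesis using True by simp
      next
        case False
        then show ?thesis using weak_pdD(4)[OF vw[OF i] False] by simp
      qed
    qed
    also have "\<dots> = ennreal (K * \<kappa> n i / 2) * ((\<integral>\<^sup>+x. indicator U x * ennreal (1 / \<epsilon> n * W (G n x)) \<partial>lborel) + (\<integral>\<^sup>+x. indicator U x * ennreal (\<epsilon> n * H n x) \<partial>lborel))"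
      by (simp add: nn_integral_cmult nn_integral_add)
    also have "\<dots> \<le> ennreal (K * \<kappa> n i / 2) * (ennreal E + ennreal E)"
      by (intro mult_left_mono add_mono E) simp
    also have "\<dots> = ennreal (K * \<kappa> n i / 2 * (E + E))"
    proof -
      have "0 \<le> K * \<kappa> n i / 2"
        using K(1) lam(1) by simp
      from ennreal_mult[OF this add_nonneg_nonneg[OF E(1) E(1)]] ennreal_plus[OF E(1) E(1)] show ?thesis
        by presburger
    qed
    finally show ?thesis by (simp add: mult_ac)
  qed
  define M where "M = (\<Sum>i\<in>(Basis::'a set). K * E * \<Lambda>)"
  have "\<Lambda> \<ge> 0" using lam[of 0 b] by linarith
  then have M: "M \<ge> 0"
    unfolding M_def using K(1) E(1) by (intro sum_nonneg) auto
  have w_M: "(\<integral>\<^sup>+x. ennreal (\<Sum>i\<in>Basis. norm (w n i x)) \<partial>lborel) \<le> ennreal M" for n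
  proof -
    have [measurable]: "w n i \<in> borel_measurable borel" if "i \<in> Basis" for i
      by (rule integrable_lborel_borel[OF weak_pdD(2)[OF vw[OF that]]])
    have "(\<integral>\<^sup>+x. ennreal (\<Sum>i\<in>Basis. norm (w n i x)) \<partial>lborel) = (\<integral>\<^sup>+x. (\<Sum>i\<in>Basis. ennreal \<bar>w n i x\<bar>) \<partial>lborel)"
      by (intro nn_integral_cong) (simp add: sum_ennreal)
    also have "\<dots> = (\<Sum>i\<in>Basis. \<integral>\<^sup>+x. ennreal \<bar>w n i x\<bar> \<partial>lborel)"
      by (intro nn_integral_sum) simp
    also have "\<dots> \<le> (\<Sum>i\<in>(Basis::'a set). ennreal (K * E * \<Lambda>))"
    proof (rule sum_mono)
      fix i :: 'a assume "i \<in> Basis"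
      from w_le[OF this, of n] show "(\<integral>\<^sup>+x. ennreal \<bar>w n i x\<bar> \<partial>lborel) \<le> ennreal (K * E * \<Lambda>)"
        by (rule order_trans) (use K(1) E(1) lam in \<open>auto intro!: ennreal_leI mult_left_mono\<close>)
    qed
    also have "\<dots> = ennreal M"
      unfolding M_def using K(1) E(1) \<open>\<Lambda> \<ge> 0\<close> by (intro sum_ennreal) auto
    finally show ?thesis .
  qed
  obtain r1 :: "nat \<Rightarrow> nat" where r1: "strict_mono r1" "AE x in lborel. convergent (\<lambda>n. v (r1 n) x)"
  proof (rule bounded_W11_compact[where v = v and g = w and M = M, OF U])
    show "weak_pd U i (v n) (w n i)" if "i \<in> Basis" for n i
      using that by (rule vw)
    show "norm (v n x) \<le> 1" for n x
      using v_le[of n x] by simp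
  qed (use w_M M that in blast)+
  \<comment> \<open>Multiplying the energy bound by \<epsilon> n shows that \<open>W\<close> along
    the sequence tends to 0 in L1, from which pointwise convergence follows along a further
    subsequence.\<close>
  have W_int: "integrable lborel (\<lambda>x. indicator U x * W (G n x))" "(\<integral>x. indicator U x * W (G n x) \<partial>lborel) \<le> E * \<epsilon> n" for n
  proof -
    have nnle: "(\<integral>\<^sup>+x. ennreal (indicator U x * W (G n x)) \<partial>lborel) \<le> ennreal (E * \<epsilon> n)"
    proof -
      have "(\<integral>\<^sup>+x. ennreal (indicator U x * W (G n x)) \<partial>lborel) = (\<integral>\<^sup>+x. ennreal (\<epsilon> n) * (indicator U x * ennreal (1 / \<epsilon> n * W (G n x))) \<partial>lborel)"
        using \<epsilon>(1)[of n] W(2) by (intro nn_integral_cong) (auto simp: indicator_def ennreal_mult[symmetric])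
      also have "\<dots> = ennreal (\<epsilon> n) * (\<integral>\<^sup>+x. indicator U x * ennreal (1 / \<epsilon> n * W (G n x)) \<partial>lborel)"
        by (rule nn_integral_cmult) measurable
      also have "\<dots> \<le> ennreal (\<epsilon> n) * ennreal E"
        by (intro mult_left_mono E) simp
      finally show ?thesis
        using \<epsilon>(1)[of n] E(1) by (simp add: ennreal_mult mult.commute)
    qed
    have "(\<integral>\<^sup>+x. ennreal (norm (indicator U x * W (G n x))) \<partial>lborel) < \<infinity>"
      using nnle W(2) by (simp add: le_less_trans)
    then show int: "integrable lborel (\<lambda>x. indicator U x * W (G n x))"
      by (intro integrableI_bounded) measurable
    show "(\<integral>x. indicator U x * W (G n x) \<partial>lborel) \<le> E * \<epsilon> n"
      using nnle W(2) E(1) \<epsilon>(1)[of n] by (subst (asm) nn_integral_eq_integral[OF int]) auto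
  qed
  have "(\<lambda>n. \<integral>x. norm (indicator U x * W (G (r1 n) x)) \<partial>lborel) \<longlonglongrightarrow> 0"
  proof (rule tendsto_sandwich[OF always_eventually always_eventually tendsto_const])
    show "\<forall>n. 0 \<le> (\<integral>x. norm (indicator U x * W (G (r1 n) x)) \<partial>lborel)" by simp
    show "\<forall>n. (\<integral>x. norm (indicator U x * W (G (r1 n) x)) \<partial>lborel) \<le> E * \<epsilon> (r1 n)"
      using W_int(2) W(2) by simp
    show "(\<lambda>n. E * \<epsilon> (r1 n)) \<longlonglongrightarrow> 0"
      using tendsto_mult_right_zero[OF LIMSEQ_subseq_LIMSEQ[OF \<epsilon>(2) r1(1)], of E] by (simp add: comp_def)
  qed
  from tendsto_L1_AE_subseq[OF W_int(1) this]
  obtain r2 :: "nat \<Rightarrow> nat" where r2: "strict_mono r2" "AE x in lborel. (\<lambda>n. indicator U x * W (G (r1 (r2 n)) x)) \<longlonglongrightarrow> 0"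
    by blast
  define r where "r = r1 \<circ> r2"
  have r: "strict_mono r"
    unfolding r_def using r1(1) r2(1) by (rule strict_mono_o)
  have v_m [measurable]: "v n \<in> borel_measurable borel" for n
    by (rule integrable_lborel_borel[OF weak_pdD(1)[OF vw[OF b]]])
  define l where "l x = lim (\<lambda>n. v (r n) x)" for x
  have l_m [measurable]: "l \<in> borel_measurable borel"
    unfolding l_def by (rule borel_measurable_lim_metric) measurable
  have v_lim: "AE x in lborel. (\<lambda>n. v (r n) x) \<longlonglongrightarrow> l x"
    using r1(2)
  proof eventually_elim
    case (elim x)
    then have "convergent ((\<lambda>n. v (r1 n) x) \<circ> r2)"
      using r2(1) by (rule convergent_subseq_convergent)
    then show ?case
      by (simp add: comp_def r_def l_def convergent_LIMSEQ_iff)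
  qed
  define c where "c = {x \<in> U. l x \<noteq> 0}"
  have c_m: "c \<in> sets borel"
    unfolding c_def by measurable
  have G_lim: "AE x in lborel. x \<in> U \<longrightarrow> (\<lambda>n. G (r n) x) \<longlonglongrightarrow> (if x \<in> c then B else A)"
    using r2(2) v_lim
  proof eventually_elim
    case (elim x)
    show ?case
    proof
      assume x: "x \<in> U"
      have "(\<lambda>n. G (r n) x) \<longlonglongrightarrow> (if l x = 0 then A else B)"
        by (rule phase_convergence[OF W coercive \<Phi>_cont \<Phi>(1,2)]) (use elim x in \<open>simp_all add: v_def r_def\<close>)
      then show "(\<lambda>n. G (r n) x) \<longlonglongrightarrow> (if x \<in> c then B else A)"
        using x by (auto simp: c_def split: if_splits)
    qed
  qed
  \<comment> \<open>The limit l was used only to separate l = 0 from l \<noteq> 0. Now that G is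
    known to converge to a well, continuity of \<Phi> gives the values 0 and 1.\<close>
  have v_ind: "AE x in lborel. (\<lambda>n. v (r n) x) \<longlonglongrightarrow> indicator c x"
    using G_lim
  proof eventually_elim
    case (elim x)
    show ?case
    proof (cases "x \<in> U")
      case True
      have "isCont \<Phi> (if x \<in> c then B else A)"
        by (rule has_derivative_continuous[OF deriv])
      from isCont_tendsto_compose[OF this] elim True
      have "(\<lambda>n. \<Phi> (G (r n) x)) \<longlonglongrightarrow> \<Phi> (if x \<in> c then B else A)" by blast
      with True \<Phi>(1,2) show ?thesis
        by (simp add: v_def indicator_def split: if_splits)
    qed (simp add: v_def c_def)
  qed
  show ?thesis
  proof (rule that[of r c v w "K * E"])
    show "c \<subseteq> U"
      by (auto simp: c_def)
    show "0 \<le> K * E"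
      using K(1) E(1) by simp
  qed (fact r c_m G_lim vw v_le v_ind w_le)+
qed

section \<open>Strong convergence in Sobolev spaces\<close>

text \<open>The bound s \<le> 1 + s powr p, rescaled by e', reads s \<le> e' + c * s powr p. The
  constant part costs e' times the measure of U, less than e / 2, and \<eta> = e / (2 c) makes the
  other part at most e / 2.\<close>

lemma L1_small_if_Lp_small:
  fixes U :: "'a::euclidean_space set"
  assumes U: "U \<in> sets borel" "emeasure lborel U < \<infinity>" and p: "p \<ge> 1" and e: "e > 0"
  obtains \<eta> where "\<eta> > 0" "\<And>g :: 'a \<Rightarrow> 'b::euclidean_space. g \<in> borel_measurable borel \<Longrightarrow> (\<And>x. x \<notin> U \<Longrightarrow> g x = 0) \<Longrightarrow>
    (\<integral>\<^sup>+x. ennreal (norm (g x) powr p) \<partial>lborel) \<le> ennreal \<eta> \<Longrightarrow> (\<integral>\<^sup>+x. ennreal (norm (g x)) \<partial>lborel) < ennreal e"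
proof -
  define m where "m = measure lborel U"
  have m: "m \<ge> 0" "emeasure lborel U = ennreal m"
    using U(2) by (simp_all add: m_def emeasure_eq_ennreal_measure)
  define e' where "e' = e / (2 * (m + 1))"
  have e': "e' > 0" "e' * m < e / 2"
  proof -
    show "e' > 0" using e m by (simp add: e'_def)
    have "e' * m < e' * (m + 1)" using \<open>e' > 0\<close> by simp
    also have "\<dots> = e / 2" using m(1) by (simp add: e'_def field_simps)
    finally show "e' * m < e / 2" .
  qed
  define c where "c = e' / e' powr p"
  have c: "c > 0" using e' by (simp add: c_def)
  have pw: "s \<le> e' + c * s powr p" if "s \<ge> 0" for s
  proof -
    have "s / e' \<le> 1 + (s / e') powr p"
      using that e' by (intro le_one_plus_powr[OF p]) simp
    then have "s \<le> e' * (1 + (s / e') powr p)"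
      using e' by (simp add: field_simps)
    also have "(s / e') powr p = s powr p / e' powr p"
      using that e' by (simp add: powr_divide)
    finally show ?thesis by (simp add: c_def algebra_simps)
  qed
  show ?thesis
  proof (rule that[of "e / (2 * c)"])
    show "e / (2 * c) > 0" using e c by simp
    fix g :: "'a \<Rightarrow> 'b"
    assume g [measurable]: "g \<in> borel_measurable borel" and off: "\<And>x. x \<notin> U \<Longrightarrow> g x = 0"
      and small: "(\<integral>\<^sup>+x. ennreal (norm (g x) powr p) \<partial>lborel) \<le> ennreal (e / (2 * c))"
    note [measurable] = U(1)
    have "(\<integral>\<^sup>+x. ennreal (norm (g x)) \<partial>lborel) \<le> (\<integral>\<^sup>+x. ennreal e' * indicator U x + ennreal c * ennreal (norm (g x) powr p) \<partial>lborel)"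
    proof (rule nn_integral_mono)
      fix x
      have "ennreal (norm (g x)) \<le> ennreal (e' + c * norm (g x) powr p)"
        by (intro ennreal_leI pw) simp
      also have "\<dots> = ennreal e' + ennreal c * ennreal (norm (g x) powr p)"
        using e' c by (simp add: ennreal_mult)
      finally show "ennreal (norm (g x)) \<le> ennreal e' * indicator U x + ennreal c * ennreal (norm (g x) powr p)"
        using off[of x] by (cases "x \<in> U") simp_all
    qed
    also have "\<dots> = ennreal e' * emeasure lborel U + ennreal c * (\<integral>\<^sup>+x. ennreal (norm (g x) powr p) \<partial>lborel)"
      by (simp add: nn_integral_add nn_integral_cmult)
    also have "\<dots> \<le> ennreal e' * ennreal m + ennreal c * ennreal (e / (2 * c))"
      unfolding m(2) by (intro add_left_mono mult_left_mono small) simp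
    also have "\<dots> = ennreal (e' * m + e / 2)"
      using e' m c e by (simp add: ennreal_mult[symmetric] ennreal_plus[symmetric] del: ennreal_plus)
    also have "\<dots> < ennreal e"
      using e' e by (intro ennreal_lessI) auto
    finally show "(\<integral>\<^sup>+x. ennreal (norm (g x)) \<partial>lborel) < ennreal e" .
  qed
qed

lemma integrable_if_Lp:
  fixes g :: "'a::euclidean_space \<Rightarrow> 'b::euclidean_space"
  assumes "U \<in> sets borel" "emeasure lborel U < \<infinity>" "p \<ge> 1"
    and g: "g \<in> borel_measurable borel" "\<And>x. x \<notin> U \<Longrightarrow> g x = 0" "(\<integral>\<^sup>+x. ennreal (norm (g x) powr p) \<partial>lborel) < \<infinity>"
  shows "integrable lborel g"
proof (rule Bochner_Integration.integrable_bound)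
  have "integrable lborel (\<lambda>x. norm (g x) powr p)"
    using g by (intro integrableI_bounded) simp_all
  moreover have "integrable lborel (indicator U :: 'a \<Rightarrow> real)"
    using assms(1,2) by simp
  ultimately show "integrable lborel (\<lambda>x. indicator U x + norm (g x) powr p)"
    by simp
  show "AE x in lborel. norm (g x) \<le> norm (indicator U x + norm (g x) powr p :: real)"
  proof (intro always_eventually allI)
    fix x
    show "norm (g x) \<le> norm (indicator U x + norm (g x) powr p :: real)"
      using le_one_plus_powr[OF assms(3), of "norm (g x)"] g(2)[of x] by (cases "x \<in> U") simp_all
  qed
qed (use g in simp)

lemma integral_norm_tendsto_0:
  fixes g :: "nat \<Rightarrow> 'a::euclidean_space \<Rightarrow> 'b::euclidean_space"
  assumes U: "U \<in> sets borel" "emeasure lborel U < \<infinity>" and p: "p \<ge> 1"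
    and g: "\<And>n. g n \<in> borel_measurable borel" "\<And>n x. x \<notin> U \<Longrightarrow> g n x = 0"
    and lim: "(\<lambda>n. \<integral>\<^sup>+x. ennreal (norm (g n x) powr p) \<partial>lborel) \<longlonglongrightarrow> 0"
  shows "(\<lambda>n. \<integral>x. norm (g n x) \<partial>lborel) \<longlonglongrightarrow> 0"
proof (rule tendstoI)
  fix e :: real assume e: "e > 0"
  obtain \<eta> where \<eta>: "\<eta> > 0" "\<And>g :: 'a \<Rightarrow> 'b. g \<in> borel_measurable borel \<Longrightarrow> (\<And>x. x \<notin> U \<Longrightarrow> g x = 0) \<Longrightarrow>
    (\<integral>\<^sup>+x. ennreal (norm (g x) powr p) \<partial>lborel) \<le> ennreal \<eta> \<Longrightarrow> (\<integral>\<^sup>+x. ennreal (norm (g x)) \<partial>lborel) < ennreal e"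
    using L1_small_if_Lp_small[OF U p e, where 'b='b] by metis
  have "eventually (\<lambda>n. (\<integral>\<^sup>+x. ennreal (norm (g n x) powr p) \<partial>lborel) < ennreal \<eta>) sequentially"
    using \<eta>(1) by (intro order_tendstoD(2)[OF lim]) simp
  then show "eventually (\<lambda>n. dist (\<integral>x. norm (g n x) \<partial>lborel) 0 < e) sequentially"
  proof eventually_elim
    case (elim n)
    have "(\<integral>\<^sup>+x. ennreal (norm (g n x)) \<partial>lborel) < ennreal e"
      using elim by (intro \<eta>(2) g) simp_all
    then have "ennreal (\<integral>x. norm (g n x) \<partial>lborel) < ennreal e"
      using g(1) integrable_if_Lp[OF U p g, of n] elim
      by (subst (asm) nn_integral_eq_integral) (auto intro: le_less_trans less_imp_le order.strict_trans ennreal_less_top)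
    then show ?case
      by (simp add: ennreal_less_iff)
  qed
qed

text \<open>Each term is at most s, the l^p norm of the family, so the sum is at most the number of
  terms times s.\<close>

lemma sum_powr_le:
  fixes a :: "'i \<Rightarrow> real"
  assumes "finite I" "\<And>i. i \<in> I \<Longrightarrow> a i \<ge> 0" "p > 0"
  shows "(\<Sum>i\<in>I. a i) powr p \<le> real (card I) powr p * (\<Sum>i\<in>I. a i powr p)"
proof -
  define s where "s = (\<Sum>i\<in>I. a i powr p) powr (1 / p)"
  have "a i \<le> s" if "i \<in> I" for i
  proof -
    have "a i powr p \<le> (\<Sum>i\<in>I. a i powr p)"
      using that assms(1) by (intro member_le_sum) auto
    then have "(a i powr p) powr (1 / p) \<le> s"
      unfolding s_def using assms(3) by (intro powr_mono2) auto
    then show ?thesis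
      using assms(2)[OF that] assms(3) by (simp add: powr_powr)
  qed
  then have "(\<Sum>i\<in>I. a i) \<le> real (card I) * s"
    using sum_bounded_above[of I a s] by simp
  then have "(\<Sum>i\<in>I. a i) powr p \<le> (real (card I) * s) powr p"
    using assms by (intro powr_mono2 sum_nonneg) auto
  also have "\<dots> = real (card I) powr p * (\<Sum>i\<in>I. a i powr p)"
    using assms(3) by (simp add: s_def powr_mult powr_powr sum_nonneg)
  finally show ?thesis .
qed

lemma powr_norm_diff_le:
  assumes "p \<ge> 0"
  shows "norm (x - y) powr p \<le> 2 powr p * (norm (x - z) powr p + norm (y - z) powr p)"
proof -
  have "norm (x - y) \<le> norm (x - z) + norm (y - z)"
    using norm_triangle_ineq4[of "x - z" "y - z"] by simp
  then have "norm (x - y) powr p \<le> (norm (x - z) + norm (y - z)) powr p"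
    using assms by (intro powr_mono2) auto
  also have "\<dots> \<le> 2 powr p * (norm (x - z) powr p + norm (y - z) powr p)"
    using assms by (intro powr_add_le) auto
  finally show ?thesis .
qed

lemma nn_integral_powr_diff_le:
  fixes x y z :: "'a::euclidean_space \<Rightarrow> 'b::euclidean_space"
  assumes [measurable]: "x \<in> borel_measurable borel" "y \<in> borel_measurable borel" "z \<in> borel_measurable borel" and p: "p \<ge> 0"
  shows "(\<integral>\<^sup>+t. ennreal (norm (x t - y t) powr p) \<partial>lborel) \<le>
    ennreal (2 powr p) * ((\<integral>\<^sup>+t. ennreal (norm (x t - z t) powr p) \<partial>lborel) + (\<integral>\<^sup>+t. ennreal (norm (y t - z t) powr p) \<partial>lborel))"
proof -
  have "(\<integral>\<^sup>+t. ennreal (norm (x t - y t) powr p) \<partial>lborel) \<le>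
    (\<integral>\<^sup>+t. ennreal (2 powr p) * (ennreal (norm (x t - z t) powr p) + ennreal (norm (y t - z t) powr p)) \<partial>lborel)"
  proof (rule nn_integral_mono)
    fix t
    have "ennreal (norm (x t - y t) powr p) \<le> ennreal (2 powr p * (norm (x t - z t) powr p + norm (y t - z t) powr p))"
      by (rule ennreal_leI[OF powr_norm_diff_le[OF p]])
    then show "ennreal (norm (x t - y t) powr p) \<le> ennreal (2 powr p) * (ennreal (norm (x t - z t) powr p) + ennreal (norm (y t - z t) powr p))"
      by (simp add: ennreal_mult)
  qed
  also have "\<dots> = ennreal (2 powr p) * ((\<integral>\<^sup>+t. ennreal (norm (x t - z t) powr p) \<partial>lborel) + (\<integral>\<^sup>+t. ennreal (norm (y t - z t) powr p) \<partial>lborel))"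
    by (simp add: nn_integral_cmult nn_integral_add)
  finally show ?thesis .
qed

lemma poincare_mean_Lp:
  fixes f :: "'a::euclidean_space \<Rightarrow> 'b::euclidean_space"
  assumes U: "open U" "convex U" "emeasure lborel U < \<infinity>" and d: "\<And>x y. x \<in> U \<Longrightarrow> y \<in> U \<Longrightarrow> norm (x - y) \<le> d"
    and wp: "\<And>i. i \<in> Basis \<Longrightarrow> weak_pd U i f (g i)" and p: "p \<ge> 1"
    and fin: "\<And>i. i \<in> Basis \<Longrightarrow> (\<integral>\<^sup>+x. ennreal (norm (g i x) powr p) \<partial>lborel) < \<infinity>"
  shows "(\<integral>\<^sup>+x. ennreal (norm (indicator U x *\<^sub>R (f x - (1 / measure lborel U) *\<^sub>R integral\<^sup>L lborel f)) powr p) \<partial>lborel) \<le>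
    ennreal (d powr p * 2 ^ DIM('a) * DIM('a) powr p) * (\<Sum>i\<in>Basis. \<integral>\<^sup>+x. ennreal (norm (g i x) powr p) \<partial>lborel)"
proof -
  have g_m: "g i \<in> borel_measurable borel" if "i \<in> Basis" for i
    by (rule integrable_lborel_borel[OF weak_pdD(2)[OF wp[OF that]]])
  define S where "S x = (\<Sum>i\<in>Basis. norm (g i x)) powr p" for x
  have S_m: "S \<in> borel_measurable borel"
  proof -
    have [measurable]: "(\<lambda>x. \<Sum>i\<in>Basis. norm (g i x)) \<in> borel_measurable borel"
    proof (rule borel_measurable_sum)
      fix i :: 'a assume "i \<in> Basis"
      note [measurable] = g_m[OF this]
      show "(\<lambda>x. norm (g i x)) \<in> borel_measurable borel" by measurable
    qed
    show ?thesis
      unfolding S_def by measurable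
  qed
  have S_le: "(\<integral>\<^sup>+x. ennreal (S x) \<partial>lborel) \<le> ennreal (DIM('a) powr p) * (\<Sum>i\<in>Basis. \<integral>\<^sup>+x. ennreal (norm (g i x) powr p) \<partial>lborel)"
  proof -
    have "(\<integral>\<^sup>+x. ennreal (S x) \<partial>lborel) \<le> (\<integral>\<^sup>+x. ennreal (DIM('a) powr p) * (\<Sum>i\<in>Basis. ennreal (norm (g i x) powr p)) \<partial>lborel)"
    proof (rule nn_integral_mono)
      fix x
      have "ennreal (S x) \<le> ennreal (DIM('a) powr p * (\<Sum>i\<in>Basis. norm (g i x) powr p))"
        unfolding S_def using p by (intro ennreal_leI sum_powr_le) auto
      also have "\<dots> = ennreal (DIM('a) powr p) * (\<Sum>i\<in>Basis. ennreal (norm (g i x) powr p))"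
        by (simp add: ennreal_mult sum_nonneg)
      finally show "ennreal (S x) \<le> \<dots>" .
    qed
    also have "\<dots> = ennreal (DIM('a) powr p) * (\<integral>\<^sup>+x. (\<Sum>i\<in>Basis. ennreal (norm (g i x) powr p)) \<partial>lborel)"
      using g_m by (intro nn_integral_cmult borel_measurable_sum) simp
    also have "(\<integral>\<^sup>+x. (\<Sum>i\<in>Basis. ennreal (norm (g i x) powr p)) \<partial>lborel) = (\<Sum>i\<in>Basis. \<integral>\<^sup>+x. ennreal (norm (g i x) powr p) \<partial>lborel)"
      using g_m by (intro nn_integral_sum) simp
    finally show ?thesis .
  qed
  also have "\<dots> < \<infinity>"
    using fin by (auto simp: ennreal_mult_less_top)
  finally have int_S: "integrable lborel S"
    using S_m by (intro integrableI_bounded) (simp_all add: S_def)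
  have "(\<integral>\<^sup>+x. ennreal (norm (indicator U x *\<^sub>R (f x - (1 / measure lborel U) *\<^sub>R integral\<^sup>L lborel f)) powr p) \<partial>lborel) =
      (\<integral>\<^sup>+x. indicator U x * ennreal (norm (f x - (1 / measure lborel U) *\<^sub>R integral\<^sup>L lborel f) powr p) \<partial>lborel)"
    by (intro nn_integral_cong) (auto simp: indicator_def)
  also have "\<dots> \<le> ennreal (d powr p * 2 ^ DIM('a)) * (\<integral>\<^sup>+x. ennreal (S x) \<partial>lborel)"
    unfolding S_def by (rule poincare_mean[OF U d wp p int_S[unfolded S_def]])
  also have "\<dots> \<le> ennreal (d powr p * 2 ^ DIM('a)) * (ennreal (DIM('a) powr p) * (\<Sum>i\<in>Basis. \<integral>\<^sup>+x. ennreal (norm (g i x) powr p) \<partial>lborel))"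
    by (intro mult_left_mono S_le) simp
  also have "\<dots> = ennreal (d powr p * 2 ^ DIM('a) * DIM('a) powr p) * (\<Sum>i\<in>Basis. \<integral>\<^sup>+x. ennreal (norm (g i x) powr p) \<partial>lborel)"
    by (simp add: ennreal_mult mult.assoc)
  finally show ?thesis .
qed

text \<open>Poincare's inequality for differences makes the centred functions Cauchy in L^p, with
  distances bounded by the gradient errors \<Delta> n + \<Delta> k. The limit comes from an almost
  everywhere convergent subsequence, Fatou's lemma extends the Cauchy bounds to it, and closedness
  of weak differentiation identifies its gradient.\<close>

lemma sobolev_strong_limit:
  fixes f :: "nat \<Rightarrow> 'a::euclidean_space \<Rightarrow> 'b::euclidean_space" and g :: "nat \<Rightarrow> 'a \<Rightarrow> 'a \<Rightarrow> 'b"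
  assumes U: "open U" "convex U" "emeasure lborel U < \<infinity>" and d: "\<And>x y. x \<in> U \<Longrightarrow> y \<in> U \<Longrightarrow> norm (x - y) \<le> d"
    and wp: "\<And>n i. i \<in> Basis \<Longrightarrow> weak_pd U i (f n) (g n i)" and p: "p \<ge> 1"
    and fin: "\<And>n i. i \<in> Basis \<Longrightarrow> (\<integral>\<^sup>+x. ennreal (norm (g n i x) powr p) \<partial>lborel) < \<infinity>"
    and z: "\<And>i. i \<in> Basis \<Longrightarrow> z i \<in> borel_measurable borel" "\<And>i x. i \<in> Basis \<Longrightarrow> x \<notin> U \<Longrightarrow> z i x = 0"
    and lim: "\<And>i. i \<in> Basis \<Longrightarrow> (\<lambda>n. \<integral>\<^sup>+x. ennreal (norm (g n i x - z i x) powr p) \<partial>lborel) \<longlonglongrightarrow> 0"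
  defines "w \<equiv> \<lambda>n x. indicator U x *\<^sub>R (f n x - (1 / measure lborel U) *\<^sub>R integral\<^sup>L lborel (f n))"
  obtains u\<^sub>0 where "u\<^sub>0 \<in> borel_measurable borel" "\<And>x. x \<notin> U \<Longrightarrow> u\<^sub>0 x = 0"
    "\<And>n. (\<integral>\<^sup>+x. ennreal (norm (w n x) powr p) \<partial>lborel) < \<infinity>" "(\<integral>\<^sup>+x. ennreal (norm (u\<^sub>0 x) powr p) \<partial>lborel) < \<infinity>"
    "(\<lambda>n. \<integral>\<^sup>+x. ennreal (norm (w n x - u\<^sub>0 x) powr p) \<partial>lborel) \<longlonglongrightarrow> 0"
    "\<And>n i. i \<in> Basis \<Longrightarrow> weak_pd U i (w n) (g n i)" "\<And>i. i \<in> Basis \<Longrightarrow> weak_pd U i u\<^sub>0 (z i)"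
proof -
  have Um [measurable]: "U \<in> sets borel" using U(1) by simp
  have p0: "p \<ge> 0" using p by simp
  obtain b :: 'a where b: "b \<in> Basis" using nonempty_Basis by blast
  define m where "m = measure lborel U"
  define C where "C = d powr p * 2 ^ DIM('a) * DIM('a) powr p"
  have "C \<ge> 0" by (simp add: C_def)
  have g_m: "g n i \<in> borel_measurable borel" if "i \<in> Basis" for n i
    by (rule integrable_lborel_borel[OF weak_pdD(2)[OF wp[OF that]]])
  have f_int: "integrable lborel (f n)" for n
    by (rule weak_pdD(1)[OF wp[OF b]])
  have f_off: "f n x = 0" if "x \<notin> U" for n x
    by (rule weak_pdD(3)[OF wp[OF b] that])
  have wp_w: "weak_pd U i (w n) (g n i)" if "i \<in> Basis" for n i
  proof -
    have "weak_pd U i (\<lambda>x. f n x - indicator U x *\<^sub>R ((1 / m) *\<^sub>R integral\<^sup>L lborel (f n))) (\<lambda>x. g n i x - 0)"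
      by (rule weak_pd_diff[OF that wp[OF that] weak_pd_const[OF U(1,3) that]])
    also have "(\<lambda>x. f n x - indicator U x *\<^sub>R ((1 / m) *\<^sub>R integral\<^sup>L lborel (f n))) = w n"
      using f_off by (auto simp: w_def m_def fun_eq_iff indicator_def)
    finally show ?thesis by simp
  qed
  have w_m [measurable]: "w n \<in> borel_measurable borel" and w_int: "integrable lborel (w n)"
    and w_off: "x \<notin> U \<Longrightarrow> w n x = 0" for n x
    using weak_pdD(1,3)[OF wp_w[OF b]] integrable_lborel_borel by blast+
  have w_fin: "(\<integral>\<^sup>+x. ennreal (norm (w n x) powr p) \<partial>lborel) < \<infinity>" for n
  proof -
    have "(\<integral>\<^sup>+x. ennreal (norm (w n x) powr p) \<partial>lborel) \<le> ennreal C * (\<Sum>i\<in>Basis. \<integral>\<^sup>+x. ennreal (norm (g n i x) powr p) \<partial>lborel)"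
      unfolding w_def C_def by (rule poincare_mean_Lp[OF U d wp p fin])
    also have "\<dots> < \<infinity>"
      using fin by (auto simp: ennreal_mult_less_top)
    finally show ?thesis .
  qed
  define \<Delta> where "\<Delta> n = (\<Sum>i\<in>Basis. \<integral>\<^sup>+x. ennreal (norm (g n i x - z i x) powr p) \<partial>lborel)" for n
  have \<Delta>: "\<Delta> \<longlonglongrightarrow> 0"
    unfolding \<Delta>_def using tendsto_sum[of Basis "\<lambda>i n. \<integral>\<^sup>+x. ennreal (norm (g n i x - z i x) powr p) \<partial>lborel" "\<lambda>i. 0"] lim by simp
  define C' where "C' = C * 2 powr p"
  have ww: "(\<integral>\<^sup>+x. ennreal (norm (w n x - w k x) powr p) \<partial>lborel) \<le> ennreal C' * (\<Delta> n + \<Delta> k)" for n k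
  proof -
    have wp_nk: "weak_pd U i (\<lambda>x. f n x - f k x) (\<lambda>x. g n i x - g k i x)" if "i \<in> Basis" for i
      by (rule weak_pd_diff[OF that wp[OF that] wp[OF that]])
    have 1: "(\<integral>\<^sup>+x. ennreal (norm (g n i x - g k i x) powr p) \<partial>lborel) \<le>
      ennreal (2 powr p) * ((\<integral>\<^sup>+x. ennreal (norm (g n i x - y x) powr p) \<partial>lborel) + (\<integral>\<^sup>+x. ennreal (norm (g k i x - y x) powr p) \<partial>lborel))"
      if "i \<in> Basis" "y \<in> borel_measurable borel" for i y
      by (rule nn_integral_powr_diff_le[OF g_m[OF that(1)] g_m[OF that(1)] that(2) p0])
    have fin': "(\<integral>\<^sup>+x. ennreal (norm (g n i x - g k i x) powr p) \<partial>lborel) < \<infinity>" if "i \<in> Basis" for i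
      using 1[OF that, of "\<lambda>x. 0"] fin[OF that, of n] fin[OF that, of k]
      by (auto intro: le_less_trans simp: ennreal_mult_less_top)
    have eq: "w n x - w k x = indicator U x *\<^sub>R ((f n x - f k x) - (1 / m) *\<^sub>R integral\<^sup>L lborel (\<lambda>x. f n x - f k x))" for x
      using f_int by (simp add: w_def m_def algebra_simps)
    have "(\<integral>\<^sup>+x. ennreal (norm (w n x - w k x) powr p) \<partial>lborel) \<le> ennreal C * (\<Sum>i\<in>Basis. \<integral>\<^sup>+x. ennreal (norm (g n i x - g k i x) powr p) \<partial>lborel)"
      unfolding eq C_def m_def by (rule poincare_mean_Lp[OF U d wp_nk p fin'])
    also have "\<dots> \<le> ennreal C * (\<Sum>i\<in>Basis. ennreal (2 powr p) * ((\<integral>\<^sup>+x. ennreal (norm (g n i x - z i x) powr p) \<partial>lborel) + (\<integral>\<^sup>+x. ennreal (norm (g k i x - z i x) powr p) \<partial>lborel)))"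
      by (intro mult_left_mono sum_mono 1 z(1)) simp_all
    also have "\<dots> = ennreal C' * (\<Delta> n + \<Delta> k)"
      using \<open>C \<ge> 0\<close> by (simp add: C'_def \<Delta>_def ennreal_mult sum.distrib sum_distrib_left[symmetric] mult.assoc)
    finally show ?thesis .
  qed
  have \<Delta>_small: "\<exists>N. \<forall>n\<ge>N. ennreal C' * (\<Delta> n + \<Delta> n) \<le> ennreal \<eta> \<and> (\<forall>k\<ge>N. ennreal C' * (\<Delta> n + \<Delta> k) \<le> ennreal \<eta>)" if "\<eta> > 0" for \<eta>
  proof -
    define \<eta>' where "\<eta>' = \<eta> / (2 * (C' + 1))"
    have C': "C' \<ge> 0" using \<open>C \<ge> 0\<close> by (simp add: C'_def)
    have \<eta>': "\<eta>' > 0" "C' * (\<eta>' + \<eta>') \<le> \<eta>"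
    proof -
      show "\<eta>' > 0" using that C' by (simp add: \<eta>'_def)
      have "C' * (\<eta>' + \<eta>') \<le> (C' + 1) * (\<eta>' + \<eta>')"
        using \<open>\<eta>' > 0\<close> by (intro mult_right_mono) auto
      also have "\<dots> = \<eta>' * (2 * (C' + 1))"
        by simp
      also have "\<dots> = \<eta>"
      proof -
        have "0 < 2 * (C' + 1)" using C' by simp
        then have "2 * (C' + 1) \<noteq> 0" by (rule less_imp_neq[symmetric])
        then show ?thesis
          unfolding \<eta>'_def by (metis nonzero_divide_eq_eq)
      qed
      finally show "C' * (\<eta>' + \<eta>') \<le> \<eta>" .
    qed
    have "eventually (\<lambda>n. \<Delta> n < ennreal \<eta>') sequentially"
      using \<eta>'(1) by (intro order_tendstoD(2)[OF \<Delta>]) simp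
    then obtain N where N: "\<And>n. n \<ge> N \<Longrightarrow> \<Delta> n < ennreal \<eta>'"
      by (auto simp: eventually_sequentially)
    have "ennreal C' * (\<Delta> n + \<Delta> k) \<le> ennreal \<eta>" if "n \<ge> N" "k \<ge> N" for n k
    proof -
      have "ennreal C' * (\<Delta> n + \<Delta> k) \<le> ennreal C' * (ennreal \<eta>' + ennreal \<eta>')"
        using N[OF that(1)] N[OF that(2)] by (intro mult_left_mono add_mono) simp_all
      also have "\<dots> = ennreal (C' * (\<eta>' + \<eta>'))"
        using ennreal_mult[OF C', of "\<eta>' + \<eta>'"] ennreal_plus[of \<eta>' \<eta>'] \<eta>'(1) by (simp del: ennreal_plus)
      also have "\<dots> \<le> ennreal \<eta>" by (rule ennreal_leI[OF \<eta>'(2)])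
      finally show ?thesis .
    qed
    then show ?thesis by blast
  qed
  have "\<exists>N. \<forall>n\<ge>N. \<forall>k\<ge>N. (\<integral>x. norm (w n x - w k x) \<partial>lborel) < e" if e: "e > 0" for e
  proof -
    obtain \<eta> where \<eta>: "\<eta> > 0" "\<And>g :: 'a \<Rightarrow> 'b. g \<in> borel_measurable borel \<Longrightarrow> (\<And>x. x \<notin> U \<Longrightarrow> g x = 0) \<Longrightarrow>
      (\<integral>\<^sup>+x. ennreal (norm (g x) powr p) \<partial>lborel) \<le> ennreal \<eta> \<Longrightarrow> (\<integral>\<^sup>+x. ennreal (norm (g x)) \<partial>lborel) < ennreal e"
      using L1_small_if_Lp_small[OF Um U(3) p e, where 'b='b] by metis
    obtain N where N: "\<And>n k. n \<ge> N \<Longrightarrow> k \<ge> N \<Longrightarrow> ennreal C' * (\<Delta> n + \<Delta> k) \<le> ennreal \<eta>"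
      using \<Delta>_small[OF \<eta>(1)] by blast
    have "(\<integral>x. norm (w n x - w k x) \<partial>lborel) < e" if "n \<ge> N" "k \<ge> N" for n k
    proof -
      have "(\<integral>\<^sup>+x. ennreal (norm (w n x - w k x)) \<partial>lborel) < ennreal e"
        by (rule \<eta>(2)) (use w_off order_trans[OF ww N[OF that]] in simp_all)
      moreover have "(\<integral>\<^sup>+x. ennreal (norm (w n x - w k x)) \<partial>lborel) = ennreal (\<integral>x. norm (w n x - w k x) \<partial>lborel)"
        using w_int by (intro nn_integral_eq_integral) auto
      ultimately show ?thesis
        by (simp add: ennreal_less_iff)
    qed
    then show ?thesis by blast
  qed
  from L1_Cauchy_AE_subseq[OF w_int this]
  obtain s :: "nat \<Rightarrow> nat" where s: "strict_mono s" "AE x in lborel. convergent (\<lambda>n. w (s n) x)"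
    by blast
  \<comment> \<open>The value of \<open>lim\<close> is meaningful only almost everywhere; elsewhere
    it is some default, which changes nothing up to null sets.\<close>
  define u\<^sub>0 where "u\<^sub>0 x = indicator U x *\<^sub>R lim (\<lambda>n. w (s n) x)" for x
  have u0_m [measurable]: "u\<^sub>0 \<in> borel_measurable borel"
  proof -
    have [measurable]: "(\<lambda>x. lim (\<lambda>n. w (s n) x)) \<in> borel_measurable borel"
      by (rule borel_measurable_lim_metric) measurable
    show ?thesis
      unfolding u\<^sub>0_def by measurable
  qed
  have u0_off: "u\<^sub>0 x = 0" if "x \<notin> U" for x
    using that by (simp add: u\<^sub>0_def)
  have u0_lim: "AE x in lborel. (\<lambda>n. w (s n) x) \<longlonglongrightarrow> u\<^sub>0 x"
    using s(2)
  proof eventually_elim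
    case (elim x)
    then show ?case
      using w_off[of x] by (cases "x \<in> U") (simp_all add: u\<^sub>0_def convergent_LIMSEQ_iff)
  qed
  have wu: "\<exists>N. \<forall>n\<ge>N. (\<integral>\<^sup>+x. ennreal (norm (w n x - u\<^sub>0 x) powr p) \<partial>lborel) \<le> ennreal \<eta>" if \<eta>0: "\<eta> > 0" for \<eta>
  proof -
    obtain N where N: "\<And>n k. n \<ge> N \<Longrightarrow> k \<ge> N \<Longrightarrow> ennreal C' * (\<Delta> n + \<Delta> k) \<le> ennreal \<eta>"
      using \<Delta>_small[OF \<eta>0] by blast
    have "(\<integral>\<^sup>+x. ennreal (norm (w n x - u\<^sub>0 x) powr p) \<partial>lborel) \<le> ennreal \<eta>" if n: "n \<ge> N" for n
    \<comment> \<open>The shift by N guarantees s (k + N) \<ge> N, so the Cauchy bound holds for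
      every k.\<close>
    proof (rule nn_integral_le_if_liminf[where A = "\<lambda>k x. ennreal (norm (w n x - w (s (k + N)) x) powr p)"])
      show "AE x in lborel. ennreal (norm (w n x - u\<^sub>0 x) powr p) \<le> liminf (\<lambda>k. ennreal (norm (w n x - w (s (k + N)) x) powr p))"
        using u0_lim
      proof eventually_elim
        case (elim x)
        have "(\<lambda>k. ennreal (norm (w n x - w (s (k + N)) x) powr p)) \<longlonglongrightarrow> ennreal (norm (w n x - u\<^sub>0 x) powr p)"
          using p by (intro tendsto_ennrealI tendsto_powr2 tendsto_norm tendsto_diff tendsto_const LIMSEQ_ignore_initial_segment elim) auto
        then show ?case
          by (rule le_liminf_if_tendsto) simp
      qed
      have "N \<le> s (k + N)" for k
        using seq_suble[OF s(1), of "k + N"] by linarith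
      then show "(\<integral>\<^sup>+x. ennreal (norm (w n x - w (s (k + N)) x) powr p) \<partial>lborel) \<le> ennreal \<eta>" for k
        using order_trans[OF ww N[OF n]] by blast
    qed measurable
    then show ?thesis by blast
  qed
  have w_lim: "(\<lambda>n. \<integral>\<^sup>+x. ennreal (norm (w n x - u\<^sub>0 x) powr p) \<partial>lborel) \<longlonglongrightarrow> 0"
  proof (rule order_tendstoI)
    fix a :: ennreal assume "0 < a"
    then obtain \<eta> where "\<eta> > 0" "ennreal \<eta> < a"
      by (metis ennreal_0 ennreal_less_zero_iff ennreal_less_top dense ennreal_cases less_ennreal.rep_eq not_less_zero order_less_trans top.not_eq_extremum)
    with wu[of \<eta>] show "eventually (\<lambda>n. (\<integral>\<^sup>+x. ennreal (norm (w n x - u\<^sub>0 x) powr p) \<partial>lborel) < a) sequentially"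
      by (auto simp: eventually_sequentially intro: le_less_trans)
  qed simp
  have u0_fin: "(\<integral>\<^sup>+x. ennreal (norm (u\<^sub>0 x) powr p) \<partial>lborel) < \<infinity>"
  proof -
    obtain n where n: "(\<integral>\<^sup>+x. ennreal (norm (w n x - u\<^sub>0 x) powr p) \<partial>lborel) \<le> ennreal 1"
      using wu[of 1] by auto
    have "(\<integral>\<^sup>+x. ennreal (norm (u\<^sub>0 x - 0) powr p) \<partial>lborel) \<le>
      ennreal (2 powr p) * ((\<integral>\<^sup>+x. ennreal (norm (u\<^sub>0 x - w n x) powr p) \<partial>lborel) + (\<integral>\<^sup>+x. ennreal (norm (0 - w n x) powr p) \<partial>lborel))"
      by (rule nn_integral_powr_diff_le) (use p0 in simp_all)
    also have "\<dots> < \<infinity>"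
      using le_less_trans[OF n ennreal_less_top] w_fin[of n] by (auto simp: ennreal_mult_less_top norm_minus_commute)
    finally show ?thesis by simp
  qed
  have wp_u0: "weak_pd U i u\<^sub>0 (z i)" if i: "i \<in> Basis" for i
  proof (rule weak_pd_limit[OF i wp_w[OF i]])
    show "integrable lborel u\<^sub>0"
      by (rule integrable_if_Lp[OF Um U(3) p u0_m u0_off u0_fin])
    show "(\<lambda>n. \<integral>x. norm (w n x - u\<^sub>0 x) \<partial>lborel) \<longlonglongrightarrow> 0"
      by (rule integral_norm_tendsto_0[OF Um U(3) p _ _ w_lim]) (use w_off u0_off in simp_all)
    note [measurable] = z(1)[OF i] g_m[OF i]
    show "(\<lambda>n. \<integral>x. norm (g n i x - z i x) \<partial>lborel) \<longlonglongrightarrow> 0"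
      by (rule integral_norm_tendsto_0[OF Um U(3) p _ _ lim[OF i]]) (use z(2)[OF i] weak_pdD(4)[OF wp[OF i]] in simp_all)
    have "eventually (\<lambda>n. (\<integral>\<^sup>+x. ennreal (norm (g n i x - z i x) powr p) \<partial>lborel) < 1) sequentially"
      by (intro order_tendstoD(2)[OF lim[OF i]]) simp
    then obtain n where n: "(\<integral>\<^sup>+x. ennreal (norm (g n i x - z i x) powr p) \<partial>lborel) < 1"
      by (auto simp: eventually_sequentially)
    have "(\<integral>\<^sup>+x. ennreal (norm (z i x - 0) powr p) \<partial>lborel) \<le>
      ennreal (2 powr p) * ((\<integral>\<^sup>+x. ennreal (norm (z i x - g n i x) powr p) \<partial>lborel) + (\<integral>\<^sup>+x. ennreal (norm (0 - g n i x) powr p) \<partial>lborel))"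
      by (rule nn_integral_powr_diff_le) (use p0 in simp_all)
    also have "\<dots> < \<infinity>"
      using order.strict_trans[OF n ennreal_one_less_top] fin[OF i, of n] by (auto simp: ennreal_mult_less_top norm_minus_commute)
    finally show "integrable lborel (z i)"
      by (intro integrable_if_Lp[OF Um U(3) p z(1)[OF i] z(2)[OF i]]) simp_all
  qed (use u0_off z(2)[OF i] in simp_all)
  show ?thesis
    by (rule that[OF u0_m u0_off w_fin u0_fin w_lim wp_w wp_u0])
qed

section \<open>Thin films\<close>

lemma cylinder_geometry:
  assumes "bounded \<omega>" "convex \<omega>" "open \<omega>"
  shows "open (cylinder \<omega>)" "convex (cylinder \<omega>)" "bounded (cylinder \<omega>)"
proof -
  define L where "L x = (vector [x$1, x$2] :: real^2)" for x :: "real^3"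
  have L: "linear L"
    by (rule linearI) (simp_all add: L_def vec_eq_iff forall_2)
  have N: "linear (\<lambda>x::real^3. x $ 3)"
    by (rule linearI) simp_all
  have eq: "cylinder \<omega> = L -` \<omega> \<inter> (\<lambda>x. x $ 3) -` {-1/2<..<1/2}"
    by (auto simp: cylinder_def L_def)
  show "open (cylinder \<omega>)"
    unfolding eq using assms(3)
    by (intro open_Int open_vimage linear_continuous_on linear_conv_bounded_linear[THEN iffD1] L N) auto
  show "convex (cylinder \<omega>)"
    unfolding eq using assms(2) by (intro convex_Int convex_linear_vimage L N) auto
  obtain R where R: "\<And>y. y \<in> \<omega> \<Longrightarrow> norm y \<le> R"
    using assms(1) by (auto simp: bounded_iff)
  have "norm x \<le> R + R + 1" if "x \<in> cylinder \<omega>" for x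
  proof -
    have "norm (L x) \<le> R" "\<bar>x $ 3\<bar> \<le> 1"
      using that R[of "L x"] by (auto simp: eq)
    moreover have "\<bar>x $ 1\<bar> \<le> norm (L x)" "\<bar>x $ 2\<bar> \<le> norm (L x)"
      using component_le_norm_cart[of "L x" 1] component_le_norm_cart[of "L x" 2] by (simp_all add: L_def)
    moreover have "norm x \<le> \<bar>x $ 1\<bar> + \<bar>x $ 2\<bar> + \<bar>x $ 3\<bar>"
      using norm_le_l1_cart[of x] by (simp add: sum_3)
    ultimately show ?thesis by linarith
  qed
  then show "bounded (cylinder \<omega>)"
    by (auto simp: bounded_iff)
qed

section \<open>Matrices and their columns\<close>

lemma Basis_3: "(Basis :: (real^3) set) = range (\<lambda>j. axis j 1)"
  by (auto simp: Basis_vec_def)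

lemma axis_in_Basis [simp]: "axis j 1 \<in> (Basis :: (real^3) set)"
  by (simp add: Basis_3)

text \<open>Matrices are vectors of rows, whereas partial derivatives form columns; this is the
  assembly from columns, and the squared Frobenius norm splits accordingly.\<close>

definition cols :: "(3 \<Rightarrow> real^3) \<Rightarrow> real^3^3" where
  "cols v = (\<chi> i k. v k $ i)"

lemma column_cols [simp]: "column k (cols v) = v k"
  by (simp add: column_def cols_def vec_eq_iff)

lemma cols_column: "cols (\<lambda>k. column k M) = M"
  by (simp add: column_def cols_def vec_eq_iff)

lemma norm_cols: "(norm (cols v))\<^sup>2 = (\<Sum>k\<in>UNIV. (norm (v k))\<^sup>2)"
  unfolding power2_norm_eq_inner inner_vec_def cols_def vec_lambda_beta by (rule sum.swap)

lemma norm_column_le: "norm (column k (M :: real^3^3)) \<le> norm M"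
proof -
  have "(norm (column k M))\<^sup>2 \<le> (\<Sum>k\<in>UNIV. (norm (column k M))\<^sup>2)"
    by (rule member_le_sum) auto
  also have "\<dots> = (norm M)\<^sup>2"
    using norm_cols[of "\<lambda>k. column k M"] by (simp add: cols_column)
  finally show ?thesis
    by (rule power2_le_imp_le) simp
qed

lemma bounded_linear_column: "bounded_linear (column k :: real^3^3 \<Rightarrow> real^3)"
proof -
  have "linear (column k :: real^3^3 \<Rightarrow> real^3)"
    by (rule linearI) (simp_all add: column_def vec_eq_iff)
  then show ?thesis by (simp add: linear_conv_bounded_linear)
qed

text \<open>The matrix is the sum of its columns under the linear embeddings e k, so linearity of
  the weak derivative suffices.\<close>

lemma weak_pd_cols:
  assumes "i \<in> Basis" "\<And>k. weak_pd U i (f k) (g k)"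
  shows "weak_pd U i (\<lambda>x. cols (\<lambda>k. f k x)) (\<lambda>x. cols (\<lambda>k. g k x))"
proof -
  define e where "e k v = (\<chi> i j. if j = k then v $ i else 0 :: real^3^3)" for k :: 3 and v :: "real^3"
  have "linear (e k)" for k
    by (rule linearI) (simp_all add: e_def vec_eq_iff)
  then have "bounded_linear (e k)" for k
    by (simp add: linear_conv_bounded_linear)
  then have "weak_pd U i (\<lambda>x. \<Sum>k\<in>UNIV. e k (f k x)) (\<lambda>x. \<Sum>k\<in>UNIV. e k (g k x))"
    by (intro weak_pd_sum[OF assms(1)] weak_pd_linear[OF _ assms(1) assms(2)])
  moreover have "(\<Sum>k\<in>UNIV. e k (v k)) = cols v" for v
    by (simp add: vec_eq_iff e_def cols_def)
  ultimately show ?thesis by simp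
qed

section \<open>Lebesgue norms through Borel representatives\<close>

lemma
  fixes F :: "'a::euclidean_space \<Rightarrow> 'b::euclidean_space"
  assumes F: "F \<in> borel_measurable (lebesgue_on U)" and U: "U \<in> sets borel"
    and F': "F' \<in> borel_measurable borel" "\<And>x. x \<notin> U \<Longrightarrow> F' x = 0" "AE x in lebesgue_on U. F x = F' x"
  shows Lp_space_representative: "F \<in> Lp_space p U \<longleftrightarrow> (\<integral>\<^sup>+x. ennreal (norm (F' x) powr p) \<partial>lborel) < \<infinity>"
    and Lp_norm_representative: "Lp_norm p U F = enn2real (\<integral>\<^sup>+x. ennreal (norm (F' x) powr p) \<partial>lborel) powr (1 / p)"
proof -
  have Fp: "(\<lambda>x. norm (F x) powr p) \<in> borel_measurable (lebesgue_on U)"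
    using F by measurable
  note [measurable] = F'(1)
  have F'p: "(\<lambda>x. norm (F' x) powr p) \<in> borel_measurable borel"
    by measurable
  have off: "norm (F' x) powr p = 0" if "x \<notin> U" for x
    using F'(2)[OF that] by simp
  have eq: "AE x in lebesgue_on U. norm (F x) powr p = norm (F' x) powr p"
    using F'(3) by eventually_elim simp
  have "integrable (lebesgue_on U) (\<lambda>x. norm (F x) powr p) \<longleftrightarrow> integrable lborel (\<lambda>x. norm (F' x) powr p)"
    by (rule integrable_lebesgue_on_representative[OF Fp U F'p off eq])
  then show "F \<in> Lp_space p U \<longleftrightarrow> (\<integral>\<^sup>+x. ennreal (norm (F' x) powr p) \<partial>lborel) < \<infinity>"
    using F F'p by (simp add: Lp_space_def integrable_iff_bounded)
  have "(\<integral>x. norm (F x) powr p \<partial>lebesgue_on U) = (\<integral>x. norm (F' x) powr p \<partial>lborel)"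
    by (rule integral_lebesgue_on_representative[OF Fp U F'p off eq])
  also have "\<dots> = enn2real (\<integral>\<^sup>+x. ennreal (norm (F' x) powr p) \<partial>lborel)"
    using F'p by (intro integral_eq_nn_integral) auto
  finally show "Lp_norm p U F = enn2real (\<integral>\<^sup>+x. ennreal (norm (F' x) powr p) \<partial>lborel) powr (1 / p)"
    by (simp add: Lp_norm_def)
qed

lemma Lp_norm_tendsto_0:
  fixes F :: "nat \<Rightarrow> 'a::euclidean_space \<Rightarrow> 'b::euclidean_space"
  assumes F: "\<And>n. F n \<in> borel_measurable (lebesgue_on U)" and U: "U \<in> sets borel"
    and F': "\<And>n. F' n \<in> borel_measurable borel" "\<And>n x. x \<notin> U \<Longrightarrow> F' n x = 0" "\<And>n. AE x in lebesgue_on U. F n x = F' n x"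
    and p: "p > 0" and lim: "(\<lambda>n. \<integral>\<^sup>+x. ennreal (norm (F' n x) powr p) \<partial>lborel) \<longlonglongrightarrow> 0"
  shows "(\<lambda>n. Lp_norm p U (F n)) \<longlonglongrightarrow> 0"
proof -
  have "(\<lambda>n. enn2real (\<integral>\<^sup>+x. ennreal (norm (F' n x) powr p) \<partial>lborel)) \<longlonglongrightarrow> 0"
    using lim by (intro tendsto_enn2real) simp_all
  then have "(\<lambda>n. enn2real (\<integral>\<^sup>+x. ennreal (norm (F' n x) powr p) \<partial>lborel) powr (1 / p)) \<longlonglongrightarrow> 0 powr (1 / p)"
    using p by (intro tendsto_powr2 tendsto_const) auto
  then show ?thesis
    using p by (simp add: Lp_norm_representative[OF F U F'])
qed

section \<open>Variation of the limit phase\<close>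

text \<open>Against a C^1 function the indicator is the limit of the v n, for which the derivative
  can be moved onto v n. The mass bound for w n survives in the limit, although w n itself need not
  converge.\<close>

lemma phase_integral_bound:
  fixes v :: "nat \<Rightarrow> 'a::euclidean_space \<Rightarrow> real" and \<psi> :: "'a \<Rightarrow> real"
  assumes U: "open U" and i: "i \<in> Basis" and wp: "\<And>n. weak_pd U i (v n) (w n)"
    and v: "\<And>n x. \<bar>v n x\<bar> \<le> 1" "AE x in lborel. (\<lambda>n. v n x) \<longlonglongrightarrow> indicator c x" "c \<in> sets borel"
    and M: "0 \<le> M" "\<And>n. (\<integral>\<^sup>+x. ennreal \<bar>w n x\<bar> \<partial>lborel) \<le> ennreal M"
    and \<psi>: "\<psi> \<in> Ck_compact (Suc 0) U" "\<And>x. \<bar>\<psi> x\<bar> \<le> N"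
  shows "\<bar>\<integral>x. frechet_derivative \<psi> (at x) i * indicator c x \<partial>lborel\<bar> \<le> N * M"
proof (rule tendsto_upperbound)
  define d where "d x = frechet_derivative \<psi> (at x) i" for x
  have d_Ck: "d \<in> Ck_compact 0 U"
    unfolding d_def by (rule frechet_derivative_Ck_compact[OF \<psi>(1) i])
  have [measurable]: "d \<in> borel_measurable borel" "c \<in> sets borel"
    by (rule Ck_compact_measurable[OF d_Ck]) (rule v(3))
  have [measurable]: "v n \<in> borel_measurable borel" for n
    by (rule integrable_lborel_borel[OF weak_pdD(1)[OF wp]])
  have "(\<lambda>n. \<integral>x. d x * v n x \<partial>lborel) \<longlonglongrightarrow> (\<integral>x. d x * indicator c x \<partial>lborel)"
  proof (rule integral_dominated_convergence[where w = "\<lambda>x. \<bar>d x\<bar>"])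
    show "integrable lborel (\<lambda>x. \<bar>d x\<bar>)"
      using Ck_compact_integrable[OF d_Ck] by (rule integrable_abs)
    show "AE x in lborel. (\<lambda>n. d x * v n x) \<longlonglongrightarrow> d x * indicator c x"
      using v(2) by eventually_elim (intro tendsto_mult tendsto_const)
    show "AE x in lborel. norm (d x * v n x) \<le> \<bar>d x\<bar>" for n
      using v(1)[of n] by (auto simp: abs_mult intro!: mult_left_le)
  qed measurable
  then show "(\<lambda>n. \<bar>\<integral>x. d x * v n x \<partial>lborel\<bar>) \<longlonglongrightarrow> \<bar>\<integral>x. frechet_derivative \<psi> (at x) i * indicator c x \<partial>lborel\<bar>"
    unfolding d_def by (rule tendsto_rabs)
  show "eventually (\<lambda>n. \<bar>\<integral>x. d x * v n x \<partial>lborel\<bar> \<le> N * M) sequentially"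
  proof (intro always_eventually allI)
    fix n
    have w_int: "integrable lborel (w n)"
      by (rule weak_pdD(2)[OF wp])
    have "(\<integral>x. d x * v n x \<partial>lborel) = - (\<integral>x. \<psi> x * w n x \<partial>lborel)"
      unfolding d_def using integration_by_parts_C1[OF U wp i \<psi>(1), of n] by simp
    then have "\<bar>\<integral>x. d x * v n x \<partial>lborel\<bar> = \<bar>\<integral>x. \<psi> x * w n x \<partial>lborel\<bar>"
      by simp
    also have "\<dots> \<le> (\<integral>x. \<bar>\<psi> x * w n x\<bar> \<partial>lborel)"
      by (rule integral_abs_bound)
    also have "\<dots> \<le> (\<integral>x. N * \<bar>w n x\<bar> \<partial>lborel)"
    proof (rule integral_mono)
      show "integrable lborel (\<lambda>x. \<bar>\<psi> x * w n x\<bar>)"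
        using integrable_test_function_scaleR[OF \<psi>(1) w_int] by (intro integrable_abs) simp
      show "\<bar>\<psi> x * w n x\<bar> \<le> N * \<bar>w n x\<bar>" for x
        using \<psi>(2)[of x] by (simp add: abs_mult mult_right_mono)
    qed (use w_int in simp)
    also have "\<dots> = N * (\<integral>x. \<bar>w n x\<bar> \<partial>lborel)" by simp
    also have "\<dots> \<le> N * M"
    proof (rule mult_left_mono)
      have "ennreal (\<integral>x. \<bar>w n x\<bar> \<partial>lborel) \<le> ennreal M"
        using M(2)[of n] w_int by (subst (asm) nn_integral_eq_integral) auto
      then show "(\<integral>x. \<bar>w n x\<bar> \<partial>lborel) \<le> M"
        using M(1) by simp
      show "0 \<le> N"
        using \<psi>(2)[of undefined] by linarith
    qed
    finally show "\<bar>\<integral>x. d x * v n x \<partial>lborel\<bar> \<le> N * M" .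
  qed
qed simp

text \<open>F is A plus the jump B - A on c. The constant A integrates to 0 against derivatives of
  compactly supported fields, and pairing the jump with the test field leaves scalar test functions,
  bounded by norm (B - A), for each direction.\<close>

lemma phase_variation_finite:
  fixes F :: "'a::euclidean_space \<Rightarrow> 'm::euclidean_space" and A B :: 'm
  assumes U: "open U" and wp: "\<And>n i. i \<in> Basis \<Longrightarrow> weak_pd U i (v n) (w n i)"
    and v: "\<And>n x. \<bar>v n x\<bar> \<le> 1" "AE x in lborel. (\<lambda>n. v n x) \<longlonglongrightarrow> indicator c x" "c \<in> sets borel"
    and M: "0 \<le> M" "\<And>n i. i \<in> Basis \<Longrightarrow> (\<integral>\<^sup>+x. ennreal \<bar>w n i x\<bar> \<partial>lborel) \<le> ennreal M"
    and F: "AE x in lebesgue_on U. F x = (if x \<in> c then B else A)"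
  shows "variation U F < \<infinity>"
proof -
  have Um: "U \<in> sets borel" using U by simp
  have "variation U F \<le> ereal (\<Sum>i\<in>(Basis::'a set). norm (B - A) * M)"
    unfolding variation_def
  proof (rule SUP_least)
    fix \<phi> :: "'a \<Rightarrow> 'a \<Rightarrow> 'm" assume \<phi>: "\<phi> \<in> BV_test_fields U"
    have \<phi>_Ck: "\<phi> i \<in> Ck_compact (Suc 0) U" if "i \<in> Basis" for i
      using \<phi> that by (simp add: BV_test_fields_def)
    have \<phi>_le: "norm (\<phi> i x) \<le> 1" if "i \<in> Basis" for i x
    proof -
      have "(norm (\<phi> i x))\<^sup>2 \<le> (\<Sum>i\<in>Basis. (norm (\<phi> i x))\<^sup>2)"
        using that by (intro member_le_sum) auto
      also have "\<dots> \<le> 1\<^sup>2"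
        using \<phi> by (simp add: BV_test_fields_def)
      finally show ?thesis by (rule power2_le_imp_le) simp
    qed
    define \<psi> where "\<psi> i x = (B - A) \<bullet> \<phi> i x" for i x
    define d where "d i x = frechet_derivative (\<phi> i) (at x) i" for i x
    have d_Ck: "d i \<in> Ck_compact 0 U" if "i \<in> Basis" for i
      unfolding d_def by (rule frechet_derivative_Ck_compact[OF \<phi>_Ck[OF that] that])
    have d_m: "d i \<in> borel_measurable borel" if "i \<in> Basis" for i
      by (rule Ck_compact_measurable[OF d_Ck[OF that]])
    have d_int: "integrable lborel (d i)" if "i \<in> Basis" for i
      by (rule Ck_compact_integrable[OF d_Ck[OF that]])
    have d_off: "d i x = 0" if i: "i \<in> Basis" and x: "x \<notin> U" for i x
    proof -
      obtain K where "K \<subseteq> U" "\<And>x. x \<notin> K \<Longrightarrow> d i x = 0"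
        by (rule Ck_compact_supportE[OF d_Ck[OF i]]) (rule that; assumption)
      then show ?thesis using x by (metis subsetD)
    qed
    have \<psi>_Ck: "\<psi> i \<in> Ck_compact (Suc 0) U" if i: "i \<in> Basis" for i
    proof -
      obtain K where K: "compact K" "K \<subseteq> U" "\<And>x. x \<notin> K \<Longrightarrow> \<phi> i x = 0"
        by (rule Ck_compact_supportE[OF \<phi>_Ck[OF i]]) (rule that; assumption)
      have "Ck (Suc 0) (\<phi> i)"
        using \<phi>_Ck[OF i] by (simp add: Ck_compact_def)
      from Ck_linear[OF bounded_linear_inner_right this, of "B - A"] show ?thesis
        unfolding \<psi>_def by (rule Ck_compactI[OF _ K(1,2)]) (simp add: K(3))
    qed
    have d\<psi>: "frechet_derivative (\<psi> i) (at x) i = (B - A) \<bullet> d i x" if "i \<in> Basis" for i x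
    proof -
      have "(\<phi> i has_derivative frechet_derivative (\<phi> i) (at x)) (at x)"
        using Ck_compact_differentiable[OF \<phi>_Ck[OF that]] by (simp add: frechet_derivative_works[symmetric])
      from bounded_linear.has_derivative[OF bounded_linear_inner_right this, of "B - A"]
      have "(\<psi> i has_derivative (\<lambda>z. (B - A) \<bullet> frechet_derivative (\<phi> i) (at x) z)) (at x)"
        by (simp add: \<psi>_def[abs_def])
      from frechet_derivative_at[OF this] show ?thesis
        unfolding d_def by metis
    qed
    have \<psi>_le: "\<bar>\<psi> i x\<bar> \<le> norm (B - A)" if "i \<in> Basis" for i x
      using Cauchy_Schwarz_ineq2[of "B - A" "\<phi> i x"] \<phi>_le[OF that, of x] mult_left_le[of "norm (\<phi> i x)" "norm (B - A)"]
      by (simp add: \<psi>_def)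
    have bound: "\<bar>\<integral>x. ((B - A) \<bullet> d i x) * indicator c x \<partial>lborel\<bar> \<le> norm (B - A) * M" if "i \<in> Basis" for i
      using phase_integral_bound[OF U that wp[OF that] v M(1) M(2)[OF that] \<psi>_Ck[OF that] \<psi>_le[OF that]]
      by (simp add: d\<psi>[OF that])
    have int_c: "integrable lborel (\<lambda>x. ((B - A) \<bullet> d i x) * indicator c x)" if "i \<in> Basis" for i
      using integrable_mult_indicator[of c lborel "\<lambda>x. (B - A) \<bullet> d i x"] v(3) d_int[OF that] by (simp add: mult.commute)
    define G where "G x = (\<Sum>i\<in>Basis. A \<bullet> d i x + ((B - A) \<bullet> d i x) * indicator c x)" for x
    have G_m: "G \<in> borel_measurable borel"
      unfolding G_def using d_m v(3)
      by (intro borel_measurable_sum borel_measurable_add borel_measurable_times borel_measurable_inner borel_measurable_indicator) auto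
    have G_eq: "AE x in lebesgue_on U. (\<Sum>i\<in>Basis. F x \<bullet> frechet_derivative (\<phi> i) (at x) i) = G x"
      using F
    proof eventually_elim
      case (elim x)
      show ?case
        unfolding G_def d_def[symmetric] elim by (intro sum.cong refl) (simp add: indicator_def inner_diff_left)
    qed
    have "(\<integral>x. (\<Sum>i\<in>Basis. F x \<bullet> frechet_derivative (\<phi> i) (at x) i) \<partial>lebesgue_on U) = (\<integral>x. G x \<partial>lborel)"
    proof (rule integral_lebesgue_on_representative[OF _ Um G_m _ G_eq])
      show "(\<lambda>x. \<Sum>i\<in>Basis. F x \<bullet> frechet_derivative (\<phi> i) (at x) i) \<in> borel_measurable (lebesgue_on U)"
        by (rule measurable_lebesgue_on_AE_cong[OF measurable_lebesgue_on_borel[OF G_m] Um G_eq])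
      show "G x = 0" if "x \<notin> U" for x
        using d_off[OF _ that] by (simp add: G_def)
    qed
    also have "\<dots> = (\<Sum>i\<in>Basis. (\<integral>x. A \<bullet> d i x + ((B - A) \<bullet> d i x) * indicator c x \<partial>lborel))"
      unfolding G_def by (rule Bochner_Integration.integral_sum) (use d_int int_c in auto)
    also have "\<dots> = (\<Sum>i\<in>Basis. (\<integral>x. ((B - A) \<bullet> d i x) * indicator c x \<partial>lborel))"
    proof (rule sum.cong[OF refl])
      fix i :: 'a assume i: "i \<in> Basis"
      have "integral\<^sup>L lborel (d i) = 0"
        unfolding d_def by (rule integral_partial_Ck_compact[OF \<phi>_Ck[OF i]])
      then have "(\<integral>x. A \<bullet> d i x \<partial>lborel) = 0"
        using d_int[OF i] by simp
      then show "(\<integral>x. A \<bullet> d i x + ((B - A) \<bullet> d i x) * indicator c x \<partial>lborel) = (\<integral>x. ((B - A) \<bullet> d i x) * indicator c x \<partial>lborel)"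
        using d_int[OF i] int_c[OF i] by simp
    qed
    also have "\<dots> \<le> (\<Sum>i\<in>(Basis::'a set). norm (B - A) * M)"
      using bound by (intro sum_mono) (use abs_ge_self order_trans in blast)
    finally show "ereal (\<integral>x. (\<Sum>i\<in>Basis. F x \<bullet> frechet_derivative (\<phi> i) (at x) i) \<partial>lebesgue_on U) \<le> ereal (\<Sum>i\<in>(Basis::'a set). norm (B - A) * M)"
      by simp
  qed
  then show ?thesis
    by (rule le_less_trans) simp
qed

section \<open>Convergence in Sobolev norm and bounded limits\<close>

lemma Lp_space_borel:
  fixes g :: "'a::euclidean_space \<Rightarrow> 'b::euclidean_space"
  assumes "g \<in> borel_measurable borel" "\<And>x. x \<notin> U \<Longrightarrow> g x = 0" "U \<in> sets borel"
  shows "g \<in> Lp_space p U \<longleftrightarrow> (\<integral>\<^sup>+x. ennreal (norm (g x) powr p) \<partial>lborel) < \<infinity>"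
  by (rule Lp_space_representative[OF measurable_lebesgue_on_borel]) (use assms in auto)

text \<open>\<open>weak_partial\<close> of the difference is determined up to null sets, hence
  agrees with the difference of the given derivatives; the norm then consists of finitely many terms
  tending to 0.\<close>

lemma W1p_tendstoI:
  fixes F :: "nat \<Rightarrow> 'a::euclidean_space \<Rightarrow> 'b::euclidean_space"
  assumes U: "open U" and p: "p \<ge> 1"
    and F: "\<And>n. AE x in lebesgue_on U. F n x = w n x"
    and wp: "\<And>n i. i \<in> Basis \<Longrightarrow> weak_pd U i (w n) (g n i)" "\<And>i. i \<in> Basis \<Longrightarrow> weak_pd U i u\<^sub>0 (z i)"
    and fin: "\<And>n. (\<integral>\<^sup>+x. ennreal (norm (w n x) powr p) \<partial>lborel) < \<infinity>"
      "\<And>n i. i \<in> Basis \<Longrightarrow> (\<integral>\<^sup>+x. ennreal (norm (g n i x) powr p) \<partial>lborel) < \<infinity>"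
      "(\<integral>\<^sup>+x. ennreal (norm (u\<^sub>0 x) powr p) \<partial>lborel) < \<infinity>"
      "\<And>i. i \<in> Basis \<Longrightarrow> (\<integral>\<^sup>+x. ennreal (norm (z i x) powr p) \<partial>lborel) < \<infinity>"
    and lim: "(\<lambda>n. \<integral>\<^sup>+x. ennreal (norm (w n x - u\<^sub>0 x) powr p) \<partial>lborel) \<longlonglongrightarrow> 0"
      "\<And>i. i \<in> Basis \<Longrightarrow> (\<lambda>n. \<integral>\<^sup>+x. ennreal (norm (g n i x - z i x) powr p) \<partial>lborel) \<longlonglongrightarrow> 0"
  shows "W1p_tendsto p U F u\<^sub>0"
proof -
  have Um: "U \<in> sets borel" using U by simp
  obtain b :: 'a where b: "b \<in> Basis" using nonempty_Basis by blast
  have w_m: "w n \<in> borel_measurable borel" for n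
    by (rule integrable_lborel_borel[OF weak_pdD(1)[OF wp(1)[OF b]]])
  have w_off: "w n x = 0" if "x \<notin> U" for n x
    by (rule weak_pdD(3)[OF wp(1)[OF b] that])
  have u_m: "u\<^sub>0 \<in> borel_measurable borel"
    by (rule integrable_lborel_borel[OF weak_pdD(1)[OF wp(2)[OF b]]])
  have u_off: "u\<^sub>0 x = 0" if "x \<notin> U" for x
    by (rule weak_pdD(3)[OF wp(2)[OF b] that])
  have g_m: "g n i \<in> borel_measurable borel" if "i \<in> Basis" for n i
    by (rule integrable_lborel_borel[OF weak_pdD(2)[OF wp(1)[OF that]]])
  have g_off: "g n i x = 0" if "i \<in> Basis" "x \<notin> U" for n i x
    by (rule weak_pdD(4)[OF wp(1)[OF that(1)] that(2)])
  have z_m: "z i \<in> borel_measurable borel" if "i \<in> Basis" for i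
    by (rule integrable_lborel_borel[OF weak_pdD(2)[OF wp(2)[OF that]]])
  have z_off: "z i x = 0" if "i \<in> Basis" "x \<notin> U" for i x
    by (rule weak_pdD(4)[OF wp(2)[OF that(1)] that(2)])
  have F_m: "F n \<in> borel_measurable (lebesgue_on U)" for n
    by (rule measurable_lebesgue_on_AE_cong[OF measurable_lebesgue_on_borel[OF w_m] Um F])
  have "F n \<in> W1p_space p U" for n
  proof -
    have "F n \<in> Lp_space p U"
      using Lp_space_representative[OF F_m Um w_m w_off F] fin(1) by blast
    moreover have "g n i \<in> Lp_space p U \<and> has_weak_partial U i (F n) (g n i)" if i: "i \<in> Basis" for i
    proof
      show "g n i \<in> Lp_space p U"
        using Lp_space_borel[OF g_m[OF i] g_off[OF i] Um] fin(2)[OF i] by blast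
      show "has_weak_partial U i (F n) (g n i)"
        by (rule weak_pd_imp_has_weak_partial[OF U i wp(1)[OF i] F_m F measurable_lebesgue_on_borel[OF g_m[OF i]]]) simp
    qed
    ultimately show ?thesis
      unfolding W1p_space_def by blast
  qed
  moreover have "u\<^sub>0 \<in> W1p_space p U"
  proof -
    have "u\<^sub>0 \<in> Lp_space p U"
      using Lp_space_borel[OF u_m u_off Um] fin(3) by blast
    moreover have "z i \<in> Lp_space p U \<and> has_weak_partial U i u\<^sub>0 (z i)" if i: "i \<in> Basis" for i
    proof
      show "z i \<in> Lp_space p U"
        using Lp_space_borel[OF z_m[OF i] z_off[OF i] Um] fin(4)[OF i] by blast
      show "has_weak_partial U i u\<^sub>0 (z i)"
        by (rule weak_pd_imp_has_weak_partial[OF U i wp(2)[OF i] measurable_lebesgue_on_borel[OF u_m] _ measurable_lebesgue_on_borel[OF z_m[OF i]]]) simp_all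
    qed
    ultimately show ?thesis
      unfolding W1p_space_def by blast
  qed
  moreover have "(\<lambda>n. W1p_norm p U (\<lambda>x. F n x - u\<^sub>0 x)) \<longlonglongrightarrow> 0"
  proof -
    have d_m: "(\<lambda>x. w n x - u\<^sub>0 x) \<in> borel_measurable borel" for n
      using w_m u_m by measurable
    have d_eq: "AE x in lebesgue_on U. F n x - u\<^sub>0 x = w n x - u\<^sub>0 x" for n
      using F by eventually_elim simp
    have Fd_m: "(\<lambda>x. F n x - u\<^sub>0 x) \<in> borel_measurable (lebesgue_on U)" for n
      by (rule measurable_lebesgue_on_AE_cong[OF measurable_lebesgue_on_borel[OF d_m] Um d_eq])
    have 0: "(\<lambda>n. Lp_norm p U (\<lambda>x. F n x - u\<^sub>0 x)) \<longlonglongrightarrow> 0"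
      by (rule Lp_norm_tendsto_0[OF Fd_m Um d_m _ d_eq _ lim(1)]) (use w_off u_off p in auto)
    have 1: "(\<lambda>n. Lp_norm p U (weak_partial U i (\<lambda>x. F n x - u\<^sub>0 x))) \<longlonglongrightarrow> 0" if i: "i \<in> Basis" for i
    proof -
      have e_m: "(\<lambda>x. g n i x - z i x) \<in> borel_measurable borel" for n
        using g_m[OF i] z_m[OF i] by measurable
      have "has_weak_partial U i (\<lambda>x. F n x - u\<^sub>0 x) (\<lambda>x. g n i x - z i x)" for n
        by (rule weak_pd_imp_has_weak_partial[OF U i weak_pd_diff[OF i wp(1)[OF i] wp(2)[OF i]] Fd_m d_eq measurable_lebesgue_on_borel[OF e_m]]) simp
      then have e_eq: "AE x in lebesgue_on U. weak_partial U i (\<lambda>x. F n x - u\<^sub>0 x) x = g n i x - z i x" for n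
        by (rule weak_partial_AE[OF U i])
      show ?thesis
        by (rule Lp_norm_tendsto_0[OF measurable_lebesgue_on_AE_cong[OF measurable_lebesgue_on_borel[OF e_m] Um e_eq] Um e_m _ e_eq _ lim(2)[OF i]])
          (use g_off[OF i] z_off[OF i] p in auto)
    qed
    have nn: "0 \<le> Lp_norm p U k" for k :: "'a \<Rightarrow> 'b"
      by (simp add: Lp_norm_def)
    have pw: "(\<lambda>n. X n powr q) \<longlonglongrightarrow> 0" if "X \<longlonglongrightarrow> 0" "\<And>n. 0 \<le> X n" "q > 0" for X :: "nat \<Rightarrow> real" and q
    proof -
      have "(\<lambda>n. X n powr q) \<longlonglongrightarrow> 0 powr q"
        using that by (intro tendsto_powr2 tendsto_const) auto
      then show ?thesis using that(3) by simp
    qed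
    have "(\<lambda>n. Lp_norm p U (\<lambda>x. F n x - u\<^sub>0 x) powr p + (\<Sum>i\<in>Basis. Lp_norm p U (weak_partial U i (\<lambda>x. F n x - u\<^sub>0 x)) powr p)) \<longlonglongrightarrow> 0 + (\<Sum>i\<in>(Basis::'a set). 0)"
      using p by (intro tendsto_add tendsto_sum pw 0 1 nn) auto
    then show ?thesis
      unfolding W1p_norm_def
    proof (intro pw)
      show "0 \<le> Lp_norm p U (\<lambda>x. F n x - u\<^sub>0 x) powr p + (\<Sum>i\<in>Basis. Lp_norm p U (weak_partial U i (\<lambda>x. F n x - u\<^sub>0 x)) powr p)" for n
        by (intro add_nonneg_nonneg sum_nonneg) simp_all
    qed (use p in simp_all)
  qed
  ultimately show ?thesis
    unfolding W1p_tendsto_def by blast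
qed

text \<open>A bounded gradient on a convex set bounds the oscillation, by
  \<open>poincare_sup\<close>; comparison with one good point turns this into an essential
  bound.\<close>

lemma Linf_space_if_gradient_bounded:
  fixes u :: "'a::euclidean_space \<Rightarrow> 'b::euclidean_space"
  assumes U: "open U" "convex U" and d: "\<And>x y. x \<in> U \<Longrightarrow> y \<in> U \<Longrightarrow> norm (x - y) \<le> d"
    and wp: "\<And>i. i \<in> Basis \<Longrightarrow> weak_pd U i u (z i)" and M: "\<And>x. (\<Sum>i\<in>Basis. norm (z i x)) \<le> M"
  shows "u \<in> Linf_space U"
proof -
  have Um: "U \<in> sets borel" using U by simp
  obtain b :: 'a where b: "b \<in> Basis" using nonempty_Basis by blast
  have u_m: "u \<in> borel_measurable borel"
    by (rule integrable_lborel_borel[OF weak_pdD(1)[OF wp[OF b]]])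
  have "(\<Sum>i\<in>Basis. norm (z i undefined)) \<ge> 0" by (intro sum_nonneg) simp
  with M[of undefined] have "0 \<le> M" by linarith
  have osc: "AE x in lborel. AE y in lborel. x \<in> U \<longrightarrow> y \<in> U \<longrightarrow> norm (u x - u y) \<le> d * M"
    by (rule poincare_sup[OF U d wp _ \<open>0 \<le> M\<close>]) (use M in auto)
  have "\<exists>C. AE y in lborel. y \<in> U \<longrightarrow> norm (u y) \<le> C"
  proof (cases "U = {}")
    case False
    have "\<not> (AE x in lborel. x \<notin> U)"
    proof
      assume "AE x in lborel. x \<notin> U"
      then have "emeasure lborel U = 0"
        using Um by (subst (asm) AE_iff_measurable[OF _ refl]) auto
      then show False
        using open_not_negligible[OF U(1) False] U(1) by (simp add: negligible_iff_emeasure0)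
    qed
    \<comment> \<open>Since U is not a null set, the property that holds for almost every x holds
      for some x in U.\<close>
    then obtain x where x: "x \<in> U" "AE y in lborel. x \<in> U \<longrightarrow> y \<in> U \<longrightarrow> norm (u x - u y) \<le> d * M"
      using osc by (metis (mono_tags, lifting) eventually_mono)
    have "AE y in lborel. y \<in> U \<longrightarrow> norm (u y) \<le> norm (u x) + d * M"
      using x(2)
    proof eventually_elim
      case (elim y)
      show ?case
      proof
        assume "y \<in> U"
        with elim x(1) have "norm (u x - u y) \<le> d * M" by blast
        then show "norm (u y) \<le> norm (u x) + d * M"
          using norm_triangle_ineq4[of "u x" "u x - u y"] by simp
      qed
    qed
    then show ?thesis by blast
  qed simp
  then show ?thesis
    using measurable_lebesgue_on_borel[OF u_m] Um by (simp add: Linf_space_def AE_lebesgue_on_iff)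
qed

lemma Linf_space_borel:
  fixes z :: "'a::euclidean_space \<Rightarrow> 'b::euclidean_space"
  assumes "z \<in> borel_measurable borel" "\<And>x. norm (z x) \<le> C"
  shows "z \<in> Linf_space U"
  using measurable_lebesgue_on_borel[OF assms(1)] assms(2) by (auto simp: Linf_space_def)

section \<open>Energy in terms of representatives\<close>

text \<open>The first derivative is indexed by its column number, the second by a basis vector:
  \<open>dd b\<close> is then a triple of fields of the same kind as \<open>d\<close>, the
  derivative of \<open>d\<close> in direction b.\<close>

lemma H2_space_representatives_3:
  fixes u :: "real^3 \<Rightarrow> real^3"
  assumes u: "u \<in> H2_space U" and U: "open U" "emeasure lborel U < \<infinity>"
  shows "\<exists>f d (dd :: real^3 \<Rightarrow> 3 \<Rightarrow> real^3 \<Rightarrow> real^3). (AE x in lebesgue_on U. u x = f x) \<and> (\<forall>j. weak_pd U (axis j 1) f (d j)) \<and>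
    (\<forall>j. AE x in lebesgue_on U. D U j u x = d j x) \<and> (\<forall>i j. weak_pd U (axis i 1) (d j) (dd (axis i 1) j)) \<and>
    (\<forall>i j. AE x in lebesgue_on U. D U i (D U j u) x = dd (axis i 1) j x)"
proof (rule H2_space_representatives[OF assms])
  fix f and d :: "real^3 \<Rightarrow> real^3 \<Rightarrow> real^3" and dd
  assume 1: "AE x in lebesgue_on U. u x = f x" "\<And>i. i \<in> Basis \<Longrightarrow> weak_pd U i f (d i)"
    "\<And>i. i \<in> Basis \<Longrightarrow> AE x in lebesgue_on U. weak_partial U i u x = d i x"
    "\<And>i j. i \<in> Basis \<Longrightarrow> j \<in> Basis \<Longrightarrow> weak_pd U i (d j) (dd i j)"
    "\<And>i j. i \<in> Basis \<Longrightarrow> j \<in> Basis \<Longrightarrow> AE x in lebesgue_on U. weak_partial U i (weak_partial U j u) x = dd i j x"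
  show ?thesis
    using 1 by (intro exI[of _ f] exI[of _ "\<lambda>j. d (axis j 1)"] exI[of _ "\<lambda>i j. dd i (axis j 1)"] conjI allI) simp_all
qed

text \<open>Taking the column fields as an argument lets the same formula express the rescaled
  gradient, from \<open>d\<close>, and its derivative in direction b, from
  \<open>dd b\<close>.\<close>

definition rescaled_gradient :: "real \<Rightarrow> (3 \<Rightarrow> real^3 \<Rightarrow> real^3) \<Rightarrow> real^3 \<Rightarrow> real^3^3" where
  "rescaled_gradient h d x = cols (\<lambda>k. (if k = 3 then 1 / h else 1) *\<^sub>R d k x)"

definition rescaled_hessian_sq :: "real \<Rightarrow> (real^3 \<Rightarrow> 3 \<Rightarrow> real^3 \<Rightarrow> real^3) \<Rightarrow> real^3 \<Rightarrow> real" where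
  "rescaled_hessian_sq h dd x = (\<Sum>i\<in>{1,2}. \<Sum>j\<in>{1,2}. (norm (dd (axis i 1) j x))\<^sup>2) +
    2 / h\<^sup>2 * (\<Sum>i\<in>{1,2}. (norm (dd (axis i 1) 3 x))\<^sup>2) + 1 / h ^ 4 * (norm (dd (axis 3 1) 3 x))\<^sup>2"

lemma rescaled_hessian_sq_nonneg: "0 \<le> rescaled_hessian_sq h dd x"
  unfolding rescaled_hessian_sq_def by (intro add_nonneg_nonneg sum_nonneg mult_nonneg_nonneg) auto

lemma energy_representative:
  assumes U: "U \<in> sets borel" and d: "\<And>j. AE x in lebesgue_on U. D U j u x = d j x"
    and dd: "\<And>i j. AE x in lebesgue_on U. D U i (D U j u) x = dd (axis i 1) j x"
  shows "energy W U h \<epsilon> u = (\<integral>\<^sup>+x. indicator U x * ennreal (1 / \<epsilon> * W (rescaled_gradient h d x) + \<epsilon> * rescaled_hessian_sq h dd x) \<partial>lborel)"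
proof -
  have "AE x in lebesgue_on U. \<forall>j\<in>UNIV. D U j u x = d j x"
    by (rule AE_finite_allI) (use d in auto)
  moreover have "AE x in lebesgue_on U. \<forall>i\<in>UNIV. \<forall>j\<in>UNIV. D U i (D U j u) x = dd (axis i 1) j x"
    by (intro AE_finite_allI) (use dd in auto)
  ultimately have "AE x in lebesgue_on U. ennreal (1 / \<epsilon> * W (scaled_grad h U u x) + \<epsilon> * scaled_hessian_norm_sq h U u x) =
      ennreal (1 / \<epsilon> * W (rescaled_gradient h d x) + \<epsilon> * rescaled_hessian_sq h dd x)"
  proof eventually_elim
    case (elim x)
    have "scaled_grad h U u x = rescaled_gradient h d x"
      using elim(1) by (simp add: scaled_grad_def planar_grad_with_def rescaled_gradient_def cols_def vec_eq_iff)
    moreover have "scaled_hessian_norm_sq h U u x = rescaled_hessian_sq h dd x"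
      using elim(2) by (simp add: scaled_hessian_norm_sq_def rescaled_hessian_sq_def)
    ultimately show ?case by simp
  qed
  then have "energy W U h \<epsilon> u = (\<integral>\<^sup>+x. ennreal (1 / \<epsilon> * W (rescaled_gradient h d x) + \<epsilon> * rescaled_hessian_sq h dd x) \<partial>lebesgue_on U)"
    unfolding energy_def by (rule nn_integral_cong_AE)
  then show ?thesis
    by (simp add: nn_integral_lebesgue_on[OF U] mult.commute)
qed

text \<open>Differentiating once more in the thin direction gains the factor \<open>h\<close>, because the weak
  second derivatives are symmetric.\<close>

lemma norm_rescaled_gradient_derivative_le:
  assumes U: "open U" and h: "h > 0" and f: "\<And>j. weak_pd U (axis j 1) f (d j)"
    and d: "\<And>i j. weak_pd U (axis i 1) (d j) (dd (axis i 1) j)" and b: "b \<in> Basis"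
  shows "AE x in lborel. norm (rescaled_gradient h (dd b) x) \<le> (if b = axis 3 1 then h else 1) * sqrt (rescaled_hessian_sq h dd x)"
proof -
  obtain i where i: "b = axis i 1" using b by (auto simp: Basis_3)
  have sq: "(norm (rescaled_gradient h (dd b) x))\<^sup>2 = (norm (dd b 1 x))\<^sup>2 + (norm (dd b 2 x))\<^sup>2 + (norm (dd b 3 x))\<^sup>2 / h\<^sup>2" for b x
    unfolding rescaled_gradient_def norm_cols by (simp add: sum_3 power_mult_distrib power_divide)
  define a where "a i j x = (norm (dd (axis i 1) j x))\<^sup>2" for i j x
  have a_nn: "0 \<le> a i j x" for i j x by (simp add: a_def)
  have H: "rescaled_hessian_sq h dd x = a 1 1 x + a 1 2 x + (a 2 1 x + a 2 2 x) + 2 * (a 1 3 x / h\<^sup>2) + 2 * (a 2 3 x / h\<^sup>2) + a 3 3 x / h ^ 4" for x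
    by (simp add: rescaled_hessian_sq_def a_def algebra_simps add_divide_distrib)
  have q_nn: "0 \<le> a i j x / h\<^sup>2" "0 \<le> a i j x / h ^ 4" for i j x
    using a_nn by simp_all
  show ?thesis
  proof (cases "i = 3")
    case False
    then consider "i = 1" | "i = 2" using exhaust_3 by blast
    then have "(norm (rescaled_gradient h (dd b) x))\<^sup>2 \<le> rescaled_hessian_sq h dd x" for x
    proof cases
      case 1
      then show ?thesis
        unfolding sq H i
        using a_nn[of 2 1 x] a_nn[of 2 2 x] q_nn(1)[of 1 3 x] q_nn(1)[of 2 3 x] q_nn(2)[of 3 3 x] by (simp add: a_def[symmetric])
    next
      case 2
      then show ?thesis
        unfolding sq H i
        using a_nn[of 1 1 x] a_nn[of 1 2 x] q_nn(1)[of 1 3 x] q_nn(1)[of 2 3 x] q_nn(2)[of 3 3 x] by (simp add: a_def[symmetric])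
    qed
    then have "norm (rescaled_gradient h (dd b) x) \<le> sqrt (rescaled_hessian_sq h dd x)" for x
      by (rule real_le_rsqrt)
    then show ?thesis
      using False by (simp add: i axis_eq_axis)
  next
    case True
    have "AE x in lborel. dd (axis 3 1) j x = dd (axis j 1) 3 x" for j
      by (rule weak_pd_mixed[OF U _ _ f f d d]) simp_all
    from this[of 1] this[of 2] show ?thesis
    proof eventually_elim
      case (elim x)
      have "(norm (rescaled_gradient h (dd b) x))\<^sup>2 = a 1 3 x + a 2 3 x + a 3 3 x / h\<^sup>2"
        unfolding sq i True elim by (simp add: a_def)
      \<comment> \<open>Pulling out h^2 gives the entries the powers of 1/h that they carry in the
        rescaled Hessian.\<close>
      also have "\<dots> = h\<^sup>2 * (a 1 3 x / h\<^sup>2 + a 2 3 x / h\<^sup>2 + a 3 3 x / h ^ 4)"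
        using h by (simp add: field_simps power2_eq_square power4_eq_xxxx)
      also have "\<dots> \<le> h\<^sup>2 * rescaled_hessian_sq h dd x"
        unfolding H using a_nn[of 1 1 x] a_nn[of 1 2 x] a_nn[of 2 1 x] a_nn[of 2 2 x] q_nn(1)[of 1 3 x] q_nn(1)[of 2 3 x]
        by (intro mult_left_mono) auto
      finally have "norm (rescaled_gradient h (dd b) x) \<le> sqrt (h\<^sup>2 * rescaled_hessian_sq h dd x)"
        by (rule real_le_rsqrt)
      then show ?case
        using h by (simp add: real_sqrt_mult i True)
    qed
  qed
qed

theorem theorem1p1:
  fixes \<omega> :: "(real^2) set" and \<Omega> :: "(real^3) set"
    and W :: "real^3^3 \<Rightarrow> real" and A B :: "real^3^3"
    and a :: "real^3" and \<nu> :: "real^2" and p C1 :: real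
    and h \<epsilon> :: "nat \<Rightarrow> real" and u :: "nat \<Rightarrow> real^3 \<Rightarrow> real^3"
  assumes "bounded \<omega>" and "convex \<omega>" and "open \<omega>"
    and "\<Omega> = cylinder \<omega>"
    and "continuous_on UNIV W" and "\<And>\<xi>. W \<xi> \<ge> 0"
    and "{\<xi>. W \<xi> = 0} = {A, B}" and "A \<noteq> B"
    and "first_two_columns A - first_two_columns B = tensor (2 *\<^sub>R a) \<nu>" and "norm \<nu> = 1"
    and "p \<ge> 2" and "C1 > 0"
    and "\<And>\<xi>. 1 / C1 * norm \<xi> powr p - C1 \<le> W \<xi>"
    and "\<And>\<xi>. W \<xi> \<le> C1 * norm \<xi> powr p + C1"
    and "\<And>n. h n > 0" and "h \<longlonglongrightarrow> 0"
    and "\<And>n. \<epsilon> n > 0" and "\<epsilon> \<longlonglongrightarrow> 0"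
    and "\<And>n. u n \<in> H2_space \<Omega>"
    and "(SUP n. energy W \<Omega> (h n) (\<epsilon> n) (u n)) < \<infinity>"
  shows "\<exists>r u0 b. strict_mono (r :: nat \<Rightarrow> nat) \<and> (u0, b) \<in> limit_class \<Omega> A B \<and>
    W1p_tendsto p \<Omega> (\<lambda>n x. u (r n) x - mean_value \<Omega> (u (r n))) u0 \<and>
    Lp_tendsto p \<Omega> (\<lambda>n x. (1 / h (r n)) *\<^sub>R D \<Omega> 3 (u (r n)) x) b"
proof -
  have \<Omega>: "open \<Omega>" "convex \<Omega>" "bounded \<Omega>"
    unfolding assms(4) by (rule cylinder_geometry[OF assms(1-3)])+
  have \<Omega>m [measurable]: "\<Omega> \<in> sets borel" using \<Omega>(1) by simp
  have \<Omega>fin: "emeasure lborel \<Omega> < \<infinity>"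
    by (rule emeasure_bounded_finite[OF \<Omega>(3)])
  obtain \<rho> where \<rho>: "\<And>x. x \<in> \<Omega> \<Longrightarrow> norm x \<le> \<rho>"
    using \<Omega>(3) by (auto simp: bounded_iff)
  have diam: "norm (x - y) \<le> 2 * \<rho>" if "x \<in> \<Omega>" "y \<in> \<Omega>" for x y
    using \<rho>[OF that(1)] \<rho>[OF that(2)] norm_triangle_ineq4[of x y] by linarith
  have W_m [measurable]: "W \<in> borel_measurable borel"
    using assms(5) by (rule borel_measurable_continuous_onI)
  have W0: "W \<xi> = 0 \<longleftrightarrow> \<xi> = A \<or> \<xi> = B" for \<xi>
    using assms(7) by (auto simp: set_eq_iff)
  have p: "p \<ge> 1" "p > 0" "p \<ge> 0" using assms(11) by simp_all
  have h0: "h n > 0" for n by (rule assms(15))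

  \<comment> \<open>Borel representatives of the sequence\<close>
  define P where "P n f d (dd :: real^3 \<Rightarrow> 3 \<Rightarrow> real^3 \<Rightarrow> real^3) \<longleftrightarrow>
    (AE x in lebesgue_on \<Omega>. u n x = f x) \<and> (\<forall>j. weak_pd \<Omega> (axis j 1) f (d j)) \<and>
    (\<forall>j. AE x in lebesgue_on \<Omega>. D \<Omega> j (u n) x = d j x) \<and> (\<forall>i j. weak_pd \<Omega> (axis i 1) (d j) (dd (axis i 1) j)) \<and>
    (\<forall>i j. AE x in lebesgue_on \<Omega>. D \<Omega> i (D \<Omega> j (u n)) x = dd (axis i 1) j x)"
    for n f d dd
  have "\<exists>f d dd. P n f d dd" for n
    unfolding P_def by (rule H2_space_representatives_3[OF assms(19) \<Omega>(1) \<Omega>fin])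
  then obtain f d dd where "\<And>n. P n (f n) (d n) (dd n)"
    by metis
  then have uf: "AE x in lebesgue_on \<Omega>. u n x = f n x"
    and wf: "weak_pd \<Omega> (axis j 1) (f n) (d n j)"
    and ud: "AE x in lebesgue_on \<Omega>. D \<Omega> j (u n) x = d n j x"
    and wd: "weak_pd \<Omega> (axis i 1) (d n j) (dd n (axis i 1) j)"
    and udd: "AE x in lebesgue_on \<Omega>. D \<Omega> i (D \<Omega> j (u n)) x = dd n (axis i 1) j x" for n i j
    unfolding P_def by simp_all
  have d_m [measurable]: "d n j \<in> borel_measurable borel" for n j
    by (rule integrable_lborel_borel[OF weak_pdD(2)[OF wf]])
  have d_off: "d n j x = 0" if "x \<notin> \<Omega>" for n j x
    by (rule weak_pdD(4)[OF wf that])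
  have f_m: "f n \<in> borel_measurable borel" for n
    by (rule integrable_lborel_borel[OF weak_pdD(1)[OF wf]])
  have f_off: "f n x = 0" if "x \<notin> \<Omega>" for n x
    by (rule weak_pdD(3)[OF wf that])
  have dd_m: "dd n b j \<in> borel_measurable borel" if "b \<in> Basis" for n b j
    using integrable_lborel_borel[OF weak_pdD(2)[OF wd]] that by (auto simp: Basis_3)

  \<comment> \<open>Rescaled gradients and Hessians\<close>
  define G where "G n = rescaled_gradient (h n) (d n)" for n
  define H where "H n = rescaled_hessian_sq (h n) (dd n)" for n
  define \<kappa> where "\<kappa> n b = (if b = axis 3 1 then h n else 1)" for n and b :: "real^3"
  \<comment> \<open>The rescaling factors do not depend on x, so the weak derivative passes through
    the columns.\<close>
  have wG: "weak_pd \<Omega> b (G n) (rescaled_gradient (h n) (dd n b))" if b: "b \<in> Basis" for n b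
  proof -
    obtain i where i: "b = axis i 1" using b by (auto simp: Basis_3)
    show ?thesis
      unfolding G_def rescaled_gradient_def i
      by (intro weak_pd_cols weak_pd_linear[OF bounded_linear_scaleR_right] wd) simp_all
  qed
  have G_m [measurable]: "G n \<in> borel_measurable borel" for n
    by (rule integrable_lborel_borel[OF weak_pdD(1)[OF wG[OF axis_in_Basis]]])
  have G_off: "G n x = 0" if "x \<notin> \<Omega>" for n x
    by (rule weak_pdD(3)[OF wG[OF axis_in_Basis] that])
  \<comment> \<open>Reads the unscaled derivatives back from G; the factor h in the third column is
    what makes the thin derivative of u vanish in the limit.\<close>
  have d_G: "d n j x = (if j = 3 then h n else 1) *\<^sub>R column j (G n x)" for n j x
    using h0[of n] by (simp add: G_def rescaled_gradient_def)
  have H_m [measurable]: "H n \<in> borel_measurable borel" for n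
  proof -
    have [measurable]: "dd n (axis i 1) j \<in> borel_measurable borel" for i j
      by (rule dd_m) simp
    show ?thesis
      unfolding H_def rescaled_hessian_sq_def[abs_def] by measurable
  qed
  have H_nn: "0 \<le> H n x" for n x
    unfolding H_def by (rule rescaled_hessian_sq_nonneg)

  \<comment> \<open>Uniform energy bounds\<close>
  define E where "E = enn2real (SUP n. energy W \<Omega> (h n) (\<epsilon> n) (u n))"
  have E0: "0 \<le> E" by (simp add: E_def)
  have en: "(\<integral>\<^sup>+x. indicator \<Omega> x * ennreal (1 / \<epsilon> n * W (G n x) + \<epsilon> n * H n x) \<partial>lborel) \<le> ennreal E" for n
  proof -
    have "energy W \<Omega> (h n) (\<epsilon> n) (u n) \<le> (SUP n. energy W \<Omega> (h n) (\<epsilon> n) (u n))"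
      by (rule SUP_upper) simp
    also have "\<dots> = ennreal E"
      using assms(20) by (simp add: E_def)
    finally show ?thesis
      unfolding energy_representative[OF \<Omega>m ud udd] G_def H_def .
  qed
  have eW: "(\<integral>\<^sup>+x. indicator \<Omega> x * ennreal (1 / \<epsilon> n * W (G n x)) \<partial>lborel) \<le> ennreal E" for n
    by (rule order_trans[OF nn_integral_mono en[of n]])
      (use assms(17)[of n] H_nn[of n] in \<open>intro mult_left_mono ennreal_leI, auto simp: less_imp_le\<close>)
  have eH: "(\<integral>\<^sup>+x. indicator \<Omega> x * ennreal (\<epsilon> n * H n x) \<partial>lborel) \<le> ennreal E" for n
    by (rule order_trans[OF nn_integral_mono en[of n]])
      (use assms(17)[of n] assms(6) in \<open>intro mult_left_mono ennreal_leI, auto simp: less_imp_le\<close>)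

  obtain \<Lambda>h where \<Lambda>h: "\<And>n. \<bar>h n\<bar> \<le> \<Lambda>h"
    using convergent_imp_Bseq[OF convergentI[OF assms(16)]] by (auto simp: Bseq_def)
  \<comment> \<open>The maximum with 1 bounds both values of \<kappa>: 1 in the planar directions
    and h n in the thin one.\<close>
  define \<Lambda> where "\<Lambda> = max 1 \<Lambda>h"
  have \<kappa>: "0 \<le> \<kappa> n b" "\<kappa> n b \<le> \<Lambda>" for n b
    using h0[of n] \<Lambda>h[of n] by (auto simp: \<kappa>_def \<Lambda>_def less_imp_le)
  have "\<Lambda> \<ge> 1" by (simp add: \<Lambda>_def)

  \<comment> \<open>Compactness of the phases and convergence of the rescaled gradients\<close>
  obtain r :: "nat \<Rightarrow> nat" and c :: "(real^3) set" and v :: "nat \<Rightarrow> real^3 \<Rightarrow> real" and w K where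
    r: "strict_mono r" and c: "c \<in> sets borel" "c \<subseteq> \<Omega>"
    and G_lim: "AE x in lborel. x \<in> \<Omega> \<longrightarrow> (\<lambda>n. G (r n) x) \<longlonglongrightarrow> (if x \<in> c then B else A)"
    and vw: "\<And>n b. b \<in> Basis \<Longrightarrow> weak_pd \<Omega> b (v n) (w n b)" and v_le: "\<And>n x. \<bar>v n x\<bar> \<le> 1"
    and v_lim: "AE x in lborel. (\<lambda>n. v (r n) x) \<longlonglongrightarrow> indicator c x" and K: "0 \<le> K"
    and w_le: "\<And>n b. b \<in> Basis \<Longrightarrow> (\<integral>\<^sup>+x. ennreal \<bar>w n b x\<bar> \<partial>lborel) \<le> ennreal (K * \<kappa> n b)"
  proof (rule phase_compactness[OF \<Omega>(1,2) \<Omega>fin assms(5,6) W0 assms(8) assms(13,12) p(1) wG H_m H_nn _ \<kappa> assms(17,18) E0 eW eH])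
    show "AE x in lborel. norm (rescaled_gradient (h n) (dd n b) x) \<le> \<kappa> n b * sqrt (H n x)" if "b \<in> Basis" for n b
      unfolding \<kappa>_def H_def by (rule norm_rescaled_gradient_derivative_le[OF \<Omega>(1) h0 wf wd that])
  qed (assumption, (rule that; assumption))

  note [measurable] = c(1)
  define G\<^sub>0 where "G\<^sub>0 x = (if x \<in> c then B else A)" for x
  have G0_m [measurable]: "G\<^sub>0 \<in> borel_measurable borel"
    unfolding G\<^sub>0_def by measurable
  define R where "R = max (norm A) (norm B)"
  have G0_le: "norm (G\<^sub>0 x) \<le> R" for x
    by (simp add: G\<^sub>0_def R_def)
  have "R \<ge> 0" by (simp add: R_def le_max_iff_disj)
  have W_int: "(\<integral>\<^sup>+x. indicator \<Omega> x * ennreal (W (G n x)) \<partial>lborel) \<le> ennreal (E * \<epsilon> n)" for n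
  proof -
    have "(\<integral>\<^sup>+x. indicator \<Omega> x * ennreal (W (G n x)) \<partial>lborel) = (\<integral>\<^sup>+x. ennreal (\<epsilon> n) * (indicator \<Omega> x * ennreal (1 / \<epsilon> n * W (G n x))) \<partial>lborel)"
      using assms(17)[of n] assms(6) by (intro nn_integral_cong) (auto simp: indicator_def ennreal_mult[symmetric])
    also have "\<dots> = ennreal (\<epsilon> n) * (\<integral>\<^sup>+x. indicator \<Omega> x * ennreal (1 / \<epsilon> n * W (G n x)) \<partial>lborel)"
      by (rule nn_integral_cmult) measurable
    also have "\<dots> \<le> ennreal (\<epsilon> n) * ennreal E"
      by (intro mult_left_mono eW) simp
    finally show ?thesis
      using assms(17)[of n] E0 by (simp add: ennreal_mult mult.commute)
  qed
  define T where "T n = (\<integral>\<^sup>+x. indicator \<Omega> x * ennreal (norm (G (r n) x - G\<^sub>0 x) powr p) \<partial>lborel)" for n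
  have "(\<lambda>n. E * \<epsilon> (r n)) \<longlonglongrightarrow> 0"
    using tendsto_mult_right_zero[OF LIMSEQ_subseq_LIMSEQ[OF assms(18) r], of E] by (simp add: comp_def)
  then have T0: "T \<longlonglongrightarrow> 0"
    unfolding T_def
    by (intro Lp_convergence_from_energy[OF \<Omega>m \<Omega>fin W_m assms(6) assms(13,12) p(1) G_m G0_m G0_le _ W_int])
      (use G_lim in \<open>simp_all add: G\<^sub>0_def\<close>)
  \<comment> \<open>Membership in H^2 alone gives no p-integrability of the gradient for large p; it
    comes from the finite energy of each u n and coercivity.\<close>
  have G_fin: "(\<integral>\<^sup>+x. ennreal (norm (G n x) powr p) \<partial>lborel) < \<infinity>" for n
  proof -
    have "(\<integral>\<^sup>+x. ennreal (norm (G n x) powr p) \<partial>lborel) \<le>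
        (\<integral>\<^sup>+x. ennreal C1 * (indicator \<Omega> x * ennreal (W (G n x))) + ennreal (C1 * C1) * indicator \<Omega> x \<partial>lborel)"
    proof (rule nn_integral_mono)
      fix x
      have "norm (G n x) powr p \<le> C1 * W (G n x) + C1 * C1"
        using assms(13)[of "G n x"] assms(12) by (simp add: field_simps)
      then have "ennreal (norm (G n x) powr p) \<le> ennreal (C1 * W (G n x) + C1 * C1)"
        by (rule ennreal_leI)
      also have "\<dots> = ennreal C1 * ennreal (W (G n x)) + ennreal (C1 * C1)"
        using assms(6)[of "G n x"] assms(12) by (simp add: ennreal_mult)
      finally show "ennreal (norm (G n x) powr p) \<le> ennreal C1 * (indicator \<Omega> x * ennreal (W (G n x))) + ennreal (C1 * C1) * indicator \<Omega> x"
        using G_off[of x n] by (cases "x \<in> \<Omega>") simp_all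
    qed
    also have "\<dots> = ennreal C1 * (\<integral>\<^sup>+x. indicator \<Omega> x * ennreal (W (G n x)) \<partial>lborel) + ennreal (C1 * C1) * emeasure lborel \<Omega>"
      by (simp add: nn_integral_add nn_integral_cmult)
    also have "\<dots> < \<infinity>"
      using le_less_trans[OF W_int[of n] ennreal_less_top] \<Omega>fin by (simp add: ennreal_mult_less_top)
    finally show ?thesis .
  qed

  \<comment> \<open>Convergence of the partial derivatives\<close>
  define z where "z j x = (if j = 3 then 0 else indicator \<Omega> x *\<^sub>R column j (G\<^sub>0 x))" for j x
  have col_m [measurable]: "(column j :: real^3^3 \<Rightarrow> real^3) \<in> borel_measurable borel" for j
    by (rule borel_measurable_continuous_onI[OF linear_continuous_on[OF bounded_linear_column]])
  have z_m [measurable]: "z j \<in> borel_measurable borel" for j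
    unfolding z_def by measurable
  have z_off: "z j x = 0" if "x \<notin> \<Omega>" for j x
    using that by (simp add: z_def)
  have z_le: "norm (z j x) \<le> R" for j x
    using norm_column_le[of j "G\<^sub>0 x"] G0_le[of x] \<open>R \<ge> 0\<close> by (auto simp: z_def indicator_def)
  have col_T: "(\<integral>\<^sup>+x. ennreal (norm (column j (G (r n) x) - indicator \<Omega> x *\<^sub>R column j (G\<^sub>0 x)) powr p) \<partial>lborel) \<le> T n" for j n
    unfolding T_def
  proof (rule nn_integral_mono)
    fix x
    have "norm (column j (G (r n) x) - column j (G\<^sub>0 x)) \<le> norm (G (r n) x - G\<^sub>0 x)"
      using norm_column_le[of j "G (r n) x - G\<^sub>0 x"]
      by (simp add: linear_diff[OF bounded_linear.linear[OF bounded_linear_column]])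
    then have "norm (column j (G (r n) x) - column j (G\<^sub>0 x)) powr p \<le> norm (G (r n) x - G\<^sub>0 x) powr p"
      using p by (intro powr_mono2) auto
    then show "ennreal (norm (column j (G (r n) x) - indicator \<Omega> x *\<^sub>R column j (G\<^sub>0 x)) powr p) \<le> indicator \<Omega> x * ennreal (norm (G (r n) x - G\<^sub>0 x) powr p)"
      using G_off[of x "r n"] linear_0[OF bounded_linear.linear[OF bounded_linear_column], of j]
      by (cases "x \<in> \<Omega>") (auto intro: ennreal_leI)
  qed
  have d_fin: "(\<integral>\<^sup>+x. ennreal (norm (d n j x) powr p) \<partial>lborel) < \<infinity>" for n j
  proof -
    have "(\<integral>\<^sup>+x. ennreal (norm (d n j x) powr p) \<partial>lborel) \<le> (\<integral>\<^sup>+x. ennreal (\<Lambda> powr p) * ennreal (norm (G n x) powr p) \<partial>lborel)"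
    proof (rule nn_integral_mono)
      fix x
      have "norm (d n j x) = (if j = 3 then h n else 1) * norm (column j (G n x))"
        using h0[of n] by (simp add: d_G)
      also have "\<dots> \<le> \<Lambda> * norm (G n x)"
        using h0[of n] \<Lambda>h[of n] by (intro mult_mono norm_column_le) (auto simp: \<Lambda>_def)
      finally have "norm (d n j x) \<le> \<Lambda> * norm (G n x)" .
      then have "norm (d n j x) powr p \<le> (\<Lambda> * norm (G n x)) powr p"
        using p by (intro powr_mono2) auto
      then show "ennreal (norm (d n j x) powr p) \<le> ennreal (\<Lambda> powr p) * ennreal (norm (G n x) powr p)"
        using \<open>\<Lambda> \<ge> 1\<close> by (simp add: powr_mult ennreal_mult[symmetric] ennreal_leI)
    qed
    also have "\<dots> = ennreal (\<Lambda> powr p) * (\<integral>\<^sup>+x. ennreal (norm (G n x) powr p) \<partial>lborel)"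
      by (rule nn_integral_cmult) measurable
    also have "\<dots> < \<infinity>"
      using G_fin by (simp add: ennreal_mult_less_top)
    finally show ?thesis .
  qed
  have d_lim: "(\<lambda>n. \<integral>\<^sup>+x. ennreal (norm (d (r n) j x - z j x) powr p) \<partial>lborel) \<longlonglongrightarrow> 0" for j
  proof (cases "j = 3")
    case False
    show ?thesis
    proof (rule tendsto_sandwich[OF always_eventually always_eventually tendsto_const T0])
      show "\<forall>n. (\<integral>\<^sup>+x. ennreal (norm (d (r n) j x - z j x) powr p) \<partial>lborel) \<le> T n"
        using col_T[of j] False by (simp add: d_G z_def)
    qed simp
  next
    case True
    let ?C = "ennreal (R powr p) * emeasure lborel \<Omega>"
    \<comment> \<open>In the thin direction only boundedness of the third column of G in L^p is
      used: its p-th power integral is at most a multiple of T n plus a constant, and the prefactor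
      h powr p tends to 0.\<close>
    have le: "(\<integral>\<^sup>+x. ennreal (norm (d (r n) j x - z j x) powr p) \<partial>lborel) \<le> ennreal (h (r n) powr p * 2 powr p) * (T n + ?C)" for n
    proof -
      have "(\<integral>\<^sup>+x. ennreal (norm (d (r n) j x - z j x) powr p) \<partial>lborel) \<le>
        (\<integral>\<^sup>+x. ennreal (h (r n) powr p * 2 powr p) * (indicator \<Omega> x * ennreal (norm (G (r n) x - G\<^sub>0 x) powr p) + ennreal (R powr p) * indicator \<Omega> x) \<partial>lborel)"
      proof (rule nn_integral_mono)
        fix x
        have "norm (G (r n) x) \<le> norm (G (r n) x - G\<^sub>0 x) + R"
          using norm_triangle_ineq[of "G (r n) x - G\<^sub>0 x" "G\<^sub>0 x"] G0_le[of x] by simp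
        then have "norm (column j (G (r n) x)) \<le> norm (G (r n) x - G\<^sub>0 x) + R"
          using norm_column_le order_trans by blast
        then have "norm (d (r n) j x) \<le> h (r n) * (norm (G (r n) x - G\<^sub>0 x) + R)"
          using h0[of "r n"] True by (simp add: d_G)
        then have "norm (d (r n) j x) powr p \<le> (h (r n) * (norm (G (r n) x - G\<^sub>0 x) + R)) powr p"
          using p by (intro powr_mono2) auto
        also have "\<dots> = h (r n) powr p * (norm (G (r n) x - G\<^sub>0 x) + R) powr p"
          using h0[of "r n"] \<open>R \<ge> 0\<close> by (simp add: powr_mult)
        also have "\<dots> \<le> h (r n) powr p * (2 powr p * (norm (G (r n) x - G\<^sub>0 x) powr p + R powr p))"
          using p \<open>R \<ge> 0\<close> by (intro mult_left_mono powr_add_le) auto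
        finally have "ennreal (norm (d (r n) j x) powr p) \<le> ennreal (h (r n) powr p * 2 powr p * (norm (G (r n) x - G\<^sub>0 x) powr p + R powr p))"
          by (intro ennreal_leI) (simp add: mult.assoc)
        also have "\<dots> = ennreal (h (r n) powr p * 2 powr p) * (ennreal (norm (G (r n) x - G\<^sub>0 x) powr p) + ennreal (R powr p))"
          by (simp add: ennreal_mult)
        finally show "ennreal (norm (d (r n) j x - z j x) powr p) \<le> ennreal (h (r n) powr p * 2 powr p) *
            (indicator \<Omega> x * ennreal (norm (G (r n) x - G\<^sub>0 x) powr p) + ennreal (R powr p) * indicator \<Omega> x)"
          using d_off[of x "r n" j] True by (cases "x \<in> \<Omega>") (simp_all add: z_def)
      qed
      also have "\<dots> = ennreal (h (r n) powr p * 2 powr p) * (T n + ?C)"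
        unfolding T_def by (simp add: nn_integral_cmult nn_integral_add)
      finally show ?thesis .
    qed
    show ?thesis
    proof (rule tendsto_sandwich[OF always_eventually always_eventually tendsto_const])
      show "\<forall>n. (\<integral>\<^sup>+x. ennreal (norm (d (r n) j x - z j x) powr p) \<partial>lborel) \<le> ennreal (h (r n) powr p * 2 powr p) * (T n + ?C)"
        using le by blast
      have "(\<lambda>n. h (r n)) \<longlonglongrightarrow> 0"
        using LIMSEQ_subseq_LIMSEQ[OF assms(16) r] by (simp add: comp_def)
      then have "(\<lambda>n. h (r n) powr p) \<longlonglongrightarrow> 0 powr p"
        using p h0 by (intro tendsto_powr2 tendsto_const) (auto simp: less_imp_le)
      then have "(\<lambda>n. h (r n) powr p * 2 powr p) \<longlonglongrightarrow> 0"
        using tendsto_mult_left_zero by fastforce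
      then have "(\<lambda>n. ennreal (h (r n) powr p * 2 powr p) * (T n + ?C)) \<longlonglongrightarrow> ennreal 0 * (0 + ?C)"
        using \<Omega>fin by (intro tendsto_mult_ennreal tendsto_ennrealI tendsto_add T0 tendsto_const) (auto simp: ennreal_mult_eq_top_iff)
      then show "(\<lambda>n. ennreal (h (r n) powr p * 2 powr p) * (T n + ?C)) \<longlonglongrightarrow> 0"
        by simp
    qed simp
  qed

  \<comment> \<open>The limit deformation and the limit director\<close>
  \<comment> \<open>Translates basis vectors back into column numbers, as the Sobolev lemmas
    quantify over basis vectors.\<close>
  define idx where "idx b = (THE j. b = axis j (1::real))" for b :: "real^3"
  have idx [simp]: "idx (axis j 1) = j" for j
    unfolding idx_def by (rule the_equality) (auto simp: axis_eq_axis)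
  have wf': "weak_pd \<Omega> b (f n) (d n (idx b))" if "b \<in> Basis" for n b
    using that wf by (auto simp: Basis_3)
  define U where "U n x = indicator \<Omega> x *\<^sub>R (f (r n) x - (1 / measure lborel \<Omega>) *\<^sub>R integral\<^sup>L lborel (f (r n)))" for n x
  obtain u\<^sub>0 where u0_m: "u\<^sub>0 \<in> borel_measurable borel" and u0_off: "\<And>x. x \<notin> \<Omega> \<Longrightarrow> u\<^sub>0 x = 0"
    and U_fin: "\<And>n. (\<integral>\<^sup>+x. ennreal (norm (U n x) powr p) \<partial>lborel) < \<infinity>" and u0_fin: "(\<integral>\<^sup>+x. ennreal (norm (u\<^sub>0 x) powr p) \<partial>lborel) < \<infinity>"
    and U_lim: "(\<lambda>n. \<integral>\<^sup>+x. ennreal (norm (U n x - u\<^sub>0 x) powr p) \<partial>lborel) \<longlonglongrightarrow> 0"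
    and U_wp: "\<And>n b. b \<in> Basis \<Longrightarrow> weak_pd \<Omega> b (U n) (d (r n) (idx b))" and u0_wp: "\<And>b. b \<in> Basis \<Longrightarrow> weak_pd \<Omega> b u\<^sub>0 (z (idx b))"
    by (rule sobolev_strong_limit[where f = "\<lambda>n. f (r n)" and g = "\<lambda>n b. d (r n) (idx b)" and z = "\<lambda>b. z (idx b)",
          OF \<Omega>(1,2) \<Omega>fin diam wf' p(1) d_fin z_m z_off d_lim, folded U_def]) (assumption+, (rule that; assumption))
  define b\<^sub>0 where "b\<^sub>0 x = indicator \<Omega> x *\<^sub>R column 3 (G\<^sub>0 x)" for x
  have b0_m [measurable]: "b\<^sub>0 \<in> borel_measurable borel"
    unfolding b\<^sub>0_def by measurable
  have b0_le: "norm (b\<^sub>0 x) \<le> R" for x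
    using norm_column_le[of 3 "G\<^sub>0 x"] G0_le[of x] \<open>R \<ge> 0\<close> by (auto simp: b\<^sub>0_def indicator_def)

  \<comment> \<open>Membership in the limiting class\<close>
  have Linf_u0: "u\<^sub>0 \<in> W1inf_space \<Omega>"
  proof -
    have "u\<^sub>0 \<in> Linf_space \<Omega>"
    proof (rule Linf_space_if_gradient_bounded[OF \<Omega>(1,2) diam u0_wp])
      show "(\<Sum>b\<in>Basis. norm (z (idx b) x)) \<le> (\<Sum>b\<in>(Basis :: (real^3) set). R)" for x
        by (intro sum_mono z_le)
    qed
    moreover have "z (idx b) \<in> Linf_space \<Omega> \<and> has_weak_partial \<Omega> b u\<^sub>0 (z (idx b))" if "b \<in> Basis" for b
      using Linf_space_borel[OF z_m z_le]
        weak_pd_imp_has_weak_partial[OF \<Omega>(1) that u0_wp[OF that] measurable_lebesgue_on_borel[OF u0_m] _ measurable_lebesgue_on_borel[OF z_m]]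
      by simp
    ultimately show ?thesis
      unfolding W1inf_space_def by blast
  qed
  have u0_hw: "has_weak_partial \<Omega> (axis j 1) u\<^sub>0 (z j)" for j
    using weak_pd_imp_has_weak_partial[OF \<Omega>(1) axis_in_Basis u0_wp[OF axis_in_Basis] measurable_lebesgue_on_borel[OF u0_m] _ measurable_lebesgue_on_borel[OF z_m], of j]
    by simp
  have grad: "AE x in lebesgue_on \<Omega>. planar_grad_with \<Omega> u\<^sub>0 b\<^sub>0 x = G\<^sub>0 x"
  proof -
    have "AE x in lebesgue_on \<Omega>. \<forall>j\<in>UNIV. D \<Omega> j u\<^sub>0 x = z j x"
      by (intro AE_finite_allI weak_partial_AE[OF \<Omega>(1) axis_in_Basis u0_hw]) simp
    moreover have "AE x in lebesgue_on \<Omega>. x \<in> \<Omega>"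
      using AE_space[of "lebesgue_on \<Omega>"] by (simp add: space_restrict_space)
    ultimately show ?thesis
      by eventually_elim (simp add: planar_grad_with_def vec_eq_iff z_def b\<^sub>0_def column_def)
  qed
  have "planar_grad_with \<Omega> u\<^sub>0 b\<^sub>0 \<in> BV_valued \<Omega> {A, B}"
  proof -
    \<comment> \<open>\<open>G\<^sub>0\<close> equals A also outside the domain; a representative
      has to vanish there.\<close>
    define G\<^sub>1 where "G\<^sub>1 x = indicator \<Omega> x *\<^sub>R G\<^sub>0 x" for x
    have G1_m: "G\<^sub>1 \<in> borel_measurable borel"
      unfolding G\<^sub>1_def by measurable
    have "AE x in lebesgue_on \<Omega>. x \<in> \<Omega>"
      using AE_space[of "lebesgue_on \<Omega>"] by (simp add: space_restrict_space)
    with grad have G1_eq: "AE x in lebesgue_on \<Omega>. planar_grad_with \<Omega> u\<^sub>0 b\<^sub>0 x = G\<^sub>1 x"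
      by eventually_elim (simp add: G\<^sub>1_def)
    have pg_m: "planar_grad_with \<Omega> u\<^sub>0 b\<^sub>0 \<in> borel_measurable (lebesgue_on \<Omega>)"
      by (rule measurable_lebesgue_on_AE_cong[OF measurable_lebesgue_on_borel[OF G1_m] \<Omega>m G1_eq])
    have "(\<integral>\<^sup>+x. ennreal (norm (G\<^sub>1 x) powr 1) \<partial>lborel) \<le> (\<integral>\<^sup>+x. ennreal R * indicator \<Omega> x \<partial>lborel)"
      using G0_le by (intro nn_integral_mono) (auto simp: G\<^sub>1_def indicator_def intro: ennreal_leI)
    also have "\<dots> < \<infinity>"
      using \<Omega>fin by (simp add: nn_integral_cmult ennreal_mult_less_top)
    finally have "planar_grad_with \<Omega> u\<^sub>0 b\<^sub>0 \<in> Lp_space 1 \<Omega>"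
      using Lp_space_representative[OF pg_m \<Omega>m G1_m _ G1_eq, of 1] by (simp add: G\<^sub>1_def)
    moreover have "variation \<Omega> (planar_grad_with \<Omega> u\<^sub>0 b\<^sub>0) < \<infinity>"
    proof (rule phase_variation_finite[OF \<Omega>(1) vw v_le v_lim c(1)])
      show "0 \<le> K * \<Lambda>"
        using K \<open>\<Lambda> \<ge> 1\<close> by simp
      show "(\<integral>\<^sup>+x. ennreal \<bar>w (r n) b x\<bar> \<partial>lborel) \<le> ennreal (K * \<Lambda>)" if "b \<in> Basis" for n b
        by (rule order_trans[OF w_le[OF that]]) (intro ennreal_leI mult_left_mono \<kappa> K)
      show "AE x in lebesgue_on \<Omega>. planar_grad_with \<Omega> u\<^sub>0 b\<^sub>0 x = (if x \<in> c then B else A)"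
        using grad unfolding G\<^sub>0_def .
    qed
    moreover have "AE x in lebesgue_on \<Omega>. planar_grad_with \<Omega> u\<^sub>0 b\<^sub>0 x \<in> {A, B}"
      using grad by eventually_elim (simp add: G\<^sub>0_def)
    ultimately show ?thesis
      by (simp add: BV_valued_def BV_space_def)
  qed
  moreover have "has_weak_partial \<Omega> (axis 3 1) u\<^sub>0 (\<lambda>_. 0)"
    using u0_hw[of 3] by (simp add: z_def[abs_def])
  moreover have "has_weak_partial \<Omega> (axis 3 1) b\<^sub>0 (\<lambda>_. 0)"
  proof -
    have v_m [measurable]: "v n \<in> borel_measurable borel" for n
      by (rule integrable_lborel_borel[OF weak_pdD(1)[OF vw[OF axis_in_Basis]]])
    have v_off: "v n x = 0" if "x \<notin> \<Omega>" for n x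
      by (rule weak_pdD(3)[OF vw[OF axis_in_Basis] that])
    have c_int: "integrable lborel (indicator c :: real^3 \<Rightarrow> real)"
      using c emeasure_mono[OF c(2), of lborel] \<Omega>fin by (simp add: le_less_trans)
    \<comment> \<open>The thin derivatives of the phase functions have L1 norm at most K * h and
      hence tend to 0, so by closedness the limit phase has thin derivative 0.\<close>
    have "weak_pd \<Omega> (axis 3 1) (indicator c :: real^3 \<Rightarrow> real) (\<lambda>x. 0)"
    proof (rule weak_pd_limit[OF axis_in_Basis vw[OF axis_in_Basis]])
      show "integrable lborel (indicator c :: real^3 \<Rightarrow> real)" by (rule c_int)
      show "indicator c x = (0::real)" if "x \<notin> \<Omega>" for x
        using that c(2) by (auto simp: indicator_def)
      have "(\<lambda>n. \<integral>x. norm (v (r n) x - indicator c x) \<partial>lborel) \<longlonglongrightarrow> integral\<^sup>L lborel (\<lambda>x::real^3. 0)"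
      proof (rule integral_dominated_convergence[where w = "\<lambda>x. 2 * indicator \<Omega> x"])
        show "AE x in lborel. (\<lambda>n. norm (v (r n) x - indicator c x)) \<longlonglongrightarrow> 0"
          using v_lim by eventually_elim (intro tendsto_norm_zero, simp add: LIM_zero)
        show "AE x in lborel. norm (norm (v (r n) x - indicator c x)) \<le> 2 * indicator \<Omega> x" for n
        proof (intro always_eventually allI)
          fix x
          show "norm (norm (v (r n) x - indicator c x)) \<le> 2 * indicator \<Omega> x"
            using v_le[of "r n" x] v_off[of x "r n"] c(2) by (cases "x \<in> \<Omega>") (auto simp: indicator_def)
        qed
        show "integrable lborel (\<lambda>x. 2 * indicator \<Omega> x :: real)"
          using \<Omega>fin by (intro integrable_mult_right) simp
      qed measurable
      then show "(\<lambda>n. \<integral>x. norm (v (r n) x - indicator c x) \<partial>lborel) \<longlonglongrightarrow> 0" by simp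
      show "(\<lambda>n. \<integral>x. norm (w (r n) (axis 3 1) x - 0) \<partial>lborel) \<longlonglongrightarrow> 0"
      proof (rule tendsto_sandwich[OF always_eventually always_eventually tendsto_const])
        show "\<forall>n. 0 \<le> (\<integral>x. norm (w (r n) (axis 3 1) x - 0) \<partial>lborel)" by simp
        show "\<forall>n. (\<integral>x. norm (w (r n) (axis 3 1) x - 0) \<partial>lborel) \<le> K * h (r n)"
        proof
          fix n
          have "ennreal (\<integral>x. \<bar>w (r n) (axis 3 1) x\<bar> \<partial>lborel) \<le> ennreal (K * h (r n))"
            using w_le[OF axis_in_Basis, of "r n" 3] weak_pdD(2)[OF vw[OF axis_in_Basis], of "r n" 3]
            by (subst (asm) nn_integral_eq_integral) (auto simp: \<kappa>_def)
          then show "(\<integral>x. norm (w (r n) (axis 3 1) x - 0) \<partial>lborel) \<le> K * h (r n)"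
            using K h0[of "r n"] by (simp add: mult_nonneg_nonneg less_imp_le)
        qed
        show "(\<lambda>n. K * h (r n)) \<longlonglongrightarrow> 0"
          using tendsto_mult_right_zero[OF LIMSEQ_subseq_LIMSEQ[OF assms(16) r], of K] by (simp add: comp_def)
      qed
    qed simp_all
    \<comment> \<open>The director is an affine function of the phase: the third column of A on the
      domain, plus the difference of the third columns on c.\<close>
    from weak_pd_linear[OF bounded_linear_scaleR_left axis_in_Basis this, of "column 3 B - column 3 A"]
      weak_pd_const[OF \<Omega>(1) \<Omega>fin axis_in_Basis, of 3 "column 3 A"]
    have "weak_pd \<Omega> (axis 3 1) (\<lambda>x. indicator \<Omega> x *\<^sub>R column 3 A + indicator c x *\<^sub>R (column 3 B - column 3 A)) (\<lambda>x. 0 + 0 *\<^sub>R (column 3 B - column 3 A))"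
      by (intro weak_pd_add axis_in_Basis)
    also have "(\<lambda>x. indicator \<Omega> x *\<^sub>R column 3 A + indicator c x *\<^sub>R (column 3 B - column 3 A)) = b\<^sub>0"
      using c(2) by (auto simp: fun_eq_iff b\<^sub>0_def G\<^sub>0_def indicator_def)
    finally have "weak_pd \<Omega> (axis 3 1) b\<^sub>0 (\<lambda>x. 0)" by simp
    from weak_pd_imp_has_weak_partial[OF \<Omega>(1) axis_in_Basis this measurable_lebesgue_on_borel[OF b0_m] _ measurable_lebesgue_on_borel]
    show ?thesis by simp
  qed
  ultimately have limit: "(u\<^sub>0, b\<^sub>0) \<in> limit_class \<Omega> A B"
    using Linf_u0 Linf_space_borel[OF b0_m b0_le] by (simp add: limit_class_def)

  \<comment> \<open>Convergence of the centred deformations in the Sobolev norm\<close>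
  have W1p: "W1p_tendsto p \<Omega> (\<lambda>n x. u (r n) x - mean_value \<Omega> (u (r n))) u\<^sub>0"
  proof (rule W1p_tendstoI[OF \<Omega>(1) p(1) _ U_wp u0_wp U_fin d_fin u0_fin _ U_lim d_lim])
    fix n
    have "(\<integral>x. u (r n) x \<partial>lebesgue_on \<Omega>) = integral\<^sup>L lborel (f (r n))"
      by (rule integral_lebesgue_on_representative[OF _ \<Omega>m f_m f_off uf])
        (use assms(19)[of "r n"] in \<open>simp add: H2_space_def Lp_space_def\<close>)
    moreover have "measure lebesgue \<Omega> = measure lborel \<Omega>"
      by (simp add: measure_completion)
    ultimately have mean: "mean_value \<Omega> (u (r n)) = (1 / measure lborel \<Omega>) *\<^sub>R integral\<^sup>L lborel (f (r n))"
      by (simp add: mean_value_def)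
    have "AE x in lebesgue_on \<Omega>. x \<in> \<Omega>"
      using AE_space[of "lebesgue_on \<Omega>"] by (simp add: space_restrict_space)
    with uf[of "r n"] show "AE x in lebesgue_on \<Omega>. u (r n) x - mean_value \<Omega> (u (r n)) = U n x"
      by eventually_elim (simp add: U_def mean)
  next
    fix b :: "real^3" assume "b \<in> Basis"
    have "(\<integral>\<^sup>+x. ennreal (norm (z (idx b) x) powr p) \<partial>lborel) \<le> (\<integral>\<^sup>+x. ennreal (R powr p) * indicator \<Omega> x \<partial>lborel)"
    proof (rule nn_integral_mono)
      fix x
      show "ennreal (norm (z (idx b) x) powr p) \<le> ennreal (R powr p) * indicator \<Omega> x"
        using z_le[of "idx b" x] z_off[of x "idx b"] p by (cases "x \<in> \<Omega>") (auto intro!: ennreal_leI powr_mono2)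
    qed
    also have "\<dots> < \<infinity>"
      using \<Omega>fin by (simp add: nn_integral_cmult ennreal_mult_less_top)
    finally show "(\<integral>\<^sup>+x. ennreal (norm (z (idx b) x) powr p) \<partial>lborel) < \<infinity>" .
  qed

  \<comment> \<open>Convergence of the rescaled thin derivatives\<close>
  have "Lp_tendsto p \<Omega> (\<lambda>n x. (1 / h (r n)) *\<^sub>R D \<Omega> 3 (u (r n)) x) b\<^sub>0"
  proof -
    define g where "g n x = column 3 (G n x)" for n x
    have g_m [measurable]: "g n \<in> borel_measurable borel" for n
      unfolding g_def by measurable
    have g_off: "g n x = 0" if "x \<notin> \<Omega>" for n x
      using G_off[OF that] linear_0[OF bounded_linear.linear[OF bounded_linear_column], of 3] by (simp add: g_def)
    have b0_off: "b\<^sub>0 x = 0" if "x \<notin> \<Omega>" for x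
      using that by (simp add: b\<^sub>0_def)
    have eq: "AE x in lebesgue_on \<Omega>. (1 / h n) *\<^sub>R D \<Omega> 3 (u n) x = g n x" for n
      using ud[of 3 n] by eventually_elim (use h0[of n] in \<open>simp add: d_G g_def\<close>)
    have F_m: "(\<lambda>x. (1 / h n) *\<^sub>R D \<Omega> 3 (u n) x) \<in> borel_measurable (lebesgue_on \<Omega>)" for n
      by (rule measurable_lebesgue_on_AE_cong[OF measurable_lebesgue_on_borel[OF g_m] \<Omega>m eq])
    have "(\<integral>\<^sup>+x. ennreal (norm (g n x) powr p) \<partial>lborel) < \<infinity>" for n
    proof (rule le_less_trans[OF nn_integral_mono G_fin[of n]])
      fix x
      show "ennreal (norm (g n x) powr p) \<le> ennreal (norm (G n x) powr p)"
        unfolding g_def using p by (intro ennreal_leI powr_mono2 norm_column_le) auto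
    qed
    then have "(\<lambda>x. (1 / h n) *\<^sub>R D \<Omega> 3 (u n) x) \<in> Lp_space p \<Omega>" for n
      using Lp_space_representative[OF F_m \<Omega>m g_m g_off eq] by blast
    moreover have "b\<^sub>0 \<in> Lp_space p \<Omega>"
    proof -
      have "(\<integral>\<^sup>+x. ennreal (norm (b\<^sub>0 x) powr p) \<partial>lborel) \<le> (\<integral>\<^sup>+x. ennreal (R powr p) * indicator \<Omega> x \<partial>lborel)"
      proof (rule nn_integral_mono)
        fix x
        show "ennreal (norm (b\<^sub>0 x) powr p) \<le> ennreal (R powr p) * indicator \<Omega> x"
          using b0_le[of x] b0_off[of x] p by (cases "x \<in> \<Omega>") (auto intro!: ennreal_leI powr_mono2)
      qed
      also have "\<dots> < \<infinity>"
        using \<Omega>fin by (simp add: nn_integral_cmult ennreal_mult_less_top)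
      finally show ?thesis
        using Lp_space_borel[OF b0_m b0_off \<Omega>m] by blast
    qed
    moreover have "(\<lambda>n. Lp_norm p \<Omega> (\<lambda>x. (1 / h (r n)) *\<^sub>R D \<Omega> 3 (u (r n)) x - b\<^sub>0 x)) \<longlonglongrightarrow> 0"
    proof -
      have e_m: "(\<lambda>x. g (r n) x - b\<^sub>0 x) \<in> borel_measurable borel" for n
        by measurable
      have e_eq: "AE x in lebesgue_on \<Omega>. (1 / h (r n)) *\<^sub>R D \<Omega> 3 (u (r n)) x - b\<^sub>0 x = g (r n) x - b\<^sub>0 x" for n
        using eq[of "r n"] by eventually_elim simp
      show ?thesis
      proof (rule Lp_norm_tendsto_0[OF measurable_lebesgue_on_AE_cong[OF measurable_lebesgue_on_borel[OF e_m] \<Omega>m e_eq] \<Omega>m e_m _ e_eq p(2)])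
        show "(\<lambda>n. \<integral>\<^sup>+x. ennreal (norm (g (r n) x - b\<^sub>0 x) powr p) \<partial>lborel) \<longlonglongrightarrow> 0"
          by (rule tendsto_sandwich[OF always_eventually always_eventually tendsto_const T0])
            (use col_T[of 3] in \<open>simp_all add: g_def b\<^sub>0_def\<close>)
      qed (use g_off b0_off in simp)
    qed
    ultimately show ?thesis
      unfolding Lp_tendsto_def by blast
  qed
  with r limit W1p show ?thesis by blast
qed

end
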